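(* Let $n\ge1$. (i) $\mathrm{grFrob}(A(U_{n,n})_{\mathbb C},t)=Q_n(\mathbf x,t)$. (ii) If $n\ge2$, $\mathrm{grFrob}(A(U_{n-1,n})_{\mathbb C},t)=t^{-1}Q_n^0(\mathbf x,t)$.
   Context: For $1\le r\le n$, the uniform matroid $U_{r,n}$ is the matroid on $[n]=\{1,\dots,n\}$ with flats $\{S\subseteq[n]:|S|\le r-1\}\cup\{[n]\}$. For a loopless matroid $M$ on $E$ with lattice of flats $\mathcal L(M)$, the Chow ring is the graded $\mathbb{Q}$-algebra (all variables in degree 1) $A(M)=\mathbb{Q}[x_F:F\in\mathcal L(M)\setminus\{\emptyset\}]/(I+J)$, where $I$ is generated by $x_Fx_{F'}$ for incomparable $F,F'$, and $J$ by $\sum_{F:\,i\in F}x_F$ for $i\in E$. Put $A(M)_{\mathbb C}=\mathbb C\otimes_{\mathbb Q}A(M)$. $\mathfrak S_n$ acts on $A(U_{r,n})_{\mathbb C}$ by $\sigma x_F=x_{\sigma(F)}$. For a graded $\mathbb C[\mathfrak S_n]$-module $V=\bigoplus_iV^i$, $\mathrm{grFrob}(V,t)=\sum_i\mathrm{ch}(V^i)t^i$, where $\mathrm{ch}$ is the Frobenius characteristic (irreducible $\chi^\lambda\mapsto$ Schur function $s_\lambda$, trivial character $\mapsto h_n$), with symmetric functions in $\mathbf x=(x_1,x_2,\dots)$. For $\sigma=\sigma_1\cdots\sigma_n\in\mathfrak S_n$: $\mathrm{EXC}(\sigma)=\{i\in[n-1]:\sigma_i>i\}$, $\mathrm{exc}(\sigma)=|\mathrm{EXC}(\sigma)|$.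 Let $\overline\sigma$ be the word over $\{\overline1<\cdots<\overline n<1<\cdots<n\}$ obtained from $\sigma$ by replacing $\sigma_i$ by $\overline{\sigma_i}$ for each $i\in\mathrm{EXC}(\sigma)$; $\mathrm{DEX}(\sigma)=\{i\in[n-1]:\overline\sigma_i>\overline\sigma_{i+1}\}$. For $S\subseteq[n-1]$, $F_{S,n}(\mathbf x)=\sum x_{i_1}\cdots x_{i_n}$ over $i_1\ge\cdots\ge i_n\geq 1$ with $i_j>i_{j+1}$ for $j\in S$. With $D_n$ the set of derangements in $\mathfrak S_n$, $$Q_n(\mathbf x,t)=\sum_{\sigma\in\mathfrak S_n}F_{\mathrm{DEX}(\sigma),n}t^{\mathrm{exc}(\sigma)},\qquad Q_n^0(\mathbf x,t)=\sum_{\sigma\in D_n}F_{\mathrm{DEX}(\sigma),n}t^{\mathrm{exc}(\sigma)}.$$ *)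

theory Defs
  imports
    "HOL-Algebra.QuotRing"
    "HOL-Algebra.Module"
    "HOL-Library.Poly_Mapping"
    "HOL-Library.Multiset"
    "HOL-Library.FuncSet"
    "HOL-Combinatorics.Permutations"
    "HOL-Combinatorics.Orbits"
    "HOL-Computational_Algebra.Formal_Laurent_Series"
begin

section \<open>Formal power series in countably many variables\<close>

text \<open>
  A monomial \<open>x\<^bsub>i\<^sub>1\<^esub> \<cdots> x\<^bsub>i\<^sub>k\<^esub>\<close> is the multiset \<open>{#i\<^sub>1, \<dots>, i\<^sub>k#}\<close>. Symmetric and quasisymmetric
  functions live in this ring; they only involve the variables with index at least 1.
\<close>

typedef 'a mseries = "UNIV :: (nat multiset \<Rightarrow> 'a) set"
  morphisms mcoeff Abs_mseries ..

setup_lifting type_definition_mseries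

lemma mseries_eqI: "(\<And>m. mcoeff f m = mcoeff g m) \<Longrightarrow> f = g"
  by (metis ext mcoeff_inject)

lemma finite_submultisets: "finite {a. a \<subseteq># (m :: 'b multiset)}"
proof (induction m)
  case empty
  then show ?case by simp
next
  case (add x m)
  have "{a. a \<subseteq># add_mset x m} \<subseteq> {a. a \<subseteq># m} \<union> add_mset x ` {a. a \<subseteq># m}"
  proof
    fix a assume "a \<in> {a. a \<subseteq># add_mset x m}"
    then have a: "a \<subseteq># add_mset x m" by simp
    show "a \<in> {a. a \<subseteq># m} \<union> add_mset x ` {a. a \<subseteq># m}"
    proof (cases "x \<in># a")
      case True
      then obtain b where b: "a = add_mset x b" by (metis multi_member_split)
      with a show ?thesis by simp
    next
      case False
      with a have "a \<subseteq># m"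
        by (metis diff_single_trivial subset_eq_diff_conv add_mset_add_single)
      then show ?thesis by simp
    qed
  qed
  then show ?case using add finite_subset by blast
qed

instantiation mseries :: (comm_ring_1) comm_ring_1
begin

lift_definition zero_mseries :: "'a mseries" is "\<lambda>_. 0" .
lift_definition one_mseries :: "'a mseries" is "\<lambda>m. if m = {#} then 1 else 0" .
lift_definition plus_mseries :: "'a mseries \<Rightarrow> 'a mseries \<Rightarrow> 'a mseries" is "\<lambda>f g m. f m + g m" .
lift_definition minus_mseries :: "'a mseries \<Rightarrow> 'a mseries \<Rightarrow> 'a mseries" is "\<lambda>f g m. f m - g m" .
lift_definition uminus_mseries :: "'a mseries \<Rightarrow> 'a mseries" is "\<lambda>f m. - f m" .
lift_definition times_mseries :: "'a mseries \<Rightarrow> 'a mseries \<Rightarrow> 'a mseries"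
  is "\<lambda>f g m. \<Sum>a | a \<subseteq># m. f a * g (m - a)" .

instance
proof
  fix f g h :: "'a mseries"
  show "f + g + h = f + (g + h)" by transfer (simp add: algebra_simps)
  show "f + g = g + f" by transfer (simp add: algebra_simps)
  show "0 + f = f" by transfer simp
  show "- f + f = 0" by transfer simp
  show "f - g = f + - g" by transfer simp
  show "(0 :: 'a mseries) \<noteq> 1" by transfer (metis zero_neq_one)
  show "(f + g) * h = f * h + g * h"
    by transfer (simp add: algebra_simps sum.distrib)
  show "f * g = g * f"
  proof transfer
    fix f g :: "nat multiset \<Rightarrow> 'a"
    have "(\<Sum>a | a \<subseteq># m. f a * g (m - a)) = (\<Sum>a | a \<subseteq># m. g a * f (m - a))" for m
      by (rule sum.reindex_bij_witness[of _ "\<lambda>a. m - a" "\<lambda>a. m - a"]) (auto simp: mult.commute subset_mset.le_iff_add)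
    then show "(\<lambda>m. \<Sum>a | a \<subseteq># m. f a * g (m - a)) = (\<lambda>m. \<Sum>a | a \<subseteq># m. g a * f (m - a))"
      by blast
  qed
  show "1 * f = f"
  proof transfer
    fix f :: "nat multiset \<Rightarrow> 'a"
    have "(\<Sum>a | a \<subseteq># m. (if a = {#} then 1 else 0) * f (m - a)) = f m" for m
    proof -
      have "(\<Sum>a | a \<subseteq># m. (if a = {#} then 1 else 0) * f (m - a))
          = (\<Sum>a | a \<subseteq># m. if a = {#} then f m else 0)"
        by (rule sum.cong) auto
      also have "\<dots> = f m" by (simp add: finite_submultisets)
      finally show ?thesis .
    qed
    then show "(\<lambda>m. \<Sum>a | a \<subseteq># m. (if a = {#} then 1 else 0) * f (m - a)) = f" by blast
  qed
  show "f * g * h = f * (g * h)"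
  proof transfer
    fix f g h :: "nat multiset \<Rightarrow> 'a"
    have "(\<Sum>a | a \<subseteq># m. (\<Sum>b | b \<subseteq># a. f b * g (a - b)) * h (m - a))
        = (\<Sum>b | b \<subseteq># m. f b * (\<Sum>c | c \<subseteq># m - b. g c * h (m - b - c)))" for m
    proof -
      have "(\<Sum>a | a \<subseteq># m. (\<Sum>b | b \<subseteq># a. f b * g (a - b)) * h (m - a))
          = (\<Sum>(a, b) \<in> (SIGMA a:{a. a \<subseteq># m}. {b. b \<subseteq># a}). f b * g (a - b) * h (m - a))"
        by (simp add: sum.Sigma[symmetric] finite_submultisets sum_distrib_right)
      also have "\<dots> = (\<Sum>(b, c) \<in> (SIGMA b:{b. b \<subseteq># m}. {c. c \<subseteq># m - b}). f b * (g c * h (m - b - c)))"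
        by (rule sum.reindex_bij_witness[of _ "\<lambda>(b, c). (b + c, b)" "\<lambda>(a, b). (b, a - b)"])
          (auto simp: subset_mset.le_iff_add add.assoc mult.assoc)
      also have "\<dots> = (\<Sum>b | b \<subseteq># m. f b * (\<Sum>c | c \<subseteq># m - b. g c * h (m - b - c)))"
        by (simp add: sum.Sigma[symmetric] finite_submultisets sum_distrib_left)
      finally show ?thesis .
    qed
    then show "(\<lambda>m. \<Sum>a | a \<subseteq># m. (\<Sum>b | b \<subseteq># a. f b * g (a - b)) * h (m - a))
        = (\<lambda>m. \<Sum>b | b \<subseteq># m. f b * (\<Sum>c | c \<subseteq># m - b. g c * h (m - b - c)))"
      by blast
  qed
qed

end

lift_definition mseries_const :: "'a :: zero \<Rightarrow> 'a mseries" is "\<lambda>c m. if m = {#} then c else 0" .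

lift_definition power_sum :: "nat \<Rightarrow> 'a :: zero_neq_one mseries"
  is "\<lambda>k m. if \<exists>i\<ge>1. m = replicate_mset k i then 1 else 0" .

text \<open>
  The coefficient of a monomial \<open>m\<close> counts the index sequences \<open>i\<^sub>1 \<ge> \<dots> \<ge> i\<^sub>n \<ge> 1\<close> producing \<open>m\<close>;
  list positions start at 0, so \<open>i\<^sub>j\<close> is \<open>xs ! (j - 1)\<close>.
\<close>

lift_definition fund_qsym :: "nat set \<Rightarrow> nat \<Rightarrow> 'a :: comm_ring_1 mseries"
  is "\<lambda>S n m. of_nat (card {xs. length xs = n \<and> sorted_wrt (\<ge>) xs \<and> (\<forall>i\<in>set xs. i \<ge> 1)
        \<and> (\<forall>j\<in>S. xs ! (j - 1) > xs ! j) \<and> mset xs = m})" .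


section \<open>Permutation statistics\<close>

definition EXC :: "nat \<Rightarrow> (nat \<Rightarrow> nat) \<Rightarrow> nat set"
  where "EXC n \<sigma> = {i \<in> {1..n - 1}. \<sigma> i > i}"

definition exc :: "nat \<Rightarrow> (nat \<Rightarrow> nat) \<Rightarrow> nat"
  where "exc n \<sigma> = card (EXC n \<sigma>)"

text \<open>
  The ordered alphabet, in which all barred letters precede all unbarred ones, is encoded
  order-isomorphically as \<open>1 < \<dots> < 2 n\<close>: barred \<open>k\<close> becomes \<open>k\<close>, unbarred \<open>k\<close> becomes \<open>n + k\<close>.
\<close>

definition barred_word :: "nat \<Rightarrow> (nat \<Rightarrow> nat) \<Rightarrow> nat \<Rightarrow> nat"
  where "barred_word n \<sigma> i = (if i \<in> EXC n \<sigma> then \<sigma> i else n + \<sigma> i)"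

definition DEX :: "nat \<Rightarrow> (nat \<Rightarrow> nat) \<Rightarrow> nat set"
  where "DEX n \<sigma> = {i \<in> {1..n - 1}. barred_word n \<sigma> i > barred_word n \<sigma> (i + 1)}"

definition derangements :: "nat \<Rightarrow> (nat \<Rightarrow> nat) set"
  where "derangements n = {\<sigma>. \<sigma> permutes {1..n} \<and> (\<forall>i\<in>{1..n}. \<sigma> i \<noteq> i)}"

text \<open>The grading variable \<open>t\<close> is \<^const>\<open>fls_X\<close>; Laurent series accommodate the factor \<open>t\<^sup>-\<^sup>1\<close>.\<close>

definition Q_eulerian :: "nat \<Rightarrow> complex mseries fls"
  where "Q_eulerian n =
    (\<Sum>\<sigma> | \<sigma> permutes {1..n}. fls_const (fund_qsym (DEX n \<sigma>) n) * fls_X ^ exc n \<sigma>)"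

definition Q0_eulerian :: "nat \<Rightarrow> complex mseries fls"
  where "Q0_eulerian n =
    (\<Sum>\<sigma>\<in>derangements n. fls_const (fund_qsym (DEX n \<sigma>) n) * fls_X ^ exc n \<sigma>)"


section \<open>Quotients, extension of scalars and traces\<close>

text \<open>The map between quotients by \<open>N\<close> induced by an \<open>N\<close>-preserving additive map \<open>f\<close>.\<close>

definition induced_map :: "('b, 'm) ring_scheme \<Rightarrow> 'b set \<Rightarrow> ('b \<Rightarrow> 'b) \<Rightarrow> 'b set \<Rightarrow> 'b set"
  where "induced_map M N f X = (\<Union>x\<in>X. N +>\<^bsub>M\<^esub> f x)"

text \<open>
  As in the library, the fields \<^const>\<open>monoid.mult\<close> and \<^const>\<open>one\<close> of a module record carry no meaning
  unless the module is an algebra; they are left \<^const>\<open>undefined\<close>.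
\<close>

definition quot_module :: "('k, 'b) module \<Rightarrow> 'b set \<Rightarrow> ('k, 'b set) module"
  where "quot_module M N =
    \<lparr>carrier = a_rcosets\<^bsub>M\<^esub> N, monoid.mult = undefined, one = undefined, zero = N, add = set_add M,
     module.smult = (\<lambda>c. induced_map M N (\<lambda>x. c \<odot>\<^bsub>M\<^esub> x))\<rparr>"

definition pm_scale :: "'k :: semiring_0 \<Rightarrow> ('b \<Rightarrow>\<^sub>0 'k) \<Rightarrow> ('b \<Rightarrow>\<^sub>0 'k)"
  where "pm_scale c p = Poly_Mapping.map ((*) c) p"

definition pm_extend :: "('a \<Rightarrow> 'b) \<Rightarrow> ('a \<Rightarrow>\<^sub>0 'k :: comm_monoid_add) \<Rightarrow> ('b \<Rightarrow>\<^sub>0 'k)"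
  where "pm_extend f p = (\<Sum>a\<in>Poly_Mapping.keys p. Poly_Mapping.single (f a) (Poly_Mapping.lookup p a))"

definition free_module :: "'b set \<Rightarrow> ('k :: semiring_0, 'b \<Rightarrow>\<^sub>0 'k) module"
  where "free_module S =
    \<lparr>carrier = {p. Poly_Mapping.keys p \<subseteq> S}, monoid.mult = undefined, one = undefined,
     zero = 0, add = (+), module.smult = pm_scale\<rparr>"

text \<open>
  \<open>\<complex> \<otimes>\<^sub>\<rat> V\<close> is the free complex vector space on the symbols \<open>1 \<otimes> v\<close> (\<open>v \<in> V\<close>) modulo the relations
  making \<open>v \<mapsto> 1 \<otimes> v\<close> a \<open>\<rat>\<close>-linear map; \<open>c \<otimes> v\<close> is the class of \<open>Poly_Mapping.single v c\<close>.
\<close>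

definition tensor_rels :: "(rat, 'b) module \<Rightarrow> ('b \<Rightarrow>\<^sub>0 complex) set"
  where "tensor_rels V = module.span pm_scale
    ({Poly_Mapping.single (v \<oplus>\<^bsub>V\<^esub> w) 1 - Poly_Mapping.single v 1 - Poly_Mapping.single w 1 | v w.
        v \<in> carrier V \<and> w \<in> carrier V}
     \<union> {Poly_Mapping.single (q \<odot>\<^bsub>V\<^esub> v) 1 - Poly_Mapping.single v (of_rat q) | q v. v \<in> carrier V})"

definition complexify :: "(rat, 'b) module \<Rightarrow> (complex, ('b \<Rightarrow>\<^sub>0 complex) set) module"
  where "complexify V = quot_module (free_module (carrier V)) (tensor_rels V)"

text \<open>\<open>1 \<otimes> g\<close> for a linear endomorphism \<open>g\<close> of \<open>V\<close>.\<close>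

definition complexify_map ::
    "(rat, 'b) module \<Rightarrow> ('b \<Rightarrow> 'b) \<Rightarrow> ('b \<Rightarrow>\<^sub>0 complex) set \<Rightarrow> ('b \<Rightarrow>\<^sub>0 complex) set"
  where "complexify_map V g =
    induced_map (free_module (carrier V) :: (complex, _) module) (tensor_rels V) (pm_extend g)"

definition is_coords :: "(complex, 'b) module \<Rightarrow> 'b set \<Rightarrow> 'b \<Rightarrow> ('b \<Rightarrow> complex) \<Rightarrow> bool"
  where "is_coords V B v c \<longleftrightarrow>
    c \<in> B \<rightarrow>\<^sub>E UNIV \<and> v = (\<Oplus>\<^bsub>V\<^esub>b\<in>B. c b \<odot>\<^bsub>V\<^esub> b)"

definition is_basis :: "(complex, 'b) module \<Rightarrow> 'b set \<Rightarrow> bool"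
  where "is_basis V B \<longleftrightarrow>
    finite B \<and> B \<subseteq> carrier V \<and> (\<forall>v\<in>carrier V. \<exists>!c. is_coords V B v c)"

text \<open>Trace of an endomorphism of a finite-dimensional space; the choice of basis is immaterial.\<close>

definition lin_trace :: "(complex, 'b) module \<Rightarrow> ('b \<Rightarrow> 'b) \<Rightarrow> complex"
  where "lin_trace V f =
    (let B = (SOME B. is_basis V B) in \<Sum>b\<in>B. (THE c. is_coords V B (f b) c) b)"


section \<open>Frobenius characteristic\<close>

text \<open>\<open>p\<^sub>\<lambda>\<close> for \<open>\<lambda>\<close> the cycle type of \<open>\<sigma> \<in> \<SS>\<^sub>n\<close>; the cycles are the orbits, including fixed points.\<close>

definition cycle_power_sum :: "nat \<Rightarrow> (nat \<Rightarrow> nat) \<Rightarrow> complex mseries"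
  where "cycle_power_sum n \<sigma> = (\<Prod>C \<in> orbit \<sigma> ` {1..n}. power_sum (card C))"

text \<open>
  \<open>ch V = 1/n! \<Sum>\<^sub>\<sigma> \<chi>\<^sub>V(\<sigma>) p\<^bsub>cyc(\<sigma>)\<^esub>\<close> for a complex representation \<open>\<rho>\<close> of \<open>\<SS>\<^sub>n\<close> on \<open>V\<close>. This is the
  normalisation under which \<open>\<chi>\<^sup>\<lambda> \<mapsto> s\<^sub>\<lambda>\<close> and the trivial character maps to \<open>h\<^sub>n\<close>.
\<close>

definition frob_ch ::
    "nat \<Rightarrow> (complex, 'b) module \<Rightarrow> ((nat \<Rightarrow> nat) \<Rightarrow> 'b \<Rightarrow> 'b) \<Rightarrow> complex mseries"
  where "frob_ch n V \<rho> = mseries_const (1 / fact n) *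
    (\<Sum>\<sigma> | \<sigma> permutes {1..n}. mseries_const (lin_trace V (\<rho> \<sigma>)) * cycle_power_sum n \<sigma>)"

definition grFrob ::
    "nat \<Rightarrow> (nat \<Rightarrow> (complex, 'b) module) \<Rightarrow> (nat \<Rightarrow> (nat \<Rightarrow> nat) \<Rightarrow> 'b \<Rightarrow> 'b)
      \<Rightarrow> complex mseries fls"
  where "grFrob n V \<rho> = fps_to_fls (Abs_fps (\<lambda>i. frob_ch n (V i) (\<rho> i)))"


section \<open>Chow rings of matroids\<close>

text \<open>
  Polynomials over \<open>\<rat>\<close> in variables \<open>x\<^sub>v\<close>; monomials are multisets of variables, and multiplication of
  \<^typ>\<open>'v multiset \<Rightarrow>\<^sub>0 rat\<close> is the convolution product.
\<close>

type_synonym 'v mpoly = "'v multiset \<Rightarrow>\<^sub>0 rat"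

definition Var :: "'v \<Rightarrow> 'v mpoly"
  where "Var v = Poly_Mapping.single {#v#} 1"

definition Const :: "rat \<Rightarrow> 'v mpoly"
  where "Const q = Poly_Mapping.single {#} q"

definition mpoly_ring :: "'v set \<Rightarrow> 'v mpoly ring"
  where "mpoly_ring X =
    \<lparr>carrier = {p. \<forall>m\<in>Poly_Mapping.keys p. set_mset m \<subseteq> X},
     monoid.mult = (*), one = 1, zero = 0, add = (+)\<rparr>"

text \<open>
  A loopless matroid enters only through its ground set \<open>E\<close> and its lattice of flats \<open>L\<close>, where
  looplessness means \<open>{} \<in> L\<close>.
\<close>

definition chow_vars :: "'e set set \<Rightarrow> 'e set mpoly ring"
  where "chow_vars L = mpoly_ring (L - {{}})"

definition chow_I :: "'e set set \<Rightarrow> 'e set mpoly set"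
  where "chow_I L = Idl\<^bsub>chow_vars L\<^esub>
    {Var F * Var G | F G. F \<in> L - {{}} \<and> G \<in> L - {{}} \<and> \<not> F \<subseteq> G \<and> \<not> G \<subseteq> F}"

definition chow_J :: "'e set \<Rightarrow> 'e set set \<Rightarrow> 'e set mpoly set"
  where "chow_J E L = Idl\<^bsub>chow_vars L\<^esub> {\<Sum>F | F \<in> L - {{}} \<and> i \<in> F. Var F | i. i \<in> E}"

definition chow_ideal :: "'e set \<Rightarrow> 'e set set \<Rightarrow> 'e set mpoly set"
  where "chow_ideal E L = chow_I L <+>\<^bsub>chow_vars L\<^esub> chow_J E L"

definition chow_ring :: "'e set \<Rightarrow> 'e set set \<Rightarrow> 'e set mpoly set ring"
  where "chow_ring E L = chow_vars L Quot chow_ideal E L"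

definition chow_algebra :: "'e set \<Rightarrow> 'e set set \<Rightarrow> (rat, 'e set mpoly set) module"
  where "chow_algebra E L = ring.extend (chow_ring E L)
    (module.fields (\<lambda>q a. (chow_ideal E L +>\<^bsub>chow_vars L\<^esub> Const q) \<otimes>\<^bsub>chow_ring E L\<^esub> a))"

text \<open>The degree \<open>d\<close> component: classes of homogeneous polynomials of degree \<open>d\<close>.\<close>

definition chow_degree :: "'e set \<Rightarrow> 'e set set \<Rightarrow> nat \<Rightarrow> (rat, 'e set mpoly set) module"
  where "chow_degree E L d = (chow_algebra E L)
    \<lparr>carrier := {chow_ideal E L +>\<^bsub>chow_vars L\<^esub> p | p.
       p \<in> carrier (chow_vars L) \<and> (\<forall>m\<in>Poly_Mapping.keys p. size m = d)}\<rparr>"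

text \<open>\<open>\<sigma> x\<^sub>F = x\<^bsub>\<sigma>(F)\<^esub>\<close>, extended to an algebra automorphism.\<close>

definition chow_action ::
    "'e set \<Rightarrow> 'e set set \<Rightarrow> ('e \<Rightarrow> 'e) \<Rightarrow> 'e set mpoly set \<Rightarrow> 'e set mpoly set"
  where "chow_action E L \<sigma> =
    induced_map (chow_vars L) (chow_ideal E L) (pm_extend (image_mset ((`) \<sigma>)))"

definition uniform_flats :: "nat \<Rightarrow> nat \<Rightarrow> nat set set"
  where "uniform_flats r n = {S. S \<subseteq> {1..n} \<and> card S \<le> r - 1} \<union> {{1..n}}"

definition grFrob_chow_uniform :: "nat \<Rightarrow> nat \<Rightarrow> complex mseries fls"
  where "grFrob_chow_uniform r n =
    grFrob n
      (\<lambda>d. complexify (chow_degree {1..n} (uniform_flats r n) d))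
      (\<lambda>d \<sigma>. complexify_map (chow_degree {1..n} (uniform_flats r n) d)
                (chow_action {1..n} (uniform_flats r n) \<sigma>))"

end

theory Submission
  imports Defs
begin

text \<open>
  \<^bold>\<open>The Chow ring.\<close> In every degree the Chow ring of a uniform matroid of rank \<open>r\<close> on \<open>{1..n}\<close> has a
  basis of Feichtner--Yuzvinsky monomials: products of powers \<open>x\<^bsub>F\<^esub> ^ c\<close> along a chain of nonempty
  flats, in which the exponent \<open>c\<close> of \<open>F\<close> is smaller than \<open>rk F - rk G\<close>, where \<open>G\<close> is the preceding
  member of the chain, or the empty set. They span for every rank, by a straightening argument
  (\<open>fy_spanning\<close>). For \<open>r = n\<close> the generating function of their numbers, times the Hilbert series of a
  polynomial ring in \<open>n\<close> variables, is that of the numbers of chain monomials; since the basis monomials times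
  products of the linear relations span the chain monomials, nothing can be dependent
  (\<open>fy_independent_boolean\<close>). For
  \<open>r = n - 1\<close> multiplication by the variable of the ground set carries all relations and
  the basis to the case \<open>r = n\<close> (\<open>fy_independent_truncated\<close>). The symmetric group permutes the
  basis, so the trace of \<open>\<sigma>\<close>, which extension of scalars does not change, is the number of basis
  monomials fixed by \<open>\<sigma>\<close> (\<open>chow_trace\<close>).

  \<^bold>\<open>Levelled multisets.\<close> A chain monomial is recorded by the function that sends \<open>i\<close> to the number of its
  factors containing \<open>i\<close>. Its values are the levels; the degree is the largest level, and the bound on the
  exponents becomes the condition that a level \<open>a > 0\<close> has a smaller level \<open>a'\<close> (or \<open>0\<close>) with \<open>a - a'\<close>
  smaller than the number of points at level \<open>a\<close>. The basis in degree \<open>d\<close> for \<open>r = n - 1\<close> corresponds to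
  such functions with largest level \<open>d + 1\<close> and all levels positive. The coefficient of the monomial \<open>m\<close> in
  the Frobenius characteristic counts, by Burnside's lemma, the orbits of pairs consisting of a level
  function and a colouring with content \<open>m\<close>, that is, the multisets of pairs (level, colour)
  with admissible levels and with colours \<open>m\<close> (\<open>frobenius_of_level_action\<close>).

  \<^bold>\<open>Permutations.\<close> The coefficient of \<open>m\<close> in \<open>Q\<^sub>n\<close> counts the permutations whose set \<open>DEX\<close> is compatible
  with the decreasing word \<open>s\<close> of content \<open>m\<close>. Reading the letter \<open>s (\<sigma>\<^sup>-\<^sup>1 v)\<close> at position \<open>v\<close>, with a bar if
  \<open>\<sigma>\<^sup>-\<^sup>1 v < v\<close>, identifies them with the rearrangements of \<open>s\<close> whose letters are barred according to
  a rule that looks at one position at a time (\<open>encode_bij\<close>). Hence the excedance polynomial is the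
  coefficient of \<open>m\<close> in a product of linear forms (\<open>excedance_sum_eq_mcoeff\<close>).

  \<^bold>\<open>Comparison.\<close> Let \<open>H(s)\<close> be the sum of all \<open>s\<^sup>k h\<^sub>k\<close>. Both generating series \<open>f\<close> satisfy
  \<open>f (H(t) - t H(1)) = (1 - t) H(1)\<close>. For the levelled multisets this is the recursion that strips the top
  level (\<open>level_series_equation\<close>), for the products of linear forms a telescoping
  identity (\<open>excedance_series_equation\<close>). The variants without level \<open>0\<close> and without fixed
  points satisfy the same equation with right-hand side \<open>1 - t\<close>. The factor on the left can be cancelled.
\<close>

section \<open>Power series with multiplicative coefficients\<close>

lift_definition mmono :: "nat multiset \<Rightarrow> 'a :: comm_ring_1 mseries"
  is "\<lambda>p m. if m = p then 1 else 0" .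

lift_definition linear_series :: "(nat \<Rightarrow> 'a :: comm_ring_1) \<Rightarrow> 'a mseries"
  is "\<lambda>a m. if size m = 1 then a (the_elem (set_mset m)) else 0" .

lift_definition restrict_vars :: "nat set \<Rightarrow> 'a :: comm_ring_1 mseries \<Rightarrow> 'a mseries"
  is "\<lambda>V f m. if set_mset m \<subseteq> V then f m else 0" .

text \<open>
  For a series \<open>f\<close> with constant term 1 this is the infinite product of all \<open>f(x\<^sub>b)\<close>.
\<close>

lift_definition multiplicative_series :: "'a :: comm_ring_1 fps \<Rightarrow> 'a mseries"
  is "\<lambda>f m. \<Prod>b\<in>set_mset m. fps_nth f (count m b)" .

lemma mcoeff_times: "mcoeff (f * g) m = (\<Sum>a | a \<subseteq># m. mcoeff f a * mcoeff g (m - a))"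
  by (simp add: times_mseries.rep_eq)

lemma mcoeff_sum: "mcoeff (\<Sum>i\<in>A. f i) m = (\<Sum>i\<in>A. mcoeff (f i) m)"
  by (induction A rule: infinite_finite_induct) (simp_all add: zero_mseries.rep_eq plus_mseries.rep_eq)

lemmas mcoeff_simps = zero_mseries.rep_eq plus_mseries.rep_eq minus_mseries.rep_eq
  uminus_mseries.rep_eq one_mseries.rep_eq mcoeff_sum

lemma mcoeff_const_times [simp]: "mcoeff (mseries_const c * f) m = c * mcoeff f m"
proof -
  have "mcoeff (mseries_const c * f) m = (\<Sum>a | a \<subseteq># m. if a = {#} then c * mcoeff f m else 0)"
    unfolding mcoeff_times by (rule sum.cong) (auto simp: mseries_const.rep_eq)
  then show ?thesis by (simp add: finite_submultisets)
qed

lemma mcoeff_mmono_times: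
  "mcoeff (mmono p * f) m = (if p \<subseteq># m then mcoeff f (m - p) else 0)"
proof -
  have "mcoeff (mmono p * f) m = (\<Sum>a | a \<subseteq># m. if a = p then mcoeff f (m - p) else 0)"
    unfolding mcoeff_times by (rule sum.cong) (auto simp: mmono.rep_eq)
  then show ?thesis by (simp add: finite_submultisets)
qed

lemma mmono_mult: "mmono p * mmono q = mmono (p + q)"
proof (rule mseries_eqI)
  show "mcoeff (mmono p * mmono q :: 'a mseries) m = mcoeff (mmono (p + q)) m" for m
    unfolding mcoeff_mmono_times by (auto simp: mmono.rep_eq subset_mset.add_diff_inverse)
qed

lemma mmono_empty: "mmono {#} = 1"
  by (rule mseries_eqI) (simp add: mmono.rep_eq one_mseries.rep_eq)

lemma mmono_sum: "mmono (\<Sum>i\<in>A. p i) = (\<Prod>i\<in>A. mmono (p i))"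
  by (induction A rule: infinite_finite_induct) (simp_all add: mmono_empty mmono_mult[symmetric])

lemma mseries_const_mult: "mseries_const (c * d) = mseries_const c * mseries_const d"
  by (rule mseries_eqI) (simp add: mseries_const.rep_eq)

lemma mseries_const_one: "mseries_const 1 = 1"
  by (rule mseries_eqI) (simp add: mseries_const.rep_eq one_mseries.rep_eq)

lemma mseries_const_zero: "mseries_const 0 = 0"
  by (rule mseries_eqI) (simp add: mseries_const.rep_eq zero_mseries.rep_eq)

lemma mseries_const_minus: "mseries_const (- s) = - mseries_const (s :: 'a :: comm_ring_1)"
  by (rule mseries_eqI) (simp add: mseries_const.rep_eq uminus_mseries.rep_eq)

lemma mseries_const_add: "mseries_const (s + s') = mseries_const s + mseries_const (s' :: 'a :: comm_ring_1)"
  by (rule mseries_eqI) (simp add: mseries_const.rep_eq plus_mseries.rep_eq)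

lemma mseries_const_prod: "mseries_const (\<Prod>i\<in>A. c i) = (\<Prod>i\<in>A. mseries_const (c i))"
  by (induction A rule: infinite_finite_induct) (simp_all add: mseries_const_one mseries_const_mult)

lemma restrict_vars_mult: "restrict_vars V (f * g) = restrict_vars V f * restrict_vars V g"
proof (rule mseries_eqI)
  fix m
  show "mcoeff (restrict_vars V (f * g)) m = mcoeff (restrict_vars V f * restrict_vars V g) m"
  proof (cases "set_mset m \<subseteq> V")
    case True
    then have "a \<subseteq># m \<Longrightarrow> set_mset a \<subseteq> V \<and> set_mset (m - a) \<subseteq> V" for a
      using set_mset_mono[of a m] in_diffD[of _ m a] by blast
    then have "a \<subseteq># m \<Longrightarrow> mcoeff f a * mcoeff g (m - a)
        = mcoeff (restrict_vars V f) a * mcoeff (restrict_vars V g) (m - a)" for a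
      by (simp add: restrict_vars.rep_eq)
    then show ?thesis
      using True by (simp add: restrict_vars.rep_eq mcoeff_times)
  next
    case False
    have "\<not> (set_mset a \<subseteq> V \<and> set_mset (m - a) \<subseteq> V)" if "a \<subseteq># m" for a
    proof -
      have "set_mset m = set_mset a \<union> set_mset (m - a)"
        using that by (metis set_mset_union subset_mset.add_diff_inverse)
      with False show ?thesis by blast
    qed
    with False have "mcoeff (restrict_vars V f * restrict_vars V g) m = 0"
      unfolding mcoeff_times by (intro sum.neutral) (auto simp: restrict_vars.rep_eq)
    with False show ?thesis by (simp add: restrict_vars.rep_eq)
  qed
qed

lemma restrict_vars_one: "restrict_vars V 1 = 1"
  by (rule mseries_eqI) (simp add: restrict_vars.rep_eq one_mseries.rep_eq)

lemma restrict_vars_prod: "restrict_vars V (\<Prod>i\<in>A. f i) = (\<Prod>i\<in>A. restrict_vars V (f i))"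
  by (induction A rule: infinite_finite_induct) (simp_all add: restrict_vars_mult restrict_vars_one)

lemma linear_series_sum:
  assumes "finite V" "\<And>c. c \<notin> V \<Longrightarrow> a c = 0"
  shows "linear_series a = (\<Sum>c\<in>V. mseries_const (a c) * mmono {#c#})"
proof (rule mseries_eqI)
  fix m
  have "(\<Sum>c\<in>V. a c * (if m = {#c#} then 1 else 0)) = (if size m = 1 then a (the_elem (set_mset m)) else 0)"
  proof (cases "size m = 1")
    case True
    then obtain d where "m = {#d#}" using size_1_singleton_mset by blast
    with assms show ?thesis by (cases "d \<in> V") (simp_all add: if_distrib cong: if_cong)
  next
    case False
    then show ?thesis by (auto intro!: sum.neutral)
  qed
  then show "mcoeff (linear_series a) m = mcoeff (\<Sum>c\<in>V. mseries_const (a c) * mmono {#c#}) m"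
    by (simp add: linear_series.rep_eq mcoeff_sum mmono.rep_eq)
qed

lemma restrict_vars_linear:
  "restrict_vars V (linear_series a) = linear_series (\<lambda>c. if c \<in> V then a c else 0)"
proof (rule mseries_eqI)
  show "mcoeff (restrict_vars V (linear_series a)) m
      = mcoeff (linear_series (\<lambda>c. if c \<in> V then a c else 0)) m" for m
  proof (cases "size m = 1")
    case True
    then obtain d where "m = {#d#}" using size_1_singleton_mset by blast
    then show ?thesis by (simp add: restrict_vars.rep_eq linear_series.rep_eq)
  qed (simp add: restrict_vars.rep_eq linear_series.rep_eq)
qed

lemma linear_series_diff: "linear_series a - linear_series b = linear_series (\<lambda>c. a c - b c)"
  by (rule mseries_eqI) (simp add: linear_series.rep_eq minus_mseries.rep_eq)

lemma linear_series_cmul: "mseries_const s * linear_series a = linear_series (\<lambda>c. s * a c)"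
  by (rule mseries_eqI) (simp add: linear_series.rep_eq)

lemma linear_series_var: "linear_series (\<lambda>c. if c = b then 1 else 0) = mmono {#b#}"
  by (subst linear_series_sum[of "{b}"]) (simp_all add: mseries_const_one)

lemma mset_set_sum_single: "finite I \<Longrightarrow> image_mset g (mset_set I) = (\<Sum>i\<in>I. {#g i#})"
  by (induction I rule: finite_induct) simp_all

text \<open>
  Expanding the product chooses one variable from each factor; the choices are the functions \<open>g\<close>.
\<close>

lemma mcoeff_prod_linear_series:
  assumes "finite I"
  shows "mcoeff (\<Prod>v\<in>I. linear_series (a v)) m =
    (\<Sum>g | g \<in> I \<rightarrow>\<^sub>E UNIV \<and> image_mset g (mset_set I) = m. \<Prod>v\<in>I. a v (g v))"
proof -
  let ?V = "set_mset m"
  have "mcoeff (\<Prod>v\<in>I. linear_series (a v)) m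
      = mcoeff (restrict_vars ?V (\<Prod>v\<in>I. linear_series (a v))) m"
    by (simp add: restrict_vars.rep_eq)
  also have "restrict_vars ?V (\<Prod>v\<in>I. linear_series (a v))
      = (\<Prod>v\<in>I. \<Sum>c\<in>?V. mseries_const (a v c) * mmono {#c#})"
    unfolding restrict_vars_prod restrict_vars_linear
    by (intro prod.cong refl, subst linear_series_sum[of ?V]) (auto intro!: sum.cong)
  also have "\<dots> = (\<Sum>g\<in>I \<rightarrow>\<^sub>E ?V. \<Prod>v\<in>I. mseries_const (a v (g v)) * mmono {#g v#})"
    using assms by (intro prod_sum_PiE) auto
  also have "\<dots> = (\<Sum>g\<in>I \<rightarrow>\<^sub>E ?V. mseries_const (\<Prod>v\<in>I. a v (g v)) * mmono (image_mset g (mset_set I)))"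
    using assms by (simp add: prod.distrib mseries_const_prod mmono_sum mset_set_sum_single)
  also have "mcoeff \<dots> m = (\<Sum>g\<in>I \<rightarrow>\<^sub>E ?V. if image_mset g (mset_set I) = m then \<Prod>v\<in>I. a v (g v) else 0)"
    by (auto simp: mcoeff_sum mmono.rep_eq intro!: sum.cong)
  also have "\<dots> = (\<Sum>g | g \<in> I \<rightarrow>\<^sub>E ?V \<and> image_mset g (mset_set I) = m. \<Prod>v\<in>I. a v (g v))"
    using assms by (simp add: sum.If_cases finite_PiE Int_def)
  also have "{g. g \<in> I \<rightarrow>\<^sub>E ?V \<and> image_mset g (mset_set I) = m}
      = {g. g \<in> I \<rightarrow>\<^sub>E UNIV \<and> image_mset g (mset_set I) = m}"
    using assms by (auto simp: PiE_iff)
  finally show ?thesis .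
qed

lemma sum_submultisets_prod:
  fixes F :: "'b \<Rightarrow> nat \<Rightarrow> 'a :: comm_semiring_1"
  assumes "finite V" "set_mset m \<subseteq> V"
  shows "(\<Sum>\<nu> | \<nu> \<subseteq># m. \<Prod>b\<in>V. F b (count \<nu> b)) = (\<Prod>b\<in>V. \<Sum>j\<le>count m b. F b j)"
proof -
  have cnt: "count (\<Sum>b\<in>V. replicate_mset (g b) b) c = (if c \<in> V then g c else 0)" for g c
    using assms(1) by (simp add: count_sum if_distrib cong: if_cong)
  have "(\<Prod>b\<in>V. \<Sum>j\<le>count m b. F b j) = (\<Sum>g\<in>PiE V (\<lambda>b. {..count m b}). \<Prod>b\<in>V. F b (g b))"
    using assms by (intro prod_sum_PiE) auto
  also have "\<dots> = (\<Sum>\<nu> | \<nu> \<subseteq># m. \<Prod>b\<in>V. F b (count \<nu> b))"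
  proof (rule sum.reindex_bij_witness[of _ "\<lambda>\<nu>. restrict (count \<nu>) V" "\<lambda>g. \<Sum>b\<in>V. replicate_mset (g b) b"])
    fix g assume g: "g \<in> PiE V (\<lambda>b. {..count m b})"
    show "restrict (count (\<Sum>b\<in>V. replicate_mset (g b) b)) V = g"
      using g by (auto simp: cnt restrict_def PiE_def extensional_def)
    show "(\<Sum>b\<in>V. replicate_mset (g b) b) \<in> {\<nu>. \<nu> \<subseteq># m}"
      using g by (auto simp: subseteq_mset_def cnt)
    show "(\<Prod>b\<in>V. F b (count (\<Sum>b\<in>V. replicate_mset (g b) b) b)) = (\<Prod>b\<in>V. F b (g b))"
      by (intro prod.cong) (auto simp: cnt)
  next
    fix \<nu> assume "\<nu> \<in> {\<nu>. \<nu> \<subseteq># m}"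
    then have \<nu>: "\<nu> \<subseteq># m" by simp
    then have "set_mset \<nu> \<subseteq> V" using assms(2) set_mset_mono by blast
    then show "(\<Sum>b\<in>V. replicate_mset (restrict (count \<nu>) V b) b) = \<nu>"
      by (intro multiset_eqI) (auto simp: cnt count_eq_zero_iff)
    show "restrict (count \<nu>) V \<in> PiE V (\<lambda>b. {..count m b})"
      using \<nu> by (auto simp: subseteq_mset_def)
  qed
  finally show ?thesis ..
qed

lemma mcoeff_multiplicative_series:
  assumes "fps_nth f 0 = 1" "finite V" "set_mset m \<subseteq> V"
  shows "mcoeff (multiplicative_series f) m = (\<Prod>b\<in>V. fps_nth f (count m b))"
  unfolding multiplicative_series.rep_eq using assms
  by (intro prod.mono_neutral_left) (auto simp: not_in_iff)

lemma multiplicative_series_mult: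
  fixes f g :: "'a :: comm_ring_1 fps"
  assumes "fps_nth f 0 = 1" "fps_nth g 0 = 1"
  shows "multiplicative_series f * multiplicative_series g = multiplicative_series (f * g)"
proof (rule mseries_eqI)
  fix m :: "nat multiset"
  let ?V = "set_mset m"
  have "mcoeff (multiplicative_series f * multiplicative_series g) m
      = (\<Sum>\<nu> | \<nu> \<subseteq># m. \<Prod>b\<in>?V. fps_nth f (count \<nu> b) * fps_nth g (count m b - count \<nu> b))"
    unfolding mcoeff_times
  proof (intro sum.cong refl)
    fix \<nu> assume "\<nu> \<in> {\<nu>. \<nu> \<subseteq># m}"
    then have "set_mset \<nu> \<subseteq> ?V" "set_mset (m - \<nu>) \<subseteq> ?V"
      using set_mset_mono by (auto dest: in_diffD)
    then show "mcoeff (multiplicative_series f) \<nu> * mcoeff (multiplicative_series g) (m - \<nu>)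
      = (\<Prod>b\<in>?V. fps_nth f (count \<nu> b) * fps_nth g (count m b - count \<nu> b))"
      using assms by (simp add: mcoeff_multiplicative_series[of _ ?V] prod.distrib)
  qed
  also have "\<dots> = (\<Prod>b\<in>?V. \<Sum>j\<le>count m b. fps_nth f j * fps_nth g (count m b - j))"
    by (rule sum_submultisets_prod) auto
  also have "\<dots> = mcoeff (multiplicative_series (f * g)) m"
    by (simp add: multiplicative_series.rep_eq fps_mult_nth atMost_atLeast0)
  finally show "mcoeff (multiplicative_series f * multiplicative_series g) m
      = mcoeff (multiplicative_series (f * g)) m" .
qed

text \<open>
  The sum of \<open>s ^ k\<close> times the complete homogeneous symmetric function of degree \<open>k\<close>, and below its inverse,
  the product of all \<open>1 - s x\<^sub>b\<close>.
\<close>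

definition H_series :: "'a :: comm_ring_1 \<Rightarrow> 'a mseries"
  where "H_series s = multiplicative_series (Abs_fps (\<lambda>j. s ^ j))"

definition E_series :: "'a :: comm_ring_1 \<Rightarrow> 'a mseries"
  where "E_series s = multiplicative_series (1 - fps_const s * fps_X)"

lemma mcoeff_H_series: "mcoeff (H_series s) m = s ^ size m"
  by (simp add: H_series_def multiplicative_series.rep_eq power_sum size_multiset_overloaded_eq)

lemma H_times_E: "H_series s * E_series s = 1"
proof -
  have "Abs_fps (\<lambda>j. s ^ j) * (1 - fps_const s * fps_X) = 1"
  proof (rule fps_ext)
    show "fps_nth (Abs_fps (\<lambda>j. s ^ j) * (1 - fps_const s * fps_X)) n = fps_nth 1 n" for n
      by (cases n) (simp_all add: right_diff_distrib mult.left_commute[of _ "fps_const s"])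
  qed
  moreover have "multiplicative_series (1 :: 'a fps) = 1"
  proof (rule mseries_eqI)
    show "mcoeff (multiplicative_series (1 :: 'a fps)) m = mcoeff 1 m" for m
    proof (cases "m = {#}")
      case False
      then obtain b where "b \<in># m" by blast
      then have "(\<Prod>b\<in>set_mset m. fps_nth (1 :: 'a fps) (count m b)) = 0"
        by (intro prod_zero) (auto intro!: bexI[of _ b])
      with False show ?thesis by (simp add: multiplicative_series.rep_eq one_mseries.rep_eq)
    qed (simp add: multiplicative_series.rep_eq one_mseries.rep_eq)
  qed
  ultimately show ?thesis
    by (simp add: H_series_def E_series_def multiplicative_series_mult)
qed

section \<open>A series of products of linear forms\<close>

context
  fixes t :: "'a :: comm_ring_1"
begin

text \<open>
  The generating function of one barred letter under a letter \<open>b\<close>: larger letters carry a bar, which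
  \<open>t\<close> records, smaller ones do not, and the letter \<open>b\<close> itself may or may not.
\<close>

definition block_form :: "nat \<Rightarrow> 'a mseries"
  where "block_form b = linear_series (\<lambda>c. (if c \<ge> b then t else 0) + (if c \<le> b then 1 else 0))"

text \<open>
  As in MacMahon's master theorem, the product of linear forms depends on the monomial whose coefficient
  is taken. Multiplication by a multiplicative series only changes the exponents of these forms.
\<close>

lift_definition master_series :: "'a mseries"
  is "\<lambda>m. mcoeff (\<Prod>b\<in>set_mset m. block_form b ^ count m b) m" .

text \<open>
  A monomial \<open>\<nu> \<subseteq># m\<close> of the first factor leaves the monomial \<open>m - \<nu>\<close>, and so the product in which the
  exponents of the forms are lowered by the counts of \<open>\<nu>\<close>. The sum over \<open>\<nu>\<close> factors over the variables.
\<close>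

lemma mcoeff_multiplicative_times_master:
  assumes "fps_nth f 0 = 1"
  shows "mcoeff (multiplicative_series f * master_series) m =
    mcoeff (\<Prod>b\<in>set_mset m. \<Sum>j\<le>count m b.
      mseries_const (fps_nth f j) * mmono (replicate_mset j b) * block_form b ^ (count m b - j)) m"
proof -
  let ?V = "set_mset m"
  have "(\<Prod>b\<in>?V. \<Sum>j\<le>count m b.
      mseries_const (fps_nth f j) * mmono (replicate_mset j b) * block_form b ^ (count m b - j))
    = (\<Sum>\<nu> | \<nu> \<subseteq># m. \<Prod>b\<in>?V. mseries_const (fps_nth f (count \<nu> b))
        * mmono (replicate_mset (count \<nu> b) b) * block_form b ^ (count m b - count \<nu> b))"
    by (rule sum_submultisets_prod[symmetric]) auto
  also have "mcoeff \<dots> m = (\<Sum>\<nu> | \<nu> \<subseteq># m. mcoeff (multiplicative_series f) \<nu> * mcoeff master_series (m - \<nu>))"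
    unfolding mcoeff_sum
  proof (intro sum.cong refl)
    fix \<nu> assume "\<nu> \<in> {\<nu>. \<nu> \<subseteq># m}"
    then have \<nu>: "\<nu> \<subseteq># m" by simp
    then have sub: "set_mset \<nu> \<subseteq> ?V" "set_mset (m - \<nu>) \<subseteq> ?V"
      using set_mset_mono by (auto dest: in_diffD)
    have "(\<Sum>b\<in>?V. replicate_mset (count \<nu> b) b) = \<nu>"
      using sub(1) by (intro multiset_eqI) (auto simp: count_sum if_distrib count_eq_zero_iff cong: if_cong)
    then have "(\<Prod>b\<in>?V. mseries_const (fps_nth f (count \<nu> b))
        * mmono (replicate_mset (count \<nu> b) b) * block_form b ^ (count m b - count \<nu> b))
      = mseries_const (mcoeff (multiplicative_series f) \<nu>)
        * (mmono \<nu> * (\<Prod>b\<in>?V. block_form b ^ (count m b - count \<nu> b)))"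
      using mcoeff_multiplicative_series[OF assms _ sub(1)]
      by (simp add: prod.distrib mseries_const_prod[symmetric] mmono_sum[symmetric] mult.assoc)
    moreover have "(\<Prod>b\<in>?V. block_form b ^ (count m b - count \<nu> b))
        = (\<Prod>b\<in>set_mset (m - \<nu>). block_form b ^ count (m - \<nu>) b)"
    proof (rule prod.mono_neutral_cong_right)
      show "\<forall>b\<in>?V - set_mset (m - \<nu>). block_form b ^ (count m b - count \<nu> b) = 1"
        by (auto simp flip: count_diff simp: not_in_iff)
    qed (use sub in auto)
    ultimately show "mcoeff (\<Prod>b\<in>?V. mseries_const (fps_nth f (count \<nu> b))
        * mmono (replicate_mset (count \<nu> b) b) * block_form b ^ (count m b - count \<nu> b)) m
      = mcoeff (multiplicative_series f) \<nu> * mcoeff master_series (m - \<nu>)"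
      using \<nu> by (simp add: mcoeff_mmono_times master_series.rep_eq)
  qed
  finally show ?thesis unfolding mcoeff_times by simp
qed

text \<open>
  If \<open>b\<^sub>1 < \<dots> < b\<^sub>k\<close> are the elements of \<open>V\<close>, the elements above \<open>b\<^sub>j\<close> are those from \<open>b\<^bsub>j+1\<^esub>\<close> on. So the
  two products share all factors except the first of the one and the last of the other.
\<close>

lemma prod_upper_sets_telescope:
  fixes Y :: "nat set \<Rightarrow> 'b :: comm_monoid_mult"
  assumes "finite V" "V \<noteq> {}"
  shows "\<exists>Z. (\<Prod>b\<in>V. Y {c \<in> V. c \<ge> b}) = Y V * Z \<and> (\<Prod>b\<in>V. Y {c \<in> V. c > b}) = Y {} * Z"
  using assms
proof (induction V rule: finite_linorder_min_induct)
  case (insert b V)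
  have s: "{c \<in> insert b V. c \<ge> b} = insert b V" "{c \<in> insert b V. c > b} = V"
    using insert.hyps by auto
  have t: "{c \<in> insert b V. c \<ge> b'} = {c \<in> V. c \<ge> b'}" "{c \<in> insert b V. c > b'} = {c \<in> V. c > b'}"
    if "b' \<in> V" for b'
    using insert.hyps that by force+
  have b: "b \<notin> V" using insert.hyps by blast
  have 1: "(\<Prod>b'\<in>insert b V. Y {c \<in> insert b V. c \<ge> b'}) = Y (insert b V) * (\<Prod>b'\<in>V. Y {c \<in> V. c \<ge> b'})"
    using insert.hyps b s t by simp
  have 2: "(\<Prod>b'\<in>insert b V. Y {c \<in> insert b V. c > b'}) = Y V * (\<Prod>b'\<in>V. Y {c \<in> V. c > b'})"
    using insert.hyps b s t by simp
  show ?case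
  proof (cases "V = {}")
    case True
    then have "Y {c \<in> insert b V. c \<ge> b} = Y {b}" "Y {c \<in> insert b V. c > b} = Y {}"
      using s True by (metis, metis)
    with True show ?thesis by (intro exI[of _ 1]) simp
  next
    case False
    then obtain Z where "(\<Prod>b\<in>V. Y {c \<in> V. c \<ge> b}) = Y V * Z" "(\<Prod>b\<in>V. Y {c \<in> V. c > b}) = Y {} * Z"
      using insert.IH by blast
    then show ?thesis unfolding 1 2 by (intro exI[of _ "Y V * Z"]) (simp add: ac_simps)
  qed
qed simp

lemma block_form_minus:
  "block_form b - mseries_const s * mmono {#b#} =
   linear_series (\<lambda>c. (if c > b then t else 0) + (if c < b then 1 else 0) + (if c = b then 1 + t - s else 0))"
proof -
  have "block_form b - mseries_const s * mmono {#b#} = linear_series (\<lambda>c. ((if c \<ge> b then t else 0) + (if c \<le> b then 1 else 0)) - s * (if c = b then 1 else 0))"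
   by (simp only: linear_series_diff[symmetric] linear_series_cmul[symmetric] linear_series_var block_form_def)
  also have "\<dots> = linear_series (\<lambda>c. (if c > b then t else 0) + (if c < b then 1 else 0) + (if c = b then 1 + t - s else 0))"
   apply (rule arg_cong[where f = linear_series])
   apply (rule ext)
   subgoal for c by (cases c b rule: linorder_cases) simp_all
   done
  finally show ?thesis .
qed

text \<open>
  A factor \<open>1 - s x\<^sub>b\<close> of the series \<open>E\<close> contributes either \<open>1\<close>, or \<open>- s x\<^sub>b\<close> and one power of the
  form less. Together the two terms replace one of the forms of \<open>b\<close> by its difference with \<open>s x\<^sub>b\<close>.
\<close>

lemma mcoeff_E_times_master:
  "mcoeff (E_series s * master_series) m =
    mcoeff (\<Prod>b\<in>set_mset m. block_form b ^ (count m b - 1) * (block_form b - mseries_const s * mmono {#b#})) m"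
proof -
  have "(\<Sum>j\<le>k. mseries_const (fps_nth (1 - fps_const s * fps_X) j) * mmono (replicate_mset j b) * block_form b ^ (k - j))
      = block_form b ^ (k - 1) * (block_form b - mseries_const s * mmono {#b#})"
    if k0: "k > 0" for k b
  proof -
    obtain k' where k: "k = Suc k'" using k0 by (cases k) auto
    have "(\<Sum>j\<le>k. mseries_const (fps_nth (1 - fps_const s * fps_X) j) * mmono (replicate_mset j b) * block_form b ^ (k - j))
      = (\<Sum>j\<in>{0, 1}. mseries_const (fps_nth (1 - fps_const s * fps_X) j) * mmono (replicate_mset j b) * block_form b ^ (k - j))"
      by (rule sum.mono_neutral_right) (auto simp: k fps_X_nth mseries_const_zero)
    also have "\<dots> = block_form b ^ (k - 1) * (block_form b - mseries_const s * mmono {#b#})"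
      by (simp add: k mseries_const_one mseries_const_minus mmono_empty) (simp add: algebra_simps)
    finally show ?thesis .
  qed
  note * = this
  have "fps_nth (1 - fps_const s * fps_X) 0 = 1" by simp
  then show ?thesis unfolding E_series_def
    by (simp only: mcoeff_multiplicative_times_master)
       (intro arg_cong2[where f = mcoeff] prod.cong refl *, simp add: count_greater_zero_iff)
qed

text \<open>
  In the variables \<open>V\<close> of a monomial, the form of \<open>b\<close> minus \<open>x\<^sub>b\<close> has the coefficient \<open>t\<close> exactly on the
  variables \<open>\<ge> b\<close>, and the form minus \<open>t x\<^sub>b\<close> exactly on those \<open>> b\<close>. Both are values of one function \<open>Y\<close> on
  upper sets, so the products telescope, and \<open>Y V = t Y {}\<close> makes the two sides cancel unless \<open>V\<close> is
  empty.
\<close>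

lemma E_master_identity:
  "E_series 1 * master_series - mseries_const t * (E_series t * master_series) = mseries_const (1 - t)"
proof (rule mseries_eqI)
  fix m :: "nat multiset"
  let ?V = "set_mset m"
  show "mcoeff (E_series 1 * master_series - mseries_const t * (E_series t * master_series)) m
      = mcoeff (mseries_const (1 - t)) m"
  proof (cases "m = {#}")
    case True
    then show ?thesis
      by (simp add: mcoeff_E_times_master mcoeff_simps mseries_const.rep_eq)
  next
    case False
    define Y where "Y U = linear_series (\<lambda>c. if c \<in> ?V then if c \<in> U then t else 1 else 0)" for U
    have rY: "restrict_vars ?V (block_form b - mseries_const 1 * mmono {#b#}) = Y {c \<in> ?V. c \<ge> b}"
             "restrict_vars ?V (block_form b - mseries_const t * mmono {#b#}) = Y {c \<in> ?V. c > b}" for b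
      unfolding block_form_minus restrict_vars_linear Y_def
      by (auto intro!: arg_cong[where f = linear_series])
    define B where "B = restrict_vars ?V (\<Prod>b\<in>?V. block_form b ^ (count m b - 1))"
    have c1: "mcoeff (E_series 1 * master_series) m = mcoeff (B * (\<Prod>b\<in>?V. Y {c \<in> ?V. c \<ge> b})) m"
    proof -
      have "mcoeff (E_series 1 * master_series) m = mcoeff (restrict_vars ?V (\<Prod>b\<in>?V. block_form b ^ (count m b - 1)
          * (block_form b - mseries_const 1 * mmono {#b#}))) m"
        by (simp add: mcoeff_E_times_master restrict_vars.rep_eq)
      then show ?thesis by (simp only: restrict_vars_prod restrict_vars_mult prod.distrib rY B_def)
    qed
    have c2: "mcoeff (E_series t * master_series) m = mcoeff (B * (\<Prod>b\<in>?V. Y {c \<in> ?V. c > b})) m"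
    proof -
      have "mcoeff (E_series t * master_series) m = mcoeff (restrict_vars ?V (\<Prod>b\<in>?V. block_form b ^ (count m b - 1)
          * (block_form b - mseries_const t * mmono {#b#}))) m"
        by (simp add: mcoeff_E_times_master restrict_vars.rep_eq)
      then show ?thesis by (simp only: restrict_vars_prod restrict_vars_mult prod.distrib rY B_def)
    qed
    obtain Z where Z: "(\<Prod>b\<in>?V. Y {c \<in> ?V. c \<ge> b}) = Y ?V * Z" "(\<Prod>b\<in>?V. Y {c \<in> ?V. c > b}) = Y {} * Z"
      using prod_upper_sets_telescope[of ?V Y] False by auto
    have "Y ?V = mseries_const t * Y {}"
      unfolding Y_def linear_series_cmul by (rule arg_cong[where f = linear_series]) auto
    then have "B * (\<Prod>b\<in>?V. Y {c \<in> ?V. c \<ge> b}) = mseries_const t * (B * (\<Prod>b\<in>?V. Y {c \<in> ?V. c > b}))"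
      unfolding Z by (simp add: mult_ac)
    then show ?thesis
      using False by (simp add: mcoeff_simps c1 c2 mseries_const.rep_eq)
  qed
qed

text \<open>
  Now two of the forms of \<open>b\<close> are changed, by \<open>t x\<^sub>b\<close> and by \<open>x\<^sub>b\<close>: they stand for the first and the last
  position of a block of equal letters. If \<open>b\<close> occurs once, a single position is both.
\<close>

lemma mcoeff_E_E_times_master:
  "mcoeff (E_series 1 * (E_series t * master_series)) m =
    mcoeff (\<Prod>b\<in>set_mset m. if count m b = 1 then block_form b - mseries_const (1 + t) * mmono {#b#}
      else block_form b ^ (count m b - 2) * (block_form b - mseries_const t * mmono {#b#})
        * (block_form b - mseries_const 1 * mmono {#b#})) m"
proof -
  let ?f = "(1 - fps_const 1 * fps_X) * (1 - fps_const t * fps_X)"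
  have f: "?f = 1 - fps_const (1 + t) * fps_X + fps_const t * fps_X\<^sup>2"
  proof -
    have "fps_const (1 + t) = 1 + fps_const t" by (metis fps_const_1_eq_1 fps_const_add)
    then show ?thesis unfolding power2_eq_square
      by (simp only: fps_const_1_eq_1)
         (simp only: ring_distribs mult_1_left mult_1_right mult.assoc, simp add: mult.commute mult.left_commute)
  qed
  have m': "mseries_const (- 1 - t) = - mseries_const (1 + t)"
    by (simp flip: mseries_const_minus)
  note m = mseries_const_minus and z = mseries_const_zero
  have a: "mseries_const (1 + t) = 1 + mseries_const t"
    by (simp add: mseries_const_add mseries_const_one)
  have "(\<Sum>j\<le>k. mseries_const (fps_nth ?f j) * mmono (replicate_mset j b) * block_form b ^ (k - j))
      = (if k = 1 then block_form b - mseries_const (1 + t) * mmono {#b#}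
      else block_form b ^ (k - 2) * (block_form b - mseries_const t * mmono {#b#})
        * (block_form b - mseries_const 1 * mmono {#b#}))"
    if k0: "k > 0" for k b
  proof (cases "k = 1")
    case True
    then show ?thesis unfolding f
      by (simp add: atMost_Suc mseries_const_one mmono_empty m m' fps_X_power_nth a) (simp add: algebra_simps)
  next
    case False
    then obtain l where l: "k = Suc (Suc l)" using k0 by (cases k; cases "k - 1") auto
    have "(\<Sum>j\<le>k. mseries_const (fps_nth ?f j) * mmono (replicate_mset j b) * block_form b ^ (k - j))
      = (\<Sum>j\<in>{0, 1, 2}. mseries_const (fps_nth ?f j) * mmono (replicate_mset j b) * block_form b ^ (k - j))"
      unfolding f by (rule sum.mono_neutral_right) (auto simp: l fps_X_nth fps_X_power_nth z)
    also have "\<dots> = block_form b ^ (k - 2) * (block_form b - mseries_const t * mmono {#b#})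
        * (block_form b - mseries_const 1 * mmono {#b#})"
    proof -
      have "(mmono {#b, b#} :: 'a mseries) = mmono {#b#} * mmono {#b#}" by (simp add: mmono_mult)
      then show ?thesis unfolding f
        by (simp add: l mseries_const_one mmono_empty fps_X_power_nth numeral_2_eq_2 m m' a) (simp add: algebra_simps)
    qed
    finally show ?thesis using False by simp
  qed
  note * = this
  have "E_series 1 * (E_series t * master_series) = multiplicative_series ?f * master_series"
    unfolding E_series_def by (simp add: mult.assoc[symmetric] multiplicative_series_mult)
  moreover have "fps_nth ?f 0 = 1" by simp
  ultimately show ?thesis
    by (simp only: mcoeff_multiplicative_times_master)
       (intro arg_cong2[where f = mcoeff] prod.cong refl *, simp add: count_greater_zero_iff)
qed

lemma excedance_series_equation:
  "E_series t * master_series * (H_series t - mseries_const t * H_series 1)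
    = mseries_const (1 - t) * H_series 1"
proof -
  have "E_series t * master_series * (H_series t - mseries_const t * H_series 1)
      = (H_series t * E_series t) * master_series - mseries_const t * H_series 1 * (E_series t * master_series)"
    by (simp add: algebra_simps)
  also have "\<dots> = (H_series 1 * E_series 1) * master_series - mseries_const t * H_series 1 * (E_series t * master_series)"
    by (simp add: H_times_E)
  also have "\<dots> = H_series 1 * (E_series 1 * master_series - mseries_const t * (E_series t * master_series))"
    by (simp add: algebra_simps)
  finally show ?thesis by (simp add: E_master_identity mult.commute)
qed

lemma derangement_series_equation:
  "E_series 1 * (E_series t * master_series) * (H_series t - mseries_const t * H_series 1)
    = mseries_const (1 - t)"
proof -
  have "E_series 1 * (E_series t * master_series) * (H_series t - mseries_const t * H_series 1)
      = E_series 1 * (mseries_const (1 - t) * H_series 1)"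
    by (simp add: mult.assoc flip: excedance_series_equation)
  also have "\<dots> = mseries_const (1 - t) * (H_series 1 * E_series 1)"
    by (simp only: ac_simps)
  finally show ?thesis by (simp add: H_times_E)
qed

end

text \<open>
  Induction on the degree: in the coefficient of \<open>(f - g) w\<close>, all terms of smaller degree in \<open>f - g\<close> vanish.
\<close>

lemma mseries_cancel:
  fixes f g w :: "'a :: idom mseries"
  assumes "f * w = g * w" "mcoeff w {#} \<noteq> 0"
  shows "f = g"
proof -
  have "mcoeff (f - g) m = 0" for m
  proof (induction "size m" arbitrary: m rule: less_induct)
    case less
    have "0 = mcoeff (w * (f - g)) m"
      using assms(1) by (simp add: algebra_simps mcoeff_simps)
    also have "\<dots> = (\<Sum>a\<in>{{#}}. mcoeff w a * mcoeff (f - g) (m - a))"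
      unfolding mcoeff_times
    proof (rule sum.mono_neutral_right)
      show "\<forall>a\<in>{a. a \<subseteq># m} - {{#}}. mcoeff w a * mcoeff (f - g) (m - a) = 0"
      proof
        fix a assume a: "a \<in> {a. a \<subseteq># m} - {{#}}"
        then have "size (m - a) < size m"
          by (metis DiffD1 DiffD2 diff_less mem_Collect_eq nonempty_has_size order_less_le_trans
              singletonI size_Diff_submset size_mset_mono)
        then show "mcoeff w a * mcoeff (f - g) (m - a) = 0" using less by simp
      qed
    qed (auto simp: finite_submultisets)
    finally show ?case using assms(2) by simp
  qed
  then show ?thesis by (intro mseries_eqI) (simp add: minus_mseries.rep_eq)
qed

section \<open>Excedances as a count of barred rearrangements\<close>

lemma up_closed_initial_segment:
  fixes P :: "nat \<Rightarrow> bool"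
  assumes "\<And>i j. 1 \<le> i \<Longrightarrow> i \<le> j \<Longrightarrow> j \<le> n \<Longrightarrow> P j \<Longrightarrow> P i"
  shows "{i \<in> {1..n}. P i} = {1..card {i \<in> {1..n}. P i}}"
  using assms
proof (induction n)
  case (Suc n)
  have IH: "{i \<in> {1..n}. P i} = {1..card {i \<in> {1..n}. P i}}" using Suc by force
  show ?case
  proof (cases "P (Suc n)")
    case True
    then have "{i \<in> {1..Suc n}. P i} = {1..Suc n}" using Suc.prems by force
    then show ?thesis by simp
  next
    case False
    then have "{i \<in> {1..Suc n}. P i} = {i \<in> {1..n}. P i}" by (auto simp: le_Suc_eq)
    with IH show ?thesis by simp
  qed
qed simp

abbreviation pinv :: "('a \<Rightarrow> 'a) \<Rightarrow> 'a \<Rightarrow> 'a"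
  where "pinv \<equiv> inv_into UNIV"

text \<open>
  A coefficient of a quasisymmetric function at the monomial \<open>m\<close> only involves the decreasing word \<open>s\<close>
  of content \<open>m\<close>. Its blocks are the maximal intervals of positions with equal letters.
\<close>

locale weakly_decreasing_word =
  fixes n :: nat and s :: "nat \<Rightarrow> nat" and m :: "nat multiset"
  assumes antitone: "\<And>i j. 1 \<le> i \<Longrightarrow> i \<le> j \<Longrightarrow> j \<le> n \<Longrightarrow> s j \<le> s i"
    and content: "image_mset s (mset_set {1..n}) = m"
begin

definition first_of_block :: "nat \<Rightarrow> bool"
  where "first_of_block v \<longleftrightarrow> (\<forall>u\<in>{1..<v}. s u \<noteq> s v)"

definition last_of_block :: "nat \<Rightarrow> bool"
  where "last_of_block v \<longleftrightarrow> (\<forall>u\<in>{v<..n}. s u \<noteq> s v)"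

definition compatible :: "(nat \<Rightarrow> nat) \<Rightarrow> bool"
  where "compatible \<sigma> \<longleftrightarrow> (\<forall>j\<in>DEX n \<sigma>. s j > s (j + 1))"

text \<open>
  The local rule for a letter \<open>c\<close> at position \<open>v\<close> and its bar \<open>\<beta>\<close>. The flag \<open>der\<close> adds the condition
  that excludes fixed points. Since \<open>s\<close> decreases, a letter that comes from an earlier block is larger than
  \<open>s v\<close> and must have a bar; inside the block of \<open>v\<close> both cases occur, except at the two ends.
\<close>

definition barred_letter_ok :: "bool \<Rightarrow> nat \<Rightarrow> nat \<Rightarrow> bool \<Rightarrow> bool"
  where "barred_letter_ok der v c \<beta> \<longleftrightarrow> (c > s v \<longrightarrow> \<beta>) \<and> (c < s v \<longrightarrow> \<not> \<beta>)
    \<and> (c = s v \<and> first_of_block v \<longrightarrow> \<not> \<beta>) \<and> (der \<and> c = s v \<and> last_of_block v \<longrightarrow> \<beta>)"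

definition barred_rearrangements :: "bool \<Rightarrow> (nat \<Rightarrow> nat \<times> bool) set"
  where "barred_rearrangements der = {g \<in> {1..n} \<rightarrow>\<^sub>E UNIV. image_mset (\<lambda>v. fst (g v)) (mset_set {1..n}) = m
    \<and> (\<forall>v\<in>{1..n}. barred_letter_ok der v (fst (g v)) (snd (g v)))}"

text \<open>
  Position \<open>v\<close> carries the letter of \<open>s\<close> at the place where \<open>\<sigma>\<close> takes the value \<open>v\<close>; the bar says that this
  place is an excedance.
\<close>

definition encode :: "(nat \<Rightarrow> nat) \<Rightarrow> nat \<Rightarrow> nat \<times> bool"
  where "encode \<sigma> = (\<lambda>v\<in>{1..n}. (s (pinv \<sigma> v), pinv \<sigma> v < v))"

text \<open>
  The order in which a compatible permutation takes its values: by decreasing letter, within a letter first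
  the barred values and then the others, both increasingly. The rank of \<open>v\<close> in this order recovers
  the place of the value \<open>v\<close>.
\<close>

definition precedes :: "(nat \<Rightarrow> nat \<times> bool) \<Rightarrow> nat \<Rightarrow> nat \<Rightarrow> bool"
  where "precedes g u v \<longleftrightarrow> fst (g u) > fst (g v) \<or> fst (g u) = fst (g v) \<and>
    (snd (g u) \<and> \<not> snd (g v) \<or> snd (g u) = snd (g v) \<and> u < v)"

definition rank :: "(nat \<Rightarrow> nat \<times> bool) \<Rightarrow> nat \<Rightarrow> nat"
  where "rank g v = (if v \<in> {1..n} then card {u \<in> {1..n}. precedes g u v} + 1 else v)"

lemma precedes_asym_total: "u \<noteq> v \<Longrightarrow> precedes g u v \<longleftrightarrow> \<not> precedes g v u"
  unfolding precedes_def by (cases "fst (g u)" "fst (g v)" rule: linorder_cases) auto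

lemma precedes_irrefl [simp]: "\<not> precedes g v v"
  by (simp add: precedes_def)

lemma precedes_trans: "precedes g u v \<Longrightarrow> precedes g v w \<Longrightarrow> precedes g u w"
  unfolding precedes_def by auto

lemma rank_strict_mono:
  assumes "u \<in> {1..n}" "v \<in> {1..n}" "precedes g u v"
  shows "rank g u < rank g v"
proof -
  have "{x \<in> {1..n}. precedes g x u} \<subseteq> {x \<in> {1..n}. precedes g x v}"
    using assms(3) precedes_trans by blast
  moreover have "u \<in> {x \<in> {1..n}. precedes g x v}" "u \<notin> {x \<in> {1..n}. precedes g x u}"
    using assms by simp_all
  ultimately have "{x \<in> {1..n}. precedes g x u} \<subset> {x \<in> {1..n}. precedes g x v}" by blast
  then have "card {x \<in> {1..n}. precedes g x u} < card {x \<in> {1..n}. precedes g x v}"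
    by (intro psubset_card_mono) auto
  then show ?thesis using assms by (simp add: rank_def)
qed

lemma rank_permutes: "rank g permutes {1..n}"
proof (rule bij_imp_permutes)
  have inj: "inj_on (rank g) {1..n}"
  proof (rule inj_onI)
    fix u v assume "u \<in> {1..n}" "v \<in> {1..n}" "rank g u = rank g v"
    then show "u = v" using rank_strict_mono[of u v g] rank_strict_mono[of v u g] precedes_asym_total[of u v g] by fastforce
  qed
  have "rank g ` {1..n} \<subseteq> {1..n}"
  proof
    fix x assume "x \<in> rank g ` {1..n}"
    then obtain v where v: "v \<in> {1..n}" "x = rank g v" by blast
    then have "{u \<in> {1..n}. precedes g u v} \<subset> {1..n}" using precedes_irrefl[of g v] by blast
    then have "card {u \<in> {1..n}. precedes g u v} < card {1..n}" by (intro psubset_card_mono) auto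
    then show "x \<in> {1..n}" using v by (simp add: rank_def)
  qed
  then show "bij_betw (rank g) {1..n} {1..n}"
    using inj by (metis bij_betw_def endo_inj_surj finite_atLeastAtMost)
qed (auto simp: rank_def)

lemma exc_iff:
  assumes "\<sigma> permutes {1..n}" "v \<in> {1..n}"
  shows "pinv \<sigma> v \<in> EXC n \<sigma> \<longleftrightarrow> pinv \<sigma> v < v"
proof -
  have "\<sigma> (pinv \<sigma> v) = v" "pinv \<sigma> v \<in> {1..n}"
    using permutes_inverses(1)[OF assms(1)] permutes_in_image[OF permutes_inv[OF assms(1)], of v] assms(2) by simp_all
  then show ?thesis using assms(2) by (auto simp: EXC_def)
qed

lemma exc_eq:
  assumes "\<sigma> permutes {1..n}"
  shows "exc n \<sigma> = card {v \<in> {1..n}. snd (encode \<sigma> v)}"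
proof -
  have "EXC n \<sigma> = pinv \<sigma> ` {v \<in> {1..n}. snd (encode \<sigma> v)}"
  proof (rule Set.set_eqI)
    fix i
    have "i \<in> EXC n \<sigma> \<longleftrightarrow> i \<in> {1..n} \<and> i \<in> EXC n \<sigma>" by (auto simp: EXC_def)
    also have "\<dots> \<longleftrightarrow> (\<exists>v\<in>{1..n}. i = pinv \<sigma> v \<and> i \<in> EXC n \<sigma>)"
      using permutes_image[OF permutes_inv[OF assms]] by blast
    also have "\<dots> \<longleftrightarrow> i \<in> pinv \<sigma> ` {v \<in> {1..n}. snd (encode \<sigma> v)}"
      using exc_iff[OF assms] by (auto simp: encode_def)
    finally show "i \<in> EXC n \<sigma> \<longleftrightarrow> i \<in> pinv \<sigma> ` {v \<in> {1..n}. snd (encode \<sigma> v)}" .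
  qed
  moreover have "inj_on (pinv \<sigma>) A" for A
    using permutes_inj[OF permutes_inv[OF assms]] inj_on_subset by blast
  ultimately show ?thesis by (simp add: exc_def card_image)
qed

text \<open>
  Within a block of \<open>s\<close>, compatibility forbids descents of the barred word. As barred letters are
  smaller than unbarred ones, the values in the block must be the excedance values in increasing order,
  followed by the others in increasing order.
\<close>

lemma compatible_iff_precedes:
  assumes "\<sigma> permutes {1..n}"
  shows "compatible \<sigma> \<longleftrightarrow>
    (\<forall>u\<in>{1..n}. \<forall>v\<in>{1..n}. pinv \<sigma> u < pinv \<sigma> v \<longrightarrow> precedes (encode \<sigma>) u v)"
proof
  assume comp: "compatible \<sigma>"
  show "\<forall>u\<in>{1..n}. \<forall>v\<in>{1..n}. pinv \<sigma> u < pinv \<sigma> v \<longrightarrow> precedes (encode \<sigma>) u v"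
  proof (intro ballI impI)
    fix u v assume u: "u \<in> {1..n}" and v: "v \<in> {1..n}" and lt: "pinv \<sigma> u < pinv \<sigma> v"
    define i j where "i = pinv \<sigma> u" and "j = pinv \<sigma> v"
    have ij: "\<sigma> i = u" "\<sigma> j = v" "i \<in> {1..n}" "j \<in> {1..n}"
      using permutes_inverses(1)[OF assms] permutes_in_image[OF permutes_inv[OF assms]] u v
      by (simp_all add: i_def j_def)
    have ge: "s j \<le> s i" using antitone[of i j] ij lt by (auto simp: i_def j_def)
    show "precedes (encode \<sigma>) u v"
    proof (cases "s i = s j")
      case False
      then show ?thesis using ge u v by (simp add: precedes_def encode_def i_def j_def)
    next
      case True
      have "barred_word n \<sigma> i \<le> barred_word n \<sigma> j'" if "i \<le> j'" "j' \<le> j" for j'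
        using that
      proof (induction j' rule: dec_induct)
        case (step k)
        have "s j \<le> s (k + 1)" "s (k + 1) \<le> s k" "s k \<le> s i"
          using antitone ij step by auto
        then have "\<not> s k > s (k + 1)" using True by simp
        then have "k \<notin> DEX n \<sigma>" using comp unfolding compatible_def by blast
        moreover have "k \<in> {1..n - 1}" using step ij by auto
        ultimately show ?case using step by (auto simp: DEX_def)
      qed simp
      then have bw: "barred_word n \<sigma> i \<le> barred_word n \<sigma> j"
        using lt by (simp add: i_def j_def)
      have "u \<noteq> v" using lt by auto
      have ei: "i \<in> EXC n \<sigma> \<longleftrightarrow> snd (encode \<sigma> u)" and ej: "j \<in> EXC n \<sigma> \<longleftrightarrow> snd (encode \<sigma> v)"
        using exc_iff[OF assms] u v by (simp_all add: i_def j_def encode_def)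
      have "fst (encode \<sigma> u) = fst (encode \<sigma> v)" using True u v by (simp add: encode_def i_def j_def)
      then show ?thesis using bw \<open>u \<noteq> v\<close> ij u v unfolding precedes_def barred_word_def ei ej
        by (auto split: if_splits)
    qed
  qed
next
  assume prec: "\<forall>u\<in>{1..n}. \<forall>v\<in>{1..n}. pinv \<sigma> u < pinv \<sigma> v \<longrightarrow> precedes (encode \<sigma>) u v"
  show "compatible \<sigma>" unfolding compatible_def
  proof
    fix j assume j: "j \<in> DEX n \<sigma>"
    then have jn: "j \<in> {1..n}" "j + 1 \<in> {1..n}" by (auto simp: DEX_def)
    define u v where "u = \<sigma> j" and "v = \<sigma> (j + 1)"
    have uv: "u \<in> {1..n}" "v \<in> {1..n}" "pinv \<sigma> u = j" "pinv \<sigma> v = j + 1"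
      using permutes_in_image[OF assms] permutes_inverses(2)[OF assms] jn by (auto simp: u_def v_def)
    have bw: "barred_word n \<sigma> j > barred_word n \<sigma> (j + 1)" using j by (simp add: DEX_def)
    have e: "j \<in> EXC n \<sigma> \<longleftrightarrow> snd (encode \<sigma> u)" "j + 1 \<in> EXC n \<sigma> \<longleftrightarrow> snd (encode \<sigma> v)"
      using exc_iff[OF assms uv(1)] exc_iff[OF assms uv(2)] uv by (simp_all add: encode_def)
    have "precedes (encode \<sigma>) u v" using prec uv by auto
    moreover have "s (j + 1) \<le> s j" using antitone jn by auto
    ultimately show "s j > s (j + 1)"
      using bw uv unfolding precedes_def barred_word_def e u_def[symmetric] v_def[symmetric]
      by (auto simp: encode_def split: if_splits)
  qed
qed

lemma rank_encode:
  assumes "\<sigma> permutes {1..n}" "compatible \<sigma>"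
  shows "rank (encode \<sigma>) = pinv \<sigma>"
proof
  fix v
  show "rank (encode \<sigma>) v = pinv \<sigma> v"
  proof (cases "v \<in> {1..n}")
    case True
    have inv: "pinv \<sigma> permutes {1..n}" using assms(1) by (rule permutes_inv)
    have "precedes (encode \<sigma>) u v \<longleftrightarrow> pinv \<sigma> u < pinv \<sigma> v" if "u \<in> {1..n}" for u
    proof (cases "u = v")
      case False
      then have "pinv \<sigma> u \<noteq> pinv \<sigma> v" using permutes_inj[OF inv] by (auto dest: injD)
      then show ?thesis
        using compatible_iff_precedes[OF assms(1)] assms(2) that True precedes_asym_total[OF False]
        by (metis linorder_neqE_nat)
    qed simp
    then have "{u \<in> {1..n}. precedes (encode \<sigma>) u v} = {u \<in> {1..n}. pinv \<sigma> u < pinv \<sigma> v}" by blast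
    moreover have "pinv \<sigma> ` {u \<in> {1..n}. pinv \<sigma> u < pinv \<sigma> v} = {1..<pinv \<sigma> v}"
    proof -
      have "pinv \<sigma> ` {u \<in> {1..n}. pinv \<sigma> u < pinv \<sigma> v} = {i \<in> pinv \<sigma> ` {1..n}. i < pinv \<sigma> v}" by blast
      also have "\<dots> = {1..<pinv \<sigma> v}"
        unfolding permutes_image[OF inv] using permutes_in_image[OF inv, of v] True by auto
      finally show ?thesis .
    qed
    moreover have "card (pinv \<sigma> ` {u \<in> {1..n}. pinv \<sigma> u < pinv \<sigma> v}) = card {u \<in> {1..n}. pinv \<sigma> u < pinv \<sigma> v}"
      using permutes_inj[OF inv] by (intro card_image) (auto intro: inj_on_subset)
    moreover have "pinv \<sigma> v \<ge> 1" using permutes_in_image[OF inv, of v] True by auto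
    ultimately show ?thesis using True by (simp add: rank_def)
  next
    case False
    then show ?thesis using permutes_inv[OF assms(1)] by (auto simp: rank_def permutes_def)
  qed
qed

lemma encode_in:
  assumes "\<sigma> permutes {1..n}" and der: "der \<Longrightarrow> \<forall>v\<in>{1..n}. \<sigma> v \<noteq> v"
  shows "encode \<sigma> \<in> barred_rearrangements der"
proof -
  have inv: "pinv \<sigma> permutes {1..n}" using assms(1) by (rule permutes_inv)
  have "image_mset (\<lambda>v. fst (encode \<sigma> v)) (mset_set {1..n}) = image_mset s (image_mset (pinv \<sigma>) (mset_set {1..n}))"
    by (auto simp: encode_def multiset.map_comp intro!: image_mset_cong)
  also have "image_mset (pinv \<sigma>) (mset_set {1..n}) = mset_set {1..n}"
    using inv by (simp add: image_mset_mset_set permutes_inj_on permutes_image)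
  finally have "image_mset (\<lambda>v. fst (encode \<sigma> v)) (mset_set {1..n}) = m" by (simp only: content)
  moreover have "barred_letter_ok der v (fst (encode \<sigma> v)) (snd (encode \<sigma> v))" if v: "v \<in> {1..n}" for v
  proof -
    have i: "pinv \<sigma> v \<in> {1..n}" using v permutes_in_image[OF inv] by blast
    have "s (pinv \<sigma> v) > s v \<Longrightarrow> pinv \<sigma> v < v" using antitone[of v "pinv \<sigma> v"] v i by force
    moreover have "s (pinv \<sigma> v) < s v \<Longrightarrow> \<not> pinv \<sigma> v < v" using antitone[of "pinv \<sigma> v" v] v i by force
    moreover have "s (pinv \<sigma> v) = s v \<Longrightarrow> first_of_block v \<Longrightarrow> \<not> pinv \<sigma> v < v"
      using i unfolding first_of_block_def by fastforce
    moreover have "s (pinv \<sigma> v) = s v \<Longrightarrow> last_of_block v \<Longrightarrow> pinv \<sigma> v < v" if der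
    proof (rule ccontr)
      assume *: "s (pinv \<sigma> v) = s v" "last_of_block v" "\<not> pinv \<sigma> v < v"
      then have "pinv \<sigma> v = v" using i unfolding last_of_block_def by fastforce
      then have "\<sigma> v = v" using permutes_inverses(1)[OF assms(1), of v] by simp
      then show False using assms(2) that v by blast
    qed
    ultimately show ?thesis using v by (auto simp: barred_letter_ok_def encode_def)
  qed
  ultimately show ?thesis by (auto simp: barred_rearrangements_def encode_def)
qed

lemma size_filter_content: "card {i \<in> {1..n}. P (s i)} = size (filter_mset P m)"
  by (simp add: content[symmetric] filter_mset_image_mset)

context
  fixes der g
  assumes g: "g \<in> barred_rearrangements der"
begin

lemma card_letters: "card {v \<in> {1..n}. P (fst (g v))} = card {i \<in> {1..n}. P (s i)}"
proof -
  have "image_mset (\<lambda>v. fst (g v)) (mset_set {1..n}) = m" using g by (simp add: barred_rearrangements_def)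
  then have "size (filter_mset P m) = card {v \<in> {1..n}. P (fst (g v))}"
    by (auto simp: filter_mset_image_mset)
  then show ?thesis by (simp only: size_filter_content)
qed

lemma letter_ok: "v \<in> {1..n} \<Longrightarrow> barred_letter_ok der v (fst (g v)) (snd (g v))"
  using g by (simp add: barred_rearrangements_def)

lemma greater_segment: "{i \<in> {1..n}. s i > b} = {1..card {i \<in> {1..n}. s i > b}}"
  by (rule up_closed_initial_segment) (meson antitone le_trans not_le)

lemma ge_segment: "{i \<in> {1..n}. s i \<ge> b} = {1..card {i \<in> {1..n}. s i \<ge> b}}"
  by (rule up_closed_initial_segment) (meson antitone le_trans)

lemma rank_in: "v \<in> {1..n} \<Longrightarrow> rank g v \<in> {1..n}"
  using permutes_in_image[OF rank_permutes] by blast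

text \<open>
  The entries with a letter larger than that of \<open>v\<close> all come before \<open>v\<close>, and those with a smaller letter
  after it. Since \<open>s\<close> is a decreasing rearrangement of the same letters, \<open>s\<close> has the letter of \<open>v\<close> at
  the rank of \<open>v\<close>.
\<close>

lemma letter_of_rank:
  assumes v: "v \<in> {1..n}"
  shows "s (rank g v) = fst (g v)"
proof -
  let ?b = "fst (g v)"
  have "card {u \<in> {1..n}. fst (g u) > ?b} \<le> card {u \<in> {1..n}. precedes g u v}"
    by (rule card_mono) (auto simp: precedes_def)
  then have "rank g v \<notin> {1..card {i \<in> {1..n}. s i > ?b}}"
    unfolding card_letters[of "\<lambda>c. c > ?b"] using v by (simp add: rank_def)
  then have "rank g v \<notin> {i \<in> {1..n}. s i > ?b}"
    by (simp only: greater_segment[symmetric]) simp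
  moreover have "card {u \<in> {1..n}. precedes g u v} < card {u \<in> {1..n}. fst (g u) \<ge> ?b}"
    using v by (intro psubset_card_mono) (auto simp: precedes_def)
  then have "rank g v \<in> {1..card {i \<in> {1..n}. s i \<ge> ?b}}"
    unfolding card_letters[of "\<lambda>c. c \<ge> ?b"] using v by (simp add: rank_def)
  then have "rank g v \<in> {i \<in> {1..n}. s i \<ge> ?b}"
    by (simp only: ge_segment[symmetric])
  ultimately show ?thesis using rank_in[OF v] by simp
qed

text \<open>
  A larger letter has all its places before \<open>v\<close>. If the letter of \<open>v\<close> is \<open>s v\<close> itself, and the block of
  \<open>v\<close> starts at \<open>N + 1\<close>, then \<open>v\<close> is preceded by \<open>N\<close> entries with larger letters, and otherwise only by
  barred entries with the same letter at positions before \<open>v\<close>. By the rule for bars these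
  positions lie after \<open>N + 1\<close>, so there are fewer than \<open>v - 1 - N\<close> of them.
\<close>

lemma barred_rank_less:
  assumes v: "v \<in> {1..n}" and bar: "snd (g v)"
  shows "rank g v < v"
proof (cases "fst (g v) > s v")
  case True
  then have "s (rank g v) > s v" using letter_of_rank v by simp
  then show ?thesis using antitone[of v "rank g v"] rank_in[OF v] v by force
next
  case False
  then have b: "fst (g v) = s v" using letter_ok[OF v] bar by (auto simp: barred_letter_ok_def)
  \<comment> \<open>\<open>N\<close> is the number of positions before the block of \<open>v\<close>.\<close>
  obtain N where N: "card {i \<in> {1..n}. s i > s v} = N" and seg: "{i \<in> {1..n}. s i > s v} = {1..N}"
    using greater_segment by blast
  have Nv: "N < v" using seg v by (metis (no_types, lifting) atLeastAtMost_iff less_irrefl mem_Collect_eq not_le)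
  have N1: "s (N + 1) = s v"
  proof -
    have "N + 1 \<notin> {i \<in> {1..n}. s i > s v}" using seg by auto
    moreover have "s v \<le> s (N + 1)" using antitone[of "N + 1" v] Nv v by auto
    ultimately show ?thesis using Nv v by auto
  qed
  have first: "first_of_block (N + 1)"
    unfolding first_of_block_def N1
  proof
    fix u assume u: "u \<in> {1..<N + 1}"
    then have "u \<in> {i \<in> {1..n}. s i > s v}" unfolding seg by simp
    then show "s u \<noteq> s v" by simp
  qed
  have "v \<noteq> N + 1" using letter_ok[OF v] bar first b by (auto simp: barred_letter_ok_def)
  have "{u \<in> {1..n}. precedes g u v} \<subseteq> {u \<in> {1..n}. fst (g u) > s v} \<union> {N + 2..v - 1}"
  proof
    fix u assume u: "u \<in> {u \<in> {1..n}. precedes g u v}"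
    show "u \<in> {u \<in> {1..n}. fst (g u) > s v} \<union> {N + 2..v - 1}"
    proof (cases "fst (g u) > s v")
      case False
      then have *: "fst (g u) = s v" "snd (g u)" "u < v" using u b bar by (auto simp: precedes_def)
      have ok: "barred_letter_ok der u (fst (g u)) (snd (g u))" using letter_ok u by blast
      then have "s u \<le> s v" using * by (auto simp: barred_letter_ok_def)
      then have "u \<notin> {1..N}" unfolding seg[symmetric] by simp
      moreover have "u \<noteq> N + 1" using ok first * N1 by (auto simp: barred_letter_ok_def)
      ultimately show ?thesis using * u by auto
    qed (use u in auto)
  qed
  then have "card {u \<in> {1..n}. precedes g u v} \<le> card ({u \<in> {1..n}. fst (g u) > s v} \<union> {N + 2..v - 1})"
    by (intro card_mono) auto
  also have "\<dots> \<le> N + card {N + 2..v - 1}"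
    using card_Un_le[of "{u \<in> {1..n}. fst (g u) > s v}"] unfolding card_letters[of "\<lambda>c. c > s v"] N .
  also have "\<dots> < v - 1" using Nv \<open>v \<noteq> N + 1\<close> by auto
  finally show ?thesis using v by (simp add: rank_def)
qed

lemma rank_complement: "v \<in> {1..n} \<Longrightarrow> rank g v + card {u \<in> {1..n}. precedes g v u} = n"
proof -
  assume v: "v \<in> {1..n}"
  have "{1..n} = insert v ({u \<in> {1..n}. precedes g u v} \<union> {u \<in> {1..n}. precedes g v u})"
    using v precedes_asym_total by blast
  then have "card {1..n} = card (insert v ({u \<in> {1..n}. precedes g u v} \<union> {u \<in> {1..n}. precedes g v u}))"
    by (rule arg_cong)
  also have "\<dots> = Suc (card ({u \<in> {1..n}. precedes g u v} \<union> {u \<in> {1..n}. precedes g v u}))"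
    by (rule card_insert_disjoint) auto
  also have "card ({u \<in> {1..n}. precedes g u v} \<union> {u \<in> {1..n}. precedes g v u})
      = card {u \<in> {1..n}. precedes g u v} + card {u \<in> {1..n}. precedes g v u}"
    by (rule card_Un_disjoint) (auto simp: precedes_def)
  finally show ?thesis using v by (simp add: rank_def)
qed

text \<open>
  The mirror image of the barred case: count what follows \<open>v\<close>. If the block of \<open>v\<close> ends at \<open>N\<close>, these
  are \<open>n - N\<close> entries with smaller letters and unbarred entries at positions from \<open>v + 1\<close> to \<open>N\<close>. With the flag
  \<open>der\<close>, the position \<open>N\<close> is excluded as well, which makes the inequality strict.
\<close>

lemma unbarred_rank_ge:
  assumes v: "v \<in> {1..n}" and bar: "\<not> snd (g v)"
  shows "v \<le> rank g v" "der \<Longrightarrow> v < rank g v"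
proof -
  have "v \<le> rank g v \<and> (der \<longrightarrow> v < rank g v)"
  proof (cases "fst (g v) < s v")
    case True
    then have "s (rank g v) < s v" using letter_of_rank v by simp
    then have "v < rank g v" using antitone[of "rank g v" v] rank_in[OF v] v by force
    then show ?thesis by simp
  next
    case False
    then have b: "fst (g v) = s v" using letter_ok[OF v] bar by (auto simp: barred_letter_ok_def)
    \<comment> \<open>\<open>N\<close> is the last position of the block of \<open>v\<close>.\<close>
    obtain N where seg: "{i \<in> {1..n}. s i \<ge> s v} = {1..N}" using ge_segment by blast
    have "v \<in> {i \<in> {1..n}. s i \<ge> s v}" using v by simp
    then have Nv: "v \<le> N" unfolding seg by simp
    have "N \<in> {1..N}" using Nv v by simp
    then have "s N \<ge> s v" and Nn: "N \<le> n" unfolding seg[symmetric] by auto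
    then have N1: "s N = s v" using antitone[of v N] Nv v by auto
    have last: "last_of_block N"
      unfolding last_of_block_def N1
    proof
      fix u assume u: "u \<in> {N<..n}"
      show "s u \<noteq> s v"
      proof
        assume "s u = s v"
        then have "u \<in> {i \<in> {1..n}. s i \<ge> s v}" using u by auto
        then show False unfolding seg using u by simp
      qed
    qed
    have sub: "{u \<in> {1..n}. precedes g v u} \<subseteq> {u \<in> {1..n}. fst (g u) < s v} \<union> ({v + 1..N} - (if der then {N} else {}))"
    proof
      fix u assume u: "u \<in> {u \<in> {1..n}. precedes g v u}"
      show "u \<in> {u \<in> {1..n}. fst (g u) < s v} \<union> ({v + 1..N} - (if der then {N} else {}))"
      proof (cases "fst (g u) < s v")
        case False
        then have *: "fst (g u) = s v" "\<not> snd (g u)" "v < u" using u b bar by (auto simp: precedes_def)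
        have ok: "barred_letter_ok der u (fst (g u)) (snd (g u))" using letter_ok u by blast
        then have "s u \<ge> s v" using * by (auto simp: barred_letter_ok_def)
        then have "u \<in> {1..N}" unfolding seg[symmetric] using u by simp
        moreover have "u \<noteq> N" if der using ok last * N1 that by (auto simp: barred_letter_ok_def)
        ultimately show ?thesis using * u by auto
      qed (use u in auto)
    qed
    have "card {u \<in> {1..n}. fst (g u) < s v} = n - N"
    proof -
      have "card {u \<in> {1..n}. fst (g u) < s v} = card ({1..n} - {1..N})"
        unfolding card_letters[of "\<lambda>c. c < s v"] seg[symmetric] by (rule arg_cong[where f = card]) auto
      also have "\<dots> = n - N" using Nn by (subst card_Diff_subset) auto
      finally show ?thesis .
    qed
    moreover have "card {u \<in> {1..n}. precedes g v u}
        \<le> card ({u \<in> {1..n}. fst (g u) < s v} \<union> ({v + 1..N} - (if der then {N} else {})))"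
      by (rule card_mono[OF _ sub]) auto
    ultimately have le: "card {u \<in> {1..n}. precedes g v u} \<le> n - N + card ({v + 1..N} - (if der then {N} else {}))"
      using card_Un_le[of "{u \<in> {1..n}. fst (g u) < s v}" "{v + 1..N} - (if der then {N} else {})"] by linarith
    show ?thesis
    proof (cases der)
      case True
      have "v \<noteq> N" using letter_ok[OF v] bar last b True by (auto simp: barred_letter_ok_def)
      then have "card {u \<in> {1..n}. precedes g v u} \<le> n - N + (N - v - 1)"
        using le True Nv by simp
      then show ?thesis using rank_complement[OF v] Nv \<open>v \<noteq> N\<close> Nn by linarith
    next
      case False
      then show ?thesis using le rank_complement[OF v] Nv Nn by simp
    qed
  qed
  then show "v \<le> rank g v" "der \<Longrightarrow> v < rank g v" by auto
qed

lemma encode_inv_rank: "encode (pinv (rank g)) = g"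
proof
  fix v
  have i: "pinv (pinv (rank g)) = rank g"
    by (rule inv_inv_eq[OF permutes_bij[OF rank_permutes]])
  have "snd (g v) = (rank g v < v)" if "v \<in> {1..n}"
    using barred_rank_less unbarred_rank_ge(1) that by (meson not_le)
  then show "encode (pinv (rank g)) v = g v"
    using g letter_of_rank
    by (cases "v \<in> {1..n}") (auto simp: encode_def i barred_rearrangements_def PiE_def extensional_def intro: prod_eqI)
qed

lemma inv_rank_compatible: "compatible (pinv (rank g))"
proof -
  have i: "pinv (pinv (rank g)) = rank g"
    by (rule inv_inv_eq[OF permutes_bij[OF rank_permutes]])
  show ?thesis
    unfolding compatible_iff_precedes[OF permutes_inv[OF rank_permutes]] encode_inv_rank i
    by (metis nat_neq_iff order_less_imp_not_less precedes_asym_total rank_strict_mono)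
qed

lemma inv_rank_derangement: "der \<Longrightarrow> v \<in> {1..n} \<Longrightarrow> pinv (rank g) v \<noteq> v"
  by (metis barred_rank_less nat_neq_iff permutes_inverses(1) rank_permutes unbarred_rank_ge(2))

end

lemma encode_bij:
  "bij_betw encode {\<sigma>. \<sigma> permutes {1..n} \<and> compatible \<sigma> \<and> (der \<longrightarrow> (\<forall>v\<in>{1..n}. \<sigma> v \<noteq> v))}
    (barred_rearrangements der)"
proof (rule bij_betw_byWitness[where f' = "\<lambda>g. pinv (rank g)"])
  show "\<forall>\<sigma>\<in>{\<sigma>. \<sigma> permutes {1..n} \<and> compatible \<sigma> \<and> (der \<longrightarrow> (\<forall>v\<in>{1..n}. \<sigma> v \<noteq> v))}. pinv (rank (encode \<sigma>)) = \<sigma>"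
    by (auto simp: rank_encode inv_inv_eq permutes_bij)
  show "encode ` {\<sigma>. \<sigma> permutes {1..n} \<and> compatible \<sigma> \<and> (der \<longrightarrow> (\<forall>v\<in>{1..n}. \<sigma> v \<noteq> v))} \<subseteq> barred_rearrangements der"
    using encode_in by blast
  show "\<forall>g\<in>barred_rearrangements der. encode (pinv (rank g)) = g"
    using encode_inv_rank by blast
  show "(\<lambda>g. pinv (rank g)) ` barred_rearrangements der
      \<subseteq> {\<sigma>. \<sigma> permutes {1..n} \<and> compatible \<sigma> \<and> (der \<longrightarrow> (\<forall>v\<in>{1..n}. \<sigma> v \<noteq> v))}"
    using inv_rank_compatible inv_rank_derangement permutes_inv[OF rank_permutes] by blast
qed

text \<open>
  Once the word is fixed, the bars are chosen independently at all positions.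
\<close>

lemma excedance_sum_eq_words:
  fixes t :: "'a :: comm_ring_1"
  shows "(\<Sum>\<sigma> | \<sigma> permutes {1..n} \<and> compatible \<sigma> \<and> (der \<longrightarrow> (\<forall>v\<in>{1..n}. \<sigma> v \<noteq> v)). t ^ exc n \<sigma>)
    = mcoeff (\<Prod>v\<in>{1..n}. linear_series (\<lambda>c. \<Sum>\<beta> | barred_letter_ok der v c \<beta>. if \<beta> then t else 1)) m"
proof -
  let ?wt = "\<lambda>\<beta>. if \<beta> then t else 1"
  let ?W = "{w. w \<in> {1..n} \<rightarrow>\<^sub>E UNIV \<and> image_mset w (mset_set {1..n}) = m}"
  let ?B = "\<lambda>w. PiE {1..n} (\<lambda>v. {\<beta>. barred_letter_ok der v (w v) \<beta>})"
  have fin: "finite ?W"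
  proof (rule finite_subset)
    show "?W \<subseteq> {1..n} \<rightarrow>\<^sub>E set_mset m" by (auto simp: PiE_iff extensional_def)
  qed (simp add: finite_PiE)
  have "(\<Sum>\<sigma> | \<sigma> permutes {1..n} \<and> compatible \<sigma> \<and> (der \<longrightarrow> (\<forall>v\<in>{1..n}. \<sigma> v \<noteq> v)). t ^ exc n \<sigma>)
    = (\<Sum>g\<in>barred_rearrangements der. \<Prod>v\<in>{1..n}. ?wt (snd (g v)))"
  proof -
    have "t ^ exc n \<sigma> = (\<Prod>v\<in>{1..n}. ?wt (snd (encode \<sigma> v)))" if "\<sigma> permutes {1..n}" for \<sigma>
      by (simp add: exc_eq[OF that] prod.If_cases Int_def)
    then show ?thesis by (simp add: sum.reindex_bij_betw[OF encode_bij, symmetric])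
  qed
  also have "\<dots> = (\<Sum>(w, \<beta>)\<in>(SIGMA w:?W. ?B w). \<Prod>v\<in>{1..n}. ?wt (\<beta> v))"
  proof (rule sum.reindex_bij_witness[of _ "\<lambda>(w, \<beta>). \<lambda>v\<in>{1..n}. (w v, \<beta> v)"
          "\<lambda>g. (\<lambda>v\<in>{1..n}. fst (g v), \<lambda>v\<in>{1..n}. snd (g v))"])
    fix g assume g: "g \<in> barred_rearrangements der"
    have "image_mset (\<lambda>v\<in>{1..n}. fst (g v)) (mset_set {1..n}) = image_mset (\<lambda>v. fst (g v)) (mset_set {1..n})"
      by (rule image_mset_cong) simp
    then show "(\<lambda>v\<in>{1..n}. fst (g v), \<lambda>v\<in>{1..n}. snd (g v)) \<in> (SIGMA w:?W. ?B w)"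
      using g by (auto simp: barred_rearrangements_def)
    show "(case (\<lambda>v\<in>{1..n}. fst (g v), \<lambda>v\<in>{1..n}. snd (g v)) of (w, \<beta>) \<Rightarrow> \<lambda>v\<in>{1..n}. (w v, \<beta> v)) = g"
      using g by (auto simp: barred_rearrangements_def PiE_def extensional_def fun_eq_iff)
    show "(case (\<lambda>v\<in>{1..n}. fst (g v), \<lambda>v\<in>{1..n}. snd (g v)) of (w, \<beta>) \<Rightarrow> \<Prod>v\<in>{1..n}. ?wt (\<beta> v))
        = (\<Prod>v\<in>{1..n}. ?wt (snd (g v)))"
      by simp
  next
    fix p assume p: "p \<in> (SIGMA w:?W. ?B w)"
    obtain w \<beta> where p': "p = (w, \<beta>)" by fastforce
    have "image_mset (\<lambda>v. fst ((\<lambda>v\<in>{1..n}. (w v, \<beta> v)) v)) (mset_set {1..n}) = image_mset w (mset_set {1..n})"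
      by (rule image_mset_cong) simp
    then show "(case p of (w, \<beta>) \<Rightarrow> \<lambda>v\<in>{1..n}. (w v, \<beta> v)) \<in> barred_rearrangements der"
      using p p' by (auto simp: barred_rearrangements_def)
    show "(\<lambda>v\<in>{1..n}. fst ((case p of (w, \<beta>) \<Rightarrow> \<lambda>v\<in>{1..n}. (w v, \<beta> v)) v),
        \<lambda>v\<in>{1..n}. snd ((case p of (w, \<beta>) \<Rightarrow> \<lambda>v\<in>{1..n}. (w v, \<beta> v)) v)) = p"
      using p p' by (auto simp: PiE_def extensional_def fun_eq_iff)
  qed
  also have "\<dots> = (\<Sum>w\<in>?W. \<Sum>\<beta>\<in>?B w. \<Prod>v\<in>{1..n}. ?wt (\<beta> v))"
    using fin by (intro sum.Sigma[symmetric]) (auto intro!: finite_PiE)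
  also have "\<dots> = (\<Sum>w\<in>?W. \<Prod>v\<in>{1..n}. \<Sum>\<beta> | barred_letter_ok der v (w v) \<beta>. ?wt \<beta>)"
    by (intro sum.cong refl prod_sum_PiE[symmetric]) auto
  also have "\<dots> = mcoeff (\<Prod>v\<in>{1..n}. linear_series (\<lambda>c. \<Sum>\<beta> | barred_letter_ok der v c \<beta>. ?wt \<beta>)) m"
    by (subst mcoeff_prod_linear_series) auto
  finally show ?thesis .
qed

text \<open>
  At the first position of a block the forbidden choice is a bar on the own letter, of weight \<open>t\<close>; at the
  last position it is the missing bar, of weight 1.
\<close>

lemma position_form_eq:
  fixes t :: "'a :: comm_ring_1"
  shows "linear_series (\<lambda>c. \<Sum>\<beta> | barred_letter_ok der v c \<beta>. if \<beta> then t else 1) =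
    block_form t (s v) - mseries_const ((if first_of_block v then t else 0)
      + (if der \<and> last_of_block v then 1 else 0)) * mmono {#s v#}"
  unfolding block_form_minus
proof (rule arg_cong[where f = linear_series], rule ext)
  fix c
  have bool: "(\<Sum>\<beta> | P \<beta>. if \<beta> then t else 1) = (if P True then t else 0) + (if P False then 1 else 0)" for P
  proof -
    have "{\<beta>. P \<beta>} = (if P True then {True} else {}) \<union> (if P False then {False} else {})"
      by (auto split: if_splits) (metis (full_types))+
    then show ?thesis by simp
  qed
  show "(\<Sum>\<beta> | barred_letter_ok der v c \<beta>. if \<beta> then t else 1) =
      (if s v < c then t else 0) + (if c < s v then 1 else 0) + (if c = s v then 1 + t
        - ((if first_of_block v then t else 0) + (if der \<and> last_of_block v then 1 else 0)) else 0)"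
    unfolding bool by (cases c "s v" rule: linorder_cases) (auto simp: barred_letter_ok_def)
qed

text \<open>
  Grouped by blocks, the linear forms of the positions are those found in the products with \<open>E\<close>: each
  block has one first and one last position.
\<close>

lemma excedance_sum_eq_mcoeff:
  fixes t :: "'a :: comm_ring_1"
  shows "(\<Sum>\<sigma> | \<sigma> permutes {1..n} \<and> compatible \<sigma>. t ^ exc n \<sigma>) = mcoeff (E_series t * master_series t) m" (is ?exc)
    and "(\<Sum>\<sigma> | \<sigma> permutes {1..n} \<and> compatible \<sigma> \<and> (\<forall>v\<in>{1..n}. \<sigma> v \<noteq> v). t ^ exc n \<sigma>)
      = mcoeff (E_series 1 * (E_series t * master_series t)) m" (is ?der)
proof -
  let ?L = "\<lambda>der v. linear_series (\<lambda>c. \<Sum>\<beta> | barred_letter_ok der v c \<beta>. if \<beta> then t else 1)"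
  define F where "F b e = block_form t b - mseries_const e * mmono {#b#}" for b e
  have F0: "F b 0 = block_form t b" for b by (simp add: F_def mseries_const_zero)
  define B where "B b = {v \<in> {1..n}. s v = b}" for b
  have cardB: "card (B b) = count m b" for b
    using size_filter_content[of "\<lambda>c. c = b"] by (simp only: B_def filter_eq_replicate_mset size_replicate_mset)
  have setm: "s ` {1..n} = set_mset m" by (simp add: content[symmetric] del: One_nat_def)
  have first: "first_of_block v \<longleftrightarrow> v = Min (B b)" and last: "last_of_block v \<longleftrightarrow> v = Max (B b)"
    if v: "v \<in> B b" for v b
  proof -
    have fin: "finite (B b)" and ne: "B b \<noteq> {}" using v by (auto simp: B_def)
    have Min: "Min (B b) \<in> B b" "Min (B b) \<le> v" and Max: "Max (B b) \<in> B b" "v \<le> Max (B b)"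
      using fin ne v by auto
    show "first_of_block v \<longleftrightarrow> v = Min (B b)"
    proof
      assume "first_of_block v"
      then have "Min (B b) \<notin> {1..<v}" using v Min(1) unfolding first_of_block_def B_def by auto
      then show "v = Min (B b)" using Min by (auto simp: B_def)
    next
      assume v': "v = Min (B b)"
      show "first_of_block v" unfolding first_of_block_def
      proof
        fix u assume u: "u \<in> {1..<v}"
        show "s u \<noteq> s v"
        proof
          assume "s u = s v"
          then have "u \<in> B b" using u v by (auto simp: B_def)
          then have "Min (B b) \<le> u" using fin by simp
          then show False using u v' by simp
        qed
      qed
    qed
    show "last_of_block v \<longleftrightarrow> v = Max (B b)"
    proof
      assume "last_of_block v"
      then have "Max (B b) \<notin> {v<..n}" using v Max(1) unfolding last_of_block_def B_def by auto
      then show "v = Max (B b)" using Max by (auto simp: B_def)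
    next
      assume v': "v = Max (B b)"
      show "last_of_block v" unfolding last_of_block_def
      proof
        fix u assume u: "u \<in> {v<..n}"
        show "s u \<noteq> s v"
        proof
          assume "s u = s v"
          then have "u \<in> B b" using u v by (auto simp: B_def)
          then have "u \<le> Max (B b)" using fin by simp
          then show False using u v' by simp
        qed
      qed
    qed
  qed
  have group: "(\<Prod>v\<in>{1..n}. ?L der v) = (\<Prod>b\<in>set_mset m. \<Prod>v\<in>B b.
      F b ((if v = Min (B b) then t else 0) + (if der \<and> v = Max (B b) then 1 else 0)))" for der
  proof -
    have "(\<Prod>v\<in>{1..n}. ?L der v) = (\<Prod>b\<in>s ` {1..n}. \<Prod>v\<in>B b. ?L der v)"
      unfolding B_def by (rule prod.image_gen) simp
    also have "\<dots> = (\<Prod>b\<in>set_mset m. \<Prod>v\<in>B b.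
      F b ((if v = Min (B b) then t else 0) + (if der \<and> v = Max (B b) then 1 else 0)))"
      unfolding setm
    proof (intro prod.cong refl)
      fix b v assume v: "v \<in> B b"
      then have "s v = b" by (simp add: B_def)
      then show "?L der v = F b ((if v = Min (B b) then t else 0) + (if der \<and> v = Max (B b) then 1 else 0))"
        by (simp only: position_form_eq first[OF v] last[OF v] F_def)
    qed
    finally show ?thesis .
  qed
  have finB: "finite (B b)" for b by (simp add: B_def)
  have neB: "B b \<noteq> {}" if "b \<in># m" for b
    using that cardB[of b] by (metis card.empty count_eq_zero_iff)
  have block1: "(\<Prod>v\<in>B b. F b ((if v = Min (B b) then t else 0) + (if False \<and> v = Max (B b) then 1 else 0)))
      = block_form t b ^ (count m b - 1) * F b t" if "b \<in># m" for b
  proof -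
    have "(\<Prod>v\<in>B b. F b ((if v = Min (B b) then t else 0) + (if False \<and> v = Max (B b) then 1 else 0)))
      = F b t * (\<Prod>v\<in>B b - {Min (B b)}. F b 0)"
      using finB neB[OF that] by (subst prod.remove[of _ "Min (B b)"]) (auto intro!: arg_cong2[where f = "(*)"] prod.cong)
    then show ?thesis using finB neB[OF that] by (simp add: F0 cardB card_Diff_singleton mult.commute)
  qed
  have block2: "(\<Prod>v\<in>B b. F b ((if v = Min (B b) then t else 0) + (if True \<and> v = Max (B b) then 1 else 0)))
      = (if count m b = 1 then F b (1 + t) else block_form t b ^ (count m b - 2) * F b t * F b 1)"
    if b: "b \<in># m" for b
  proof (cases "count m b = 1")
    case True
    then obtain v where "B b = {v}" using cardB[of b] by (metis card_1_singletonE)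
    with True show ?thesis by (simp add: add.commute)
  next
    case False
    have ne: "Min (B b) \<noteq> Max (B b)"
    proof
      assume eq: "Min (B b) = Max (B b)"
      have "B b = {Min (B b)}"
      proof
        show "B b \<subseteq> {Min (B b)}"
        proof
          fix x assume "x \<in> B b"
          then have "Min (B b) \<le> x" "x \<le> Max (B b)" using finB by auto
          then show "x \<in> {Min (B b)}" using eq by simp
        qed
      qed (use finB neB[OF b] in auto)
      then have "card (B b) = 1" by (metis card_1_singleton_iff One_nat_def)
      then show False using False cardB by simp
    qed
    have mem: "Min (B b) \<in> B b" "Max (B b) \<in> B b" using finB neB[OF b] by auto
    have "(\<Prod>v\<in>B b. F b ((if v = Min (B b) then t else 0) + (if True \<and> v = Max (B b) then 1 else 0)))
      = F b t * (F b 1 * (\<Prod>v\<in>B b - {Min (B b)} - {Max (B b)}. F b 0))"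
      using finB mem ne by (subst prod.remove[of _ "Min (B b)"], simp, simp, subst prod.remove[of _ "Max (B b)"])
        (auto intro!: arg_cong2[where f = "(*)"] prod.cong)
    moreover have "card (B b - {Min (B b)} - {Max (B b)}) = count m b - 2"
      using mem ne finB by (simp add: cardB)
    ultimately show ?thesis using False by (simp add: F0 mult_ac)
  qed
  have "(\<Prod>v\<in>{1..n}. ?L False v) = (\<Prod>b\<in>set_mset m. block_form t b ^ (count m b - 1) * F b t)"
    unfolding group by (intro prod.cong refl block1)
  then show ?exc
    using excedance_sum_eq_words[where der = False and t = t] by (simp add: mcoeff_E_times_master F_def del: One_nat_def)
  have "(\<Prod>v\<in>{1..n}. ?L True v) = (\<Prod>b\<in>set_mset m. if count m b = 1 then F b (1 + t)
      else block_form t b ^ (count m b - 2) * F b t * F b 1)"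
    unfolding group by (intro prod.cong refl block2)
  then show ?der
    using excedance_sum_eq_words[where der = True and t = t] by (simp only: mcoeff_E_E_times_master F_def simp_thms)
qed

end

lemma sorted_word_of_mset:
  fixes m :: "nat multiset"
  defines "s \<equiv> \<lambda>i. rev (sorted_list_of_multiset m) ! (i - 1)"
  shows "weakly_decreasing_word (size m) s m"
proof
  let ?xs = "rev (sorted_list_of_multiset m)"
  have len': "length (sorted_list_of_multiset m) = size m" by (metis mset_sorted_list_of_multiset size_mset)
  then have len: "length ?xs = size m" by simp
  have sorted: "sorted_wrt (\<ge>) ?xs" by (simp add: sorted_wrt_rev)
  show "s j \<le> s i" if "1 \<le> i" "i \<le> j" "j \<le> size m" for i j
  proof (cases "i = j")
    case False
    then show ?thesis using sorted_wrt_nth_less[OF sorted, of "i - 1" "j - 1"] that len by (simp add: s_def)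
  qed simp
  have "mset (map s [1..<size m + 1]) = mset ?xs"
  proof (rule arg_cong[where f = mset], rule nth_equalityI)
    show "length (map s [1..<size m + 1]) = length ?xs" by (simp add: len' del: upt_Suc)
  qed (simp add: s_def del: upt_Suc)
  moreover have "image_mset s (mset_set {1..size m}) = mset (map s [1..<size m + 1])"
    by (simp only: mset_map mset_upt Suc_eq_plus1[symmetric] atLeastLessThanSuc_atLeastAtMost)
  ultimately show "image_mset s (mset_set {1..size m}) = m" by (simp only: mset_rev mset_sorted_list_of_multiset)
qed

text \<open>
  There is only one decreasing list with a given content.
\<close>

lemma mcoeff_fund_qsym:
  fixes m :: "nat multiset"
  defines "s \<equiv> \<lambda>i. rev (sorted_list_of_multiset m) ! (i - 1)"
  shows "mcoeff (fund_qsym S n) m =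
    (if size m = n \<and> 0 \<notin># m \<and> (\<forall>j\<in>S. s j > s (j + 1)) then 1 else 0)"
proof -
  let ?xs = "rev (sorted_list_of_multiset m)"
  let ?A = "{xs. length xs = n \<and> sorted_wrt (\<ge>) xs \<and> (\<forall>i\<in>set xs. i \<ge> 1)
        \<and> (\<forall>j\<in>S. xs ! (j - 1) > xs ! j) \<and> mset xs = m}"
  have uniq: "xs = ?xs" if "sorted_wrt (\<ge>) xs" "mset xs = m" for xs
  proof -
    have "sorted (rev xs)" using that(1) by (simp add: sorted_wrt_rev)
    then have "rev xs = sorted_list_of_multiset m"
      using that(2) by (metis mset_rev sorted_list_of_multiset_mset sorted_sort_id)
    then show ?thesis by (metis rev_rev_ident)
  qed
  have "?A = (if size m = n \<and> 0 \<notin># m \<and> (\<forall>j\<in>S. s j > s (j + 1)) then {?xs} else {})"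
  proof -
    have "length ?xs = size m" by (metis length_rev mset_sorted_list_of_multiset size_mset)
    moreover have "sorted_wrt (\<ge>) ?xs" by (simp add: sorted_wrt_rev)
    moreover have "(\<forall>i\<in>set ?xs. i \<ge> 1) \<longleftrightarrow> 0 \<notin># m"
      by (auto simp: Suc_le_eq) (metis gr0I)
    moreover have "mset ?xs = m" by simp
    ultimately have xs: "?xs \<in> ?A \<longleftrightarrow> size m = n \<and> 0 \<notin># m \<and> (\<forall>j\<in>S. s j > s (j + 1))"
      unfolding s_def by (simp del: One_nat_def)
    have "?A \<subseteq> {?xs}"
    proof
      fix ys assume "ys \<in> ?A"
      then have "ys = ?xs" by (intro uniq) simp_all
      then show "ys \<in> {?xs}" by simp
    qed
    have gen: "A \<subseteq> {x} \<Longrightarrow> (x \<in> A \<longleftrightarrow> c) \<Longrightarrow> A = (if c then {x} else {})" for A c and x :: "nat list"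
      by auto
    show ?thesis by (rule gen[OF \<open>?A \<subseteq> {?xs}\<close> xs])
  qed
  then have "card ?A = (if size m = n \<and> 0 \<notin># m \<and> (\<forall>j\<in>S. s j > s (j + 1)) then 1 else 0)"
    by (simp only:) simp
  then show ?thesis unfolding fund_qsym.rep_eq by (simp only:) simp
qed

section \<open>Levelled multisets\<close>

text \<open>
  The inserted \<open>0\<close> makes the level of the empty multiset a value below all positive levels.
\<close>

definition top_level :: "(nat \<times> nat) multiset \<Rightarrow> nat"
  where "top_level P = Max (insert 0 (fst ` set_mset P))"

text \<open>
  The bound on the exponents of a Feichtner--Yuzvinsky monomial in terms of levels: if a level \<open>a\<close> is occupied and the
  occupied level below is \<open>a'\<close>, then \<open>a - a'\<close> is the exponent of the set of points of level at least
  \<open>a\<close>, and the count of \<open>a\<close> is the number of points by which this set exceeds the next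
  smaller one.
\<close>

definition admissible :: "nat multiset \<Rightarrow> bool"
  where "admissible l \<longleftrightarrow> (\<forall>a\<in>#l. a > 0 \<longrightarrow> (\<exists>a'\<in>insert 0 (set_mset l). a' < a \<and> a - a' < count l a))"

definition levelled :: "bool \<Rightarrow> nat multiset \<Rightarrow> (nat \<times> nat) multiset set"
  where "levelled pos m = {P. image_mset snd P = m \<and> admissible (image_mset fst P)
    \<and> (pos \<longrightarrow> 0 \<notin> fst ` set_mset P)}"

definition attach :: "nat multiset \<Rightarrow> nat \<Rightarrow> (nat \<times> nat) multiset \<Rightarrow> (nat \<times> nat) multiset"
  where "attach \<nu> a P = image_mset (\<lambda>c. (top_level P + a, c)) \<nu> + P"

lemma top_level_ge: "p \<in># P \<Longrightarrow> fst p \<le> top_level P"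
  unfolding top_level_def by (intro Max_ge) auto

lemma top_level_in: "top_level P \<in> insert 0 (fst ` set_mset P)"
  unfolding top_level_def by (intro Max_in) auto

lemma top_level_eqI:
  "(\<And>p. p \<in># P \<Longrightarrow> fst p \<le> d) \<Longrightarrow> d \<in> insert 0 (fst ` set_mset P) \<Longrightarrow> top_level P = d"
  unfolding top_level_def by (rule Max_eqI) auto

lemma count_image_fst: "count (image_mset fst P) a = size (filter_mset (\<lambda>p. fst p = a) P)"
  by (induction P) auto

lemma top_level_attach:
  assumes "\<nu> \<noteq> {#}"
  shows "top_level (attach \<nu> a P) = top_level P + a"
proof (rule top_level_eqI)
  show "fst p \<le> top_level P + a" if "p \<in># attach \<nu> a P" for p
    using that by (auto simp: attach_def dest: top_level_ge)
  obtain c where "c \<in># \<nu>" using assms by blast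
  then have "(top_level P + a, c) \<in># attach \<nu> a P" by (simp add: attach_def)
  then show "top_level P + a \<in> insert 0 (fst ` set_mset (attach \<nu> a P))" by force
qed

lemma attach_levelled:
  assumes "\<nu> \<subseteq># m" "a \<in> {1..<size \<nu>}" "P \<in> levelled pos (m - \<nu>)"
  shows "attach \<nu> a P \<in> levelled pos m" "top_level (attach \<nu> a P) = top_level P + a"
proof -
  let ?d = "top_level P + a"
  have "\<nu> \<noteq> {#}" using assms(2) by auto
  then show top: "top_level (attach \<nu> a P) = ?d" by (rule top_level_attach)
  have adm: "admissible (image_mset fst P)" using assms(3) by (simp add: levelled_def)
  have fst: "image_mset fst (attach \<nu> a P) = replicate_mset (size \<nu>) ?d + image_mset fst P"
    by (simp add: attach_def image_mset_const_eq multiset.map_comp comp_def)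
  have lt: "x < ?d" if "x \<in> insert 0 (fst ` set_mset P)" for x
    using that top_level_ge[of _ P] assms(2) by fastforce
  have "admissible (image_mset fst (attach \<nu> a P))"
    unfolding admissible_def
  proof (intro ballI impI)
    fix x assume x: "x \<in># image_mset fst (attach \<nu> a P)" "x > 0"
    show "\<exists>a'\<in>insert 0 (set_mset (image_mset fst (attach \<nu> a P))). a' < x \<and> x - a' < count (image_mset fst (attach \<nu> a P)) x"
    proof (cases "x = ?d")
      case True
      have "top_level P \<in> insert 0 (set_mset (image_mset fst (attach \<nu> a P)))"
        using top_level_in[of P] unfolding fst by auto
      moreover have "top_level P < x" "x - top_level P < count (image_mset fst (attach \<nu> a P)) x"
        using True assms(2) by (auto simp: fst)
      ultimately show ?thesis by blast
    next
      case False
      then have "x \<in># image_mset fst P" using x unfolding fst by (auto split: if_splits)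
      then obtain a' where "a' \<in> insert 0 (set_mset (image_mset fst P))" "a' < x" "x - a' < count (image_mset fst P) x"
        using adm x(2) unfolding admissible_def by blast
      then show ?thesis using False unfolding fst by (intro bexI[of _ a']) auto
    qed
  qed
  moreover have "image_mset snd (attach \<nu> a P) = m"
    using assms(1,3) by (simp add: attach_def levelled_def multiset.map_comp comp_def)
  ultimately show "attach \<nu> a P \<in> levelled pos m"
    using assms(2,3) by (auto simp: levelled_def attach_def)
qed

lemma attach_inj:
  assumes "a \<in> {1..<size \<nu>}" "a' \<in> {1..<size \<nu>'}" "attach \<nu> a P = attach \<nu>' a' P'"
  shows "\<nu> = \<nu>' \<and> a = a' \<and> P = P'"
proof -
  have dec: "filter_mset (\<lambda>p. fst p = top_level (attach \<nu> a P)) (attach \<nu> a P) = image_mset (\<lambda>c. (top_level P + a, c)) \<nu>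
      \<and> filter_mset (\<lambda>p. fst p \<noteq> top_level (attach \<nu> a P)) (attach \<nu> a P) = P
      \<and> top_level (attach \<nu> a P) = top_level P + a"
    if a: "a \<in> {1..<size \<nu>}" for \<nu> a P
  proof -
    have ne: "\<nu> \<noteq> {#}" using a by auto
    have top: "top_level (attach \<nu> a P) = top_level P + a"
      using ne by (rule top_level_attach)
    have "fst p \<noteq> top_level P + a" if "p \<in># P" for p
      using top_level_ge[OF that] a by auto
    then have "filter_mset (\<lambda>p. fst p = top_level P + a) P = filter_mset (\<lambda>p. False) P"
      "filter_mset (\<lambda>p. fst p \<noteq> top_level P + a) P = filter_mset (\<lambda>p. True) P"
      by (intro filter_mset_cong refl; simp)+
    then have "filter_mset (\<lambda>p. fst p = top_level P + a) P = {#}" "filter_mset (\<lambda>p. fst p \<noteq> top_level P + a) P = P"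
      by simp_all
    then show ?thesis unfolding top by (simp add: attach_def filter_mset_image_mset)
  qed
  have "P = P'" using dec[OF assms(1), of P] dec[OF assms(2), of P'] assms(3) by metis
  moreover have "a = a'" using dec[OF assms(1), of P] dec[OF assms(2), of P'] assms(3) calculation by (metis add_left_cancel)
  moreover have "image_mset snd (image_mset (\<lambda>c. (top_level P + a, c)) \<nu>) = image_mset snd (image_mset (\<lambda>c. (top_level P' + a', c)) \<nu>')"
    using dec[OF assms(1), of P] dec[OF assms(2), of P'] assms(3) by metis
  ultimately show ?thesis by (simp add: multiset.map_comp comp_def)
qed

text \<open>
  Take off the top level: \<open>\<nu>\<close> are its colours and \<open>a\<close> is its distance from the level below.
\<close>

lemma levelled_decompose:
  assumes P: "P \<in> levelled pos m" and top: "top_level P > 0"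
  shows "\<exists>\<nu> a P'. \<nu> \<subseteq># m \<and> a \<in> {1..<size \<nu>} \<and> P' \<in> levelled pos (m - \<nu>) \<and> P = attach \<nu> a P'"
proof -
  define d where "d = top_level P"
  define \<nu> where "\<nu> = image_mset snd (filter_mset (\<lambda>p. fst p = d) P)"
  define P' where "P' = filter_mset (\<lambda>p. fst p \<noteq> d) P"
  define a where "a = d - top_level P'"
  have part: "P = filter_mset (\<lambda>p. fst p = d) P + P'" unfolding P'_def by (rule multiset_partition)
  have m: "m = \<nu> + image_mset snd P'"
    using P part unfolding levelled_def \<nu>_def by (metis (mono_tags, lifting) image_mset_union mem_Collect_eq)
  have adm: "admissible (image_mset fst P)" using P by (simp add: levelled_def)
  have topP': "top_level P' < d"
  proof -
    have "top_level P' \<in> insert 0 (fst ` set_mset P')" by (rule top_level_in)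
    moreover have "fst p < d" if "p \<in># P'" for p
      using that top_level_ge[of p P] by (auto simp: P'_def d_def)
    ultimately show ?thesis using top by (auto simp: d_def)
  qed
  have "d \<in># image_mset fst P" using top_level_in[of P] top by (auto simp: d_def)
  then obtain a' where a': "a' \<in> insert 0 (set_mset (image_mset fst P))" "a' < d" "d - a' < count (image_mset fst P) d"
    using adm top unfolding admissible_def d_def by blast
  have "a' \<le> top_level P'"
  proof (cases "a' = 0")
    case False
    then obtain p where "p \<in># P" "fst p = a'" using a'(1) by auto
    then show ?thesis using a'(2) by (auto simp: P'_def intro!: top_level_ge)
  qed simp
  then have a: "a \<in> {1..<size \<nu>}"
    using topP' a'(3) by (auto simp: a_def \<nu>_def count_image_fst)
  have "P = attach \<nu> a P'"
  proof -
    have "image_mset (\<lambda>c. (d, c)) \<nu> = filter_mset (\<lambda>p. fst p = d) P"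
    proof -
      have "image_mset (\<lambda>c. (d, c)) \<nu> = image_mset (\<lambda>p. (d, snd p)) (filter_mset (\<lambda>p. fst p = d) P)"
        by (simp add: \<nu>_def multiset.map_comp comp_def)
      also have "\<dots> = image_mset (\<lambda>p. p) (filter_mset (\<lambda>p. fst p = d) P)"
        by (rule image_mset_cong) auto
      finally show ?thesis by simp
    qed
    then show ?thesis using part topP' by (simp add: attach_def a_def)
  qed
  moreover have "P' \<in> levelled pos (m - \<nu>)"
  proof -
    have "admissible (image_mset fst P')" unfolding admissible_def
    proof (intro ballI impI)
      fix x assume x: "x \<in># image_mset fst P'" "x > 0"
      then have xd: "x < d" using top_level_ge[of _ P'] topP' by fastforce
      have "x \<in># image_mset fst P" using x by (auto simp: P'_def)
      then obtain y where y: "y \<in> insert 0 (set_mset (image_mset fst P))" "y < x" "x - y < count (image_mset fst P) x"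
        using adm x(2) unfolding admissible_def by blast
      have "y \<in> insert 0 (set_mset (image_mset fst P'))" using y xd by (auto simp: P'_def)
      moreover have "count (image_mset fst P) x = count (image_mset fst P') x"
        using xd unfolding count_image_fst P'_def filter_filter_mset
        by (intro arg_cong[where f = size] filter_mset_cong) auto
      ultimately show "\<exists>a'\<in>insert 0 (set_mset (image_mset fst P')). a' < x \<and> x - a' < count (image_mset fst P') x"
        using y by metis
    qed
    then show ?thesis using P m by (auto simp: levelled_def P'_def)
  qed
  moreover have "\<nu> \<subseteq># m" using m by simp
  ultimately show ?thesis using a by blast
qed

lemma top_level_zero:
  "P \<in> levelled pos m \<and> top_level P = 0 \<longleftrightarrow> P = image_mset (\<lambda>c. (0, c)) m \<and> (pos \<longrightarrow> m = {#})"
proof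
  assume P: "P \<in> levelled pos m \<and> top_level P = 0"
  then have "fst p = 0" if "p \<in># P" for p using top_level_ge[OF that] by simp
  then have "image_mset (\<lambda>p. p) P = image_mset (\<lambda>p. (0, snd p)) P" by (intro image_mset_cong) (auto simp: prod_eq_iff)
  then have "P = image_mset (\<lambda>c. (0, c)) m" using P by (auto simp: levelled_def multiset.map_comp comp_def)
  moreover have "m = {#}" if pos
  proof (rule ccontr)
    assume "m \<noteq> {#}"
    then obtain c where "c \<in># m" by blast
    then have "(0, c) \<in># P" using calculation by simp
    then show False using P that by (auto simp: levelled_def image_iff)
  qed
  ultimately show "P = image_mset (\<lambda>c. (0, c)) m \<and> (pos \<longrightarrow> m = {#})" by blast
next
  assume P: "P = image_mset (\<lambda>c. (0, c)) m \<and> (pos \<longrightarrow> m = {#})"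
  then have "top_level P = 0" by (intro top_level_eqI) auto
  then show "P \<in> levelled pos m \<and> top_level P = 0"
    using P by (auto simp: levelled_def multiset.map_comp comp_def admissible_def)
qed

definition splits :: "nat multiset \<Rightarrow> (nat multiset \<times> nat) set"
  where "splits m = (SIGMA \<nu>:{\<nu>. \<nu> \<subseteq># m}. {1..<size \<nu>})"

lemma finite_splits: "finite (splits m)"
  by (simp add: splits_def finite_submultisets)

lemma levelled_positive_eq:
  "{P \<in> levelled pos m. top_level P > 0}
    = (\<lambda>((\<nu>, a), P). attach \<nu> a P) ` (SIGMA (\<nu>, a):splits m. levelled pos (m - \<nu>))"
proof
  show "{P \<in> levelled pos m. top_level P > 0}
    \<subseteq> (\<lambda>((\<nu>, a), P). attach \<nu> a P) ` (SIGMA (\<nu>, a):splits m. levelled pos (m - \<nu>))"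
  proof
    fix P assume "P \<in> {P \<in> levelled pos m. top_level P > 0}"
    then obtain \<nu> a P' where "\<nu> \<subseteq># m" "a \<in> {1..<size \<nu>}" "P' \<in> levelled pos (m - \<nu>)" "P = attach \<nu> a P'"
      using levelled_decompose by blast
    then show "P \<in> (\<lambda>((\<nu>, a), P). attach \<nu> a P) ` (SIGMA (\<nu>, a):splits m. levelled pos (m - \<nu>))"
      by (intro image_eqI[of _ _ "((\<nu>, a), P')"]) (auto simp: splits_def)
  qed
  show "(\<lambda>((\<nu>, a), P). attach \<nu> a P) ` (SIGMA (\<nu>, a):splits m. levelled pos (m - \<nu>))
    \<subseteq> {P \<in> levelled pos m. top_level P > 0}"
    using attach_levelled by (fastforce simp: splits_def)
qed

lemma finite_levelled: "finite (levelled pos m)"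
proof (induction "size m" arbitrary: m rule: less_induct)
  case less
  have "finite (levelled pos (m - \<nu>))" if "(\<nu>, a) \<in> splits m" for \<nu> a
  proof -
    have "\<nu> \<subseteq># m" "size \<nu> > 0" using that by (auto simp: splits_def)
    then have "size (m - \<nu>) < size m"
      using size_mset_mono[of \<nu> m] by (simp add: size_Diff_submset)
    then show ?thesis by (rule less)
  qed
  then have "finite (SIGMA (\<nu>, a):splits m. levelled pos (m - \<nu>))"
    by (intro finite_SigmaI finite_splits) auto
  then have "finite {P \<in> levelled pos m. top_level P > 0}" unfolding levelled_positive_eq by (rule finite_imageI)
  moreover have "finite {P \<in> levelled pos m. top_level P = 0}"
    unfolding top_level_zero by (rule finite_subset[of _ "{image_mset (\<lambda>c. (0, c)) m}"]) auto
  ultimately have "finite ({P \<in> levelled pos m. top_level P > 0} \<union> {P \<in> levelled pos m. top_level P = 0})"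
    by (rule finite_UnI)
  then show ?case by (rule finite_subset[rotated]) auto
qed

lift_definition level_series :: "bool \<Rightarrow> 'a :: comm_ring_1 \<Rightarrow> 'a mseries"
  is "\<lambda>pos t m. \<Sum>P\<in>levelled pos m. t ^ top_level P" .

text \<open>
  The term outside the sum counts the configurations with top level \<open>0\<close>. In the others, the top level
  has colours \<open>\<nu>\<close> and can lie at any of the heights \<open>a < size \<nu>\<close> above the rest.
\<close>

lemma level_series_recursion:
  "mcoeff (level_series pos t) m = (if pos \<longrightarrow> m = {#} then 1 else 0)
    + (\<Sum>\<nu> | \<nu> \<subseteq># m. (\<Sum>a\<in>{1..<size \<nu>}. t ^ a) * mcoeff (level_series pos t) (m - \<nu>))"
proof -
  have fin: "finite (levelled pos m)" for m by (rule finite_levelled)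
  have "levelled pos m = {P \<in> levelled pos m. top_level P = 0} \<union> {P \<in> levelled pos m. top_level P > 0}" by auto
  then have "mcoeff (level_series pos t) m = (\<Sum>P \<in> {P \<in> levelled pos m. top_level P = 0}. t ^ top_level P)
      + (\<Sum>P \<in> {P \<in> levelled pos m. top_level P > 0}. t ^ top_level P)"
    unfolding level_series.rep_eq using fin by (subst sum.union_disjoint[symmetric]) auto
  also have "{P \<in> levelled pos m. top_level P = 0} = (if pos \<longrightarrow> m = {#} then {image_mset (\<lambda>c. (0, c)) m} else {})"
    unfolding top_level_zero by auto
  also have "(\<Sum>P\<in>\<dots>. t ^ top_level P) = (if pos \<longrightarrow> m = {#} then 1 else 0)"
  proof -
    have "top_level (image_mset (\<lambda>c. (0, c)) m) = 0" by (intro top_level_eqI) auto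
    then show ?thesis by simp
  qed
  also have "(\<Sum>P \<in> {P \<in> levelled pos m. top_level P > 0}. t ^ top_level P)
      = (\<Sum>((\<nu>, a), P) \<in> (SIGMA (\<nu>, a):splits m. levelled pos (m - \<nu>)). t ^ (a + top_level P))"
    unfolding levelled_positive_eq
  proof (subst sum.reindex)
    show "inj_on (\<lambda>((\<nu>, a), P). attach \<nu> a P) (SIGMA (\<nu>, a):splits m. levelled pos (m - \<nu>))"
    proof (rule inj_onI)
      fix x y assume *: "x \<in> (SIGMA (\<nu>, a):splits m. levelled pos (m - \<nu>))" "y \<in> (SIGMA (\<nu>, a):splits m. levelled pos (m - \<nu>))"
        "(\<lambda>((\<nu>, a), P). attach \<nu> a P) x = (\<lambda>((\<nu>, a), P). attach \<nu> a P) y"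
      obtain \<nu> a P \<nu>' a' P' where "x = ((\<nu>, a), P)" "y = ((\<nu>', a'), P')" by (metis surj_pair)
      then show "x = y" using * attach_inj[of a \<nu> a' \<nu>' P P'] by (simp add: splits_def)
    qed
    show "sum ((\<lambda>P. t ^ top_level P) \<circ> (\<lambda>((\<nu>, a), P). attach \<nu> a P)) (SIGMA (\<nu>, a):splits m. levelled pos (m - \<nu>))
      = (\<Sum>((\<nu>, a), P) \<in> (SIGMA (\<nu>, a):splits m. levelled pos (m - \<nu>)). t ^ (a + top_level P))"
      by (intro sum.cong refl) (auto simp: splits_def attach_levelled(2) add.commute)
  qed
  also have "\<dots> = (\<Sum>x\<in>splits m. \<Sum>P\<in>levelled pos (m - fst x). t ^ (snd x + top_level P))"
    using finite_splits fin by (subst sum.Sigma) (auto simp: split_def)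
  also have "\<dots> = (\<Sum>x\<in>splits m. t ^ snd x * mcoeff (level_series pos t) (m - fst x))"
    by (simp add: level_series.rep_eq sum_distrib_left power_add)
  also have "\<dots> = (\<Sum>\<nu> | \<nu> \<subseteq># m. \<Sum>a\<in>{1..<size \<nu>}. t ^ a * mcoeff (level_series pos t) (m - \<nu>))"
    unfolding splits_def by (subst sum.Sigma) (auto simp: split_def finite_submultisets)
  finally show ?thesis by (simp add: sum_distrib_right)
qed

text \<open>
  The recursion multiplied by \<open>1 - t\<close>, where \<open>(1 - t) (t + \<dots> + t ^ (k - 1)) = t - t ^ k\<close>.
\<close>

lemma level_series_equation:
  "level_series pos t * (H_series t - mseries_const t * H_series 1)
    = (if pos then mseries_const (1 - t) else mseries_const (1 - t) * H_series 1)"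
proof (rule mseries_eqI)
  fix m :: "nat multiset"
  let ?T = "mcoeff (level_series pos t)"
  have geo: "(1 - t) * (\<Sum>a\<in>{1..<k}. t ^ a) = t - t ^ k" if "k > 0" for k
    using that
  proof (induction k rule: nat_induct_non_zero)
    case (Suc k)
    then have "(1 - t) * (\<Sum>a\<in>{1..<Suc k}. t ^ a) = (t - t ^ k) + (1 - t) * t ^ k"
      by (simp add: distrib_left)
    then show ?case by (simp add: algebra_simps)
  qed simp
  have "mcoeff (level_series pos t * (H_series t - mseries_const t * H_series 1)) m
      = (\<Sum>\<nu> | \<nu> \<subseteq># m. (t ^ size \<nu> - t) * ?T (m - \<nu>))"
    by (subst mult.commute) (simp add: mcoeff_times[of "H_series t - mseries_const t * H_series 1"] mcoeff_simps mcoeff_H_series)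
  also have "\<dots> = (\<Sum>\<nu> | \<nu> \<subseteq># m. (if \<nu> = {#} then (1 - t) * ?T m else 0)
      - (1 - t) * ((\<Sum>a\<in>{1..<size \<nu>}. t ^ a) * ?T (m - \<nu>)))"
  proof (intro sum.cong refl)
    fix \<nu> assume "\<nu> \<in> {\<nu>. \<nu> \<subseteq># m}"
    show "(t ^ size \<nu> - t) * ?T (m - \<nu>) = (if \<nu> = {#} then (1 - t) * ?T m else 0)
      - (1 - t) * ((\<Sum>a\<in>{1..<size \<nu>}. t ^ a) * ?T (m - \<nu>))"
    proof (cases "\<nu> = {#}")
      case False
      then have "(1 - t) * (\<Sum>a\<in>{1..<size \<nu>}. t ^ a) = t - t ^ size \<nu>"
        by (intro geo) (simp add: nonempty_has_size)
      then show ?thesis using False by (simp add: mult.assoc[symmetric]) (simp add: algebra_simps)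
    qed simp
  qed
  also have "\<dots> = (1 - t) * (?T m - (\<Sum>\<nu> | \<nu> \<subseteq># m. (\<Sum>a\<in>{1..<size \<nu>}. t ^ a) * ?T (m - \<nu>)))"
    by (simp add: sum_subtractf finite_submultisets sum_distrib_left[symmetric] right_diff_distrib)
  also have "?T m - (\<Sum>\<nu> | \<nu> \<subseteq># m. (\<Sum>a\<in>{1..<size \<nu>}. t ^ a) * ?T (m - \<nu>)) = (if pos \<longrightarrow> m = {#} then 1 else 0)"
    by (subst level_series_recursion) simp
  also have "(1 - t) * \<dots> = mcoeff (if pos then mseries_const (1 - t) else mseries_const (1 - t) * H_series 1) m"
    by (simp add: mseries_const.rep_eq mcoeff_H_series)
  finally show "mcoeff (level_series pos t * (H_series t - mseries_const t * H_series 1)) m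
    = mcoeff (if pos then mseries_const (1 - t) else mseries_const (1 - t) * H_series 1) m" .
qed

text \<open>
  Both sides solve the same equation, and the factor \<open>H(t) - t H(1)\<close> has the constant term \<open>1 - t\<close>.
\<close>

theorem level_series_eq:
  fixes t :: "'a :: idom"
  assumes "t \<noteq> 1"
  shows "level_series False t = E_series t * master_series t"
    and "level_series True t = E_series 1 * (E_series t * master_series t)"
proof -
  have w: "mcoeff (H_series t - mseries_const t * H_series 1) {#} \<noteq> 0"
    using assms by (simp add: mcoeff_simps mcoeff_H_series)
  show "level_series False t = E_series t * master_series t"
    by (rule mseries_cancel[OF _ w]) (simp only: level_series_equation excedance_series_equation if_False)
  show "level_series True t = E_series 1 * (E_series t * master_series t)"
    by (rule mseries_cancel[OF _ w]) (simp only: level_series_equation derangement_series_equation if_True)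
qed

section \<open>Frobenius characteristics of actions on functions\<close>

lemma mcoeff_prod_power_sum:
  fixes w :: "'b \<Rightarrow> nat"
  assumes "finite S" "\<And>C. C \<in> S \<Longrightarrow> w C \<ge> 1" and m: "0 \<notin># m"
  shows "mcoeff (\<Prod>C\<in>S. power_sum (w C) :: 'a :: comm_ring_1 mseries) m =
    of_nat (card {g \<in> S \<rightarrow>\<^sub>E UNIV. (\<Sum>C\<in>S. replicate_mset (w C) (g C)) = m})"
proof -
  let ?V = "set_mset m"
  have r: "restrict_vars ?V (power_sum k) = (\<Sum>c\<in>?V. mmono (replicate_mset k c) :: 'a mseries)" if "k \<ge> 1" for k
  proof (rule mseries_eqI)
    fix p :: "nat multiset"
    have eq: "p = replicate_mset k c \<longleftrightarrow> p = replicate_mset k c \<and> c \<in># p" for c using that by auto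
    have "mcoeff (\<Sum>c\<in>?V. mmono (replicate_mset k c) :: 'a mseries) p = of_nat (card {c \<in> ?V. p = replicate_mset k c})"
      by (simp add: mcoeff_sum mmono.rep_eq sum.If_cases Int_def)
    also have "{c \<in> ?V. p = replicate_mset k c} = (if set_mset p \<subseteq> ?V \<and> (\<exists>i\<ge>1. p = replicate_mset k i) then {SOME c. c \<in># p} else {})"
    proof (cases "\<exists>i. p = replicate_mset k i")
      case True
      then obtain i where i: "p = replicate_mset k i" by blast
      have set: "set_mset p = {i}" using that i by simp
      then have "(SOME c. c \<in># p) = i" by simp
      moreover have "p = replicate_mset k c \<longleftrightarrow> c = i" for c
      proof
        assume "p = replicate_mset k c"
        then have "set_mset p = {c}" using that by simp
        then show "c = i" using set by simp
      qed (use i in simp)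
      moreover have "i \<ge> 1 \<longleftrightarrow> i \<noteq> 0" by auto
      ultimately show ?thesis using set m by auto
    qed auto
    also have "of_nat (card \<dots>) = mcoeff (restrict_vars ?V (power_sum k) :: 'a mseries) p"
      by (auto simp: restrict_vars.rep_eq power_sum.rep_eq)
    finally show "mcoeff (restrict_vars ?V (power_sum k) :: 'a mseries) p = mcoeff (\<Sum>c\<in>?V. mmono (replicate_mset k c)) p" ..
  qed
  have "mcoeff (\<Prod>C\<in>S. power_sum (w C) :: 'a mseries) m = mcoeff (restrict_vars ?V (\<Prod>C\<in>S. power_sum (w C))) m"
    by (simp add: restrict_vars.rep_eq)
  also have "restrict_vars ?V (\<Prod>C\<in>S. power_sum (w C) :: 'a mseries) = (\<Prod>C\<in>S. \<Sum>c\<in>?V. mmono (replicate_mset (w C) c))"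
    unfolding restrict_vars_prod using assms(2) by (intro prod.cong refl r)
  also have "\<dots> = (\<Sum>g\<in>S \<rightarrow>\<^sub>E ?V. \<Prod>C\<in>S. mmono (replicate_mset (w C) (g C)))"
    using assms(1) by (intro prod_sum_PiE) auto
  also have "mcoeff \<dots> m = (\<Sum>g\<in>S \<rightarrow>\<^sub>E ?V. if (\<Sum>C\<in>S. replicate_mset (w C) (g C)) = m then 1 else 0)"
    unfolding mcoeff_sum mmono_sum[symmetric] by (intro sum.cong refl) (auto simp: mmono.rep_eq)
  also have "\<dots> = of_nat (card {g \<in> S \<rightarrow>\<^sub>E ?V. (\<Sum>C\<in>S. replicate_mset (w C) (g C)) = m})"
    using assms(1) by (simp add: sum.If_cases finite_PiE Int_def)
  also have "{g \<in> S \<rightarrow>\<^sub>E ?V. (\<Sum>C\<in>S. replicate_mset (w C) (g C)) = m}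
      = {g \<in> S \<rightarrow>\<^sub>E UNIV. (\<Sum>C\<in>S. replicate_mset (w C) (g C)) = m}"
  proof -
    have "g C \<in># (\<Sum>C\<in>S. replicate_mset (w C) (g C))" if "C \<in> S" for g C
      using that assms(1) assms(2)[OF that] by (auto simp: set_mset_sum)
    then show ?thesis by (auto simp: PiE_iff)
  qed
  finally show ?thesis .
qed

lemma mset_set_partition:
  assumes "finite I" "\<And>i j. i \<in> I \<Longrightarrow> j \<in> I \<Longrightarrow> j \<in> B i \<longleftrightarrow> B j = B i" "\<And>i. i \<in> I \<Longrightarrow> B i \<subseteq> I"
  shows "image_mset (\<lambda>i. g (B i)) (mset_set I) = (\<Sum>C\<in>B ` I. replicate_mset (card C) (g C))"
proof -
  have "image_mset (\<lambda>i. g (B i)) (mset_set I) = (\<Sum>i\<in>I. {#g (B i)#})"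
    using assms(1) by (rule mset_set_sum_single)
  also have "\<dots> = (\<Sum>C\<in>B ` I. \<Sum>i | i \<in> I \<and> B i = C. {#g (B i)#})"
    using assms(1) by (rule sum.image_gen)
  also have "\<dots> = (\<Sum>C\<in>B ` I. replicate_mset (card C) (g C))"
  proof (intro sum.cong refl)
    fix C assume "C \<in> B ` I"
    then obtain j where j: "j \<in> I" "C = B j" by blast
    have eq: "{i \<in> I. B i = C} = C" using assms(2,3) j by blast
    have "(\<Sum>i | i \<in> I \<and> B i = C. {#g (B i)#}) = (\<Sum>i | i \<in> I \<and> B i = C. {#g C#})"
      by (rule sum.cong) auto
    also have "\<dots> = replicate_mset (card C) (g C)"
    proof -
      have "(\<Sum>i\<in>A. {#x#}) = replicate_mset (card A) x" for x and A :: "'a set"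
        by (induction A rule: infinite_finite_induct) simp_all
      then show ?thesis unfolding eq .
    qed
    finally show "(\<Sum>i | i \<in> I \<and> B i = C. {#g (B i)#}) = replicate_mset (card C) (g C)" .
  qed
  finally show ?thesis .
qed

text \<open>
  Choosing a variable for each cycle is choosing a colouring that is constant on the cycles, and \<open>x\<^sub>b\<close> to the
  power of the length of a cycle records its colour once for every point.
\<close>

lemma mcoeff_cycle_power_sum:
  assumes \<sigma>: "\<sigma> permutes {1..n}" and m: "0 \<notin># m"
  shows "mcoeff (cycle_power_sum n \<sigma>) m =
    of_nat (card {f \<in> {1..n} \<rightarrow>\<^sub>E UNIV. image_mset f (mset_set {1..n}) = m \<and> (\<forall>i\<in>{1..n}. f (\<sigma> i) = f i)})"
proof -
  let ?I = "{1..n}" let ?B = "orbit \<sigma>"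
  have perm: "permutation \<sigma>" using \<sigma> permutation_permutes by blast
  have self: "i \<in> ?B i" for i by (rule permutation_self_in_orbit[OF perm])
  have sub: "?B i \<subseteq> ?I" if "i \<in> ?I" for i using permutes_orbit_subset[OF \<sigma> that] .
  have eq: "j \<in> ?B i \<longleftrightarrow> ?B j = ?B i" for i j
  proof
    assume j: "j \<in> ?B i"
    then have "i \<in> ?B j" using orbit_swap[OF self] by blast
    then show "?B j = ?B i" using j orbit_trans[of _ \<sigma> i j] orbit_trans[of _ \<sigma> j i] by blast
  qed (use self in blast)
  let ?G = "{g \<in> ?B ` ?I \<rightarrow>\<^sub>E UNIV. (\<Sum>C\<in>?B ` ?I. replicate_mset (card C) (g C)) = m}"
  let ?F = "{f \<in> ?I \<rightarrow>\<^sub>E UNIV. image_mset f (mset_set ?I) = m \<and> (\<forall>i\<in>?I. f (\<sigma> i) = f i)}"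
  have card_G: "mcoeff (cycle_power_sum n \<sigma>) m = of_nat (card ?G)"
    unfolding cycle_power_sum_def
  proof (rule mcoeff_prod_power_sum[OF _ _ m])
    fix C assume "C \<in> ?B ` ?I"
    then obtain i where "i \<in> ?I" "C = ?B i" by blast
    then have "finite C" "i \<in> C" using finite_orbit[OF self] self by auto
    then show "card C \<ge> 1" by (metis One_nat_def Suc_leI card_gt_0_iff empty_iff)
  qed simp
  have bij: "bij_betw (\<lambda>g. \<lambda>i\<in>?I. g (?B i)) ?G ?F"
  proof (rule bij_betw_byWitness[where f' = "\<lambda>f. \<lambda>C\<in>?B ` ?I. f (SOME i. i \<in> C)"])
    have some: "(SOME i. i \<in> ?B j) \<in> ?B j" for j using self by (metis someI)
    have part: "image_mset (\<lambda>i. g (?B i)) (mset_set ?I) = (\<Sum>C\<in>?B ` ?I. replicate_mset (card C) (g C))" for g :: "nat set \<Rightarrow> nat"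
      using eq sub by (intro mset_set_partition) auto
    have const: "f j = f i" if f: "\<forall>i\<in>?I. f (\<sigma> i) = f i" "i \<in> ?I" "j \<in> ?B i" for f :: "nat \<Rightarrow> nat" and i j
      using that(3)
    proof (induction rule: orbit.induct)
      case (step y)
      then have "y \<in> ?I" using sub[OF f(2)] by blast
      then show ?case using step f(1) by simp
    qed (use f in simp)
    show "\<forall>g\<in>?G. (\<lambda>C\<in>?B ` ?I. (\<lambda>i\<in>?I. g (?B i)) (SOME i. i \<in> C)) = g"
    proof
      fix g assume g: "g \<in> ?G"
      show "(\<lambda>C\<in>?B ` ?I. (\<lambda>i\<in>?I. g (?B i)) (SOME i. i \<in> C)) = g"
      proof
        fix C
        show "(\<lambda>C\<in>?B ` ?I. (\<lambda>i\<in>?I. g (?B i)) (SOME i. i \<in> C)) C = g C"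
        proof (cases "C \<in> ?B ` ?I")
          case True
          then obtain j where j: "j \<in> ?I" "C = ?B j" by blast
          have "?B (SOME i. i \<in> C) = C" using some[of j] eq j by metis
          moreover have "(SOME i. i \<in> C) \<in> ?I" using some[of j] sub[OF j(1)] j by blast
          ultimately show ?thesis using True by simp
        next
          case False
          then show ?thesis using g by (simp add: PiE_iff extensional_def)
        qed
      qed
    qed
    show "\<forall>f\<in>?F. (\<lambda>i\<in>?I. (\<lambda>C\<in>?B ` ?I. f (SOME i. i \<in> C)) (?B i)) = f"
    proof
      fix f assume f: "f \<in> ?F"
      show "(\<lambda>i\<in>?I. (\<lambda>C\<in>?B ` ?I. f (SOME i. i \<in> C)) (?B i)) = f"
      proof
        fix i
        show "(\<lambda>i\<in>?I. (\<lambda>C\<in>?B ` ?I. f (SOME i. i \<in> C)) (?B i)) i = f i"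
          using const[of f i "SOME j. j \<in> ?B i"] some[of i] f by (cases "i \<in> ?I") (auto simp: PiE_iff extensional_def)
      qed
    qed
    show "(\<lambda>g. \<lambda>i\<in>?I. g (?B i)) ` ?G \<subseteq> ?F"
    proof (rule image_subsetI)
      fix g assume g: "g \<in> ?G"
      have "image_mset (\<lambda>i\<in>?I. g (?B i)) (mset_set ?I) = image_mset (\<lambda>i. g (?B i)) (mset_set ?I)"
        by (rule image_mset_cong) simp
      then have "image_mset (\<lambda>i\<in>?I. g (?B i)) (mset_set ?I) = m" using g part by simp
      moreover have "(\<lambda>i\<in>?I. g (?B i)) (\<sigma> i) = (\<lambda>i\<in>?I. g (?B i)) i" if "i \<in> ?I" for i
        using that permutes_in_image[OF \<sigma>, of i] permutation_orbit_step[OF perm, of i] by simp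
      ultimately show "(\<lambda>i\<in>?I. g (?B i)) \<in> ?F" by simp
    qed
    show "(\<lambda>f. \<lambda>C\<in>?B ` ?I. f (SOME i. i \<in> C)) ` ?F \<subseteq> ?G"
    proof (rule image_subsetI)
      fix f assume f: "f \<in> ?F"
      let ?g = "\<lambda>C\<in>?B ` ?I. f (SOME i. i \<in> C)"
      have "image_mset (\<lambda>i. ?g (?B i)) (mset_set ?I) = image_mset f (mset_set ?I)"
      proof (rule image_mset_cong)
        fix i assume "i \<in># mset_set ?I"
        then have "i \<in> ?I" by simp
        then show "?g (?B i) = f i" using const[of f i "SOME j. j \<in> ?B i"] some[of i] f by simp
      qed
      moreover have "?g \<in> ?B ` ?I \<rightarrow>\<^sub>E UNIV" by simp
      moreover have "image_mset f (mset_set ?I) = m" using f by blast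
      ultimately show "?g \<in> ?G" using part[of ?g] by (simp only: mem_Collect_eq)
    qed
  qed
  show ?thesis unfolding card_G bij_betw_same_card[OF bij] ..
qed

text \<open>
  Burnside's lemma for the action by precomposition. Two functions lie in one orbit if and only if their multisets
  of values agree. For a fixed \<open>g0\<close> in an orbit, the stabilizer of any \<open>g\<close> in the orbit has as many
  elements as the set of permutations that carry \<open>g0\<close> to \<open>g\<close>, and these sets partition the group.
\<close>

lemma burnside_functions:
  fixes K :: "('i \<Rightarrow> 'y) set"
  assumes I: "finite I" and K: "finite K" "K \<subseteq> I \<rightarrow>\<^sub>E UNIV"
    and closed: "\<And>g \<sigma>. g \<in> K \<Longrightarrow> \<sigma> permutes I \<Longrightarrow> restrict (g \<circ> \<sigma>) I \<in> K"
  shows "(\<Sum>\<sigma> | \<sigma> permutes I. card {g \<in> K. \<forall>i\<in>I. g (\<sigma> i) = g i})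
    = fact (card I) * card ((\<lambda>g. image_mset g (mset_set I)) ` K)"
proof -
  let ?P = "{\<sigma>. \<sigma> permutes I}" let ?\<Phi> = "\<lambda>g. image_mset g (mset_set I)"
  have finP: "finite ?P" using I by (rule finite_permutations)
  have cls: "(\<Sum>g | g \<in> K \<and> ?\<Phi> g = M. card {\<sigma> \<in> ?P. \<forall>i\<in>I. g (\<sigma> i) = g i}) = fact (card I)" if M: "M \<in> ?\<Phi> ` K" for M
  proof -
    obtain g0 where g0: "g0 \<in> K" "?\<Phi> g0 = M" using M by blast
    have stab: "card {\<sigma> \<in> ?P. \<forall>i\<in>I. g (\<sigma> i) = g i} = card {\<sigma> \<in> ?P. restrict (g0 \<circ> \<sigma>) I = g}"
      if g: "g \<in> K" "?\<Phi> g = M" for g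
    proof -
      obtain \<tau> where \<tau>: "\<tau> permutes I" "\<forall>x\<in>I. g x = g0 (\<tau> x)"
        using image_mset_eq_implies_permutes[OF I, of g g0] g g0 by metis
      have ext: "g \<in> extensional I" using K(2) g by (auto simp: PiE_def)
      have "bij_betw (\<lambda>\<sigma>. \<tau> \<circ> \<sigma>) {\<sigma> \<in> ?P. \<forall>i\<in>I. g (\<sigma> i) = g i} {\<sigma> \<in> ?P. restrict (g0 \<circ> \<sigma>) I = g}"
      proof (rule bij_betw_byWitness[where f' = "\<lambda>\<sigma>. inv_into UNIV \<tau> \<circ> \<sigma>"])
        have inv: "inv_into UNIV \<tau> permutes I" using \<tau>(1) by (rule permutes_inv)
        show "\<forall>\<sigma>\<in>{\<sigma> \<in> ?P. \<forall>i\<in>I. g (\<sigma> i) = g i}. inv_into UNIV \<tau> \<circ> (\<tau> \<circ> \<sigma>) = \<sigma>"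
          by (auto simp: fun_eq_iff permutes_inverses[OF \<tau>(1)])
        show "\<forall>\<sigma>\<in>{\<sigma> \<in> ?P. restrict (g0 \<circ> \<sigma>) I = g}. \<tau> \<circ> (inv_into UNIV \<tau> \<circ> \<sigma>) = \<sigma>"
          by (auto simp: fun_eq_iff permutes_inverses[OF \<tau>(1)])
        show "(\<lambda>\<sigma>. \<tau> \<circ> \<sigma>) ` {\<sigma> \<in> ?P. \<forall>i\<in>I. g (\<sigma> i) = g i} \<subseteq> {\<sigma> \<in> ?P. restrict (g0 \<circ> \<sigma>) I = g}"
        proof (rule image_subsetI)
          fix \<sigma> assume \<sigma>: "\<sigma> \<in> {\<sigma> \<in> ?P. \<forall>i\<in>I. g (\<sigma> i) = g i}"
          then have in_I: "i \<in> I \<Longrightarrow> \<sigma> i \<in> I" for i using permutes_in_image by fastforce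
          have "restrict (g0 \<circ> (\<tau> \<circ> \<sigma>)) I = g"
          proof
            show "restrict (g0 \<circ> (\<tau> \<circ> \<sigma>)) I i = g i" for i
              using \<sigma> \<tau>(2) in_I[of i] ext by (cases "i \<in> I") (auto simp: extensional_def)
          qed
          then show "\<tau> \<circ> \<sigma> \<in> {\<sigma> \<in> ?P. restrict (g0 \<circ> \<sigma>) I = g}"
            using \<sigma> \<tau>(1) by (auto intro: permutes_compose)
        qed
        show "(\<lambda>\<sigma>. inv_into UNIV \<tau> \<circ> \<sigma>) ` {\<sigma> \<in> ?P. restrict (g0 \<circ> \<sigma>) I = g} \<subseteq> {\<sigma> \<in> ?P. \<forall>i\<in>I. g (\<sigma> i) = g i}"
        proof (rule image_subsetI)
          fix \<sigma> assume \<sigma>: "\<sigma> \<in> {\<sigma> \<in> ?P. restrict (g0 \<circ> \<sigma>) I = g}"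
          have "g (inv_into UNIV \<tau> (\<sigma> i)) = g i" if i: "i \<in> I" for i
          proof -
            have "\<sigma> i \<in> I" using \<sigma> i permutes_in_image by fastforce
            then have "inv_into UNIV \<tau> (\<sigma> i) \<in> I" using permutes_in_image[OF inv] by blast
            then have "g (inv_into UNIV \<tau> (\<sigma> i)) = g0 (\<sigma> i)" using \<tau>(2) permutes_inverses(1)[OF \<tau>(1)] by simp
            also have "\<dots> = restrict (g0 \<circ> \<sigma>) I i" using i by simp
            also have "restrict (g0 \<circ> \<sigma>) I = g" using \<sigma> by simp
            finally show ?thesis .
          qed
          then show "inv_into UNIV \<tau> \<circ> \<sigma> \<in> {\<sigma> \<in> ?P. \<forall>i\<in>I. g (\<sigma> i) = g i}"
            using \<sigma> inv by (auto intro: permutes_compose)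
        qed
      qed
      then show ?thesis by (rule bij_betw_same_card)
    qed
    have "(\<Sum>g | g \<in> K \<and> ?\<Phi> g = M. card {\<sigma> \<in> ?P. \<forall>i\<in>I. g (\<sigma> i) = g i})
        = (\<Sum>g | g \<in> K \<and> ?\<Phi> g = M. card {\<sigma> \<in> ?P. restrict (g0 \<circ> \<sigma>) I = g})"
      by (intro sum.cong refl stab) auto
    also have "\<dots> = card (\<Union>g\<in>{g \<in> K. ?\<Phi> g = M}. {\<sigma> \<in> ?P. restrict (g0 \<circ> \<sigma>) I = g})"
      using K(1) finP by (intro card_UN_disjoint[symmetric]) auto
    also have "(\<Union>g\<in>{g \<in> K. ?\<Phi> g = M}. {\<sigma> \<in> ?P. restrict (g0 \<circ> \<sigma>) I = g}) = ?P"
    proof -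
      have "?\<Phi> (restrict (g0 \<circ> \<sigma>) I) = M" if \<sigma>: "\<sigma> permutes I" for \<sigma>
      proof -
        have "?\<Phi> (restrict (g0 \<circ> \<sigma>) I) = image_mset (g0 \<circ> \<sigma>) (mset_set I)" using I by (intro image_mset_cong) simp
        also have "\<dots> = image_mset g0 (image_mset \<sigma> (mset_set I))" by (simp add: multiset.map_comp)
        also have "image_mset \<sigma> (mset_set I) = mset_set I"
          using \<sigma> by (simp add: image_mset_mset_set permutes_inj_on permutes_image)
        finally show ?thesis unfolding g0(2) .
      qed
      then show ?thesis using closed[OF g0(1)] by auto
    qed
    finally show ?thesis using I by (simp add: card_permutations)
  qed
  have "(\<Sum>\<sigma>\<in>?P. card {g \<in> K. \<forall>i\<in>I. g (\<sigma> i) = g i}) = (\<Sum>\<sigma>\<in>?P. \<Sum>g\<in>K. if \<forall>i\<in>I. g (\<sigma> i) = g i then 1 else 0)"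
    using K(1) by (simp add: sum.If_cases Int_def)
  also have "\<dots> = (\<Sum>g\<in>K. \<Sum>\<sigma>\<in>?P. if \<forall>i\<in>I. g (\<sigma> i) = g i then 1 else 0)" by (rule sum.swap)
  also have "\<dots> = (\<Sum>g\<in>K. card {\<sigma> \<in> ?P. \<forall>i\<in>I. g (\<sigma> i) = g i})"
    using finP by (simp add: sum.If_cases Int_def)
  also have "\<dots> = (\<Sum>M\<in>?\<Phi> ` K. \<Sum>g | g \<in> K \<and> ?\<Phi> g = M. card {\<sigma> \<in> ?P. \<forall>i\<in>I. g (\<sigma> i) = g i})"
    using K(1) by (rule sum.image_gen)
  also have "\<dots> = (\<Sum>M\<in>?\<Phi> ` K. fact (card I))" by (intro sum.cong refl cls)
  finally show ?thesis by simp
qed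

lemma function_with_mset_image:
  assumes "finite I" "size P = card I"
  shows "\<exists>h\<in>I \<rightarrow>\<^sub>E UNIV. image_mset h (mset_set I) = P"
  using assms
proof (induction I arbitrary: P rule: finite_induct)
  case empty
  then show ?case by simp
next
  case (insert i I)
  then obtain x where x: "x \<in># P" by (metis card_insert_disjoint multiset_nonemptyE size_eq_Suc_imp_elem)
  then have "size (P - {#x#}) = card I" using insert by (simp add: size_Diff_singleton)
  then obtain h where h: "h \<in> I \<rightarrow>\<^sub>E UNIV" "image_mset h (mset_set I) = P - {#x#}" using insert.IH by blast
  have "image_mset (h(i := x)) (mset_set I) = image_mset h (mset_set I)"
    using insert.hyps by (intro image_mset_cong) auto
  then have "image_mset (h(i := x)) (mset_set (insert i I)) = P"
    using insert.hyps h x by simp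
  moreover have "h(i := x) \<in> insert i I \<rightarrow>\<^sub>E UNIV" using h(1) by (simp add: PiE_def extensional_def)
  ultimately show ?case by blast
qed

text \<open>
  A pair of a level function and a colouring is fixed by \<open>\<sigma>\<close> if and only if both components are. So the
  sum is the Burnside count for functions with values in pairs, whose orbits are the multisets of pairs.
\<close>

lemma frobenius_of_level_action:
  fixes K :: "(nat \<Rightarrow> nat) set"
  assumes K: "finite K" "K \<subseteq> {1..n} \<rightarrow>\<^sub>E UNIV"
    and closed: "\<And>g \<sigma>. g \<in> K \<Longrightarrow> \<sigma> permutes {1..n} \<Longrightarrow> restrict (g \<circ> \<sigma>) {1..n} \<in> K"
    and m: "0 \<notin># m"
  shows "mcoeff (mseries_const (1 / fact n) * (\<Sum>\<sigma> | \<sigma> permutes {1..n}.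
      mseries_const (of_nat (card {v \<in> K. \<forall>i\<in>{1..n}. v (\<sigma> i) = v i})) * cycle_power_sum n \<sigma>)) m
    = of_nat (card {P. image_mset snd P = m \<and> image_mset fst P \<in> (\<lambda>v. image_mset v (mset_set {1..n})) ` K})"
proof -
  let ?I = "{1..n}" let ?\<Phi> = "\<lambda>g. image_mset g (mset_set ?I)"
  define Col where "Col = {f \<in> ?I \<rightarrow>\<^sub>E UNIV. image_mset f (mset_set ?I) = m}"
  define G where "G = {g \<in> ?I \<rightarrow>\<^sub>E UNIV. restrict (fst \<circ> g) ?I \<in> K \<and> restrict (snd \<circ> g) ?I \<in> Col}"
  define pair where "pair = (\<lambda>(v, f). \<lambda>i\<in>?I. (v i :: nat, f i :: nat))"
  have Gpair: "G = pair ` (K \<times> Col)"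
  proof
    show "G \<subseteq> pair ` (K \<times> Col)"
    proof
      fix g assume g: "g \<in> G"
      have "g = pair (restrict (fst \<circ> g) ?I, restrict (snd \<circ> g) ?I)"
        using g by (auto simp: G_def pair_def PiE_def extensional_def fun_eq_iff)
      then show "g \<in> pair ` (K \<times> Col)" using g by (auto simp: G_def)
    qed
    show "pair ` (K \<times> Col) \<subseteq> G"
    proof (rule image_subsetI)
      fix p assume p: "p \<in> K \<times> Col"
      obtain v f where vf: "p = (v, f)" by fastforce
      have "restrict (fst \<circ> pair p) ?I = v" "restrict (snd \<circ> pair p) ?I = f"
        using p vf K(2) by (auto simp: Col_def pair_def PiE_def extensional_def fun_eq_iff)
      then show "pair p \<in> G" using p vf by (auto simp: G_def pair_def)
    qed
  qed
  have inj: "inj_on pair (K \<times> Col)"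
  proof (rule inj_onI)
    fix p q assume p: "p \<in> K \<times> Col" and q: "q \<in> K \<times> Col" and eq: "pair p = pair q"
    obtain v f v' f' where vf: "p = (v, f)" "q = (v', f')" by (metis surj_pair)
    have *: "v i = v' i \<and> f i = f' i" if "i \<in> ?I" for i
      using fun_cong[OF eq, of i] that vf by (simp add: pair_def)
    have "v = v'" by (rule extensionalityI[of _ ?I]) (use p q vf K(2) * in \<open>auto simp: PiE_def\<close>)
    moreover have "f = f'" by (rule extensionalityI[of _ ?I]) (use p q vf * in \<open>auto simp: Col_def PiE_def\<close>)
    ultimately show "p = q" using vf by simp
  qed
  have finCol: "finite Col"
  proof (rule finite_subset)
    show "Col \<subseteq> ?I \<rightarrow>\<^sub>E set_mset m" by (auto simp: Col_def PiE_iff extensional_def)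
  qed (simp add: finite_PiE)
  have finG: "finite G" unfolding Gpair using K(1) finCol by blast
  have fix_card: "card {v \<in> K. \<forall>i\<in>?I. v (\<sigma> i) = v i} * card {f \<in> Col. \<forall>i\<in>?I. f (\<sigma> i) = f i}
      = card {g \<in> G. \<forall>i\<in>?I. g (\<sigma> i) = g i}" if \<sigma>: "\<sigma> permutes ?I" for \<sigma>
  proof -
    have in_I: "\<sigma> i \<in> ?I" if "i \<in> ?I" for i using permutes_in_image[OF \<sigma>] that by blast
    have "{g \<in> G. \<forall>i\<in>?I. g (\<sigma> i) = g i}
        = pair ` ({v \<in> K. \<forall>i\<in>?I. v (\<sigma> i) = v i} \<times> {f \<in> Col. \<forall>i\<in>?I. f (\<sigma> i) = f i})"
    proof -
      have "(\<forall>i\<in>?I. pair (v, f) (\<sigma> i) = pair (v, f) i) \<longleftrightarrow> (\<forall>i\<in>?I. v (\<sigma> i) = v i) \<and> (\<forall>i\<in>?I. f (\<sigma> i) = f i)" for v f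
        using in_I by (auto simp: pair_def)
      then have "{p \<in> K \<times> Col. \<forall>i\<in>?I. pair p (\<sigma> i) = pair p i}
          = {v \<in> K. \<forall>i\<in>?I. v (\<sigma> i) = v i} \<times> {f \<in> Col. \<forall>i\<in>?I. f (\<sigma> i) = f i}"
        by blast
      moreover have "{g \<in> G. \<forall>i\<in>?I. g (\<sigma> i) = g i} = pair ` {p \<in> K \<times> Col. \<forall>i\<in>?I. pair p (\<sigma> i) = pair p i}"
        unfolding Gpair by blast
      ultimately show ?thesis by simp
    qed
    also have "card \<dots> = card ({v \<in> K. \<forall>i\<in>?I. v (\<sigma> i) = v i} \<times> {f \<in> Col. \<forall>i\<in>?I. f (\<sigma> i) = f i})"
      by (rule card_image, rule inj_on_subset[OF inj]) auto
    finally show ?thesis by (simp add: card_cartesian_product)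
  qed
  have Gclosed: "restrict (g \<circ> \<sigma>) ?I \<in> G" if g: "g \<in> G" and \<sigma>: "\<sigma> permutes ?I" for g \<sigma>
  proof -
    have in_I: "\<sigma> i \<in> ?I" if "i \<in> ?I" for i using permutes_in_image[OF \<sigma>] that by blast
    have 1: "restrict (fst \<circ> restrict (g \<circ> \<sigma>) ?I) ?I = restrict (restrict (fst \<circ> g) ?I \<circ> \<sigma>) ?I"
      and 2: "restrict (snd \<circ> restrict (g \<circ> \<sigma>) ?I) ?I = restrict (restrict (snd \<circ> g) ?I \<circ> \<sigma>) ?I"
      using in_I by (auto simp: fun_eq_iff)
    have "restrict (restrict (snd \<circ> g) ?I \<circ> \<sigma>) ?I \<in> Col"
    proof -
      let ?f = "restrict (snd \<circ> g) ?I"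
      have "?\<Phi> (restrict (?f \<circ> \<sigma>) ?I) = image_mset (?f \<circ> \<sigma>) (mset_set ?I)" by (rule image_mset_cong) simp
      also have "\<dots> = image_mset ?f (image_mset \<sigma> (mset_set ?I))" by (simp only: multiset.map_comp)
      also have "image_mset \<sigma> (mset_set ?I) = mset_set ?I"
        using \<sigma> by (simp only: image_mset_mset_set permutes_inj_on permutes_image)
      also have "?\<Phi> ?f = m" using g by (simp add: G_def Col_def)
      finally have "?\<Phi> (restrict (?f \<circ> \<sigma>) ?I) = m" .
      moreover have "restrict (?f \<circ> \<sigma>) ?I \<in> ?I \<rightarrow>\<^sub>E UNIV" by simp
      ultimately show ?thesis unfolding Col_def by blast
    qed
    then show ?thesis using g closed[OF _ \<sigma>, of "restrict (fst \<circ> g) ?I"] unfolding G_def mem_Collect_eq 1 2 by simp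
  qed
  have image: "?\<Phi> ` G = {P. image_mset snd P = m \<and> image_mset fst P \<in> ?\<Phi> ` K}"
  proof
    show "?\<Phi> ` G \<subseteq> {P. image_mset snd P = m \<and> image_mset fst P \<in> ?\<Phi> ` K}"
    proof (rule image_subsetI)
      fix g assume g: "g \<in> G"
      have "image_mset fst (?\<Phi> g) = ?\<Phi> (restrict (fst \<circ> g) ?I)" "image_mset snd (?\<Phi> g) = ?\<Phi> (restrict (snd \<circ> g) ?I)"
        by (auto simp: multiset.map_comp intro!: image_mset_cong)
      then show "?\<Phi> g \<in> {P. image_mset snd P = m \<and> image_mset fst P \<in> ?\<Phi> ` K}"
        using g by (auto simp: G_def Col_def)
    qed
    show "{P. image_mset snd P = m \<and> image_mset fst P \<in> ?\<Phi> ` K} \<subseteq> ?\<Phi> ` G"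
    proof
      fix P assume P: "P \<in> {P. image_mset snd P = m \<and> image_mset fst P \<in> ?\<Phi> ` K}"
      then obtain v where v: "v \<in> K" "image_mset fst P = ?\<Phi> v" by blast
      then have "size P = card ?I" by (metis size_image_mset size_mset_set)
      then obtain h where h: "h \<in> ?I \<rightarrow>\<^sub>E UNIV" "?\<Phi> h = P" using function_with_mset_image[of ?I P] by auto
      have f: "image_mset fst P = ?\<Phi> (restrict (fst \<circ> h) ?I)" and s: "image_mset snd P = ?\<Phi> (restrict (snd \<circ> h) ?I)"
        unfolding h(2)[symmetric] by (auto simp: multiset.map_comp intro!: image_mset_cong)
      obtain \<tau> where \<tau>: "\<tau> permutes ?I" "\<forall>x\<in>?I. restrict (fst \<circ> h) ?I x = v (\<tau> x)"
        using image_mset_eq_implies_permutes[of ?I "restrict (fst \<circ> h) ?I" v] f v by auto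
      have "restrict (fst \<circ> h) ?I = restrict (v \<circ> \<tau>) ?I" using \<tau>(2) by (auto simp: fun_eq_iff)
      then have "restrict (fst \<circ> h) ?I \<in> K" using closed[OF v(1) \<tau>(1)] by simp
      moreover have "restrict (snd \<circ> h) ?I \<in> Col" using s P by (simp add: Col_def)
      ultimately have "h \<in> G" using h by (simp add: G_def)
      then show "P \<in> ?\<Phi> ` G" using h by blast
    qed
  qed
  have "mcoeff (mseries_const (1 / fact n) * (\<Sum>\<sigma> | \<sigma> permutes ?I.
      mseries_const (of_nat (card {v \<in> K. \<forall>i\<in>?I. v (\<sigma> i) = v i})) * cycle_power_sum n \<sigma>)) m
    = 1 / fact n * (\<Sum>\<sigma> | \<sigma> permutes ?I. of_nat (card {v \<in> K. \<forall>i\<in>?I. v (\<sigma> i) = v i})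
        * of_nat (card {f \<in> Col. \<forall>i\<in>?I. f (\<sigma> i) = f i}))"
  proof -
    have "mcoeff (cycle_power_sum n \<sigma>) m = of_nat (card {f \<in> Col. \<forall>i\<in>?I. f (\<sigma> i) = f i})" if "\<sigma> permutes ?I" for \<sigma>
      unfolding mcoeff_cycle_power_sum[OF that m] Col_def mem_Collect_eq conj_assoc ..
    then show ?thesis by (simp add: mcoeff_sum del: One_nat_def)
  qed
  also have "\<dots> = 1 / fact n * of_nat (\<Sum>\<sigma> | \<sigma> permutes ?I. card {g \<in> G. \<forall>i\<in>?I. g (\<sigma> i) = g i})"
  proof -
    have "(of_nat (card {v \<in> K. \<forall>i\<in>?I. v (\<sigma> i) = v i}) * of_nat (card {f \<in> Col. \<forall>i\<in>?I. f (\<sigma> i) = f i}) :: complex)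
        = of_nat (card {g \<in> G. \<forall>i\<in>?I. g (\<sigma> i) = g i})" if "\<sigma> permutes ?I" for \<sigma>
      unfolding fix_card[OF that, symmetric] by simp
    then show ?thesis by (simp del: One_nat_def)
  qed
  also have "(\<Sum>\<sigma> | \<sigma> permutes ?I. card {g \<in> G. \<forall>i\<in>?I. g (\<sigma> i) = g i}) = fact n * card (?\<Phi> ` G)"
  proof -
    have "G \<subseteq> ?I \<rightarrow>\<^sub>E UNIV" by (auto simp: G_def)
    then show ?thesis using burnside_functions[of ?I G] finG Gclosed by (simp del: One_nat_def)
  qed
  also have "1 / fact n * of_nat (fact n * card (?\<Phi> ` G)) = (of_nat (card (?\<Phi> ` G)) :: complex)" by simp
  finally show ?thesis unfolding image .
qed

text \<open>
  Power sums only involve the variables with positive index.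
\<close>

lemma mcoeff_zero_variable:
  assumes "n \<ge> 1" "\<sigma> permutes {1..n}" "0 \<in># m"
  shows "mcoeff (cycle_power_sum n \<sigma>) m = 0"
proof -
  have z: "mcoeff (\<Prod>C\<in>S. power_sum (card C) :: complex mseries) m = 0" if "0 \<in># m" "finite S" for S :: "nat set set" and m
    using that(2,1)
  proof (induction S arbitrary: m rule: finite_induct)
    case (insert C S)
    have "mcoeff (power_sum (card C) :: complex mseries) a * mcoeff (\<Prod>C\<in>S. power_sum (card C)) (m - a) = 0" if a: "a \<subseteq># m" for a
    proof (cases "0 \<in># a")
      case True
      then have "mcoeff (power_sum (card C) :: complex mseries) a = 0" by (auto simp: power_sum.rep_eq split: if_splits)
      then show ?thesis by simp
    next
      case False
      then have "0 \<in># m - a" using insert.prems by (simp add: in_diff_count not_in_iff)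
      then show ?thesis using insert.IH by simp
    qed
    then have "(\<Sum>a | a \<subseteq># m. mcoeff (power_sum (card C) :: complex mseries) a * mcoeff (\<Prod>C\<in>S. power_sum (card C)) (m - a)) = 0"
      by (intro sum.neutral) blast
    then show ?case using insert.hyps by (simp only: prod.insert[OF insert.hyps] mcoeff_times)
  qed (auto simp: one_mseries.rep_eq)
  show ?thesis unfolding cycle_power_sum_def by (rule z[OF assms(3)]) simp
qed

section \<open>Spanning by Feichtner--Yuzvinsky monomials\<close>

lemma lookup_pm_scale: "Poly_Mapping.lookup (pm_scale c p) k = c * Poly_Mapping.lookup p k"
  by (simp add: pm_scale_def Poly_Mapping.map.rep_eq when_def)

interpretation pm: vector_space "pm_scale :: 'k :: field \<Rightarrow> ('b \<Rightarrow>\<^sub>0 'k) \<Rightarrow> ('b \<Rightarrow>\<^sub>0 'k)"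
  by unfold_locales
    (auto intro!: poly_mapping_eqI simp: lookup_pm_scale lookup_add algebra_simps)

abbreviation mon :: "'v multiset \<Rightarrow> 'v mpoly"
  where "mon q \<equiv> Poly_Mapping.single q 1"

lemma pm_scale_single: "pm_scale c (Poly_Mapping.single k d) = Poly_Mapping.single k (c * d)"
  by (rule poly_mapping_eqI) (simp add: lookup_pm_scale lookup_single when_def)

lemma pm_scale_mult: "pm_scale c p * g = pm_scale c (p * g :: 'v mpoly)"
  by (simp add: pm_scale_def mult_map_scale_conv_mult mult.assoc)

lemma mult_pm_scale: "g * pm_scale c p = pm_scale c (g * p :: 'v mpoly)"
  by (metis mult.commute pm_scale_mult)

lemma poly_mapping_expand:
  "p = (\<Sum>k\<in>Poly_Mapping.keys p. Poly_Mapping.single k (Poly_Mapping.lookup p k))"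
proof (rule poly_mapping_eqI)
  fix k
  have "Poly_Mapping.lookup (\<Sum>k\<in>Poly_Mapping.keys p. Poly_Mapping.single k (Poly_Mapping.lookup p k)) k
      = (\<Sum>k'\<in>Poly_Mapping.keys p. if k' = k then Poly_Mapping.lookup p k else 0)"
    by (auto simp: lookup_sum lookup_single when_def intro!: sum.cong)
  then show "Poly_Mapping.lookup p k
      = Poly_Mapping.lookup (\<Sum>k\<in>Poly_Mapping.keys p. Poly_Mapping.single k (Poly_Mapping.lookup p k)) k"
    by (simp add: in_keys_iff)
qed

lemma in_span_monomials:
  fixes p :: "'b \<Rightarrow>\<^sub>0 'k :: field"
  assumes "\<And>k. k \<in> Poly_Mapping.keys p \<Longrightarrow> Poly_Mapping.single k 1 \<in> S" "pm.subspace S"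
  shows "p \<in> S"
proof -
  have "(\<Sum>k\<in>Poly_Mapping.keys p. Poly_Mapping.single k (Poly_Mapping.lookup p k)) \<in> S"
  proof (rule pm.subspace_sum[OF assms(2)])
    fix k assume "k \<in> Poly_Mapping.keys p"
    then have "pm_scale (Poly_Mapping.lookup p k) (Poly_Mapping.single k 1) \<in> S"
      using assms by (intro pm.subspace_scale) auto
    then show "Poly_Mapping.single k (Poly_Mapping.lookup p k) \<in> S" by (simp add: pm_scale_single)
  qed
  then show ?thesis by (simp flip: poly_mapping_expand)
qed

lemma Var_power: "Var F ^ k = mon (replicate_mset k F)"
  by (induction k) (simp_all add: Var_def mult_single flip: single_one)

lemma Var_times_mon: "Var F * mon q = mon (add_mset F q)"
  by (simp add: Var_def mult_single)

text \<open>
  All computations take place in the polynomial ring with a variable for every set of numbers. The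
  monomials that are not chains of nonempty flats are declared to be relations, which also removes the superfluous
  variables.
\<close>

locale uniform_chow =
  fixes n r :: nat
  assumes r_ge: "1 \<le> r" and r_le: "r \<le> n"
begin

definition flats :: "nat set set"
  where "flats = uniform_flats r n - {{}}"

text \<open>
  The rank function on flats: a flat other than the ground set is independent.
\<close>

definition rk :: "nat set \<Rightarrow> nat"
  where "rk F = (if F = {1..n} then r else card F)"

definition chain_mset :: "nat set multiset \<Rightarrow> bool"
  where "chain_mset q \<longleftrightarrow> set_mset q \<subseteq> flats \<and> (\<forall>F\<in>#q. \<forall>G\<in>#q. F \<subseteq> G \<or> G \<subseteq> F)"

definition theta :: "nat \<Rightarrow> nat set mpoly"
  where "theta i = (\<Sum>F | F \<in> flats \<and> i \<in> F. Var F)"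

definition chow_relations :: "nat set mpoly set"
  where "chow_relations = pm.span ({mon q | q. \<not> chain_mset q} \<union> {theta i * mon q | i q. i \<in> {1..n}})"

text \<open>
  The convention that the variable of the empty set is \<open>1\<close> lets the empty set act as the bottom of
  every chain.
\<close>

definition xvar :: "nat set \<Rightarrow> nat set mpoly"
  where "xvar G = (if G = {} then 1 else Var G)"

definition alpha :: "nat set \<Rightarrow> nat set mpoly"
  where "alpha F = (\<Sum>H | H \<in> flats \<and> F \<subseteq> H. Var H)"

text \<open>
  Instead of the predecessor of \<open>F\<close> in the chain, all smaller members \<open>G\<close> are taken; the predecessor gives the
  strongest bound.
\<close>

definition fy_mset :: "nat set multiset \<Rightarrow> bool"
  where "fy_mset q \<longleftrightarrow> chain_mset q \<and>
    (\<forall>F\<in>#q. \<forall>G\<in>insert {} (set_mset q). G \<subset> F \<longrightarrow> count q F < rk F - rk G)"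

lemma flats_iff: "F \<in> flats \<longleftrightarrow> F \<subseteq> {1..n} \<and> F \<noteq> {} \<and> (F = {1..n} \<or> card F < r)"
  using r_ge r_le by (auto simp: flats_def uniform_flats_def)

lemma top_flat: "{1..n} \<in> flats"
  using r_ge r_le by (auto simp: flats_iff)

lemma finite_flats: "finite flats"
proof (rule finite_subset)
  show "flats \<subseteq> Pow {1..n}" using flats_iff by blast
qed simp

lemma finite_flat: "F \<in> flats \<Longrightarrow> finite F"
  using finite_subset[of F "{1..n}"] by (auto simp: flats_iff)

lemma rk_strict_mono:
  assumes "F \<in> insert {} flats" "G \<in> flats" "F \<subset> G"
  shows "rk F < rk G"
proof -
  have "F \<noteq> {1..n}" using assms by (auto simp: flats_iff)
  then have F: "card F < r" using assms r_ge by (auto simp: flats_iff)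
  have "card F < card G" using psubset_card_mono[OF finite_flat[OF assms(2)] assms(3)] .
  then show ?thesis using F \<open>F \<noteq> {1..n}\<close> by (simp add: rk_def)
qed

lemma mon_relation: "\<not> chain_mset q \<Longrightarrow> mon q \<in> chow_relations"
  unfolding chow_relations_def by (intro pm.span_base) auto

lemma theta_relation: "i \<in> {1..n} \<Longrightarrow> theta i * mon q \<in> chow_relations"
  unfolding chow_relations_def by (intro pm.span_base) auto

lemma relations_subspace: "pm.subspace chow_relations"
  unfolding chow_relations_def by (rule pm.subspace_span)

lemmas relations_add = pm.subspace_add[OF relations_subspace]
  and relations_diff = pm.subspace_diff[OF relations_subspace]
  and relations_neg = pm.subspace_neg[OF relations_subspace]
  and relations_sum = pm.subspace_sum[OF relations_subspace]
  and relations_zero = pm.subspace_0[OF relations_subspace]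
  and relations_scale = pm.subspace_scale[OF relations_subspace]

lemma not_chain_add: "\<not> chain_mset q \<Longrightarrow> \<not> chain_mset (q + q')"
  by (simp add: chain_mset_def) blast

lemma relations_mult_mon: "p \<in> chow_relations \<Longrightarrow> p * mon q \<in> chow_relations"
  unfolding chow_relations_def
proof (induction rule: pm.span_induct_alt)
  case (step c x y)
  have "x * mon q \<in> chow_relations"
    using step(1) not_chain_add
    by (auto simp: mult_single mult.assoc intro!: mon_relation theta_relation)
  then have "pm_scale c (x * mon q) + y * mon q \<in> chow_relations"
    using step(2) unfolding chow_relations_def[symmetric] by (intro relations_add relations_scale)
  then show ?case by (simp add: distrib_right pm_scale_mult chow_relations_def)
qed (simp add: pm.span_zero)

lemma relations_mult: "p \<in> chow_relations \<Longrightarrow> p * g \<in> chow_relations"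
proof -
  assume p: "p \<in> chow_relations"
  have "g \<in> {g. p * g \<in> chow_relations}"
  proof (rule in_span_monomials)
    show "pm.subspace {g. p * g \<in> chow_relations}"
      unfolding pm.subspace_def
      by (auto simp: distrib_left mult_pm_scale intro: relations_add relations_scale relations_zero)
  qed (use relations_mult_mon[OF p] in auto)
  then show ?thesis by simp
qed

lemma relations_mult_left: "p \<in> chow_relations \<Longrightarrow> g * p \<in> chow_relations"
  using relations_mult[of p g] by (simp add: mult.commute)

lemma relations_power_cong:
  assumes "x * a - x * b \<in> chow_relations"
  shows "x * a ^ k - x * b ^ k \<in> chow_relations"
proof (induction k)
  case (Suc k)
  have "x * a ^ Suc k - x * b ^ Suc k = (x * a ^ k - x * b ^ k) * a + (x * a - x * b) * b ^ k"
    by (simp add: algebra_simps)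
  then show ?case using Suc assms by (auto intro: relations_add relations_mult)
qed (simp add: relations_zero)

definition join :: "nat set \<Rightarrow> nat set \<Rightarrow> nat set"
  where "join H F = (if H \<union> F \<in> flats then H \<union> F else {1..n})"

lemma join_flat: "join H F \<in> flats"
  using top_flat by (simp add: join_def)

lemma join_least:
  assumes "H \<in> flats" "F \<in> flats" "K \<in> flats"
  shows "join H F \<subseteq> K \<longleftrightarrow> H \<subseteq> K \<and> F \<subseteq> K"
proof -
  have "K = {1..n}" if "H \<union> F \<subseteq> K" "H \<union> F \<notin> flats"
  proof (rule ccontr)
    assume "K \<noteq> {1..n}"
    then have "card K < r" "finite K" using assms finite_flat by (auto simp: flats_iff)
    then have "card (H \<union> F) < r" using card_mono[OF _ that(1)] by simp
    then show False using that assms by (auto simp: flats_iff)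
  qed
  then show ?thesis using assms by (auto simp: join_def flats_iff)
qed

text \<open>
  Submodularity of the rank function, used in the form that induction on \<open>rk F - rk G\<close> requires: replacing
  \<open>G \<subset> F\<close> by \<open>H \<subset> join H F\<close> shortens the interval.
\<close>

lemma rk_join:
  assumes "H \<in> flats" "F \<in> flats" "G \<in> insert {} flats" "insert i G \<subseteq> H" "insert i G \<subseteq> F" "i \<notin> G" "\<not> F \<subseteq> H"
  shows "rk (join H F) - rk H < rk F - rk G"
proof -
  have HE: "H \<noteq> {1..n}" using assms by (auto simp: flats_iff)
  have GE: "G \<noteq> {1..n}" using assms by (auto simp: flats_iff)
  have fin: "finite H" "finite F" "finite G"
    using assms finite_flat by auto
  have GH: "card G < card H" using assms fin by (intro psubset_card_mono) auto
  have Hr: "card H < r" using HE assms(1) by (auto simp: flats_iff)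
  show ?thesis
  proof (cases "F = {1..n}")
    case True
    then have "join H F = {1..n}" using assms by (auto simp: join_def flats_iff)
    then show ?thesis using True HE GE GH Hr by (simp add: rk_def)
  next
    case False
    have "card (H \<union> F) + card (H \<inter> F) = card H + card F" using card_Un_Int[OF fin(1,2)] by simp
    moreover have "card G < card (H \<inter> F)" using assms fin by (intro psubset_card_mono) auto
    moreover have "rk (join H F) \<le> card (H \<union> F)"
    proof (cases "H \<union> F \<in> flats")
      case True
      then show ?thesis using r_le by (auto simp: join_def rk_def)
    next
      case False
      then have "r \<le> card (H \<union> F)" using assms by (auto simp: flats_iff)
      then show ?thesis using False by (simp add: join_def rk_def)
    qed
    moreover have "card (H \<inter> F) \<le> card F" using fin by (intro card_mono) auto
    moreover have "rk F = card F" "rk H = card H" "rk G = card G" using False HE GE by (simp_all add: rk_def)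
    ultimately show ?thesis by arith
  qed
qed

lemma incomparable_relation:
  "F \<in> flats \<Longrightarrow> G \<in> flats \<Longrightarrow> \<not> F \<subseteq> G \<Longrightarrow> \<not> G \<subseteq> F \<Longrightarrow> Var F * Var G \<in> chow_relations"
  by (simp add: Var_def mult_single) (auto intro!: mon_relation simp: chain_mset_def)

text \<open>
  The relation of the element \<open>i\<close> times the variable of \<open>G\<close>: flats that contain \<open>i\<close> but not \<open>G\<close> are incomparable to \<open>G\<close>,
  because \<open>i\<close> is not in \<open>G\<close>.
\<close>

lemma xvar_alpha_step:
  assumes G: "G \<in> insert {} flats" and i: "i \<in> {1..n}" "i \<notin> G"
  shows "xvar G * (\<Sum>H | H \<in> flats \<and> insert i G \<subseteq> H. Var H) \<in> chow_relations"
proof -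
  have fin: "finite {H. H \<in> flats \<and> P H}" for P using finite_flats by simp
  have "xvar G * theta i \<in> chow_relations"
    using theta_relation[OF i(1), of "{#}"] relations_mult_left by simp
  moreover have "xvar G * theta i = xvar G * (\<Sum>H | H \<in> flats \<and> insert i G \<subseteq> H. Var H)
      + (\<Sum>H | H \<in> flats \<and> i \<in> H \<and> \<not> G \<subseteq> H. xvar G * Var H)"
  proof -
    have "{H. H \<in> flats \<and> i \<in> H} = {H. H \<in> flats \<and> insert i G \<subseteq> H} \<union> {H. H \<in> flats \<and> i \<in> H \<and> \<not> G \<subseteq> H}" by auto
    then have "theta i = (\<Sum>H | H \<in> flats \<and> insert i G \<subseteq> H. Var H) + (\<Sum>H | H \<in> flats \<and> i \<in> H \<and> \<not> G \<subseteq> H. Var H)"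
      unfolding theta_def using fin by (simp only:) (rule sum.union_disjoint, auto)
    then show ?thesis by (simp add: distrib_left sum_distrib_left)
  qed
  moreover have "(\<Sum>H | H \<in> flats \<and> i \<in> H \<and> \<not> G \<subseteq> H. xvar G * Var H) \<in> chow_relations"
  proof (rule relations_sum)
    fix H assume H: "H \<in> {H. H \<in> flats \<and> i \<in> H \<and> \<not> G \<subseteq> H}"
    then have "G \<noteq> {}" by auto
    then show "xvar G * Var H \<in> chow_relations"
      using H G i by (auto simp: xvar_def intro!: incomparable_relation)
  qed
  moreover have "a \<in> chow_relations" if "p \<in> chow_relations" "p = a + b" "b \<in> chow_relations" for p a b
    using relations_diff[OF that(1,3)] that(2) by simp
  ultimately show ?thesis by blast
qed

lemma var_alpha_join:
  assumes H: "H \<in> flats" and F: "F \<in> flats" and nsub: "\<not> F \<subseteq> H"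
  shows "Var H * alpha F - Var H * alpha (join H F) \<in> chow_relations"
proof -
  have fin: "finite {K. K \<in> flats \<and> P K}" for P using finite_flats by simp
  have "{K. K \<in> flats \<and> F \<subseteq> K} = {K. K \<in> flats \<and> join H F \<subseteq> K} \<union> {K. K \<in> flats \<and> F \<subseteq> K \<and> \<not> H \<subseteq> K}"
    using join_least[OF H F] by auto
  then have "alpha F = alpha (join H F) + (\<Sum>K | K \<in> flats \<and> F \<subseteq> K \<and> \<not> H \<subseteq> K. Var K)"
    unfolding alpha_def using fin join_least[OF H F] by (simp only:) (rule sum.union_disjoint, auto)
  then have "Var H * alpha F - Var H * alpha (join H F) = (\<Sum>K | K \<in> flats \<and> F \<subseteq> K \<and> \<not> H \<subseteq> K. Var H * Var K)"
    by (simp add: distrib_left sum_distrib_left)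
  also have "\<dots> \<in> chow_relations"
    using H nsub by (intro relations_sum incomparable_relation) auto
  finally show ?thesis .
qed

text \<open>
  The basic vanishing. With \<open>i\<close> in \<open>F\<close> but not in \<open>G\<close>, the preceding relation rewrites one factor \<open>alpha F\<close>,
  next to the variable of \<open>G\<close>, as minus a sum over flats \<open>H\<close> that contain \<open>insert i G\<close> but not \<open>F\<close>.
  Next to the variable of \<open>H\<close>, the remaining powers of \<open>alpha F\<close> become powers of
  \<open>alpha (join H F)\<close>, and the interval from \<open>H\<close> to the join is shorter than that from \<open>G\<close> to \<open>F\<close>.
\<close>

lemma xvar_alpha_power:
  assumes "F \<in> flats" "G \<in> insert {} flats" "G \<subset> F" "rk F - rk G \<le> k"
  shows "xvar G * alpha F ^ k \<in> chow_relations"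
  using assms
proof (induction k arbitrary: F G)
  case 0
  then show ?case using rk_strict_mono[of G F] by simp
next
  case (Suc k)
  obtain i where i: "i \<in> F" "i \<notin> G" using Suc.prems by blast
  then have iE: "i \<in> {1..n}" using Suc.prems by (auto simp: flats_iff)
  have fin: "finite {K. K \<in> flats \<and> P K}" for P using finite_flats by simp
  let ?B = "{H. H \<in> flats \<and> insert i G \<subseteq> H \<and> \<not> F \<subseteq> H}"
  have "{H. H \<in> flats \<and> insert i G \<subseteq> H} = {H. H \<in> flats \<and> F \<subseteq> H} \<union> ?B"
    using i Suc.prems by auto
  then have "(\<Sum>H | H \<in> flats \<and> insert i G \<subseteq> H. Var H) = alpha F + (\<Sum>H\<in>?B. Var H)"
    unfolding alpha_def using fin by (simp only:) (rule sum.union_disjoint, auto)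
  then have "xvar G * alpha F ^ Suc k = xvar G * (\<Sum>H | H \<in> flats \<and> insert i G \<subseteq> H. Var H) * alpha F ^ k
      - (\<Sum>H\<in>?B. xvar G * (Var H * alpha F ^ k))"
    by (simp add: algebra_simps sum_distrib_left sum_distrib_right)
  moreover have "xvar G * (\<Sum>H | H \<in> flats \<and> insert i G \<subseteq> H. Var H) * alpha F ^ k \<in> chow_relations"
    using xvar_alpha_step[OF Suc.prems(2) iE i(2)] by (rule relations_mult)
  moreover have "xvar G * (Var H * alpha F ^ k) \<in> chow_relations" if H: "H \<in> ?B" for H
  proof (rule relations_mult_left)
    have Hf: "H \<in> flats" using H by simp
    have less: "rk (join H F) - rk H < rk F - rk G"
      using H Suc.prems i by (intro rk_join[of H F G i]) auto
    have "H \<subseteq> join H F" "F \<subseteq> join H F" using join_least[OF Hf Suc.prems(1) join_flat] by auto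
    then have sub: "H \<subset> join H F" using H by auto
    have "H \<noteq> {}" using Hf by (simp add: flats_iff)
    then have "Var H * alpha (join H F) ^ k \<in> chow_relations"
      using Suc.IH[OF join_flat, of H H F] Hf sub less Suc.prems(4) by (simp add: xvar_def)
    moreover have "Var H * alpha F ^ k - Var H * alpha (join H F) ^ k \<in> chow_relations"
      using H Suc.prems(1) by (intro relations_power_cong var_alpha_join) auto
    ultimately show "Var H * alpha F ^ k \<in> chow_relations"
      using relations_add by (metis diff_add_cancel)
  qed
  ultimately show ?case by (auto intro!: relations_diff relations_sum)
qed

definition weight :: "nat set multiset \<Rightarrow> nat"
  where "weight q = (\<Sum>F\<in>#q. card F)"

text \<open>
  All terms of \<open>alpha F\<close> other than the variable of \<open>F\<close> belong to larger flats.
\<close>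

lemma alpha_power_leading:
  assumes F: "F \<in> flats"
  shows "alpha F ^ c - Var F ^ c \<in> pm.span {mon p | p. size p = c \<and> weight p > c * card F}"
proof (induction c)
  case (Suc c)
  let ?S = "\<lambda>c. {mon p | p. size p = c \<and> weight p > c * card F}"
  have fin: "finite {K. K \<in> flats \<and> P K}" for P using finite_flats by simp
  have alpha: "alpha F = Var F + (\<Sum>H | H \<in> flats \<and> F \<subset> H. Var H)"
  proof -
    have "{H. H \<in> flats \<and> F \<subseteq> H} = insert F {H. H \<in> flats \<and> F \<subset> H}" using F by auto
    then show ?thesis unfolding alpha_def using fin by simp
  qed
  have "p * alpha F \<in> pm.span (?S (Suc c))" if "p \<in> pm.span (?S c)" for p
    using that
  proof (induction rule: pm.span_induct_alt)
    case (step a x y)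
    then obtain q where q: "x = mon q" "size q = c" "weight q > c * card F" by auto
    have "Var H * mon q \<in> pm.span (?S (Suc c))" if "H \<in> flats" "F \<subseteq> H" for H
      unfolding Var_times_mon
      using that q card_mono[OF finite_flat[OF that(1)] that(2)]
      by (intro pm.span_base) (auto intro!: exI[of _ "add_mset H q"] simp: weight_def)
    then have "x * alpha F \<in> pm.span (?S (Suc c))"
      unfolding alpha_def q(1) sum_distrib_left by (auto simp: mult.commute intro!: pm.span_sum)
    then show ?case using step(2) by (simp add: distrib_right pm_scale_mult pm.span_add pm.span_scale)
  qed (simp add: pm.span_zero)
  then have "(alpha F ^ c - Var F ^ c) * alpha F \<in> pm.span (?S (Suc c))" using Suc.IH by blast
  moreover have "Var F ^ c * (\<Sum>H | H \<in> flats \<and> F \<subset> H. Var H) \<in> pm.span (?S (Suc c))"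
    unfolding sum_distrib_left
  proof (rule pm.span_sum)
    fix H assume H: "H \<in> {H. H \<in> flats \<and> F \<subset> H}"
    then have "card F < card H" using finite_flat by (auto intro: psubset_card_mono)
    then have "mon (add_mset H (replicate_mset c F)) \<in> pm.span (?S (Suc c))"
      by (intro pm.span_base) (auto intro!: exI[of _ "add_mset H (replicate_mset c F)"] simp: weight_def)
    then show "Var F ^ c * Var H \<in> pm.span (?S (Suc c))"
      by (simp add: Var_power mult.commute Var_times_mon[symmetric])
  qed
  ultimately have "(alpha F ^ c - Var F ^ c) * alpha F + Var F ^ c * (\<Sum>H | H \<in> flats \<and> F \<subset> H. Var H) \<in> pm.span (?S (Suc c))"
    by (rule pm.span_add)
  moreover have "(alpha F ^ c - Var F ^ c) * alpha F + Var F ^ c * (\<Sum>H | H \<in> flats \<and> F \<subset> H. Var H)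
      = alpha F ^ Suc c - Var F ^ Suc c"
  proof -
    have "(a ^ c - x ^ c) * a + x ^ c * s = a ^ Suc c - x ^ Suc c" if "a = x + s" for a x s :: "nat set mpoly"
      unfolding that by (simp add: algebra_simps)
    then show ?thesis using alpha by blast
  qed
  ultimately show ?case by metis
qed (simp add: pm.span_zero)

definition fy_set :: "nat \<Rightarrow> nat set multiset set"
  where "fy_set d = {q. fy_mset q \<and> size q = d}"

text \<open>
  If the exponent of \<open>F\<close> is too large, that power of the variable of \<open>F\<close> may be traded for the same power of
  \<open>alpha F\<close>, which vanishes next to \<open>G\<close>, at the cost of monomials of larger weight. The weight of a chain
  monomial of degree \<open>d\<close> is at most \<open>n * d\<close>, so the process stops.
\<close>

theorem fy_spanning:
  assumes "size q = d"
  shows "mon q \<in> pm.span (mon ` fy_set d \<union> chow_relations)"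
  using assms
proof (induction "n * d - weight q" arbitrary: q rule: less_induct)
  case less
  let ?S = "pm.span (mon ` fy_set d \<union> chow_relations)"
  have rel: "p \<in> ?S" if "p \<in> chow_relations" for p using that by (intro pm.span_base) auto
  show ?case
  proof (cases "chain_mset q")
    case False
    then show ?thesis by (intro rel mon_relation)
  next
    case chain: True
    have weight_le: "weight p \<le> n * size p" if "set_mset p \<subseteq> flats" for p
      using that
    proof (induction p)
      case (add F p)
      have "card F \<le> n" using add.prems card_mono[of "{1..n}" F] by (auto simp: flats_iff)
      then show ?case using add by (simp add: weight_def)
    qed (simp add: weight_def)
    show ?thesis
    proof (cases "fy_mset q")
      case True
      then show ?thesis using less.prems by (intro pm.span_base) (auto simp: fy_set_def)
    next
      case False
      then obtain F G where F: "F \<in># q" and G: "G \<in> insert {} (set_mset q)" and GF: "G \<subset> F"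
        and le: "rk F - rk G \<le> count q F"
        using chain unfolding fy_mset_def by (meson not_less)
      have Ff: "F \<in> flats" and Gf: "G \<in> insert {} flats" using F G chain by (auto simp: chain_mset_def)
      \<comment> \<open>Only the part of the power of \<open>F\<close> that exceeds the bound is straightened.\<close>
      define c where "c = rk F - rk G"
      define q0 where "q0 = q - replicate_mset c F"
      have q: "q = q0 + replicate_mset c F"
        using le by (simp add: q0_def c_def flip: count_le_replicate_mset_subset_eq)
      have mq: "mon q = mon q0 * Var F ^ c" unfolding Var_power mult_single by (subst q) simp
      obtain q1 where q1: "mon q0 = mon q1 * xvar G"
      proof (cases "G = {}")
        case True
        then show ?thesis using that[of q0] by (simp add: xvar_def)
      next
        case False
        then have "G \<in># q0" using G GF by (auto simp: q0_def in_diff_count)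
        then obtain q1 where "q0 = add_mset G q1" by (metis insert_DiffM)
        then show ?thesis using that[of q1] False by (simp add: xvar_def mult.commute Var_times_mon)
      qed
      have "mon q0 * alpha F ^ c \<in> chow_relations"
        unfolding q1 mult.assoc
        by (intro relations_mult_left xvar_alpha_power Ff Gf GF) (simp add: c_def)
      moreover have "mon q0 * p \<in> ?S" if "p \<in> pm.span {mon p | p. size p = c \<and> weight p > c * card F}" for p
        using that
      proof (induction rule: pm.span_induct_alt)
        case (step a x y)
        then obtain p where p: "x = mon p" "size p = c" "weight p > c * card F" by auto
        have sz: "size (q0 + p) = d" using less.prems p(2) by (subst (asm) q) simp
        have "mon (q0 + p) \<in> ?S"
        proof (cases "chain_mset (q0 + p)")
          case True
          have "weight q < weight (q0 + p)" using p by (subst q) (simp add: weight_def)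
          moreover have "weight (q0 + p) \<le> n * d" using weight_le[of "q0 + p"] True sz by (simp add: chain_mset_def)
          ultimately have "n * d - weight (q0 + p) < n * d - weight q" by linarith
          then show ?thesis using less.hyps sz by blast
        next
          case False
          then show ?thesis by (intro rel mon_relation)
        qed
        then have "mon q0 * x \<in> ?S" by (simp add: p(1) mult_single)
        then show ?case using step(2) by (simp add: distrib_left mult_pm_scale pm.span_add pm.span_scale)
      qed (simp add: pm.span_zero)
      then have "mon q0 * (alpha F ^ c - Var F ^ c) \<in> ?S" using alpha_power_leading[OF Ff] by blast
      ultimately have "mon q0 * alpha F ^ c - mon q0 * (alpha F ^ c - Var F ^ c) \<in> ?S"
        by (rule pm.span_diff[OF rel])
      then show ?thesis unfolding mq by (simp add: algebra_simps)
    qed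
  qed
qed

end

section \<open>Chains of subsets as level functions\<close>

definition levels :: "nat \<Rightarrow> nat set multiset \<Rightarrow> nat \<Rightarrow> nat"
  where "levels n q = (\<lambda>i\<in>{1..n}. size {#F \<in># q. i \<in> F#})"

definition superlevel :: "nat \<Rightarrow> (nat \<Rightarrow> nat) \<Rightarrow> nat \<Rightarrow> nat set"
  where "superlevel n v j = {i \<in> {1..n}. j \<le> v i}"

text \<open>
  The inverse of \<open>levels\<close> on chains with \<open>N\<close> members: the members of a chain are the superlevel sets of
  its level function.
\<close>

definition chain_of :: "nat \<Rightarrow> (nat \<Rightarrow> nat) \<Rightarrow> nat \<Rightarrow> nat set multiset"
  where "chain_of n v N = image_mset (superlevel n v) (mset_set {1..N})"

definition subset_chain :: "nat \<Rightarrow> nat set multiset \<Rightarrow> bool"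
  where "subset_chain n q \<longleftrightarrow> (\<forall>F\<in>#q. F \<subseteq> {1..n} \<and> F \<noteq> {}) \<and> (\<forall>F\<in>#q. \<forall>G\<in>#q. F \<subseteq> G \<or> G \<subseteq> F)"

lemma chain_of_Suc: "chain_of n v (Suc N) = add_mset (superlevel n v 1) (chain_of n (\<lambda>i. v i - 1) N)"
proof -
  have "{1..Suc N} = insert 1 (Suc ` {1..N})" by (auto simp: image_iff)
  then have "mset_set {1..Suc N} = add_mset 1 (image_mset Suc (mset_set {1..N}))"
    by (simp add: image_mset_mset_set)
  then show ?thesis unfolding chain_of_def
    by (auto simp: multiset.map_comp superlevel_def intro!: image_mset_cong)
qed

lemma subset_chain_recover:
  assumes "subset_chain n q"
  shows "chain_of n (levels n q) (size q) = q"
  using assms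
proof (induction "size q" arbitrary: q)
  case 0
  then show ?case by (simp add: chain_of_def)
next
  case (Suc N)
  have "finite (card ` set_mset q)" "card ` set_mset q \<noteq> {}" using Suc.hyps(2) by auto
  then have "Max (card ` set_mset q) \<in> card ` set_mset q" by (rule Max_in)
  then obtain F where F: "F \<in># q" "card F = Max (card ` set_mset q)" by auto
  have sub: "G \<subseteq> F" if "G \<in># q" for G
  proof (rule ccontr)
    assume "\<not> G \<subseteq> F"
    then have "F \<subset> G" using Suc.prems F that unfolding subset_chain_def by blast
    moreover have "finite G" using Suc.prems that finite_subset[of G "{1..n}"] by (auto simp: subset_chain_def)
    ultimately have "card F < card G" by (intro psubset_card_mono)
    moreover have "card G \<le> Max (card ` set_mset q)" using that by simp
    ultimately show False using F by simp
  qed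
  define q' where "q' = q - {#F#}"
  have q: "q = add_mset F q'" using F by (simp add: q'_def)
  have chain': "subset_chain n q'" using Suc.prems unfolding q subset_chain_def by auto
  have IH: "chain_of n (levels n q') (size q') = q'" using Suc.hyps(1)[of q'] Suc.hyps(2) chain' unfolding q by simp
  have Fn: "F \<subseteq> {1..n}" "F \<noteq> {}" using Suc.prems F by (auto simp: subset_chain_def)
  have lev: "levels n q i = (if i \<in> F then Suc (levels n q' i) else 0)" if i: "i \<in> {1..n}" for i
  proof (cases "i \<in> F")
    case False
    then have "{#G \<in># q'. i \<in> G#} = {#G \<in># q'. False#}" using sub q by (intro filter_mset_cong) auto
    then show ?thesis using i False by (simp add: levels_def q)
  qed (use i in \<open>simp add: levels_def q\<close>)
  have "superlevel n (levels n q) 1 = F" using lev Fn by (auto simp: superlevel_def split: if_splits)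
  moreover have "chain_of n (\<lambda>i. levels n q i - 1) (size q') = chain_of n (levels n q') (size q')"
  proof -
    have "levels n q i - 1 = levels n q' i" if i: "i \<in> {1..n}" for i
    proof (cases "i \<in> F")
      case False
      then have "{#G \<in># q'. i \<in> G#} = {#G \<in># q'. False#}" using sub q by (intro filter_mset_cong) auto
      then have "levels n q' i = 0" using i by (simp add: levels_def)
      then show ?thesis using False lev[OF i] by simp
    qed (use lev[OF i] in simp)
    then show ?thesis unfolding chain_of_def by (intro image_mset_cong) (auto simp: superlevel_def)
  qed
  ultimately show ?case using IH chain_of_Suc[of n "levels n q" "size q'"] by (simp add: q)
qed

lemma levels_chain_of:
  assumes "v \<in> {1..n} \<rightarrow>\<^sub>E {..N}"
  shows "levels n (chain_of n v N) = v"
proof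
  fix i
  show "levels n (chain_of n v N) i = v i"
  proof (cases "i \<in> {1..n}")
    case True
    then have "v i \<le> N" using assms by blast
    have "size {#F \<in># chain_of n v N. i \<in> F#} = card {j \<in> {1..N}. j \<le> v i}"
      using True by (simp add: chain_of_def filter_mset_image_mset superlevel_def)
    also have "{j \<in> {1..N}. j \<le> v i} = {1..v i}" using \<open>v i \<le> N\<close> by auto
    finally show ?thesis using True by (simp add: levels_def)
  qed (use assms in \<open>auto simp: levels_def PiE_def extensional_def\<close>)
qed

definition max_level_functions :: "nat \<Rightarrow> nat \<Rightarrow> (nat \<Rightarrow> nat) set"
  where "max_level_functions n d = {v \<in> {1..n} \<rightarrow>\<^sub>E {..d}. d > 0 \<longrightarrow> d \<in> v ` {1..n}}"

lemma subset_chain_chain_of: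
  assumes "v \<in> max_level_functions n d"
  shows "subset_chain n (chain_of n v d)" "size (chain_of n v d) = d"
proof -
  show "size (chain_of n v d) = d" by (simp add: chain_of_def)
  have "superlevel n v j \<noteq> {}" if "j \<in> {1..d}" for j
    using assms that by (force simp: max_level_functions_def superlevel_def)
  then show "subset_chain n (chain_of n v d)"
    unfolding subset_chain_def chain_of_def superlevel_def by auto
qed

lemma levels_max:
  assumes "subset_chain n q"
  shows "levels n q \<in> max_level_functions n (size q)"
proof -
  have "size {#F \<in># q. i \<in> F#} \<le> size q" for i by (rule size_filter_mset_lesseq)
  moreover have "size q \<in> levels n q ` {1..n}" if "size q > 0"
  proof -
    have "superlevel n (levels n q) (size q) \<in># chain_of n (levels n q) (size q)"
      using that by (simp add: chain_of_def)
    then have "superlevel n (levels n q) (size q) \<noteq> {}"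
      using assms unfolding subset_chain_recover[OF assms] by (auto simp: subset_chain_def)
    then obtain i where "i \<in> {1..n}" "size q \<le> levels n q i" by (auto simp: superlevel_def)
    moreover have "levels n q i \<le> size q" using \<open>i \<in> {1..n}\<close> by (simp add: levels_def size_filter_mset_lesseq)
    ultimately show ?thesis by force
  qed
  ultimately show ?thesis by (auto simp: max_level_functions_def levels_def)
qed

text \<open>
  The largest level of a chain is its number of members, as all of them contain any point of the
  smallest one.
\<close>

lemma levels_bij: "bij_betw (levels n) {q. subset_chain n q \<and> size q = d} (max_level_functions n d)"
proof (rule bij_betw_byWitness[where f' = "\<lambda>v. chain_of n v d"])
  show "\<forall>q\<in>{q. subset_chain n q \<and> size q = d}. chain_of n (levels n q) d = q"
    using subset_chain_recover by blast
  show "\<forall>v\<in>max_level_functions n d. levels n (chain_of n v d) = v"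
    by (auto simp: max_level_functions_def levels_chain_of)
  show "levels n ` {q. subset_chain n q \<and> size q = d} \<subseteq> max_level_functions n d"
    using levels_max by blast
  show "(\<lambda>v. chain_of n v d) ` max_level_functions n d \<subseteq> {q. subset_chain n q \<and> size q = d}"
    using subset_chain_chain_of by blast
qed

lemma card_max_level_functions:
  assumes "n \<ge> 1"
  shows "int (card (max_level_functions n d)) = (int d + 1) ^ n - int d ^ n"
proof (cases "d = 0")
  case True
  then show ?thesis using assms by (simp add: max_level_functions_def card_PiE)
next
  case False
  have "max_level_functions n d = ({1..n} \<rightarrow>\<^sub>E {..d}) - ({1..n} \<rightarrow>\<^sub>E {..<d})"
  proof
    show "max_level_functions n d \<subseteq> ({1..n} \<rightarrow>\<^sub>E {..d}) - ({1..n} \<rightarrow>\<^sub>E {..<d})"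
      using False by (auto simp: max_level_functions_def PiE_iff extensional_def)
    show "({1..n} \<rightarrow>\<^sub>E {..d}) - ({1..n} \<rightarrow>\<^sub>E {..<d}) \<subseteq> max_level_functions n d"
    proof
      fix v assume v: "v \<in> ({1..n} \<rightarrow>\<^sub>E {..d}) - ({1..n} \<rightarrow>\<^sub>E {..<d})"
      then obtain i where i: "i \<in> {1..n}" "v i \<notin> {..<d}" by (metis (no_types, lifting) DiffD1 DiffD2 PiE_iff)
      then have "v i \<in> {..d}" using v by blast
      then have "v i = d" using i by simp
      then show "v \<in> max_level_functions n d" using v i by (auto simp: max_level_functions_def)
    qed
  qed
  moreover have "({1..n} \<rightarrow>\<^sub>E {..<d}) \<subseteq> ({1..n} \<rightarrow>\<^sub>E {..d})" by (intro PiE_mono) auto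
  ultimately have "card (max_level_functions n d) = (d + 1) ^ n - d ^ n"
    by (simp add: card_Diff_subset finite_PiE card_PiE)
  moreover have "d ^ n \<le> (d + 1) ^ n" by (intro power_mono) auto
  ultimately show ?thesis by (simp add: of_nat_diff add.commute)
qed

lemma levels_image:
  assumes "\<sigma> permutes {1..n}" "i \<in> {1..n}"
  shows "levels n (image_mset ((`) \<sigma>) q) (\<sigma> i) = levels n q i"
proof -
  have "\<sigma> i \<in> \<sigma> ` F \<longleftrightarrow> i \<in> F" for F
    using permutes_inj[OF assms(1)] by (simp add: inj_image_mem_iff)
  then show ?thesis using assms permutes_in_image[OF assms(1), of i]
    by (simp add: levels_def filter_mset_image_mset)
qed

lemma subset_chain_image:
  assumes "\<sigma> permutes {1..n}" "subset_chain n q"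
  shows "subset_chain n (image_mset ((`) \<sigma>) q)"
proof -
  have "\<sigma> ` F \<subseteq> {1..n}" if "F \<subseteq> {1..n}" for F
    using that permutes_image[OF assms(1)] by blast
  moreover have "\<sigma> ` F \<subseteq> \<sigma> ` G \<or> \<sigma> ` G \<subseteq> \<sigma> ` F" if "F \<subseteq> G \<or> G \<subseteq> F" for F G
    using that by blast
  ultimately show ?thesis
    using assms(2) unfolding subset_chain_def set_image_mset ball_simps by (meson image_is_empty)
qed

text \<open>
  The action on chains becomes precomposition on level functions, and chains are determined by these.
\<close>

lemma image_fixed_iff_levels:
  assumes \<sigma>: "\<sigma> permutes {1..n}" and q: "subset_chain n q"
  shows "image_mset ((`) \<sigma>) q = q \<longleftrightarrow> (\<forall>i\<in>{1..n}. levels n q (\<sigma> i) = levels n q i)"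
proof
  assume "image_mset ((`) \<sigma>) q = q"
  then show "\<forall>i\<in>{1..n}. levels n q (\<sigma> i) = levels n q i" using levels_image[OF \<sigma>, of _ q] by simp
next
  assume *: "\<forall>i\<in>{1..n}. levels n q (\<sigma> i) = levels n q i"
  have "levels n (image_mset ((`) \<sigma>) q) = levels n q"
  proof
    fix j
    show "levels n (image_mset ((`) \<sigma>) q) j = levels n q j"
    proof (cases "j \<in> {1..n}")
      case True
      then obtain i where "i \<in> {1..n}" "j = \<sigma> i" using permutes_image[OF \<sigma>] by blast
      then show ?thesis using levels_image[OF \<sigma>, of i q] * by simp
    qed (simp add: levels_def restrict_def del: atLeastAtMost_iff)
  qed
  then have "chain_of n (levels n (image_mset ((`) \<sigma>) q)) (size (image_mset ((`) \<sigma>) q)) = chain_of n (levels n q) (size q)"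
    by simp
  then show "image_mset ((`) \<sigma>) q = q"
    using subset_chain_recover[OF q] subset_chain_recover[OF subset_chain_image[OF \<sigma> q]] by (simp only:)
qed

lemma count_image_mset_size: "count (image_mset f M) a = size (filter_mset (\<lambda>x. f x = a) M)"
  by (induction M) auto

lemma count_level_mset:
  fixes n :: nat
  shows "count (image_mset v (mset_set {1..n})) a = card {i \<in> {1..n}. v i = a}"
  unfolding count_image_mset_size by (subst filter_mset_mset_set) simp_all

text \<open>
  If \<open>F\<close> is the set of points of level at least \<open>a\<close>, for an occupied level \<open>a\<close>, then the multiplicity of \<open>F\<close> is
  the gap between \<open>a\<close> and the occupied level below, and the points at level \<open>a\<close> are those of \<open>F\<close> not in the next
  smaller member.
\<close>

lemma admissible_levels_iff:
  assumes q: "subset_chain n q"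
  shows "admissible (image_mset (levels n q) (mset_set {1..n})) \<longleftrightarrow>
    (\<forall>F\<in>#q. \<forall>G\<in>insert {} (set_mset q). G \<subset> F \<longrightarrow> count q F < card F - card G)"
proof -
  define v where "v = levels n q"
  define d where "d = size q"
  let ?l = "image_mset v (mset_set {1..n})"
  have rec: "q = chain_of n v d" using subset_chain_recover[OF q] by (simp add: v_def d_def)
  have vmax: "v \<in> max_level_functions n d" using levels_max[OF q] by (simp add: v_def d_def)
  then have v_le: "v i \<le> d" if "i \<in> {1..n}" for i using that by (auto simp: max_level_functions_def)
  have mem: "F \<in># q \<longleftrightarrow> (\<exists>j\<in>{1..d}. F = superlevel n v j)" for F
    unfolding rec chain_of_def by auto
  have cnt: "count q F = card {j \<in> {1..d}. superlevel n v j = F}" for F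
    unfolding rec chain_of_def
    unfolding count_image_mset_size by (subst filter_mset_mset_set) simp_all
  have fin: "finite (superlevel n v j)" for j by (simp add: superlevel_def)
  have lset: "set_mset ?l = v ` {1..n}" by simp
  show ?thesis unfolding v_def[symmetric]
  proof
    assume adm: "admissible ?l"
    show "\<forall>F\<in>#q. \<forall>G\<in>insert {} (set_mset q). G \<subset> F \<longrightarrow> count q F < card F - card G"
    proof (intro ballI impI)
      fix F G assume F: "F \<in># q" and G: "G \<in> insert {} (set_mset q)" and GF: "G \<subset> F"
      obtain j where j: "j \<in> {1..d}" "F = superlevel n v j" using F mem by blast
      have "finite (v ` F)" "v ` F \<noteq> {}" using GF j fin by auto
      then have "Min (v ` F) \<in> v ` F" by (rule Min_in)
      then obtain i0 where i0: "i0 \<in> F" "v i0 = Min (v ` F)" by auto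
      define a where "a = v i0"
      have amin: "a \<le> v i" if "i \<in> F" for i using that i0 \<open>finite (v ` F)\<close> by (simp add: a_def)
      have ja: "j \<le> a" using i0 j by (simp add: a_def superlevel_def)
      have Fa: "F = superlevel n v a" using amin ja unfolding j(2) by (auto simp: superlevel_def)
      have i0n: "i0 \<in> {1..n}" using i0 j by (simp add: superlevel_def)
      then have "a \<in># ?l" "a > 0" using ja j lset by (auto simp: a_def)
      then obtain a' where a': "a' \<in> insert 0 (set_mset ?l)" "a' < a" "a - a' < count ?l a"
        using adm unfolding admissible_def by blast
      have "{j' \<in> {1..d}. superlevel n v j' = F} \<subseteq> {a' + 1..a}"
      proof
        fix j' assume j': "j' \<in> {j' \<in> {1..d}. superlevel n v j' = F}"
        then have "j' \<le> a" using i0 by (auto simp: superlevel_def a_def)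
        moreover have "a' < j'"
        proof (rule ccontr)
          assume "\<not> a' < j'"
          then have "j' \<le> a'" "a' \<noteq> 0" using j' by auto
          then obtain i1 where "i1 \<in> {1..n}" "v i1 = a'" using a'(1) lset by auto
          then have "i1 \<in> F" using j' \<open>j' \<le> a'\<close> by (auto simp: superlevel_def)
          then show False using amin[of i1] \<open>v i1 = a'\<close> a'(2) by simp
        qed
        ultimately show "j' \<in> {a' + 1..a}" by simp
      qed
      then have "count q F \<le> card {a' + 1..a}" unfolding cnt by (intro card_mono) auto
      then have "count q F < card {i \<in> {1..n}. v i = a}" using a'(3) unfolding count_level_mset by simp
      moreover have "card G + card {i \<in> {1..n}. v i = a} \<le> card F"
      proof -
        have "G \<inter> {i \<in> {1..n}. v i = a} = {}"
        proof (cases "G = {}")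
          case False
          then obtain g where g: "g \<in> {1..d}" "G = superlevel n v g" using G mem by blast
          show ?thesis
          proof (rule ccontr)
            assume "G \<inter> {i \<in> {1..n}. v i = a} \<noteq> {}"
            then have "g \<le> a" using g by (auto simp: superlevel_def)
            then have "F \<subseteq> G" unfolding Fa g(2) by (auto simp: superlevel_def)
            then show False using GF by blast
          qed
        qed simp
        moreover have "finite G" using GF fin j finite_subset by blast
        ultimately have "card (G \<union> {i \<in> {1..n}. v i = a}) = card G + card {i \<in> {1..n}. v i = a}"
          by (intro card_Un_disjoint) auto
        moreover have "G \<union> {i \<in> {1..n}. v i = a} \<subseteq> F" using GF unfolding Fa superlevel_def by auto
        then have "card (G \<union> {i \<in> {1..n}. v i = a}) \<le> card F" using fin j by (intro card_mono) auto
        ultimately show ?thesis by simp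
      qed
      ultimately show "count q F < card F - card G" by simp
    qed
  next
    assume fy: "\<forall>F\<in>#q. \<forall>G\<in>insert {} (set_mset q). G \<subset> F \<longrightarrow> count q F < card F - card G"
    show "admissible ?l" unfolding admissible_def
    proof (intro ballI impI)
      fix a assume a: "a \<in># ?l" "a > 0"
      then obtain i0 where i0: "i0 \<in> {1..n}" "v i0 = a" using lset by auto
      have ad: "a \<le> d" using v_le i0 by blast
      define F G where "F = superlevel n v a" and "G = superlevel n v (a + 1)"
      have Fq: "F \<in># q" using mem a ad by (auto simp: F_def)
      have Gq: "G \<in> insert {} (set_mset q)"
      proof (cases "a + 1 \<le> d")
        case True
        then show ?thesis using mem by (auto simp: G_def)
      next
        case False
        then have "G = {}" using v_le ad by (fastforce simp: G_def superlevel_def)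
        then show ?thesis by simp
      qed
      have un: "F = G \<union> {i \<in> {1..n}. v i = a}" by (auto simp: F_def G_def superlevel_def)
      have disj: "G \<inter> {i \<in> {1..n}. v i = a} = {}" by (auto simp: G_def superlevel_def)
      have "G \<subset> F" using un disj i0 by blast
      then have "count q F < card F - card G" using fy Fq Gq by blast
      also have "card F = card G + card {i \<in> {1..n}. v i = a}"
        unfolding un using disj fin by (intro card_Un_disjoint) (auto simp: G_def)
      finally have less: "count q F < count ?l a" unfolding count_level_mset by simp
      define A where "A = insert 0 {x \<in> v ` {1..n}. x < a}"
      have A: "finite A" "A \<noteq> {}" by (auto simp: A_def)
      define a' where "a' = Max A"
      have a'A: "a' \<in> A" unfolding a'_def using A by (rule Max_in)
      then have "a' < a" using a by (auto simp: A_def)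
      have "{a' + 1..a} \<subseteq> {j \<in> {1..d}. superlevel n v j = F}"
      proof
        fix j assume j: "j \<in> {a' + 1..a}"
        have "superlevel n v j \<subseteq> F"
        proof
          fix i assume i: "i \<in> superlevel n v j"
          then have "i \<in> {1..n}" "j \<le> v i" by (auto simp: superlevel_def)
          have "\<not> v i < a"
          proof
            assume "v i < a"
            then have "v i \<in> A" using \<open>i \<in> {1..n}\<close> by (auto simp: A_def)
            then have "v i \<le> a'" using A by (simp add: a'_def)
            then show False using j \<open>j \<le> v i\<close> by simp
          qed
          then show "i \<in> F" using \<open>i \<in> {1..n}\<close> by (simp add: F_def superlevel_def)
        qed
        moreover have "F \<subseteq> superlevel n v j" using j by (auto simp: F_def superlevel_def)
        ultimately show "j \<in> {j \<in> {1..d}. superlevel n v j = F}" using j ad by auto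
      qed
      then have "card {a' + 1..a} \<le> count q F" unfolding cnt by (intro card_mono) auto
      then have "a - a' < count ?l a" using less by simp
      moreover have "a' \<in> insert 0 (set_mset ?l)" using a'A lset by (auto simp: A_def)
      ultimately show "\<exists>a'\<in>insert 0 (set_mset ?l). a' < a \<and> a - a' < count ?l a" using \<open>a' < a\<close> by blast
    qed
  qed
qed

section \<open>The number of admissible level functions\<close>

definition admissible_functions :: "nat \<Rightarrow> nat \<Rightarrow> (nat \<Rightarrow> nat) set"
  where "admissible_functions n d = {v \<in> max_level_functions n d. admissible (image_mset v (mset_set {1..n}))}"

lemma top_level_max:
  assumes "v \<in> {1..n} \<rightarrow>\<^sub>E UNIV" "n \<ge> 1" "fst ` set_mset P = v ` {1..n}"
  shows "v \<in> max_level_functions n d \<longleftrightarrow> top_level P = d"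
proof
  assume "v \<in> max_level_functions n d"
  then have le: "\<forall>i\<in>{1..n}. v i \<le> d" and att: "d > 0 \<Longrightarrow> d \<in> v ` {1..n}"
    by (auto simp: max_level_functions_def)
  show "top_level P = d"
  proof (rule top_level_eqI)
    fix p assume "p \<in># P"
    then have "fst p \<in> v ` {1..n}" using assms(3) by blast
    then obtain i where "i \<in> {1..n}" "fst p = v i" by (rule imageE)
    then show "fst p \<le> d" using le by simp
  next
    show "d \<in> insert 0 (fst ` set_mset P)" unfolding assms(3) using att by (cases "d = 0") auto
  qed
next
  assume top: "top_level P = d"
  have "v i \<le> d" if "i \<in> {1..n}" for i
  proof -
    have "v i \<in> fst ` set_mset P" using that assms(3) by blast
    then obtain p where "p \<in># P" "v i = fst p" by (metis imageE)
    then show ?thesis using top_level_ge[of p P] top by simp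
  qed
  moreover have "d \<in> v ` {1..n}" if "d > 0" using top_level_in[of P] top that assms(3) by auto
  ultimately show "v \<in> max_level_functions n d" using assms(1) by (auto simp: max_level_functions_def PiE_iff)
qed

text \<open>
  With the points themselves as colours, a levelled multiset is the graph of a level function.
\<close>

lemma labelled_bij:
  assumes "n \<ge> 1"
  shows "bij_betw (\<lambda>v. image_mset (\<lambda>i. (v i, i)) (mset_set {1..n})) (admissible_functions n d)
    {P \<in> levelled False (mset_set {1..n}). top_level P = d}"
  unfolding bij_betw_def
proof
  let ?f = "\<lambda>v. image_mset (\<lambda>i. (v i :: nat, i)) (mset_set {1..n})"
  have set_f: "set_mset (?f v) = (\<lambda>i. (v i, i)) ` {1..n}" for v by simp
  have ext: "v \<in> {1..n} \<rightarrow>\<^sub>E UNIV" if "v \<in> admissible_functions n d" for v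
    using that by (auto simp: admissible_functions_def max_level_functions_def PiE_iff)
  show "inj_on ?f (admissible_functions n d)"
  proof (rule inj_onI)
    fix v w assume v: "v \<in> admissible_functions n d" and w: "w \<in> admissible_functions n d" and eq: "?f v = ?f w"
    have "v i = w i" if "i \<in> {1..n}" for i
    proof -
      have "(v i, i) \<in> set_mset (?f w)" unfolding eq[symmetric] set_f using that by (rule imageI)
      then have "(v i, i) \<in> (\<lambda>i. (w i, i)) ` {1..n}" unfolding set_f .
      then show ?thesis by auto
    qed
    then show "v = w" using ext[OF v] ext[OF w] by (intro extensionalityI[of v "{1..n}" w]) (auto simp: PiE_def)
  qed
  have fst_f: "fst ` set_mset (?f v) = v ` {1..n}" for v unfolding set_f by force
  have mset_f: "image_mset snd (?f v) = mset_set {1..n}" "image_mset fst (?f v) = image_mset v (mset_set {1..n})" for v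
    by (simp_all add: multiset.map_comp comp_def)
  show "?f ` admissible_functions n d = {P \<in> levelled False (mset_set {1..n}). top_level P = d}"
  proof
    show "?f ` admissible_functions n d \<subseteq> {P \<in> levelled False (mset_set {1..n}). top_level P = d}"
    proof (rule image_subsetI)
      fix v assume v: "v \<in> admissible_functions n d"
      have "top_level (?f v) = d"
        using top_level_max[OF ext[OF v] assms fst_f, of d] v by (simp add: admissible_functions_def)
      then show "?f v \<in> {P \<in> levelled False (mset_set {1..n}). top_level P = d}"
        using v mset_f by (simp add: levelled_def admissible_functions_def)
    qed
    show "{P \<in> levelled False (mset_set {1..n}). top_level P = d} \<subseteq> ?f ` admissible_functions n d"
    proof
      fix P assume P: "P \<in> {P \<in> levelled False (mset_set {1..n}). top_level P = d}"
      then have snd: "image_mset snd P = mset_set {1..n}" and adm: "admissible (image_mset fst P)"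
        by (auto simp: levelled_def)
      have "size P = card {1..n}" using arg_cong[OF snd, of size] by simp
      then obtain h where h: "h \<in> {1..n} \<rightarrow>\<^sub>E UNIV" "image_mset h (mset_set {1..n}) = P"
        using function_with_mset_image[of "{1..n}" P] by auto
      have "image_mset (\<lambda>i. snd (h i)) (mset_set {1..n}) = mset_set {1..n}"
        using snd h(2) by (auto simp: multiset.map_comp comp_def)
      then obtain \<tau> where \<tau>: "\<tau> permutes {1..n}" "\<forall>x\<in>{1..n}. id x = snd (h (\<tau> x))"
        using image_mset_eq_implies_permutes[of "{1..n}" id "\<lambda>i. snd (h i)"] by auto
      define v where "v = (\<lambda>i\<in>{1..n}. fst (h (\<tau> i)))"
      have "?f v = image_mset (\<lambda>i. h (\<tau> i)) (mset_set {1..n})"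
        using \<tau>(2) by (intro image_mset_cong) (auto simp: v_def prod_eq_iff)
      also have "\<dots> = image_mset h (image_mset \<tau> (mset_set {1..n}))" by (simp add: multiset.map_comp comp_def)
      also have "image_mset \<tau> (mset_set {1..n}) = mset_set {1..n}"
        using \<tau>(1) by (simp only: image_mset_mset_set permutes_inj_on permutes_image)
      finally have fv: "?f v = P" using h(2) by simp
      have "v \<in> max_level_functions n d"
      proof (rule iffD2[OF top_level_max])
        show "v \<in> {1..n} \<rightarrow>\<^sub>E UNIV" by (simp add: v_def)
        show "fst ` set_mset P = v ` {1..n}" using fst_f[of v] unfolding fv .
        show "top_level P = d" using P by simp
      qed (rule assms)
      then have "v \<in> admissible_functions n d"
        using adm mset_f(2)[of v] fv by (simp add: admissible_functions_def)
      then show "P \<in> ?f ` admissible_functions n d" using fv by blast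
    qed
  qed
qed

lemma finite_max_level_functions: "finite (max_level_functions n d)"
  by (rule finite_subset[of _ "{1..n} \<rightarrow>\<^sub>E {..d}"]) (auto simp: max_level_functions_def finite_PiE)

lemma admissible_count:
  assumes "n \<ge> 1"
  shows "fps_nth (mcoeff (level_series False (fps_X :: int fps)) (mset_set {1..n})) d = int (card (admissible_functions n d))"
proof -
  have "fps_nth (mcoeff (level_series False (fps_X :: int fps)) (mset_set {1..n})) d
      = (\<Sum>P\<in>levelled False (mset_set {1..n}). if top_level P = d then 1 else 0)"
    by (simp add: level_series.rep_eq fps_sum_nth fps_X_power_nth) (intro sum.cong, auto)
  also have "\<dots> = int (card {P \<in> levelled False (mset_set {1..n}). top_level P = d})"
    using finite_levelled by (simp add: sum.If_cases Int_def)
  also have "\<dots> = int (card (admissible_functions n d))"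
    using bij_betw_same_card[OF labelled_bij[OF assms, of d]] by simp
  finally show ?thesis .
qed

text \<open>
  Worpitzky's identity says that multiplication by \<open>(1 - t) ^ (k + 1)\<close> turns this series into an Eulerian
  polynomial.
\<close>

definition shifted_powers :: "nat \<Rightarrow> int fps"
  where "shifted_powers k = Abs_fps (\<lambda>N. (int N + 1) ^ k)"

lemma sum_Pow_power: "finite A \<Longrightarrow> (\<Sum>B\<in>Pow A. x ^ card B * y ^ card (A - B)) = (x + y :: 'a :: comm_ring_1) ^ card A"
  using prod_add[of A "\<lambda>_. x" "\<lambda>_. y"] by simp

text \<open>
  Formally, summing over \<open>B\<close> first turns the coefficient of \<open>t ^ N\<close> into a difference of binomial
  expansions, and the sum over \<open>N\<close> telescopes.
\<close>

lemma worpitzky_recursion: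
  assumes A: "finite A"
  shows "(\<Sum>B\<in>Pow A. (fps_X ^ card B - fps_X) * ((1 - fps_X) ^ card (A - B) * shifted_powers (card (A - B)))) = 1"
    (is "?S = 1")
proof (rule fps_ext)
  fix k :: nat
  let ?X = "fps_X :: int fps"
  \<comment> \<open>Coefficients from \<open>M\<close> on do not affect the coefficient of degree \<open>k\<close>, so the series is cut off to a finite sum.\<close>
  define M where "M = Suc k"
  define trunc where "trunc j = (\<Sum>N<M. fps_const ((int N + 1) ^ j) * ?X ^ N)" for j
  define rest where "rest j = Abs_fps (\<lambda>N. (int (N + M) + 1) ^ j)" for j
  define a where "a N = (fps_const (int N + 1) * (1 - ?X) + ?X) ^ card A" for N
  have split: "shifted_powers j = trunc j + ?X ^ M * rest j" for j
  proof (rule fps_ext)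
    fix i
    have "fps_nth (trunc j) i = (\<Sum>N<M. if N = i then (int N + 1) ^ j else 0)"
      by (simp add: trunc_def fps_sum_nth fps_X_power_nth if_distrib cong: if_cong)
    also have "\<dots> = (if i < M then (int i + 1) ^ j else 0)" by simp
    finally show "fps_nth (shifted_powers j) i = fps_nth (trunc j + ?X ^ M * rest j) i"
      by (simp add: shifted_powers_def rest_def fps_X_power_mult_nth)
  qed
  let ?T = "\<Sum>B\<in>Pow A. (?X ^ card B - ?X) * ((1 - ?X) ^ card (A - B) * trunc (card (A - B)))"
  have "?S = ?T + ?X ^ M * (\<Sum>B\<in>Pow A. (?X ^ card B - ?X) * ((1 - ?X) ^ card (A - B) * rest (card (A - B))))"
    by (simp add: split distrib_left sum.distrib sum_distrib_left mult.left_commute)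
  moreover have zero: "fps_nth (?X ^ M * g) k = 0" for g
    by (simp only: fps_X_power_mult_nth) (simp add: M_def)
  ultimately have "fps_nth ?S k = fps_nth ?T k" by (simp only: fps_add_nth zero add_0_right)
  also have "?T = (\<Sum>N<M. ?X ^ N * a N - ?X ^ Suc N * a (Suc N))"
  proof -
    have "?T = (\<Sum>B\<in>Pow A. \<Sum>N<M. ?X ^ N * (?X ^ card B * (fps_const (int N + 1) * (1 - ?X)) ^ card (A - B))
        - ?X ^ Suc N * (1 ^ card B * (fps_const (int N + 1) * (1 - ?X)) ^ card (A - B)))"
    proof (intro sum.cong refl)
      fix B
      have ring: "(b - x) * (y ^ j * (c ^ j * z)) = z * (b * (c * y) ^ j) - x * z * (1 * (c * y) ^ j)"
        for b c x y z :: "int fps" and j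
        by (simp add: power_mult_distrib algebra_simps)
      show "(?X ^ card B - ?X) * ((1 - ?X) ^ card (A - B) * trunc (card (A - B)))
        = (\<Sum>N<M. ?X ^ N * (?X ^ card B * (fps_const (int N + 1) * (1 - ?X)) ^ card (A - B))
        - ?X ^ Suc N * (1 ^ card B * (fps_const (int N + 1) * (1 - ?X)) ^ card (A - B)))"
        unfolding trunc_def sum_distrib_left fps_const_power[symmetric] ring power_Suc power_one ..
    qed
    also have "\<dots> = (\<Sum>N<M. ?X ^ N * (\<Sum>B\<in>Pow A. ?X ^ card B * (fps_const (int N + 1) * (1 - ?X)) ^ card (A - B))
        - ?X ^ Suc N * (\<Sum>B\<in>Pow A. 1 ^ card B * (fps_const (int N + 1) * (1 - ?X)) ^ card (A - B)))"
      by (subst sum.swap) (simp only: sum_subtractf sum_distrib_left)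
    also have "\<dots> = (\<Sum>N<M. ?X ^ N * a N - ?X ^ Suc N * a (Suc N))"
    proof (intro sum.cong refl)
      fix N
      have "1 + fps_const (int N + 1) * (1 - ?X) = fps_const (int (Suc N) + 1) * (1 - ?X) + ?X"
      proof -
        have "fps_const (int (Suc N) + 1) = fps_const (int N + 1) + 1" by (simp flip: fps_const_add fps_const_1_eq_1)
        then show ?thesis by (simp add: algebra_simps)
      qed
      then show "?X ^ N * (\<Sum>B\<in>Pow A. ?X ^ card B * (fps_const (int N + 1) * (1 - ?X)) ^ card (A - B))
        - ?X ^ Suc N * (\<Sum>B\<in>Pow A. 1 ^ card B * (fps_const (int N + 1) * (1 - ?X)) ^ card (A - B))
        = ?X ^ N * a N - ?X ^ Suc N * a (Suc N)"
        unfolding sum_Pow_power[OF A] a_def by (simp only: add.commute)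
    qed
    finally show ?thesis .
  qed
  also have "\<dots> = a 0 - ?X ^ M * a M" using sum_lessThan_telescope'[of "\<lambda>N. ?X ^ N * a N" M] by simp
  also have "fps_nth \<dots> k = fps_nth 1 k" by (simp only: fps_sub_nth zero) (simp add: a_def)
  finally show "fps_nth ?S k = fps_nth 1 k" .
qed

text \<open>
  Both sides satisfy the recursion of the levelled multisets, in which the term of the empty set has the
  coefficient \<open>1 - t\<close>, so that the value at \<open>A\<close> is determined by the values at smaller sets.
\<close>

lemma level_series_distinct_colours:
  assumes "finite A"
  shows "mcoeff (level_series False (fps_X :: int fps)) (mset_set A) = (1 - fps_X) ^ (card A + 1) * shifted_powers (card A)"
  using assms
proof (induction "card A" arbitrary: A rule: less_induct)
  case less
  let ?X = "fps_X :: int fps"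
  let ?T = "\<lambda>A. mcoeff (level_series False ?X) (mset_set A)"
  let ?\<psi> = "\<lambda>A. (1 - ?X) ^ (card A + 1) * shifted_powers (card A)"
  have bij: "bij_betw mset_set (Pow A) {\<nu>. \<nu> \<subseteq># mset_set A}"
  proof (rule bij_betw_byWitness[where f' = set_mset])
    have fin: "finite B" if "B \<subseteq> A" for B using that less.prems finite_subset by blast
    show "\<forall>B\<in>Pow A. set_mset (mset_set B) = B" using fin by simp
    show "\<forall>\<nu>\<in>{\<nu>. \<nu> \<subseteq># mset_set A}. mset_set (set_mset \<nu>) = \<nu>"
    proof
      fix \<nu> assume "\<nu> \<in> {\<nu>. \<nu> \<subseteq># mset_set A}"
      then have "count \<nu> x \<le> count (mset_set A) x" for x by (simp add: subseteq_mset_def)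
      moreover have "count (mset_set A) x \<le> 1" for x by (simp add: count_mset_set')
      ultimately have le1: "count \<nu> x \<le> 1" for x by (meson le_trans)
      show "mset_set (set_mset \<nu>) = \<nu>"
      proof (rule multiset_eqI)
        fix x
        show "count (mset_set (set_mset \<nu>)) x = count \<nu> x"
        proof (cases "x \<in># \<nu>")
          case True
          then have "count \<nu> x = 1" using le1[of x] count_greater_zero_iff[of \<nu> x] by linarith
          then show ?thesis using True by simp
        qed (simp add: not_in_iff)
      qed
    qed
    show "mset_set ` Pow A \<subseteq> {\<nu>. \<nu> \<subseteq># mset_set A}" using less.prems by (auto intro: subset_imp_msubset_mset_set)
    show "set_mset ` {\<nu>. \<nu> \<subseteq># mset_set A} \<subseteq> Pow A"
      using less.prems set_mset_mono[of _ "mset_set A"] by auto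
  qed
  have eqT: "(\<Sum>B\<in>Pow A. (?X ^ card B - ?X) * ?T (A - B)) = 1 - ?X"
  proof -
    have "1 - ?X = mcoeff ((H_series ?X - mseries_const ?X * H_series 1) * level_series False ?X) (mset_set A)"
      by (subst mult.commute) (simp add: level_series_equation mcoeff_H_series)
    also have "\<dots> = (\<Sum>\<nu> | \<nu> \<subseteq># mset_set A. (?X ^ size \<nu> - ?X) * mcoeff (level_series False ?X) (mset_set A - \<nu>))"
      by (simp add: mcoeff_times[of "H_series ?X - mseries_const ?X * H_series 1"] mcoeff_simps mcoeff_H_series)
    also have "\<dots> = (\<Sum>B\<in>Pow A. (?X ^ size (mset_set B) - ?X) * mcoeff (level_series False ?X) (mset_set A - mset_set B))"
      by (rule sum.reindex_bij_betw[OF bij, symmetric])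
    also have "\<dots> = (\<Sum>B\<in>Pow A. (?X ^ card B - ?X) * ?T (A - B))"
      using less.prems by (intro sum.cong refl) (auto simp: mset_set_Diff)
    finally show ?thesis ..
  qed
  have eq\<psi>: "(\<Sum>B\<in>Pow A. (?X ^ card B - ?X) * ?\<psi> (A - B)) = 1 - ?X"
  proof -
    have "(\<Sum>B\<in>Pow A. (?X ^ card B - ?X) * ?\<psi> (A - B)) = (1 - ?X) *
      (\<Sum>B\<in>Pow A. (?X ^ card B - ?X) * ((1 - ?X) ^ card (A - B) * shifted_powers (card (A - B))))"
      by (simp add: sum_distrib_left mult_ac)
    then show ?thesis unfolding worpitzky_recursion[OF less.prems] by simp
  qed
  have "(\<Sum>B\<in>Pow A. (?X ^ card B - ?X) * (?T (A - B) - ?\<psi> (A - B))) = 0"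
    unfolding right_diff_distrib[of "?X ^ _ - ?X"] sum_subtractf eqT eq\<psi> by simp
  also have "(\<Sum>B\<in>Pow A. (?X ^ card B - ?X) * (?T (A - B) - ?\<psi> (A - B)))
      = (\<Sum>B\<in>{{}}. (?X ^ card B - ?X) * (?T (A - B) - ?\<psi> (A - B)))"
  proof (rule sum.mono_neutral_right)
    show "\<forall>B\<in>Pow A - {{}}. (?X ^ card B - ?X) * (?T (A - B) - ?\<psi> (A - B)) = 0"
    proof
      fix B assume B: "B \<in> Pow A - {{}}"
      then have "card (A - B) < card A" using less.prems by (intro psubset_card_mono) auto
      then have "?T (A - B) = ?\<psi> (A - B)" using less by simp
      then show "(?X ^ card B - ?X) * (?T (A - B) - ?\<psi> (A - B)) = 0" by simp
    qed
  qed (use less.prems in auto)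
  finally have "(1 - ?X) * (?T A - ?\<psi> A) = 0" by simp
  moreover have "fps_nth (1 - ?X) 0 \<noteq> 0" by simp
  then have "1 - ?X \<noteq> 0" by (metis fps_zero_nth)
  ultimately show ?case by simp
qed

definition multisets_gf :: "'b set \<Rightarrow> int fps"
  where "multisets_gf A = Abs_fps (\<lambda>k. int (card {\<beta>. set_mset \<beta> \<subseteq> A \<and> size \<beta> = k}))"

lemma finite_multisets_of_size: "finite A \<Longrightarrow> finite {\<beta>. set_mset \<beta> \<subseteq> A \<and> size \<beta> = k}"
proof (induction k)
  case (Suc k)
  have "{\<beta>. set_mset \<beta> \<subseteq> A \<and> size \<beta> = Suc k} \<subseteq> (\<lambda>(a, \<beta>). add_mset a \<beta>) ` (A \<times> {\<beta>. set_mset \<beta> \<subseteq> A \<and> size \<beta> = k})"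
  proof
    fix \<beta> assume \<beta>: "\<beta> \<in> {\<beta>. set_mset \<beta> \<subseteq> A \<and> size \<beta> = Suc k}"
    then obtain a \<beta>' where "\<beta> = add_mset a \<beta>'" by (auto dest: size_eq_Suc_imp_eq_union)
    then show "\<beta> \<in> (\<lambda>(a, \<beta>). add_mset a \<beta>) ` (A \<times> {\<beta>. set_mset \<beta> \<subseteq> A \<and> size \<beta> = k})" using \<beta> by force
  qed
  moreover have "finite ((\<lambda>(a, \<beta>). add_mset a \<beta>) ` (A \<times> {\<beta>. set_mset \<beta> \<subseteq> A \<and> size \<beta> = k}))"
    using Suc by (intro finite_imageI finite_cartesian_product) auto
  ultimately show ?case by (rule finite_subset)
qed simp

text \<open>
  The Hilbert series of a polynomial ring in \<open>card A\<close> variables.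
\<close>

lemma multisets_gf_eq: "finite A \<Longrightarrow> (1 - fps_X) ^ card A * multisets_gf A = 1"
proof (induction A rule: finite_induct)
  case empty
  have "{\<beta> :: 'a multiset. \<beta> = {#} \<and> size \<beta> = k} = (if k = 0 then {{#}} else {})" for k by auto
  then show ?case by (intro fps_ext) (simp add: multisets_gf_def)
next
  case (insert a A)
  let ?M = "\<lambda>A k. {\<beta>. set_mset \<beta> \<subseteq> A \<and> size \<beta> = k}"
  have "(1 - fps_X) * multisets_gf (insert a A) = multisets_gf A"
  proof (rule fps_ext)
    fix k
    show "fps_nth ((1 - fps_X) * multisets_gf (insert a A)) k = fps_nth (multisets_gf A) k"
    proof (cases k)
      case 0
      have "{\<beta>. set_mset \<beta> \<subseteq> B \<and> size \<beta> = 0} = {{#}}" for B :: "'a set" by auto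
      then show ?thesis using 0 by (simp add: multisets_gf_def left_diff_distrib)
    next
      case (Suc l)
      have "?M (insert a A) (Suc l) = ?M A (Suc l) \<union> add_mset a ` ?M (insert a A) l"
      proof
        show "?M (insert a A) (Suc l) \<subseteq> ?M A (Suc l) \<union> add_mset a ` ?M (insert a A) l"
        proof
          fix \<beta> assume \<beta>: "\<beta> \<in> ?M (insert a A) (Suc l)"
          show "\<beta> \<in> ?M A (Suc l) \<union> add_mset a ` ?M (insert a A) l"
          proof (cases "a \<in># \<beta>")
            case True
            then obtain \<gamma> where "\<beta> = add_mset a \<gamma>" by (metis insert_DiffM)
            then show ?thesis using \<beta> by auto
          qed (use \<beta> in auto)
        qed
      qed auto
      moreover have "?M A (Suc l) \<inter> add_mset a ` ?M (insert a A) l = {}" using insert.hyps by auto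
      ultimately have "card (?M (insert a A) (Suc l)) = card (?M A (Suc l)) + card (add_mset a ` ?M (insert a A) l)"
        using insert.hyps finite_multisets_of_size[of A] finite_multisets_of_size[of "insert a A"]
        by (simp only:) (rule card_Un_disjoint, auto)
      also have "card (add_mset a ` ?M (insert a A) l) = card (?M (insert a A) l)"
        by (rule card_image) (simp add: inj_on_def)
      finally have "card (?M (insert a A) (Suc l)) = card (?M A (Suc l)) + card (?M (insert a A) l)" .
      then have "fps_nth (multisets_gf (insert a A)) (Suc l)
          = fps_nth (multisets_gf A) (Suc l) + fps_nth (multisets_gf (insert a A)) l"
        unfolding multisets_gf_def fps_nth_Abs_fps by (simp only: of_nat_add)
      then show ?thesis unfolding Suc by (simp add: left_diff_distrib)
    qed
  qed
  moreover have "(1 - fps_X) ^ card (insert a A) * multisets_gf (insert a A)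
      = (1 - fps_X) ^ card A * ((1 - fps_X) * multisets_gf (insert a A))"
    by (simp only: card_insert_disjoint[OF insert.hyps] power_Suc2 mult.assoc)
  ultimately have "(1 - fps_X) ^ card (insert a A) * multisets_gf (insert a A) = (1 - fps_X) ^ card A * multisets_gf A"
    by (simp only:)
  then show ?case using insert.IH by simp
qed

text \<open>
  The right-hand side is the number of chain monomials of degree \<open>d\<close>, the left-hand side the number of
  products of an admissible monomial and a monomial in \<open>n\<close> linear forms. As power series in \<open>t\<close> both are
  \<open>(1 - t)\<close> times the sum of all \<open>(N + 1) ^ n t ^ N\<close>.
\<close>

lemma hilbert_count:
  assumes "n \<ge> 1"
  shows "(\<Sum>e\<le>d. card (admissible_functions n e) * card {\<beta> :: nat multiset. set_mset \<beta> \<subseteq> {1..n} \<and> size \<beta> = d - e})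
    = card (max_level_functions n d)"
proof -
  let ?X = "fps_X :: int fps"
  define \<phi> where "\<phi> = mcoeff (level_series False ?X) (mset_set {1..n})"
  have "int (\<Sum>e\<le>d. card (admissible_functions n e) * card {\<beta> :: nat multiset. set_mset \<beta> \<subseteq> {1..n} \<and> size \<beta> = d - e})
      = fps_nth (\<phi> * multisets_gf {1..n}) d"
    by (simp add: fps_mult_nth \<phi>_def admissible_count[OF assms] multisets_gf_def atMost_atLeast0 del: One_nat_def)
  also have "\<phi> * multisets_gf {1..n} = (1 - ?X) * shifted_powers n * ((1 - ?X) ^ card {1..n} * multisets_gf {1..n})"
    unfolding \<phi>_def level_series_distinct_colours[OF finite_atLeastAtMost] by (simp add: mult_ac)
  also have "\<dots> = (1 - ?X) * shifted_powers n" by (simp only: multisets_gf_eq finite_atLeastAtMost mult_1_right)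
  also have "fps_nth \<dots> d = (int d + 1) ^ n - int d ^ n"
    using assms by (cases d) (simp_all add: left_diff_distrib shifted_powers_def add.commute)
  finally show ?thesis using card_max_level_functions[OF assms, of d] by linarith
qed

section \<open>Independence for the Boolean matroid\<close>

definition pm_filter :: "('b \<Rightarrow> bool) \<Rightarrow> ('b \<Rightarrow>\<^sub>0 'k :: zero) \<Rightarrow> ('b \<Rightarrow>\<^sub>0 'k)"
  where "pm_filter P p = Poly_Mapping.mapp (\<lambda>k x. if P k then x else 0) p"

lemma lookup_pm_filter: "Poly_Mapping.lookup (pm_filter P p) k = (if P k then Poly_Mapping.lookup p k else 0)"
  by (simp add: pm_filter_def lookup_mapp when_def in_keys_iff)

lemma pm_filter_add: "pm_filter P (p + q) = pm_filter P p + pm_filter P (q :: 'b \<Rightarrow>\<^sub>0 'k :: field)"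
  by (rule poly_mapping_eqI) (simp add: lookup_pm_filter lookup_add)

lemma pm_filter_scale: "pm_filter P (pm_scale c p) = pm_scale c (pm_filter P (p :: 'b \<Rightarrow>\<^sub>0 'k :: field))"
  by (rule poly_mapping_eqI) (simp add: lookup_pm_filter lookup_pm_scale)

lemma pm_filter_single: "pm_filter P (Poly_Mapping.single k c) = (if P k then Poly_Mapping.single k c else 0)"
  by (rule poly_mapping_eqI) (simp add: lookup_pm_filter lookup_single when_def)

lemma pm_filter_zero: "pm_filter P 0 = 0"
  by (rule poly_mapping_eqI) (simp add: lookup_pm_filter)

lemma pm_filter_sum: "pm_filter P (\<Sum>i\<in>A. f i :: 'b \<Rightarrow>\<^sub>0 'k :: field) = (\<Sum>i\<in>A. pm_filter P (f i))"
  by (induction A rule: infinite_finite_induct) (simp_all add: pm_filter_add pm_filter_zero)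

lemma pm_filter_id: "(\<And>k. k \<in> Poly_Mapping.keys p \<Longrightarrow> P k) \<Longrightarrow> pm_filter P p = p"
  by (rule poly_mapping_eqI) (auto simp: lookup_pm_filter in_keys_iff)

lemma span_image_linear:
  fixes f :: "('b \<Rightarrow>\<^sub>0 'k :: field) \<Rightarrow> ('c \<Rightarrow>\<^sub>0 'k)"
  assumes "\<And>x y. f (x + y) = f x + f y" "\<And>c x. f (pm_scale c x) = pm_scale c (f x)"
    and "\<And>x. x \<in> S \<Longrightarrow> f x \<in> T" "pm.subspace T" "p \<in> pm.span S"
  shows "f p \<in> T"
  using assms(5)
proof (induction rule: pm.span_induct_alt)
  case base
  have "f 0 = pm_scale 0 (f 0)" using assms(2)[of 0 0] by simp
  then show ?case using pm.subspace_0[OF assms(4)] by simp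
next
  case (step c x y)
  then show ?case using assms(1,2,3) pm.subspace_add[OF assms(4)] pm.subspace_scale[OF assms(4)] by simp
qed

lemma independent_monomials: "\<not> pm.dependent ((\<lambda>q. Poly_Mapping.single q (1 :: 'k :: field)) ` A)"
proof
  assume "pm.dependent ((\<lambda>q. Poly_Mapping.single q (1 :: 'k)) ` A)"
  then obtain q where q: "Poly_Mapping.single q (1 :: 'k)
      \<in> pm.span ((\<lambda>q. Poly_Mapping.single q 1) ` A - {Poly_Mapping.single q 1})"
    unfolding pm.dependent_def by blast
  have "Poly_Mapping.single q (1 :: 'k) \<in> {p. Poly_Mapping.lookup p q = 0}"
  proof (rule span_image_linear[where f = "\<lambda>x. x", OF _ _ _ _ q])
    show "pm.subspace {p :: 'a \<Rightarrow>\<^sub>0 'k. Poly_Mapping.lookup p q = 0}"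
      by (auto simp: pm.subspace_def lookup_add lookup_pm_scale)
  qed (auto simp: lookup_single when_def)
  then show False by simp
qed

lemma inj_mon: "inj mon"
proof (rule injI)
  fix q q' :: "'a multiset"
  assume "mon q = mon q'"
  then have "Poly_Mapping.keys (mon q) = Poly_Mapping.keys (mon q')" by (rule arg_cong)
  then show "q = q'" by simp
qed

text \<open>
  A spanning family with no more members than some independent set is a basis without repetition.
\<close>

lemma spanning_family_independent:
  fixes f :: "'i \<Rightarrow> ('b \<Rightarrow>\<^sub>0 'k :: field)"
  assumes I: "finite I" and J: "\<not> pm.dependent J" "J \<subseteq> pm.span (f ` I)" "card I \<le> card J"
  shows "inj_on f I" "\<not> pm.dependent (f ` I)"
proof -
  have le: "card J \<le> card (f ` I)" using pm.independent_span_bound[OF _ J(1,2)] I by simp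
  then have "card (f ` I) = card I" using J(3) card_image_le[OF I, of f] by linarith
  then show "inj_on f I" using I by (rule eq_card_imp_inj_on[rotated])
  show "\<not> pm.dependent (f ` I)"
  proof
    assume "pm.dependent (f ` I)"
    then obtain x where x: "x \<in> f ` I" "x \<in> pm.span (f ` I - {x})" unfolding pm.dependent_def by blast
    then have "f ` I \<subseteq> pm.span (f ` I - {x})" by (metis insert_Diff pm.span_redundant pm.span_superset)
    then have "pm.span (f ` I) \<subseteq> pm.span (f ` I - {x})" by (simp add: pm.span_minimal pm.subspace_span)
    then have "J \<subseteq> pm.span (f ` I - {x})" using J(2) by blast
    then have "card J \<le> card (f ` I - {x})" using pm.independent_span_bound[OF _ J(1)] I by simp
    also have "\<dots> < card (f ` I)" using I x(1) by (intro psubset_card_mono) auto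
    finally show False using \<open>card (f ` I) = card I\<close> J(3) by simp
  qed
qed

context uniform_chow
begin

text \<open>
  The normal form modulo the monomials that are not chains.
\<close>

definition chain_part :: "nat set mpoly \<Rightarrow> nat set mpoly"
  where "chain_part = pm_filter chain_mset"

lemma chain_part_mult: "chain_part (chain_part p * g) = chain_part (p * g)"
proof -
  have "p \<in> {p. \<forall>g. chain_part (chain_part p * g) = chain_part (p * g)}"
  proof (rule in_span_monomials)
    show "pm.subspace {p. \<forall>g. chain_part (chain_part p * g) = chain_part (p * g)}"
      by (auto simp: pm.subspace_def chain_part_def pm_filter_zero pm_filter_add pm_filter_scale distrib_right pm_scale_mult)
    fix k assume "k \<in> Poly_Mapping.keys p"
    show "mon k \<in> {p. \<forall>g. chain_part (chain_part p * g) = chain_part (p * g)}"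
    proof (cases "chain_mset k")
      case False
      have "chain_part (mon k * g) = 0" for g
      proof -
        have "g \<in> {g. chain_part (mon k * g) = 0}"
        proof (rule in_span_monomials)
          show "pm.subspace {g. chain_part (mon k * g) = 0}"
            by (auto simp: pm.subspace_def chain_part_def pm_filter_zero pm_filter_add pm_filter_scale distrib_left mult_pm_scale)
        qed (use not_chain_add[OF False] in \<open>simp add: mult_single chain_part_def pm_filter_single\<close>)
        then show ?thesis by simp
      qed
      then show ?thesis using False by (simp add: chain_part_def pm_filter_single pm_filter_zero)
    qed (simp add: chain_part_def pm_filter_single)
  qed
  then show ?thesis by blast
qed

definition theta_product :: "nat multiset \<Rightarrow> nat set mpoly"
  where "theta_product \<beta> = (\<Prod>i\<in>#\<beta>. theta i)"

text \<open>
  Products of an admissible monomial and of linear relations, reduced to normal form. For the Boolean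
  matroid they form a basis of the span of the chain monomials.
\<close>

definition standard :: "nat set multiset \<times> nat multiset \<Rightarrow> nat set mpoly"
  where "standard = (\<lambda>(b, \<beta>). chain_part (mon b * theta_product \<beta>))"

definition standard_index :: "nat \<Rightarrow> (nat set multiset \<times> nat multiset) set"
  where "standard_index d = {(b, \<beta>). fy_mset b \<and> set_mset \<beta> \<subseteq> {1..n} \<and> size b + size \<beta> = d}"

lemma theta_keys: "k \<in> Poly_Mapping.keys (theta i) \<Longrightarrow> size k = 1"
proof -
  assume k: "k \<in> Poly_Mapping.keys (theta i)"
  have "Poly_Mapping.lookup (theta i) k = (\<Sum>F | F \<in> flats \<and> i \<in> F. Poly_Mapping.lookup (Var F) k)"
    by (simp add: theta_def lookup_sum)
  then obtain F where "Poly_Mapping.lookup (Var F) k \<noteq> 0"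
    using k by (metis (mono_tags, lifting) in_keys_iff sum.neutral)
  then show ?thesis by (auto simp: Var_def lookup_single when_def split: if_splits)
qed

lemma homogeneous_chain_relation:
  assumes "p \<in> chow_relations"
  shows "pm_filter (\<lambda>k. size k = d) (chain_part p) \<in>
    pm.span {chain_part (theta i * mon q) | i q. i \<in> {1..n} \<and> size q + 1 = d}" (is "_ \<in> pm.span ?S")
proof (rule span_image_linear[where f = "\<lambda>p. pm_filter (\<lambda>k. size k = d) (chain_part p)",
      OF _ _ _ _ assms[unfolded chow_relations_def]])
  fix x assume "x \<in> {mon q | q. \<not> chain_mset q} \<union> {theta i * mon q | i q. i \<in> {1..n}}"
  then consider q where "x = mon q" "\<not> chain_mset q" | i q where "x = theta i * mon q" "i \<in> {1..n}" by blast
  then show "pm_filter (\<lambda>k. size k = d) (chain_part x) \<in> pm.span ?S"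
  proof cases
    case 1
    then show ?thesis by (simp add: chain_part_def pm_filter_single pm_filter_zero pm.span_zero)
  next
    case 2
    have size: "size k = size q + 1" if k: "k \<in> Poly_Mapping.keys (chain_part x)" for k
    proof -
      have "k \<in> Poly_Mapping.keys x"
        using k by (auto simp: chain_part_def in_keys_iff lookup_pm_filter split: if_splits)
      then obtain a b where "k = a + b" "a \<in> Poly_Mapping.keys (theta i)" "b \<in> Poly_Mapping.keys (mon q)"
        using keys_mult[of "theta i" "mon q"] 2 by blast
      then show ?thesis using theta_keys by simp
    qed
    show ?thesis
    proof (cases "size q + 1 = d")
      case True
      then have "pm_filter (\<lambda>k. size k = d) (chain_part x) = chain_part x"
        using size by (intro pm_filter_id) auto
      then show ?thesis using 2 True by (auto intro!: pm.span_base)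
    next
      case False
      have "pm_filter (\<lambda>k. size k = d) (chain_part x) = 0"
      proof (rule poly_mapping_eqI)
        fix k
        have "size k = d \<Longrightarrow> k \<notin> Poly_Mapping.keys (chain_part x)" using size False by auto
        then show "Poly_Mapping.lookup (pm_filter (\<lambda>k. size k = d) (chain_part x)) k = Poly_Mapping.lookup 0 k"
          by (simp add: lookup_pm_filter in_keys_iff)
      qed
      then show ?thesis by (simp add: pm.span_zero)
    qed
  qed
qed (auto simp: chain_part_def pm_filter_add pm_filter_scale pm.subspace_span)

lemma chain_theta_span:
  assumes i: "i \<in> {1..n}" and q: "size q + 1 = d"
    and IH: "\<And>q' :: nat set multiset. chain_mset q' \<Longrightarrow> size q' + 1 = d \<Longrightarrow> mon q' \<in> pm.span (standard ` standard_index (d - 1))"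
  shows "chain_part (theta i * mon q) \<in> pm.span (standard ` {(b, \<beta>) \<in> standard_index d. \<beta> \<noteq> {#}})"
proof (cases "chain_mset q")
  case True
  show ?thesis
  proof (rule span_image_linear[where f = "\<lambda>p. chain_part (theta i * p)", OF _ _ _ _ IH[OF True q]])
    fix x assume "x \<in> standard ` standard_index (d - 1)"
    then obtain b \<beta> where x: "x = standard (b, \<beta>)" and b\<beta>: "(b, \<beta>) \<in> standard_index (d - 1)" by auto
    have "chain_part (theta i * x) = chain_part (chain_part (mon b * theta_product \<beta>) * theta i)"
      by (simp add: x standard_def mult.commute)
    also have "\<dots> = standard (b, add_mset i \<beta>)"
      unfolding chain_part_mult by (simp add: standard_def theta_product_def mult_ac)
    finally show "chain_part (theta i * x) \<in> pm.span (standard ` {(b, \<beta>) \<in> standard_index d. \<beta> \<noteq> {#}})"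
      using b\<beta> i q by (auto simp: standard_index_def intro!: pm.span_base)
  qed (auto simp: chain_part_def distrib_left mult_pm_scale pm_filter_add pm_filter_scale pm.subspace_span)
next
  case False
  have "chain_part (theta i * mon q) = chain_part (chain_part (mon q) * theta i)"
    unfolding chain_part_mult by (simp add: mult.commute)
  also have "\<dots> = 0" using False by (simp add: chain_part_def pm_filter_single pm_filter_zero)
  finally show ?thesis by (simp add: pm.span_zero)
qed

text \<open>
  By the spanning theorem a chain monomial is a combination of admissible ones and of relations. In a
  relation \<open>theta i * mon q\<close> the monomial \<open>q\<close> has smaller degree, so it is a combination of standard
  elements by induction.
\<close>

lemma standard_spanning:
  assumes "chain_mset q" "size q = d"
  shows "mon q \<in> pm.span (standard ` standard_index d)"
  using assms
proof (induction d arbitrary: q rule: less_induct)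
  case (less d)
  let ?T = "pm.span (standard ` standard_index d)"
  let ?h = "\<lambda>p. pm_filter (\<lambda>k. size k = d) (chain_part p)"
  have hmon: "?h (mon b) = mon b" if "chain_mset b" "size b = d" for b
    using that by (simp add: chain_part_def pm_filter_single)
  have "?h (mon q) \<in> ?T"
  proof (rule span_image_linear[where f = ?h, OF _ _ _ _ fy_spanning[OF less.prems(2)]])
    fix x assume "x \<in> mon ` fy_set d \<union> chow_relations"
    then show "?h x \<in> ?T"
    proof
      assume "x \<in> mon ` fy_set d"
      then obtain b where b: "x = mon b" "fy_mset b" "size b = d" by (auto simp: fy_set_def)
      then have "chain_mset b" by (simp add: fy_mset_def)
      then have "?h x = standard (b, {#})"
        using b hmon by (simp add: standard_def theta_product_def chain_part_def pm_filter_single)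
      moreover have "(b, {#}) \<in> standard_index d" using b by (simp add: standard_index_def)
      ultimately show ?thesis by (auto intro: pm.span_base)
    next
      assume "x \<in> chow_relations"
      then have "?h x \<in> pm.span {chain_part (theta i * mon q) | i q. i \<in> {1..n} \<and> size q + 1 = d}"
        by (rule homogeneous_chain_relation)
      also have "\<dots> \<subseteq> ?T"
      proof (rule pm.span_minimal[OF _ pm.subspace_span], rule subsetI)
        fix x assume "x \<in> {chain_part (theta i * mon q) | i q. i \<in> {1..n} \<and> size q + 1 = d}"
        then obtain i q' where x: "x = chain_part (theta i * mon q')" and "i \<in> {1..n}" "size q' + 1 = d" by blast
        then have "chain_part (theta i * mon q') \<in> pm.span (standard ` {(b, \<beta>) \<in> standard_index d. \<beta> \<noteq> {#}})"
          using less.IH by (intro chain_theta_span) auto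
        also have "\<dots> \<subseteq> ?T" by (intro pm.span_mono image_mono) auto
        finally show "x \<in> ?T" unfolding x .
      qed
      finally show ?thesis .
    qed
  qed (auto simp: chain_part_def pm_filter_add pm_filter_scale pm.subspace_span)
  then show ?case using hmon less.prems by simp
qed

lemma chain_mset_iff:
  assumes "r = n"
  shows "chain_mset q \<longleftrightarrow> subset_chain n q"
proof -
  have flat: "F \<in> flats \<longleftrightarrow> F \<subseteq> {1..n} \<and> F \<noteq> {}" for F
  proof -
    have "card F < n" if "F \<subset> {1..n}" using psubset_card_mono[OF _ that] by simp
    then show ?thesis unfolding flats_iff using assms by blast
  qed
  have "set_mset q \<subseteq> flats \<longleftrightarrow> (\<forall>F\<in>#q. F \<subseteq> {1..n} \<and> F \<noteq> {})" using flat by blast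
  then show ?thesis unfolding chain_mset_def subset_chain_def by (simp only:)
qed

lemma fy_mset_iff:
  assumes "r = n"
  shows "fy_mset q \<longleftrightarrow> subset_chain n q \<and> admissible (image_mset (levels n q) (mset_set {1..n}))"
proof -
  have rk: "rk F = card F" for F unfolding rk_def using assms by simp
  show ?thesis unfolding fy_mset_def chain_mset_iff[OF assms] rk
    using admissible_levels_iff[of n q] by blast
qed

lemma fy_levels_bij:
  assumes "r = n"
  shows "bij_betw (levels n) (fy_set d) (admissible_functions n d)"
proof -
  have "bij_betw (levels n) {q \<in> {q. subset_chain n q \<and> size q = d}. admissible (image_mset (levels n q) (mset_set {1..n}))}
    {v \<in> max_level_functions n d. admissible (image_mset v (mset_set {1..n}))}"
    by (rule bij_betw_Collect[OF levels_bij]) simp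
  moreover have "{q \<in> {q. subset_chain n q \<and> size q = d}. admissible (image_mset (levels n q) (mset_set {1..n}))} = fy_set d"
    using fy_mset_iff[OF assms] by (auto simp: fy_set_def)
  ultimately show ?thesis by (simp only: admissible_functions_def)
qed

text \<open>
  The numerical heart of the independence proof: the standard family has as many members as there
  are chain monomials.
\<close>

lemma card_standard_index:
  assumes "r = n"
  shows "finite (standard_index d)" "card (standard_index d) = card {q. chain_mset q \<and> size q = d}"
proof -
  let ?M = "\<lambda>k. {\<beta>. set_mset \<beta> \<subseteq> {1..n} \<and> size \<beta> = k}"
  have n: "n \<ge> 1" using r_ge r_le by simp
  have finM: "finite (?M k)" for k by (rule finite_multisets_of_size) simp
  have fin: "finite (fy_set e)" for e
  proof -
    have "finite (admissible_functions n e)" using finite_max_level_functions by (simp add: admissible_functions_def)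
    then show ?thesis using bij_betw_finite[OF fy_levels_bij[OF assms]] by blast
  qed
  have eq: "standard_index d = (\<Union>e\<in>{..d}. fy_set e \<times> ?M (d - e))"
    by (auto simp: standard_index_def fy_set_def)
  show "finite (standard_index d)" unfolding eq using fin finM by blast
  have "card (standard_index d) = (\<Sum>e\<le>d. card (fy_set e \<times> ?M (d - e)))"
    unfolding eq
  proof (rule card_UN_disjoint)
    show "\<forall>i\<in>{..d}. \<forall>j\<in>{..d}. i \<noteq> j \<longrightarrow> (fy_set i \<times> ?M (d - i)) \<inter> (fy_set j \<times> ?M (d - j)) = {}"
      by (auto simp: fy_set_def)
  qed (use fin finM in auto)
  also have "\<dots> = (\<Sum>e\<le>d. card (admissible_functions n e) * card (?M (d - e)))"
    using bij_betw_same_card[OF fy_levels_bij[OF assms]] by (simp add: card_cartesian_product)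
  also have "\<dots> = card (max_level_functions n d)" by (rule hilbert_count[OF n])
  also have "\<dots> = card {q. chain_mset q \<and> size q = d}"
    using bij_betw_same_card[OF levels_bij[of n d]] by (simp add: chain_mset_iff[OF assms])
  finally show "card (standard_index d) = card {q. chain_mset q \<and> size q = d}" .
qed

lemma finite_fy_set: "finite (fy_set d)"
proof (rule finite_subset)
  show "fy_set d \<subseteq> {\<beta>. set_mset \<beta> \<subseteq> flats \<and> size \<beta> = d}"
    by (auto simp: fy_set_def fy_mset_def chain_mset_def)
qed (rule finite_multisets_of_size[OF finite_flats])

text \<open>
  The standard elements of degree \<open>d\<close> are as many as the chain monomials they span, so they form a basis.
  The admissible monomials are the basis elements without factor \<open>theta\<close>, whereas relations
  are combinations of basis elements with such a factor.
\<close>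

lemma fy_independent_boolean:
  assumes rn: "r = n"
    and rel: "(\<Sum>b\<in>fy_set d. pm_scale (c b) (mon b)) \<in> chow_relations" and b0: "b0 \<in> fy_set d"
  shows "c b0 = 0"
proof (rule ccontr)
  assume nz: "c b0 \<noteq> 0"
  let ?I = "standard_index d"
  let ?J = "mon ` {q. chain_mset q \<and> size q = d}"
  let ?h = "\<lambda>p. pm_filter (\<lambda>k. size k = d) (chain_part p)"
  have cardJ: "card ?J = card ?I"
    unfolding card_standard_index(2)[OF rn] by (rule card_image) (rule inj_on_subset[OF inj_mon subset_UNIV])
  have sp: "?J \<subseteq> pm.span (standard ` ?I)" using standard_spanning by blast
  have inj: "inj_on standard ?I" and ind: "\<not> pm.dependent (standard ` ?I)"
    using spanning_family_independent[OF card_standard_index(1)[OF rn] independent_monomials sp] cardJ by simp_all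
  have std: "standard (b, {#}) = mon b" and idx: "(b, {#}) \<in> ?I" and chain: "chain_mset b" if "b \<in> fy_set d" for b
    using that by (auto simp: standard_def theta_product_def chain_part_def pm_filter_single standard_index_def fy_set_def fy_mset_def)
  define p where "p = (\<Sum>b\<in>fy_set d. pm_scale (c b) (mon b))"
  let ?S = "standard ` ?I - {mon b0}"
  have hp: "?h p = p"
  proof -
    have "?h (mon b) = mon b" if "b \<in> fy_set d" for b
      using that chain[OF that] by (simp add: chain_part_def pm_filter_single fy_set_def)
    then show ?thesis unfolding p_def by (simp add: chain_part_def pm_filter_sum pm_filter_scale)
  qed
  have "p \<in> pm.span {chain_part (theta i * mon q) | i q. i \<in> {1..n} \<and> size q + 1 = d}"
    using homogeneous_chain_relation[OF rel, of d] unfolding p_def[symmetric] hp .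
  also have "\<dots> \<subseteq> pm.span ?S"
  proof (rule pm.span_minimal[OF _ pm.subspace_span], rule subsetI)
    fix x assume "x \<in> {chain_part (theta i * mon q) | i q. i \<in> {1..n} \<and> size q + 1 = d}"
    then obtain i q where x: "x = chain_part (theta i * mon q)" and iq: "i \<in> {1..n}" "size q + 1 = d" by blast
    have "chain_part (theta i * mon q) \<in> pm.span (standard ` {(b, \<beta>) \<in> ?I. \<beta> \<noteq> {#}})"
      using iq standard_spanning by (intro chain_theta_span) auto
    also have "\<dots> \<subseteq> pm.span ?S"
    proof (rule pm.span_mono)
      show "standard ` {(b, \<beta>) \<in> ?I. \<beta> \<noteq> {#}} \<subseteq> ?S"
      proof clarify
        fix b \<beta> assume *: "(b, \<beta>) \<in> ?I" "\<beta> \<noteq> {#}"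
        have "standard (b, \<beta>) \<noteq> mon b0"
        proof
          assume "standard (b, \<beta>) = mon b0"
          then have "(b, \<beta>) = (b0, {#})" using inj_onD[OF inj _ *(1) idx[OF b0]] std[OF b0] by simp
          then show False using * by simp
        qed
        then show "standard (b, \<beta>) \<in> ?S" using * by blast
      qed
    qed
    finally show "x \<in> pm.span ?S" unfolding x .
  qed
  finally have pS: "p \<in> pm.span ?S" .
  have rest: "(\<Sum>b\<in>fy_set d - {b0}. pm_scale (c b) (mon b)) \<in> pm.span ?S"
  proof (intro pm.span_sum pm.span_scale pm.span_base)
    fix b assume b: "b \<in> fy_set d - {b0}"
    then have "mon b \<in> standard ` ?I" using std idx by (metis DiffD1 imageI)
    moreover have "mon b \<noteq> mon b0" using b injD[OF inj_mon] by blast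
    ultimately show "mon b \<in> ?S" by blast
  qed
  have "p = pm_scale (c b0) (mon b0) + (\<Sum>b\<in>fy_set d - {b0}. pm_scale (c b) (mon b))"
    unfolding p_def using finite_fy_set b0 by (rule sum.remove)
  then have "pm_scale (c b0) (mon b0) = p - (\<Sum>b\<in>fy_set d - {b0}. pm_scale (c b) (mon b))" by simp
  then have "pm_scale (c b0) (mon b0) \<in> pm.span ?S" using pm.span_diff[OF pS rest] by simp
  then have "pm_scale (inverse (c b0)) (pm_scale (c b0) (mon b0)) \<in> pm.span ?S" by (rule pm.span_scale)
  then have "mon b0 \<in> pm.span ?S" using nz by simp
  moreover have "mon b0 \<in> standard ` ?I" using std[OF b0] idx[OF b0] by (metis imageI)
  ultimately show False using ind unfolding pm.dependent_def by blast
qed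

end

section \<open>Independence for the truncated Boolean matroid\<close>

context
  fixes n r :: nat
  assumes nr: "n = Suc r" and r1: "r \<ge> 1"
begin

interpretation A: uniform_chow n r using nr r1 by unfold_locales auto
interpretation B: uniform_chow n n using nr by unfold_locales auto

text \<open>
  The flats of the truncation are the subsets of \<open>{1..n}\<close> other than the hyperplanes of size \<open>r\<close>. Next to the
  variable of the ground set, the variables of these hyperplanes vanish in the Boolean Chow ring, so
  multiplication by this variable carries the truncated relations to the Boolean ones.
\<close>

lemma truncated_flats: "F \<in> A.flats \<longleftrightarrow> F \<in> B.flats \<and> card F \<noteq> r"
proof -
  have "card F < n" if "F \<subset> {1..n}" using psubset_card_mono[OF _ that] by simp
  moreover have "card {1..n} \<noteq> r" using nr by simp
  ultimately show ?thesis unfolding A.flats_iff B.flats_iff using nr by (cases "F = {1..n}") (auto simp del: One_nat_def)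
qed

lemma top_times_hyperplane:
  assumes "F \<in> B.flats" "card F = r"
  shows "Var {1..n} * Var F \<in> B.chow_relations"
proof -
  have "F \<subseteq> {1..n}" using assms(1) unfolding B.flats_iff by blast
  moreover have "card F \<noteq> card {1..n}" using assms(2) nr by simp
  then have "F \<noteq> {1..n}" by blast
  ultimately have F: "F \<subset> {1..n}" by blast
  have "B.rk {1..n} - B.rk F \<le> 1" unfolding B.rk_def using assms(2) nr by simp
  then have "B.xvar F * B.alpha {1..n} ^ 1 \<in> B.chow_relations"
    using assms(1) by (intro B.xvar_alpha_power[OF B.top_flat _ F]) simp_all
  moreover have "B.alpha {1..n} = Var {1..n}"
  proof -
    have "{H. H \<in> B.flats \<and> {1..n} \<subseteq> H} = {{1..n}}" using B.top_flat by (auto simp: B.flats_iff)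
    then show ?thesis by (simp only: B.alpha_def) simp
  qed
  moreover have "B.xvar F = Var F" using assms by (simp add: B.xvar_def B.flats_iff)
  ultimately show ?thesis by (simp add: mult.commute)
qed

lemma truncation_relations:
  assumes "p \<in> A.chow_relations"
  shows "Var {1..n} * p \<in> B.chow_relations"
proof (rule span_image_linear[where f = "\<lambda>p. Var {1..n} * p",
      OF _ _ _ _ assms[unfolded A.chow_relations_def]])
  fix x assume "x \<in> {mon q | q. \<not> A.chain_mset q} \<union> {A.theta i * mon q | i q. i \<in> {1..n}}"
  then consider q where "x = mon q" "\<not> A.chain_mset q" | i q where "x = A.theta i * mon q" "i \<in> {1..n}" by blast
  then show "Var {1..n} * x \<in> B.chow_relations"
  proof cases
    case 1
    show ?thesis
    proof (cases "B.chain_mset (add_mset {1..n} q)")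
      case True
      then have "\<forall>F\<in>#q. \<forall>G\<in>#q. F \<subseteq> G \<or> G \<subseteq> F" "set_mset q \<subseteq> B.flats"
        by (auto simp: B.chain_mset_def)
      then obtain F where F: "F \<in># q" "F \<in> B.flats" "F \<notin> A.flats"
        using 1(2) unfolding A.chain_mset_def by blast
      then obtain q' where q': "q = add_mset F q'" by (metis insert_DiffM)
      have "Var {1..n} * Var F * mon q' \<in> B.chow_relations"
      proof (rule B.relations_mult[OF top_times_hyperplane])
        show "card F = r" using F truncated_flats by blast
      qed (rule F)
      then show ?thesis unfolding 1(1) q' Var_times_mon[symmetric] by (simp add: mult.assoc)
    next
      case False
      then show ?thesis unfolding 1(1) Var_times_mon by (rule B.mon_relation)
    qed
  next
    case 2
    have fin: "finite {F. F \<in> B.flats \<and> P F}" for P using B.finite_flats by simp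
    have "{F. F \<in> B.flats \<and> i \<in> F} = {F. F \<in> A.flats \<and> i \<in> F} \<union> {F. F \<in> B.flats \<and> (card F = r \<and> i \<in> F)}"
      using truncated_flats by blast
    then have "B.theta i = A.theta i + (\<Sum>F | F \<in> B.flats \<and> (card F = r \<and> i \<in> F). Var F)"
      unfolding A.theta_def B.theta_def using fin truncated_flats A.finite_flats
      by (simp only:) (rule sum.union_disjoint, auto simp del: One_nat_def)
    then have "Var {1..n} * A.theta i = Var {1..n} * B.theta i
        - (\<Sum>F | F \<in> B.flats \<and> (card F = r \<and> i \<in> F). Var {1..n} * Var F)"
      by (simp add: distrib_left sum_distrib_left del: One_nat_def)
    also have "\<dots> \<in> B.chow_relations"
    proof (intro B.relations_diff B.relations_sum)
      show "Var {1..n} * B.theta i \<in> B.chow_relations"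
        using B.theta_relation[OF 2(2), of "{#}"] B.relations_mult_left by simp
    qed (use top_times_hyperplane in auto)
    finally show ?thesis unfolding 2(1) mult.assoc[symmetric] by (rule B.relations_mult)
  qed
qed (auto simp: distrib_left mult_pm_scale B.relations_subspace)

text \<open>
  Both ranks agree on the members of \<open>q\<close> other than the ground set, and the additional factor makes up for
  the rank of the ground set, which is larger by one.
\<close>

lemma truncated_fy_iff: "A.fy_mset q \<longleftrightarrow> B.fy_mset (add_mset {1..n} q)"
proof -
  let ?E = "{1..n}"
  have chain: "B.chain_mset (add_mset ?E q) \<longleftrightarrow> B.chain_mset q"
  proof
    have "?E \<noteq> {}" using nr by simp
    assume "B.chain_mset q"
    then have c: "\<forall>F\<in>#q. F \<subseteq> ?E \<and> F \<noteq> {}" "\<forall>F\<in>#q. \<forall>G\<in>#q. F \<subseteq> G \<or> G \<subseteq> F"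
      unfolding B.chain_mset_iff[OF refl] subset_chain_def by blast+
    show "B.chain_mset (add_mset ?E q)"
      unfolding B.chain_mset_iff[OF refl] subset_chain_def
    proof (intro conjI ballI)
      fix F G assume F: "F \<in># add_mset ?E q"
      have "F \<subseteq> ?E \<and> F \<noteq> {}" using F c(1) \<open>?E \<noteq> {}\<close> unfolding set_mset_add_mset_insert by blast
      then show "F \<subseteq> ?E" "F \<noteq> {}" by blast+
      assume G: "G \<in># add_mset ?E q"
      consider "F = ?E" | "G = ?E" | "F \<in># q" "G \<in># q" using F G by (auto simp del: One_nat_def)
      then show "F \<subseteq> G \<or> G \<subseteq> F"
      proof cases
        case 1
        then show ?thesis using G c(1) unfolding set_mset_add_mset_insert by blast
      next
        case 2
        then show ?thesis using F c(1) unfolding set_mset_add_mset_insert by blast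
      next
        case 3
        then show ?thesis using c(2) by blast
      qed
    qed
  qed (auto simp: B.chain_mset_def)
  have Ac: "A.chain_mset q \<longleftrightarrow> B.chain_mset q \<and> (\<forall>F\<in>#q. card F \<noteq> r)"
    unfolding A.chain_mset_def B.chain_mset_def using truncated_flats by blast
  have rkA: "A.rk F = (if F = ?E then r else card F)" and rkB: "B.rk F = card F" for F
    by (simp_all add: A.rk_def B.rk_def)
  have Fn: "F \<subseteq> ?E" if "B.chain_mset q" "F \<in> insert {} (set_mset q)" for F
    using that unfolding B.chain_mset_iff[OF refl] subset_chain_def by blast
  have small: "card F < n" if "B.chain_mset q" "F \<in> insert {} (set_mset q)" "F \<noteq> ?E" for F
    using psubset_card_mono[of ?E F] Fn[OF that(1,2)] that(3) by auto
  show ?thesis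
  proof
    assume fy: "A.fy_mset q"
    then have c: "B.chain_mset q" and nc: "\<forall>F\<in>#q. card F \<noteq> r" using Ac by (auto simp: A.fy_mset_def)
    show "B.fy_mset (add_mset ?E q)"
      unfolding B.fy_mset_def chain
    proof (intro conjI ballI impI c)
      fix F G assume F: "F \<in># add_mset ?E q" and G: "G \<in> insert {} (set_mset (add_mset ?E q))" and GF: "G \<subset> F"
      have "F \<subseteq> ?E" using F Fn[OF c] by auto
      then have GE: "G \<noteq> ?E" using GF by blast
      then have Gq: "G \<in> insert {} (set_mset q)" using G by auto
      have Gs: "card G < r" 
      proof (cases "G = {}")
        case True
        then show ?thesis using r1 by simp
      next
        case False
        then have "card G \<noteq> r" using nc Gq by blast
        then show ?thesis using small[OF c Gq GE] nr by simp
      qed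
      show "count (add_mset ?E q) F < B.rk F - B.rk G"
      proof (cases "F \<in># q")
        case True
        then have "count q F < A.rk F - A.rk G" using fy Gq GF unfolding A.fy_mset_def by blast
        show ?thesis
        proof (cases "F = ?E")
          case True
          then have "count q ?E < r - card G" using \<open>count q F < A.rk F - A.rk G\<close> GE unfolding rkA by simp
          then show ?thesis using True Gs nr unfolding rkB by simp
        next
          case False
          then show ?thesis using \<open>count q F < A.rk F - A.rk G\<close> GE unfolding rkA rkB by simp
        qed
      next
        case False
        then have "F = ?E" using F unfolding set_mset_add_mset_insert by blast
        moreover have "count q F = 0" using False by (simp add: not_in_iff)
        ultimately show ?thesis using Gs nr unfolding rkB by simp
      qed
    qed
  next
    assume fy: "B.fy_mset (add_mset ?E q)"
    then have c: "B.chain_mset q" using chain by (simp add: B.fy_mset_def)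
    have top: "count q ?E + 1 < n - card G" if "G \<in># q" "G \<noteq> ?E" for G
    proof -
      have "G \<subset> ?E" using Fn[OF c, of G] that by auto
      then have "count (add_mset ?E q) ?E < B.rk ?E - B.rk G" using fy that unfolding B.fy_mset_def by auto
      then show ?thesis by (simp add: rkB)
    qed
    have top0: "count q ?E + 1 < n"
    proof -
      have "{} \<subset> ?E" using nr by auto
      then have "count (add_mset ?E q) ?E < B.rk ?E - B.rk {}" using fy unfolding B.fy_mset_def by auto
      then show ?thesis by (simp add: rkB)
    qed
    have nc: "card F \<noteq> r" if "F \<in># q" for F
      using top[OF that] nr by (cases "F = ?E") auto
    show "A.fy_mset q"
      unfolding A.fy_mset_def
    proof (intro conjI ballI impI)
      show "A.chain_mset q" using Ac c nc by blast
      fix F G assume F: "F \<in># q" and G: "G \<in> insert {} (set_mset q)" and GF: "G \<subset> F"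
      have GE: "G \<noteq> ?E" using GF F Fn[OF c, of F] by blast
      show "count q F < A.rk F - A.rk G"
      proof (cases "F = ?E")
        case True
        have "count q ?E + 1 < n - card G"
        proof (cases "G = {}")
          case True
          then show ?thesis using top0 by simp
        next
          case False
          then show ?thesis using G GE by (intro top) auto
        qed
        then show ?thesis unfolding rkA using True GE nr by simp
      next
        case False
        have "F \<in># add_mset ?E q" "G \<in> insert {} (set_mset (add_mset ?E q))"
          using F G unfolding set_mset_add_mset_insert by blast+
        then have "count (add_mset ?E q) F < B.rk F - B.rk G" using fy GF unfolding B.fy_mset_def by blast
        then show ?thesis using False GE unfolding rkA rkB by simp
      qed
    qed
  qed
qed

text \<open>
  Multiplication by the variable of the ground set maps the admissible monomials injectively to Boolean ones.
\<close>

lemma fy_independent_truncated: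
  assumes rel: "(\<Sum>b\<in>A.fy_set d. pm_scale (c b) (mon b)) \<in> A.chow_relations" and b0: "b0 \<in> A.fy_set d"
  shows "c b0 = 0"
proof -
  let ?E = "{1..n}"
  \<comment> \<open>The coefficients after multiplication by the variable of the ground set.\<close>
  define c' where "c' b = (if ?E \<in># b then c (b - {#?E#}) else 0)" for b
  have sub: "add_mset ?E ` A.fy_set d \<subseteq> B.fy_set (Suc d)"
    using truncated_fy_iff by (auto simp: A.fy_set_def B.fy_set_def)
  have "(\<Sum>b\<in>B.fy_set (Suc d). pm_scale (c' b) (mon b)) = (\<Sum>b\<in>add_mset ?E ` A.fy_set d. pm_scale (c' b) (mon b))"
  proof (rule sum.mono_neutral_right[OF B.finite_fy_set sub], intro ballI)
    fix b assume b: "b \<in> B.fy_set (Suc d) - add_mset ?E ` A.fy_set d"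
    have "?E \<notin># b"
    proof
      assume "?E \<in># b"
      then obtain q where q: "b = add_mset ?E q" by (metis insert_DiffM)
      then have "q \<in> A.fy_set d" using b truncated_fy_iff by (auto simp: A.fy_set_def B.fy_set_def)
      then show False using b q by blast
    qed
    then show "pm_scale (c' b) (mon b) = 0" by (simp add: c'_def)
  qed
  also have "\<dots> = (\<Sum>b\<in>A.fy_set d. pm_scale (c b) (Var ?E * mon b))"
    by (subst sum.reindex) (auto simp: inj_on_def c'_def Var_times_mon)
  also have "\<dots> = Var ?E * (\<Sum>b\<in>A.fy_set d. pm_scale (c b) (mon b))"
    by (simp add: sum_distrib_left mult_pm_scale)
  also have "\<dots> \<in> B.chow_relations" using rel by (rule truncation_relations)
  finally have "c' (add_mset ?E b0) = 0"
    using sub b0 by (intro B.fy_independent_boolean[where c = c' and d = "Suc d"]) auto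
  then show ?thesis by (simp add: c'_def)
qed

text \<open>
  Divisibility by the variable of the ground set means that all levels are positive.
\<close>

lemma truncated_levels_bij:
  "bij_betw (\<lambda>b. levels n (add_mset {1..n} b)) (A.fy_set d)
    {v \<in> admissible_functions n (Suc d). \<forall>i\<in>{1..n}. v i > 0}"
proof -
  let ?E = "{1..n}"
  have "bij_betw (levels n) {b \<in> B.fy_set (Suc d). ?E \<in># b} {v \<in> admissible_functions n (Suc d). \<forall>i\<in>?E. v i > 0}"
  proof (rule bij_betw_Collect[OF B.fy_levels_bij[OF refl]])
    fix b assume b: "b \<in> B.fy_set (Suc d)"
    then have c: "subset_chain n b" using B.chain_mset_iff by (simp add: B.fy_set_def B.fy_mset_def)
    show "(\<forall>i\<in>?E. levels n b i > 0) = (?E \<in># b)"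
    proof
      assume pos: "\<forall>i\<in>?E. levels n b i > 0"
      have "superlevel n (levels n b) 1 = ?E" using pos by (auto simp: superlevel_def Suc_le_eq)
      moreover have "superlevel n (levels n b) 1 \<in># chain_of n (levels n b) (size b)"
        using b by (auto simp: chain_of_def B.fy_set_def)
      ultimately show "?E \<in># b" unfolding subset_chain_recover[OF c] by simp
    next
      assume "?E \<in># b"
      then obtain q where q: "b = add_mset ?E q" by (metis insert_DiffM)
      then show "\<forall>i\<in>?E. levels n b i > 0" by (auto simp: levels_def)
    qed
  qed
  moreover have "bij_betw (add_mset ?E) (A.fy_set d) {b \<in> B.fy_set (Suc d). ?E \<in># b}"
    unfolding bij_betw_def
  proof
    show "add_mset ?E ` A.fy_set d = {b \<in> B.fy_set (Suc d). ?E \<in># b}"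
    proof
      show "{b \<in> B.fy_set (Suc d). ?E \<in># b} \<subseteq> add_mset ?E ` A.fy_set d"
      proof
        fix b assume b: "b \<in> {b \<in> B.fy_set (Suc d). ?E \<in># b}"
        then obtain q where q: "b = add_mset ?E q" by (metis (no_types, lifting) insert_DiffM mem_Collect_eq)
        then have "q \<in> A.fy_set d" using b truncated_fy_iff by (auto simp: A.fy_set_def B.fy_set_def)
        then show "b \<in> add_mset ?E ` A.fy_set d" using q by blast
      qed
    qed (use truncated_fy_iff in \<open>auto simp: A.fy_set_def B.fy_set_def\<close>)
  qed (simp add: inj_on_def)
  ultimately show ?thesis using bij_betw_trans[of "add_mset ?E" _ _ "levels n"] by (simp add: comp_def)
qed

end

section \<open>Traces and extension of scalars\<close>

text \<open>
  A finite-dimensional vector space presented by a linear isomorphism \<open>\<kappa>\<close> to the functions on \<open>I\<close>. The laws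
  of addition follow from the injectivity of \<open>\<kappa>\<close>.
\<close>

locale coordinatized =
  fixes W :: "('k :: field, 'c) module" (structure)
    and \<kappa> :: "'c \<Rightarrow> 'i \<Rightarrow> 'k" and I :: "'i set"
  assumes finite_I: "finite I"
    and add_closed: "x \<in> carrier W \<Longrightarrow> y \<in> carrier W \<Longrightarrow> x \<oplus> y \<in> carrier W"
    and zero_closed: "\<zero> \<in> carrier W"
    and smult_closed: "x \<in> carrier W \<Longrightarrow> c \<odot> x \<in> carrier W"
    and coord_add: "x \<in> carrier W \<Longrightarrow> y \<in> carrier W \<Longrightarrow> i \<in> I \<Longrightarrow> \<kappa> (x \<oplus> y) i = \<kappa> x i + \<kappa> y i"
    and coord_zero: "i \<in> I \<Longrightarrow> \<kappa> \<zero> i = 0"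
    and coord_smult: "x \<in> carrier W \<Longrightarrow> i \<in> I \<Longrightarrow> \<kappa> (c \<odot> x) i = c * \<kappa> x i"
    and coord_inj: "x \<in> carrier W \<Longrightarrow> y \<in> carrier W \<Longrightarrow> (\<And>i. i \<in> I \<Longrightarrow> \<kappa> x i = \<kappa> y i) \<Longrightarrow> x = y"
    and coord_unit: "i \<in> I \<Longrightarrow> \<exists>e\<in>carrier W. \<forall>j\<in>I. \<kappa> e j = (if i = j then 1 else 0)"
begin

sublocale abelian_monoid W
  by (rule abelian_monoidI)
     (auto intro!: coord_inj add_closed zero_closed simp: coord_add coord_zero add_closed zero_closed algebra_simps)

definition unit :: "'i \<Rightarrow> 'c"
  where "unit i = (SOME e. e \<in> carrier W \<and> (\<forall>j\<in>I. \<kappa> e j = (if i = j then 1 else 0)))"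

lemma unit:
  assumes "i \<in> I"
  shows "unit i \<in> carrier W" and "j \<in> I \<Longrightarrow> \<kappa> (unit i) j = (if i = j then 1 else 0)"
proof -
  have *: "unit i \<in> carrier W \<and> (\<forall>j\<in>I. \<kappa> (unit i) j = (if i = j then 1 else 0))"
    unfolding unit_def by (rule someI_ex) (use coord_unit[OF assms] in blast)
  show "unit i \<in> carrier W" using * ..
  assume "j \<in> I"
  then show "\<kappa> (unit i) j = (if i = j then 1 else 0)" using * by blast
qed

lemma coord_finsum:
  assumes "finite B" "g \<in> B \<rightarrow> carrier W" "i \<in> I"
  shows "\<kappa> (\<Oplus>b\<in>B. g b) i = (\<Sum>b\<in>B. \<kappa> (g b) i)"
  using assms(1,2)
proof (induction B rule: finite_induct)
  case empty
  then show ?case using assms(3) by (simp add: coord_zero)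
next
  case (insert b B)
  then have "g \<in> B \<rightarrow> carrier W" "g b \<in> carrier W" by auto
  then show ?case using insert assms(3) by (simp add: finsum_insert coord_add finsum_closed)
qed

lemma expand_units: "v \<in> carrier W \<Longrightarrow> v = (\<Oplus>i\<in>I. \<kappa> v i \<odot> unit i)"
proof (rule coord_inj)
  assume v: "v \<in> carrier W"
  have cl: "(\<lambda>i. \<kappa> v i \<odot> unit i) \<in> I \<rightarrow> carrier W" using unit smult_closed by blast
  then show "(\<Oplus>i\<in>I. \<kappa> v i \<odot> unit i) \<in> carrier W" by (rule finsum_closed)
  fix j assume j: "j \<in> I"
  have "\<kappa> (\<Oplus>i\<in>I. \<kappa> v i \<odot> unit i) j = (\<Sum>i\<in>I. \<kappa> v i * (if i = j then 1 else 0))"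
    using cl j unit by (simp add: coord_finsum[OF finite_I] coord_smult)
  then show "\<kappa> v j = \<kappa> (\<Oplus>i\<in>I. \<kappa> v i \<odot> unit i) j" using j finite_I by (simp add: if_distrib cong: if_cong)
qed

end

locale complex_coordinatized = coordinatized W \<kappa> I
  for W :: "(complex, 'c) module" (structure) and \<kappa> :: "'c \<Rightarrow> 'i \<Rightarrow> complex" and I
begin

lemma is_coords_iff:
  assumes "finite B" "B \<subseteq> carrier W" "v \<in> carrier W"
  shows "is_coords W B v c \<longleftrightarrow> c \<in> B \<rightarrow>\<^sub>E UNIV \<and> (\<forall>i\<in>I. \<kappa> v i = (\<Sum>b\<in>B. c b * \<kappa> b i))"
proof -
  have cl: "(\<lambda>b. c b \<odot> b) \<in> B \<rightarrow> carrier W" using assms smult_closed by blast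
  have "\<kappa> (\<Oplus>b\<in>B. c b \<odot> b) i = (\<Sum>b\<in>B. c b * \<kappa> b i)" if "i \<in> I" for i
    using coord_finsum[OF assms(1) cl that] assms that by (auto simp: coord_smult subset_iff intro!: sum.cong)
  moreover have "(\<Oplus>b\<in>B. c b \<odot> b) \<in> carrier W" using cl by (rule finsum_closed)
  ultimately have "v = (\<Oplus>b\<in>B. c b \<odot> b) \<longleftrightarrow> (\<forall>i\<in>I. \<kappa> v i = (\<Sum>b\<in>B. c b * \<kappa> b i))"
    using coord_inj[OF assms(3), of "\<Oplus>b\<in>B. c b \<odot> b"] by auto
  then show ?thesis by (simp add: is_coords_def)
qed

lemma units_basis: "is_basis W (unit ` I)"
  unfolding is_basis_def
proof (intro conjI ballI)
  show "finite (unit ` I)" using finite_I by simp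
  show sub: "unit ` I \<subseteq> carrier W" using unit by blast
  have inj: "inj_on unit I"
  proof (rule inj_onI)
    fix i j assume ij: "i \<in> I" "j \<in> I" "unit i = unit j"
    then have "\<kappa> (unit i) j = 1" using unit(2)[of j j] by simp
    then show "i = j" using unit(2)[of i j] ij by (simp split: if_splits)
  qed
  fix v assume v: "v \<in> carrier W"
  have sum: "(\<Sum>b\<in>unit ` I. c b * \<kappa> b i) = c (unit i)" if "i \<in> I" for c i
  proof -
    have "(\<Sum>b\<in>unit ` I. c b * \<kappa> b i) = (\<Sum>j\<in>I. c (unit j) * \<kappa> (unit j) i)"
      using inj by (simp add: sum.reindex)
    also have "\<dots> = (\<Sum>j\<in>I. if j = i then c (unit j) else 0)" using unit that by (intro sum.cong) auto
    finally show ?thesis using that finite_I by simp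
  qed
  have coords: "is_coords W (unit ` I) v c \<longleftrightarrow> c \<in> unit ` I \<rightarrow>\<^sub>E UNIV \<and> (\<forall>i\<in>I. c (unit i) = \<kappa> v i)" for c
    using is_coords_iff[OF _ sub v] finite_I sum by auto
  show "\<exists>!c. is_coords W (unit ` I) v c"
  proof (rule ex1I)
    show "is_coords W (unit ` I) v (\<lambda>b\<in>unit ` I. \<kappa> v (inv_into I unit b))"
      unfolding coords using inj by simp
    fix c assume "is_coords W (unit ` I) v c"
    then show "c = (\<lambda>b\<in>unit ` I. \<kappa> v (inv_into I unit b))"
      unfolding coords using inj by (auto simp: PiE_def extensional_def fun_eq_iff)
  qed
qed

text \<open>
  The trace does not depend on the basis: with \<open>\<gamma>\<close> the coordinates in the chosen basis, \<open>\<gamma>\<close> and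
  \<open>\<kappa>\<close> are inverse changes of coordinates, and the double sum collapses.
\<close>

lemma lin_trace_eq:
  assumes f: "\<And>x. x \<in> carrier W \<Longrightarrow> f x \<in> carrier W"
    and A: "\<And>x i. x \<in> carrier W \<Longrightarrow> i \<in> I \<Longrightarrow> \<kappa> (f x) i = (\<Sum>j\<in>I. A i j * \<kappa> x j)"
  shows "lin_trace W f = (\<Sum>i\<in>I. A i i)"
proof -
  define B where "B = (SOME B. is_basis W B)"
  have "is_basis W B" unfolding B_def by (rule someI[of "is_basis W", OF units_basis])
  then have B: "finite B" "B \<subseteq> carrier W" and ex1: "\<And>v. v \<in> carrier W \<Longrightarrow> \<exists>!c. is_coords W B v c"
    by (auto simp: is_basis_def)
  define \<gamma> where "\<gamma> v = (THE c. is_coords W B v c)" for v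
  have coords_\<gamma>: "is_coords W B v (\<gamma> v)" if "v \<in> carrier W" for v
    unfolding \<gamma>_def by (rule theI'[OF ex1[OF that]])
  then have \<gamma>: "\<kappa> v i = (\<Sum>b\<in>B. \<gamma> v b * \<kappa> b i)" if "v \<in> carrier W" "i \<in> I" for v i
    using is_coords_iff[OF B] that by blast
  have \<gamma>_eq: "\<gamma> v b = (\<Sum>i\<in>I. \<kappa> v i * \<gamma> (unit i) b)" if v: "v \<in> carrier W" and b: "b \<in> B" for v b
  proof -
    let ?c = "\<lambda>b\<in>B. \<Sum>i\<in>I. \<kappa> v i * \<gamma> (unit i) b"
    have c_eq: "\<kappa> v j = (\<Sum>b\<in>B. ?c b * \<kappa> b j)" if j: "j \<in> I" for j
    proof -
      have "(\<Sum>b\<in>B. ?c b * \<kappa> b j) = (\<Sum>b\<in>B. \<Sum>i\<in>I. \<kappa> v i * (\<gamma> (unit i) b * \<kappa> b j))"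
        by (intro sum.cong refl) (simp add: sum_distrib_right mult.assoc)
      also have "\<dots> = (\<Sum>i\<in>I. \<kappa> v i * (\<Sum>b\<in>B. \<gamma> (unit i) b * \<kappa> b j))"
        by (subst sum.swap) (simp add: sum_distrib_left)
      also have "\<dots> = (\<Sum>i\<in>I. \<kappa> v i * \<kappa> (unit i) j)" using \<gamma>[OF unit(1) j] by (intro sum.cong) auto
      also have "\<dots> = (\<Sum>i\<in>I. if i = j then \<kappa> v i else 0)" using unit(2)[OF _ j] by (intro sum.cong) auto
      finally show ?thesis using j finite_I by simp
    qed
    have "?c \<in> B \<rightarrow>\<^sub>E UNIV" by simp
    then have "is_coords W B v ?c" unfolding is_coords_iff[OF B v] using c_eq by blast
    then have "\<gamma> v = ?c" using coords_\<gamma>[OF v] ex1[OF v] by blast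
    then show ?thesis using b by (simp only: restrict_apply) simp
  qed
  have "lin_trace W f = (\<Sum>b\<in>B. \<gamma> (f b) b)" by (simp add: lin_trace_def B_def \<gamma>_def Let_def)
  also have "\<dots> = (\<Sum>b\<in>B. \<Sum>i\<in>I. (\<Sum>j\<in>I. A i j * \<kappa> b j) * \<gamma> (unit i) b)"
    using B f by (intro sum.cong refl) (auto simp: \<gamma>_eq A subset_iff)
  also have "\<dots> = (\<Sum>i\<in>I. \<Sum>j\<in>I. A i j * (\<Sum>b\<in>B. \<gamma> (unit i) b * \<kappa> b j))"
  proof -
    have "(\<Sum>b\<in>B. \<Sum>i\<in>I. (\<Sum>j\<in>I. A i j * \<kappa> b j) * \<gamma> (unit i) b)
        = (\<Sum>i\<in>I. \<Sum>b\<in>B. \<Sum>j\<in>I. A i j * (\<gamma> (unit i) b * \<kappa> b j))"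
      by (subst sum.swap) (simp add: sum_distrib_right sum_distrib_left mult_ac)
    also have "\<dots> = (\<Sum>i\<in>I. \<Sum>j\<in>I. \<Sum>b\<in>B. A i j * (\<gamma> (unit i) b * \<kappa> b j))"
      by (intro sum.cong refl) (rule sum.swap)
    finally show ?thesis by (simp add: sum_distrib_left)
  qed
  also have "\<dots> = (\<Sum>i\<in>I. \<Sum>j\<in>I. if i = j then A i j else 0)"
  proof (intro sum.cong refl)
    fix i j assume ij: "i \<in> I" "j \<in> I"
    have "(\<Sum>b\<in>B. \<gamma> (unit i) b * \<kappa> b j) = \<kappa> (unit i) j" using \<gamma>[OF unit(1)] ij by simp
    then show "A i j * (\<Sum>b\<in>B. \<gamma> (unit i) b * \<kappa> b j) = (if i = j then A i j else 0)"
      using unit(2) ij by simp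
  qed
  also have "\<dots> = (\<Sum>i\<in>I. A i i)" using finite_I by (intro sum.cong refl) simp
  finally show ?thesis .
qed

end

lemma mem_free_coset: "x \<in> N +>\<^bsub>free_module S\<^esub> p \<longleftrightarrow> (\<exists>h\<in>N. x = h + p)"
  by (simp add: a_r_coset_def' free_module_def)

locale rational_coordinatized = coordinatized V \<kappa> I
  for V :: "(rat, 'c) module" (structure) and \<kappa> :: "'c \<Rightarrow> 'i \<Rightarrow> rat" and I
begin

text \<open>
  The complex-linear extension of \<open>\<kappa>\<close> to the free vector space on the symbols \<open>1 \<otimes> v\<close>.
\<close>

definition extended_coord :: "('c \<Rightarrow>\<^sub>0 complex) \<Rightarrow> 'i \<Rightarrow> complex"
  where "extended_coord p i = (\<Sum>v\<in>Poly_Mapping.keys p. Poly_Mapping.lookup p v * of_rat (\<kappa> v i))"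

abbreviation T :: "('c \<Rightarrow>\<^sub>0 complex) set"
  where "T \<equiv> tensor_rels V"

abbreviation M :: "(complex, 'c \<Rightarrow>\<^sub>0 complex) module"
  where "M \<equiv> free_module (carrier V)"

lemma extended_coord_superset:
  "finite K \<Longrightarrow> Poly_Mapping.keys p \<subseteq> K \<Longrightarrow>
    extended_coord p i = (\<Sum>v\<in>K. Poly_Mapping.lookup p v * of_rat (\<kappa> v i))"
  unfolding extended_coord_def by (rule sum.mono_neutral_left) (auto simp: in_keys_iff)

lemma extended_coord_add: "extended_coord (p + q) i = extended_coord p i + extended_coord q i"
proof -
  let ?K = "Poly_Mapping.keys p \<union> Poly_Mapping.keys q"
  have "Poly_Mapping.keys (p + q) \<subseteq> ?K" by (rule keys_add)
  then show ?thesis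
    by (simp add: extended_coord_superset[of ?K] lookup_add distrib_right sum.distrib)
qed

lemma extended_coord_scale: "extended_coord (pm_scale c p) i = c * extended_coord p i"
proof -
  have "Poly_Mapping.keys (pm_scale c p) \<subseteq> Poly_Mapping.keys p" by (auto simp: in_keys_iff lookup_pm_scale)
  then show ?thesis
    by (simp add: extended_coord_superset[of "Poly_Mapping.keys p"] lookup_pm_scale sum_distrib_left mult.assoc)
qed

lemma extended_coord_single: "extended_coord (Poly_Mapping.single v c) i = c * of_rat (\<kappa> v i)"
  by (simp add: extended_coord_def)

lemma extended_coord_zero: "extended_coord 0 i = 0"
  by (simp add: extended_coord_def)

lemma extended_coord_diff: "extended_coord (p - q) i = extended_coord p i - extended_coord q i"
proof -
  have "p - q = p + pm_scale (-1) q" by (rule poly_mapping_eqI) (simp add: lookup_add lookup_minus lookup_pm_scale)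
  show ?thesis unfolding \<open>p - q = p + pm_scale (-1) q\<close> extended_coord_add extended_coord_scale by simp
qed

lemma T_subspace: "pm.subspace T"
  unfolding tensor_rels_def by (rule pm.subspace_span)

lemma T_keys: "p \<in> T \<Longrightarrow> Poly_Mapping.keys p \<subseteq> carrier V"
proof -
  assume p: "p \<in> T"
  have sub: "pm.subspace {p :: 'c \<Rightarrow>\<^sub>0 complex. Poly_Mapping.keys p \<subseteq> carrier V}"
    unfolding pm.subspace_def by (auto simp: in_keys_iff lookup_add lookup_pm_scale subset_iff) (metis add_0)
  have single: "Poly_Mapping.single v c \<in> {p :: 'c \<Rightarrow>\<^sub>0 complex. Poly_Mapping.keys p \<subseteq> carrier V}" if "v \<in> carrier V" for v c
    using that by (simp split: if_splits)
  have "T \<subseteq> {p. Poly_Mapping.keys p \<subseteq> carrier V}"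
    unfolding tensor_rels_def
  proof (rule pm.span_minimal[OF _ sub], rule Un_least; rule subsetI)
    fix x :: "'c \<Rightarrow>\<^sub>0 complex"
    assume "x \<in> {Poly_Mapping.single (v \<oplus> w) 1 - Poly_Mapping.single v 1 - Poly_Mapping.single w 1 | v w.
        v \<in> carrier V \<and> w \<in> carrier V}"
    then obtain v w where x: "x = Poly_Mapping.single (v \<oplus> w) 1 - Poly_Mapping.single v 1 - Poly_Mapping.single w 1"
      "v \<in> carrier V" "w \<in> carrier V" by blast
    show "x \<in> {p. Poly_Mapping.keys p \<subseteq> carrier V}"
      unfolding x(1) by (intro pm.subspace_diff[OF sub] single add_closed x(2,3))
  next
    fix x :: "'c \<Rightarrow>\<^sub>0 complex"
    assume "x \<in> {Poly_Mapping.single (q \<odot> v) 1 - Poly_Mapping.single v (of_rat q) | q v. v \<in> carrier V}"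
    then obtain q v where x: "x = Poly_Mapping.single (q \<odot> v) 1 - Poly_Mapping.single v (of_rat q)"
      "v \<in> carrier V" by blast
    show "x \<in> {p. Poly_Mapping.keys p \<subseteq> carrier V}"
      unfolding x(1) by (intro pm.subspace_diff[OF sub] single smult_closed x(2))
  qed
  then show ?thesis using p by blast
qed

lemma T_coord: "p \<in> T \<Longrightarrow> i \<in> I \<Longrightarrow> extended_coord p i = 0"
  unfolding tensor_rels_def
proof (induction rule: pm.span_induct_alt)
  case (step c x y)
  have "extended_coord x i = 0"
    using step(1,3) by (auto simp: extended_coord_diff extended_coord_single coord_add coord_smult of_rat_add of_rat_mult)
  then show ?case using step by (simp add: extended_coord_add extended_coord_scale)
qed (simp add: extended_coord_zero)

lemma T_add: "v \<in> carrier V \<Longrightarrow> w \<in> carrier V \<Longrightarrow>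
    Poly_Mapping.single (v \<oplus> w) 1 - Poly_Mapping.single v 1 - Poly_Mapping.single w 1 \<in> T"
  unfolding tensor_rels_def by (rule pm.span_base) blast

lemma T_smult: "v \<in> carrier V \<Longrightarrow> Poly_Mapping.single (q \<odot> v) 1 - Poly_Mapping.single v (of_rat q) \<in> T"
  unfolding tensor_rels_def by (rule pm.span_base) blast

lemma T_finsum:
  assumes "finite J" "g \<in> J \<rightarrow> carrier V"
  shows "Poly_Mapping.single (\<Oplus>j\<in>J. g j) 1 - (\<Sum>j\<in>J. Poly_Mapping.single (g j) 1) \<in> T"
  using assms
proof (induction J rule: finite_induct)
  case empty
  have "Poly_Mapping.single \<zero> 1 - Poly_Mapping.single \<zero> 1 - Poly_Mapping.single \<zero> 1 \<in> T"
    using T_add[OF zero_closed zero_closed] zero_closed by simp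
  then have "- (- Poly_Mapping.single \<zero> 1) \<in> T" using pm.subspace_neg[OF T_subspace] by fastforce
  then show ?case by simp
next
  case (insert a J)
  then have g: "g \<in> J \<rightarrow> carrier V" "g a \<in> carrier V" by auto
  have "(Poly_Mapping.single (g a \<oplus> (\<Oplus>j\<in>J. g j)) 1 - Poly_Mapping.single (g a) 1 - Poly_Mapping.single (\<Oplus>j\<in>J. g j) 1)
      + (Poly_Mapping.single (\<Oplus>j\<in>J. g j) 1 - (\<Sum>j\<in>J. Poly_Mapping.single (g j) 1)) \<in> T"
    using insert.IH[OF g(1)] g finsum_closed[OF g(1)] by (intro pm.subspace_add[OF T_subspace] T_add) auto
  then show ?case using insert.hyps g by (simp add: finsum_insert diff_diff_eq)
qed

lemma T_expand_single:
  assumes v: "v \<in> carrier V"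
  shows "Poly_Mapping.single v 1 - (\<Sum>i\<in>I. Poly_Mapping.single (unit i) (of_rat (\<kappa> v i))) \<in> T"
proof -
  have "Poly_Mapping.single (\<Oplus>i\<in>I. \<kappa> v i \<odot> unit i) 1 - (\<Sum>i\<in>I. Poly_Mapping.single (\<kappa> v i \<odot> unit i) 1) \<in> T"
    using unit smult_closed by (intro T_finsum finite_I) blast
  moreover have "(\<Sum>i\<in>I. Poly_Mapping.single (\<kappa> v i \<odot> unit i) 1 - Poly_Mapping.single (unit i) (of_rat (\<kappa> v i))) \<in> T"
    using unit by (intro pm.subspace_sum[OF T_subspace] T_smult)
  ultimately have "(Poly_Mapping.single v 1 - (\<Sum>i\<in>I. Poly_Mapping.single (\<kappa> v i \<odot> unit i) 1))
      + (\<Sum>i\<in>I. Poly_Mapping.single (\<kappa> v i \<odot> unit i) 1 - Poly_Mapping.single (unit i) (of_rat (\<kappa> v i))) \<in> T"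
    unfolding expand_units[OF v, symmetric] by (rule pm.subspace_add[OF T_subspace])
  then show ?thesis by (simp add: sum_subtractf)
qed

text \<open>
  The relations of the tensor product are the common kernel of the extended coordinates: modulo these
  relations every symbol is a combination of the symbols of the unit vectors.
\<close>

lemma T_iff:
  assumes keys: "Poly_Mapping.keys p \<subseteq> carrier V"
  shows "p \<in> T \<longleftrightarrow> (\<forall>i\<in>I. extended_coord p i = 0)"
proof
  assume zero: "\<forall>i\<in>I. extended_coord p i = 0"
  have "(\<Sum>v\<in>Poly_Mapping.keys p. pm_scale (Poly_Mapping.lookup p v)
      (Poly_Mapping.single v 1 - (\<Sum>i\<in>I. Poly_Mapping.single (unit i) (of_rat (\<kappa> v i))))) \<in> T"
    using keys by (intro pm.subspace_sum[OF T_subspace] pm.subspace_scale[OF T_subspace] T_expand_single) auto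
  also have "(\<Sum>v\<in>Poly_Mapping.keys p. pm_scale (Poly_Mapping.lookup p v)
      (Poly_Mapping.single v 1 - (\<Sum>i\<in>I. Poly_Mapping.single (unit i) (of_rat (\<kappa> v i)))))
    = (\<Sum>v\<in>Poly_Mapping.keys p. Poly_Mapping.single v (Poly_Mapping.lookup p v))
      - (\<Sum>i\<in>I. Poly_Mapping.single (unit i) (extended_coord p i))"
  proof -
    have s: "Poly_Mapping.single k (\<Sum>x\<in>A. h x) = (\<Sum>x\<in>A. Poly_Mapping.single k (h x))" for k :: 'c and A and h :: "'c \<Rightarrow> complex"
      by (induction A rule: infinite_finite_induct) (simp_all add: single_add)
    have "(\<Sum>v\<in>Poly_Mapping.keys p. \<Sum>i\<in>I. Poly_Mapping.single (unit i) (Poly_Mapping.lookup p v * of_rat (\<kappa> v i)))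
        = (\<Sum>i\<in>I. Poly_Mapping.single (unit i) (extended_coord p i))"
      unfolding extended_coord_def s by (rule sum.swap)
    then show ?thesis
      by (simp add: pm.scale_right_diff_distrib pm.scale_sum_right pm_scale_single sum_subtractf)
  qed
  also have "\<dots> = p" using zero by (simp flip: poly_mapping_expand)
  finally show "p \<in> T" .
qed (use T_coord in blast)

definition tensor_coord :: "('c \<Rightarrow>\<^sub>0 complex) set \<Rightarrow> 'i \<Rightarrow> complex"
  where "tensor_coord X = extended_coord (SOME p. p \<in> X)"

abbreviation cls :: "('c \<Rightarrow>\<^sub>0 complex) \<Rightarrow> ('c \<Rightarrow>\<^sub>0 complex) set"
  where "cls p \<equiv> T +>\<^bsub>M\<^esub> p"

lemma mem_cls: "x \<in> cls p \<longleftrightarrow> x - p \<in> T"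
  unfolding mem_free_coset by (metis add_diff_cancel_right' diff_add_cancel)

lemma self_mem_cls: "p \<in> cls p"
  using pm.subspace_0[OF T_subspace] by (simp add: mem_cls)

lemma tensor_coord_cls: "i \<in> I \<Longrightarrow> tensor_coord (cls p) i = extended_coord p i"
proof -
  assume i: "i \<in> I"
  have "(SOME x. x \<in> cls p) \<in> cls p" using self_mem_cls by (rule someI)
  then have "extended_coord ((SOME x. x \<in> cls p) - p) i = 0" using T_coord i mem_cls by blast
  then show ?thesis by (simp add: tensor_coord_def extended_coord_diff)
qed

lemma cls_eqI: "x - y \<in> T \<Longrightarrow> cls x = cls y"
proof -
  assume xy: "x - y \<in> T"
  have "z - x \<in> T \<longleftrightarrow> z - y \<in> T" for z
    using pm.subspace_add[OF T_subspace, of "z - x" "x - y"] pm.subspace_diff[OF T_subspace, of "z - y" "x - y"] xy by auto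
  then show ?thesis by (auto simp: mem_cls)
qed

lemma carrier_complexify: "carrier (complexify V) = cls ` {p. Poly_Mapping.keys p \<subseteq> carrier V}"
  by (auto simp: complexify_def quot_module_def A_RCOSETS_def' free_module_def)

lemma add_complexify: "cls p \<oplus>\<^bsub>complexify V\<^esub> cls q = cls (p + q)"
proof -
  have "cls p \<oplus>\<^bsub>complexify V\<^esub> cls q = {x + y | x y. x \<in> cls p \<and> y \<in> cls q}"
    by (auto simp: complexify_def quot_module_def set_add_def' free_module_def)
  also have "\<dots> = cls (p + q)"
  proof
    show "{x + y | x y. x \<in> cls p \<and> y \<in> cls q} \<subseteq> cls (p + q)"
      using pm.subspace_add[OF T_subspace] by (force simp: mem_cls add_diff_add)
    show "cls (p + q) \<subseteq> {x + y | x y. x \<in> cls p \<and> y \<in> cls q}"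
    proof
      fix z assume "z \<in> cls (p + q)"
      then have "z - q \<in> cls p" by (simp add: mem_cls diff_diff_eq add.commute)
      moreover have "z = (z - q) + q" by simp
      ultimately show "z \<in> {x + y | x y. x \<in> cls p \<and> y \<in> cls q}" using self_mem_cls by blast
    qed
  qed
  finally show ?thesis .
qed

lemma induced_cls:
  assumes "\<And>x. x - p \<in> T \<Longrightarrow> h x - h p \<in> T"
  shows "induced_map M T h (cls p) = cls (h p)"
proof -
  have "cls (h x) = cls (h p)" if "x \<in> cls p" for x using that assms mem_cls cls_eqI by blast
  then show ?thesis unfolding induced_map_def by (intro UN_constant_eq[OF self_mem_cls]) blast
qed

lemma smult_complexify: "c \<odot>\<^bsub>complexify V\<^esub> cls p = cls (pm_scale c p)"
proof -
  have "c \<odot>\<^bsub>complexify V\<^esub> cls p = induced_map M T (pm_scale c) (cls p)"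
    by (simp add: complexify_def quot_module_def free_module_def)
  also have "\<dots> = cls (pm_scale c p)"
    using pm.subspace_scale[OF T_subspace] by (intro induced_cls) (simp flip: pm.scale_right_diff_distrib)
  finally show ?thesis .
qed

lemma zero_complexify: "\<zero>\<^bsub>complexify V\<^esub> = cls 0"
  by (auto simp: complexify_def quot_module_def mem_cls)

lemma complexify_coordinatized: "complex_coordinatized (complexify V) tensor_coord I"
proof
  have keys_add': "Poly_Mapping.keys (p + q) \<subseteq> carrier V" if "Poly_Mapping.keys p \<subseteq> carrier V" "Poly_Mapping.keys q \<subseteq> carrier V"
    for p q :: "'c \<Rightarrow>\<^sub>0 complex" by (rule subset_trans[OF keys_add Un_least[OF that]])
  have keys_scale': "Poly_Mapping.keys (pm_scale c p) \<subseteq> carrier V" if "Poly_Mapping.keys p \<subseteq> carrier V"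
    for c and p :: "'c \<Rightarrow>\<^sub>0 complex" using that by (auto simp: in_keys_iff lookup_pm_scale)
  show "finite I" by (rule finite_I)
  fix x y assume x: "x \<in> carrier (complexify V)" and y: "y \<in> carrier (complexify V)"
  obtain p q where p: "x = cls p" "Poly_Mapping.keys p \<subseteq> carrier V" and q: "y = cls q" "Poly_Mapping.keys q \<subseteq> carrier V"
    using x y by (auto simp: carrier_complexify)
  show "x \<oplus>\<^bsub>complexify V\<^esub> y \<in> carrier (complexify V)"
    using keys_add' p q by (auto simp: carrier_complexify add_complexify)
  show "c \<odot>\<^bsub>complexify V\<^esub> x \<in> carrier (complexify V)" for c
    using keys_scale' p by (auto simp: carrier_complexify smult_complexify)
  show "tensor_coord (x \<oplus>\<^bsub>complexify V\<^esub> y) i = tensor_coord x i + tensor_coord y i" if "i \<in> I" for i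
    using that p q by (simp add: add_complexify tensor_coord_cls extended_coord_add)
  show "tensor_coord (c \<odot>\<^bsub>complexify V\<^esub> x) i = c * tensor_coord x i" if "i \<in> I" for i c
    using that p by (simp add: smult_complexify tensor_coord_cls extended_coord_scale)
  show "x = y" if "\<And>i. i \<in> I \<Longrightarrow> tensor_coord x i = tensor_coord y i"
  proof -
    have "Poly_Mapping.keys (p - q) \<subseteq> carrier V"
      by (rule subset_trans[OF keys_diff Un_least[OF p(2) q(2)]])
    then have "p - q \<in> T" using that p q by (simp add: T_iff extended_coord_diff tensor_coord_cls)
    then show ?thesis using p q cls_eqI by simp
  qed
next
  show "\<zero>\<^bsub>complexify V\<^esub> \<in> carrier (complexify V)" by (auto simp: carrier_complexify zero_complexify)
  show "tensor_coord \<zero>\<^bsub>complexify V\<^esub> i = 0" if "i \<in> I" for i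
    using that by (simp add: zero_complexify tensor_coord_cls extended_coord_zero)
  show "\<exists>e\<in>carrier (complexify V). \<forall>j\<in>I. tensor_coord e j = (if i = j then 1 else 0)" if i: "i \<in> I" for i
  proof (rule bexI[of _ "cls (Poly_Mapping.single (unit i) 1)"])
    show "\<forall>j\<in>I. tensor_coord (cls (Poly_Mapping.single (unit i) 1)) j = (if i = j then 1 else 0)"
      using unit(2)[OF i] by (auto simp: tensor_coord_cls extended_coord_single)
    show "cls (Poly_Mapping.single (unit i) 1) \<in> carrier (complexify V)"
      using unit(1)[OF i] by (auto simp: carrier_complexify)
  qed
qed

text \<open>
  The coordinates extend to the complexification, where the map has the same matrix.
\<close>

theorem trace_complexify_map:
  assumes g: "\<And>v. v \<in> carrier V \<Longrightarrow> g v \<in> carrier V"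
    and A: "\<And>v i. v \<in> carrier V \<Longrightarrow> i \<in> I \<Longrightarrow> \<kappa> (g v) i = (\<Sum>j\<in>I. A i j * \<kappa> v j)"
  shows "lin_trace (complexify V) (complexify_map V g) = of_rat (\<Sum>i\<in>I. A i i)"
proof -
  interpret C: complex_coordinatized "complexify V" tensor_coord I by (rule complexify_coordinatized)
  have keys: "Poly_Mapping.keys (pm_extend g p) \<subseteq> carrier V" if "Poly_Mapping.keys p \<subseteq> carrier V" for p :: "'c \<Rightarrow>\<^sub>0 complex"
  proof -
    have "Poly_Mapping.keys (pm_extend g p) \<subseteq> g ` Poly_Mapping.keys p"
      unfolding pm_extend_def by (rule order.trans[OF keys_sum]) (auto split: if_splits)
    then show ?thesis using that g by blast
  qed
  have coord_sum: "extended_coord (\<Sum>a\<in>K. h a) i = (\<Sum>a\<in>K. extended_coord (h a) i)" for K :: "'c set" and h i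
    by (induction K rule: infinite_finite_induct) (simp_all add: extended_coord_zero extended_coord_add)
  have coord: "extended_coord (pm_extend g p) i = (\<Sum>j\<in>I. of_rat (A i j) * extended_coord p j)"
    if p: "Poly_Mapping.keys p \<subseteq> carrier V" and i: "i \<in> I" for p :: "'c \<Rightarrow>\<^sub>0 complex" and i
  proof -
    have "extended_coord (pm_extend g p) i = (\<Sum>v\<in>Poly_Mapping.keys p. Poly_Mapping.lookup p v * of_rat (\<kappa> (g v) i))"
      by (simp add: pm_extend_def coord_sum extended_coord_single)
    also have "\<dots> = (\<Sum>v\<in>Poly_Mapping.keys p. \<Sum>j\<in>I. of_rat (A i j) * (Poly_Mapping.lookup p v * of_rat (\<kappa> v j)))"
      using p A[OF _ i] by (intro sum.cong refl) (auto simp: of_rat_sum of_rat_mult sum_distrib_left mult_ac subset_iff)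
    also have "\<dots> = (\<Sum>j\<in>I. of_rat (A i j) * extended_coord p j)"
      by (subst sum.swap) (simp add: sum_distrib_left extended_coord_def)
    finally show ?thesis .
  qed
  have map: "complexify_map V g (cls p) = cls (pm_extend g p)" if p: "Poly_Mapping.keys p \<subseteq> carrier V" for p
    unfolding complexify_map_def
  proof (rule induced_cls)
    fix x assume xp: "x - p \<in> T"
    have x: "Poly_Mapping.keys x \<subseteq> carrier V"
      using keys_add[of "x - p" p] T_keys[OF xp] p by auto
    have "Poly_Mapping.keys (pm_extend g x - pm_extend g p) \<subseteq> carrier V"
      using keys_diff[of "pm_extend g x" "pm_extend g p"] keys[OF x] keys[OF p] by blast
    moreover have "extended_coord x j = extended_coord p j" if "j \<in> I" for j
      using T_coord[OF xp that] by (simp add: extended_coord_diff)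
    ultimately show "pm_extend g x - pm_extend g p \<in> T"
      by (simp add: T_iff extended_coord_diff coord[OF x] coord[OF p])
  qed
  have "lin_trace (complexify V) (complexify_map V g) = (\<Sum>i\<in>I. of_rat (A i i))"
  proof (rule C.lin_trace_eq[where A = "\<lambda>i j. of_rat (A i j)"])
    fix X assume "X \<in> carrier (complexify V)"
    then obtain p where p: "X = cls p" "Poly_Mapping.keys p \<subseteq> carrier V" by (auto simp: carrier_complexify)
    show "complexify_map V g X \<in> carrier (complexify V)"
      using p keys by (auto simp: map carrier_complexify)
    show "tensor_coord (complexify_map V g X) i = (\<Sum>j\<in>I. of_rat (A i j) * tensor_coord X j)" if "i \<in> I" for i
      using that p by (simp add: map tensor_coord_cls coord)
  qed
  then show ?thesis by (simp add: of_rat_sum)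
qed

end

section \<open>The symmetric group on the graded pieces of the Chow ring\<close>

lemma pm_extend_superset:
  "finite K \<Longrightarrow> Poly_Mapping.keys p \<subseteq> K \<Longrightarrow>
    pm_extend f p = (\<Sum>a\<in>K. Poly_Mapping.single (f a) (Poly_Mapping.lookup p a))"
  unfolding pm_extend_def by (rule sum.mono_neutral_left) (auto simp: in_keys_iff)

lemma pm_extend_add: "pm_extend f (p + q) = pm_extend f p + pm_extend f q"
proof -
  let ?K = "Poly_Mapping.keys p \<union> Poly_Mapping.keys q"
  have "Poly_Mapping.keys (p + q) \<subseteq> ?K" by (rule keys_add)
  then show ?thesis by (simp add: pm_extend_superset[of ?K] lookup_add single_add sum.distrib)
qed

lemma pm_extend_scale: "pm_extend f (pm_scale c p) = pm_scale (c :: 'k :: field) (pm_extend f p)"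
proof -
  have "Poly_Mapping.keys (pm_scale c p) \<subseteq> Poly_Mapping.keys p" by (auto simp: in_keys_iff lookup_pm_scale)
  then show ?thesis
    by (simp add: pm_extend_superset[of "Poly_Mapping.keys p"] lookup_pm_scale pm.scale_sum_right pm_scale_single)
qed

lemma pm_extend_single: "pm_extend f (Poly_Mapping.single k c) = Poly_Mapping.single (f k) c"
  by (simp add: pm_extend_def)

lemma pm_extend_zero: "pm_extend f 0 = 0"
  by (simp add: pm_extend_def)

lemma pm_extend_sum: "pm_extend f (\<Sum>i\<in>A. h i) = (\<Sum>i\<in>A. pm_extend f (h i))"
  by (induction A rule: infinite_finite_induct) (simp_all add: pm_extend_zero pm_extend_add)

lemma pm_extend_diff: "pm_extend f (p - q) = pm_extend f p - pm_extend f (q :: 'b \<Rightarrow>\<^sub>0 'k :: field)"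
proof -
  have "pm_extend f (p - q) + pm_extend f q = pm_extend f p" by (simp flip: pm_extend_add)
  then show ?thesis by (simp add: eq_diff_eq)
qed

lemma keys_pm_extend: "Poly_Mapping.keys (pm_extend f p) \<subseteq> f ` Poly_Mapping.keys p"
  unfolding pm_extend_def by (rule order.trans[OF keys_sum]) (auto split: if_splits)

context uniform_chow
begin

abbreviation R :: "nat set mpoly ring"
  where "R \<equiv> chow_vars (uniform_flats r n)"

abbreviation K :: "nat set mpoly set"
  where "K \<equiv> chow_ideal {1..n} (uniform_flats r n)"

lemma carrier_R: "carrier R = {p. \<forall>q\<in>Poly_Mapping.keys p. set_mset q \<subseteq> flats}"
  by (simp add: chow_vars_def mpoly_ring_def flats_def)

lemma R_simps: "add R = (+)" "monoid.mult R = (*)" "zero R = 0" "one R = 1"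
  by (simp_all add: chow_vars_def mpoly_ring_def)

lemma carrier_R_subspace: "pm.subspace (carrier R)"
  unfolding pm.subspace_def carrier_R
  by (auto simp: in_keys_iff lookup_add lookup_pm_scale) (metis add_0 in_keys_iff subsetD)

lemma carrier_R_mult: "p \<in> carrier R \<Longrightarrow> q \<in> carrier R \<Longrightarrow> p * q \<in> carrier R"
  using keys_mult[of p q] unfolding carrier_R by (fastforce simp: subset_iff)

lemma R_cring: "cring R"
proof (rule cringI)
  show "abelian_group R"
  proof (rule abelian_groupI)
    fix p assume p: "p \<in> carrier R"
    then have "- p \<in> carrier R" by (rule pm.subspace_neg[OF carrier_R_subspace])
    then show "\<exists>q\<in>carrier R. q \<oplus>\<^bsub>R\<^esub> p = \<zero>\<^bsub>R\<^esub>" by (intro bexI[of _ "- p"]) (simp_all add: R_simps)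
  qed (auto simp: R_simps add_ac intro: pm.subspace_add[OF carrier_R_subspace] pm.subspace_0[OF carrier_R_subspace])
  show "comm_monoid R"
    by (rule comm_monoidI) (auto simp: R_simps mult_ac carrier_R_mult, simp add: carrier_R)
qed (simp add: R_simps distrib_right)

lemma R_ring: "ring R"
  using R_cring by (rule cring.axioms)

lemma ideal_relations: "ideal (chow_relations \<inter> carrier R) R"
proof (rule idealI[OF R_ring])
  show "subgroup (chow_relations \<inter> carrier R) (add_monoid R)"
  proof
    fix x assume x: "x \<in> chow_relations \<inter> carrier R"
    have "x \<oplus>\<^bsub>R\<^esub> (- x) = \<zero>\<^bsub>R\<^esub>" by (simp add: R_simps)
    moreover have neg: "- x \<in> chow_relations \<inter> carrier R"
      using x relations_neg pm.subspace_neg[OF carrier_R_subspace] by blast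
    ultimately have "inv\<^bsub>add_monoid R\<^esub> x = - x"
      using x abelian_group.minus_equality[OF ring.is_abelian_group[OF R_ring], of "- x" x]
      by (simp add: a_inv_def R_simps)
    then show "inv\<^bsub>add_monoid R\<^esub> x \<in> chow_relations \<inter> carrier R" using neg by simp
  qed (auto simp: R_simps intro: relations_add relations_zero pm.subspace_add[OF carrier_R_subspace] pm.subspace_0[OF carrier_R_subspace])
qed (auto simp: R_simps relations_mult relations_mult_left carrier_R_mult)

lemma Var_carrier: "F \<in> flats \<Longrightarrow> Var F \<in> carrier R"
  by (simp add: carrier_R Var_def)

lemma theta_carrier: "theta i \<in> carrier R"
  unfolding theta_def by (intro pm.subspace_sum[OF carrier_R_subspace] Var_carrier) simp

definition incomparable_products :: "nat set mpoly set"
  where "incomparable_products = {Var F * Var G | F G. F \<in> flats \<and> G \<in> flats \<and> \<not> F \<subseteq> G \<and> \<not> G \<subseteq> F}"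

lemma chow_I_eq: "chow_I (uniform_flats r n) = Idl\<^bsub>R\<^esub> incomparable_products"
  by (simp add: chow_I_def incomparable_products_def flats_def)

lemma chow_J_eq: "chow_J {1..n} (uniform_flats r n) = Idl\<^bsub>R\<^esub> (theta ` {1..n})"
  unfolding chow_J_def theta_def flats_def by (simp add: image_def Bex_def conj_commute)

lemma generators_carrier: "incomparable_products \<subseteq> carrier R" "theta ` {1..n} \<subseteq> carrier R"
  using Var_carrier carrier_R_mult theta_carrier by (auto simp: incomparable_products_def)

lemma ideals_IJ: "ideal (chow_I (uniform_flats r n)) R" "ideal (chow_J {1..n} (uniform_flats r n)) R"
  unfolding chow_I_eq chow_J_eq by (intro ring.genideal_ideal[OF R_ring] generators_carrier)+

lemma K_ideal: "ideal K R"
  unfolding chow_ideal_def by (rule ring.add_ideals[OF R_ring ideals_IJ])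

lemma mem_K: "p \<in> K \<longleftrightarrow> (\<exists>a\<in>chow_I (uniform_flats r n). \<exists>b\<in>chow_J {1..n} (uniform_flats r n). p = a + b)"
  by (auto simp: chow_ideal_def set_add_def' R_simps)

lemma IJ_subset_K: "chow_I (uniform_flats r n) \<subseteq> K" "chow_J {1..n} (uniform_flats r n) \<subseteq> K"
proof -
  have "0 \<in> chow_I (uniform_flats r n)" "0 \<in> chow_J {1..n} (uniform_flats r n)"
    using additive_subgroup.zero_closed[OF ideal.axioms(1)[OF ideals_IJ(1)]]
      additive_subgroup.zero_closed[OF ideal.axioms(1)[OF ideals_IJ(2)]] by (simp_all add: R_simps)
  then show "chow_I (uniform_flats r n) \<subseteq> K" "chow_J {1..n} (uniform_flats r n) \<subseteq> K"
    unfolding subset_iff mem_K by (metis add_0 add_0_right)+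
qed

text \<open>
  The space of relations was defined by linear spans in the polynomial ring with all variables. To return
  to the ideal of the Chow ring, the monomials with a variable that is not a nonempty flat are projected away; the
  projection sends the spanning relations to elements of the ideal.
\<close>

lemma K_eq: "K = chow_relations \<inter> carrier R"
proof
  have "incomparable_products \<subseteq> chow_relations \<inter> carrier R"
  proof (rule Int_greatest[OF _ generators_carrier(1)], rule subsetI)
    fix p assume "p \<in> incomparable_products"
    then obtain F G where "p = Var F * Var G" "F \<in> flats" "G \<in> flats" "\<not> F \<subseteq> G" "\<not> G \<subseteq> F"
      unfolding incomparable_products_def by blast
    then show "p \<in> chow_relations" using incomparable_relation by simp
  qed
  then have I: "chow_I (uniform_flats r n) \<subseteq> chow_relations \<inter> carrier R"
    unfolding chow_I_eq genideal_def using ideal_relations by blast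
  have "theta i \<in> chow_relations" if "i \<in> {1..n}" for i using theta_relation[OF that, of "{#}"] by simp
  then have "theta ` {1..n} \<subseteq> chow_relations \<inter> carrier R" using generators_carrier by blast
  then have J: "chow_J {1..n} (uniform_flats r n) \<subseteq> chow_relations \<inter> carrier R"
    unfolding chow_J_eq genideal_def using ideal_relations by blast
  show "K \<subseteq> chow_relations \<inter> carrier R"
  proof
    fix p assume "p \<in> K"
    then obtain a b where "a \<in> chow_I (uniform_flats r n)" "b \<in> chow_J {1..n} (uniform_flats r n)" "p = a + b"
      unfolding mem_K by blast
    then show "p \<in> chow_relations \<inter> carrier R"
      using I J relations_add pm.subspace_add[OF carrier_R_subspace] by blast
  qed
next
  \<comment> \<open>The projection that discards the monomials with superfluous variables.\<close>
  let ?pr = "pm_filter (\<lambda>q. set_mset q \<subseteq> flats) :: nat set mpoly \<Rightarrow> _"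
  have Kmult: "a * p \<in> K" if "p \<in> K" "a \<in> carrier R" for a p
    using ideal.I_l_closed[OF K_ideal that] by (simp add: R_simps)
  have Kadd: "p + q \<in> K" if "p \<in> K" "q \<in> K" for p q
    using additive_subgroup.a_closed[OF ideal.axioms(1)[OF K_ideal] that] by (simp add: R_simps)
  have K0: "0 \<in> K"
    using additive_subgroup.zero_closed[OF ideal.axioms(1)[OF K_ideal]] by (simp add: R_simps)
  have Kscale: "pm_scale c p \<in> K" if "p \<in> K" for c p
  proof -
    have "Poly_Mapping.single 0 c \<in> carrier R" by (simp add: carrier_R)
    then show ?thesis using Kmult[OF that] by (simp add: pm_scale_def mult_map_scale_conv_mult)
  qed
  have Ksub: "pm.subspace K" unfolding pm.subspace_def using Kadd K0 Kscale by blast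
  have mon_carrier: "mon q \<in> carrier R" if "set_mset q \<subseteq> flats" for q using that by (simp add: carrier_R)
  have pr: "?pr p \<in> K" if "p \<in> chow_relations" for p
  proof (rule span_image_linear[where f = ?pr, OF pm_filter_add pm_filter_scale _ Ksub that[unfolded chow_relations_def]])
    fix x assume "x \<in> {mon q | q. \<not> chain_mset q} \<union> {theta i * mon q | i q. i \<in> {1..n}}"
    then consider q where "x = mon q" "\<not> chain_mset q" | i q where "x = theta i * mon q" "i \<in> {1..n}" by blast
    then show "?pr x \<in> K"
    proof cases
      case 1
      show ?thesis
      proof (cases "set_mset q \<subseteq> flats")
        case True
        then obtain F G where FG: "F \<in># q" "G \<in># q" "\<not> F \<subseteq> G" "\<not> G \<subseteq> F"
          using 1(2) by (auto simp: chain_mset_def)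
        then have "G \<in># q - {#F#}" by (metis in_diff_count insert_DiffM insert_noteq_member order_refl)
        then obtain q' where q': "q = add_mset F (add_mset G q')" using FG(1) by (metis insert_DiffM)
        have "Var F * Var G \<in> incomparable_products" using FG True by (auto simp: incomparable_products_def)
        then have "Var F * Var G \<in> K"
          using IJ_subset_K(1) ring.genideal_self[OF R_ring generators_carrier(1)] unfolding chow_I_eq by blast
        then have "mon q' * (Var F * Var G) \<in> K" using True q' by (intro Kmult[OF _ mon_carrier]) auto
        moreover have "mon q' * (Var F * Var G) = mon q"
          unfolding q' Var_times_mon[symmetric] by (simp only: mult_ac)
        ultimately show ?thesis using 1 True by (simp add: pm_filter_single)
      qed (use K0 in \<open>simp add: 1 pm_filter_single\<close>)
    next
      case 2
      have x: "x = (\<Sum>F | F \<in> flats \<and> i \<in> F. mon (add_mset F q))"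
        unfolding 2 theta_def by (simp add: sum_distrib_right Var_times_mon)
      show ?thesis
      proof (cases "set_mset q \<subseteq> flats")
        case True
        have "?pr x = (\<Sum>F | F \<in> flats \<and> i \<in> F. mon (add_mset F q))"
          unfolding x pm_filter_sum using True by (intro sum.cong) (auto simp: pm_filter_single)
        then have "?pr x = mon q * theta i" using x 2 by (simp add: mult.commute)
        moreover have "theta i \<in> K"
          using IJ_subset_K(2) ring.genideal_self[OF R_ring generators_carrier(2)] 2(2) unfolding chow_J_eq by blast
        ultimately show ?thesis using Kmult mon_carrier True by simp
      next
        case False
        then have "?pr x = 0" unfolding x pm_filter_sum by (intro sum.neutral) (auto simp: pm_filter_single)
        then show ?thesis using K0 by simp
      qed
    qed
  qed
  show "chow_relations \<inter> carrier R \<subseteq> K"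
  proof
    fix p assume p: "p \<in> chow_relations \<inter> carrier R"
    then have "?pr p = p" by (intro pm_filter_id) (auto simp: carrier_R)
    then show "p \<in> K" using pr p by (metis IntD1)
  qed
qed

abbreviation chow_class :: "nat set mpoly \<Rightarrow> nat set mpoly set"
  where "chow_class p \<equiv> K +>\<^bsub>R\<^esub> p"

lemma mem_chow_class: "x \<in> chow_class p \<longleftrightarrow> x - p \<in> K"
proof -
  have "x \<in> chow_class p \<longleftrightarrow> (\<exists>h\<in>K. x = h + p)" by (simp add: a_r_coset_def' R_simps)
  also have "\<dots> \<longleftrightarrow> x - p \<in> K" by (metis add_diff_cancel_right' diff_add_cancel)
  finally show ?thesis .
qed

lemma K_subspace: "pm.subspace K"
  unfolding K_eq by (rule pm.subspace_inter[OF relations_subspace carrier_R_subspace])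

lemma self_mem_chow_class: "p \<in> chow_class p"
  unfolding mem_chow_class using pm.subspace_0[OF K_subspace] by simp

lemma chow_class_eqI: "x - y \<in> K \<Longrightarrow> chow_class x = chow_class y"
proof -
  assume xy: "x - y \<in> K"
  have "z - x \<in> K \<longleftrightarrow> z - y \<in> K" for z
    using pm.subspace_add[OF K_subspace, of "z - x" "x - y"] pm.subspace_diff[OF K_subspace, of "z - y" "x - y"] xy by auto
  then show ?thesis unfolding set_eq_iff mem_chow_class by blast
qed

definition homogeneous :: "nat \<Rightarrow> nat set mpoly set"
  where "homogeneous d = {p \<in> carrier R. \<forall>q\<in>Poly_Mapping.keys p. size q = d}"

lemma homogeneous_subspace: "pm.subspace (homogeneous d)"
proof -
  have "homogeneous d = {p. \<forall>q\<in>Poly_Mapping.keys p. set_mset q \<subseteq> flats \<and> size q = d}"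
    unfolding homogeneous_def carrier_R by blast
  moreover have "pm.subspace {p :: nat set mpoly. \<forall>q\<in>Poly_Mapping.keys p. P q}" for P
    unfolding pm.subspace_def by (auto simp: in_keys_iff lookup_add lookup_pm_scale)
  ultimately show ?thesis by simp
qed

abbreviation degree_part :: "nat \<Rightarrow> (rat, nat set mpoly set) module"
  where "degree_part d \<equiv> chow_degree {1..n} (uniform_flats r n) d"

lemma degree_part_carrier: "carrier (degree_part d) = chow_class ` homogeneous d"
  by (auto simp: chow_degree_def homogeneous_def)

lemma degree_part_add:
  assumes "p \<in> carrier R" "q \<in> carrier R"
  shows "chow_class p \<oplus>\<^bsub>degree_part d\<^esub> chow_class q = chow_class (p + q)"
proof -
  have "chow_class p \<oplus>\<^bsub>degree_part d\<^esub> chow_class q = chow_class p <+>\<^bsub>R\<^esub> chow_class q"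
    by (simp add: chow_degree_def chow_algebra_def ring.defs chow_ring_def FactRing_def)
  also have "\<dots> = chow_class (p + q)"
    using abelian_subgroup.a_rcos_sum[OF abelian_subgroupI3[OF ideal.axioms(1)[OF K_ideal] ring.is_abelian_group[OF R_ring]] assms]
    by (simp add: R_simps)
  finally show ?thesis .
qed

lemma degree_part_zero: "\<zero>\<^bsub>degree_part d\<^esub> = chow_class 0"
proof -
  have "\<zero>\<^bsub>degree_part d\<^esub> = K"
    by (simp add: chow_degree_def chow_algebra_def ring.defs chow_ring_def FactRing_def)
  also have "K = chow_class 0" unfolding set_eq_iff mem_chow_class by simp
  finally show ?thesis .
qed

lemma degree_part_smult:
  assumes "p \<in> carrier R"
  shows "c \<odot>\<^bsub>degree_part d\<^esub> chow_class p = chow_class (pm_scale c p)"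
proof -
  have "c \<odot>\<^bsub>degree_part d\<^esub> chow_class p = rcoset_mult R K (chow_class (Const c)) (chow_class p)"
    by (simp add: chow_degree_def chow_algebra_def ring.defs module.defs chow_ring_def FactRing_def)
  also have "\<dots> = chow_class (Const c * p)"
  proof -
    have "Const c \<in> carrier R" by (simp add: carrier_R Const_def)
    then show ?thesis using ideal.rcoset_mult_add[OF K_ideal _ assms, of "Const c"] by (simp add: R_simps)
  qed
  also have "Const c * p = pm_scale c p" by (simp add: Const_def pm_scale_def mult_map_scale_conv_mult)
  finally show ?thesis .
qed


definition fy_comb :: "nat \<Rightarrow> (nat set multiset \<Rightarrow> rat) \<Rightarrow> nat set mpoly"
  where "fy_comb d c = (\<Sum>b\<in>fy_set d. pm_scale (c b) (mon b))"

text \<open>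
  The two cases in which independence is known enter what follows only through this property.
\<close>

definition fy_independent :: "nat \<Rightarrow> bool"
  where "fy_independent d \<longleftrightarrow> (\<forall>c. fy_comb d c \<in> chow_relations \<longrightarrow> (\<forall>b\<in>fy_set d. c b = 0))"

definition fy_coord :: "nat \<Rightarrow> nat set mpoly \<Rightarrow> nat set multiset \<Rightarrow> rat"
  where "fy_coord d p = (SOME c. p - fy_comb d c \<in> chow_relations)"

lemma fy_comb_add: "fy_comb d (\<lambda>b. c b + c' b) = fy_comb d c + fy_comb d c'"
  by (simp add: fy_comb_def pm.scale_left_distrib sum.distrib)

lemma fy_comb_diff: "fy_comb d (\<lambda>b. c b - c' b) = fy_comb d c - fy_comb d c'"
  by (simp add: fy_comb_def pm.scale_left_diff_distrib sum_subtractf)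

lemma fy_comb_scale: "fy_comb d (\<lambda>b. a * c b) = pm_scale a (fy_comb d c)"
  by (simp add: fy_comb_def pm.scale_sum_right)

lemma fy_coord_exists:
  assumes "p \<in> homogeneous d"
  shows "\<exists>c. p - fy_comb d c \<in> chow_relations"
proof -
  have "p \<in> pm.span (mon ` fy_set d \<union> chow_relations)"
    by (rule in_span_monomials) (use assms fy_spanning in \<open>auto simp: homogeneous_def\<close>)
  then obtain x y where xy: "p = x + y" "x \<in> pm.span (mon ` fy_set d)" "y \<in> pm.span chow_relations"
    unfolding pm.span_Un by blast
  have "y \<in> chow_relations" using xy(3) pm.span_eq_iff[of chow_relations] relations_subspace by blast
  moreover have "\<exists>c. x = fy_comb d c"
  proof -
    have "x \<in> range (\<lambda>u. \<Sum>v\<in>mon ` fy_set d. pm_scale (u v) v)"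
      using xy(2) pm.span_finite[of "mon ` fy_set d"] finite_fy_set by simp
    then obtain u where "x = (\<Sum>v\<in>mon ` fy_set d. pm_scale (u v) v)" by blast
    also have "\<dots> = fy_comb d (\<lambda>b. u (mon b))"
      unfolding fy_comb_def by (subst sum.reindex) (auto intro: inj_on_subset[OF inj_mon])
    finally show ?thesis by blast
  qed
  ultimately show ?thesis using xy(1) by (metis add_diff_cancel_left')
qed

lemma fy_coord:
  assumes "p \<in> homogeneous d"
  shows "p - fy_comb d (fy_coord d p) \<in> chow_relations"
  unfolding fy_coord_def using fy_coord_exists[OF assms] by (rule someI_ex)

lemma fy_coord_unique:
  assumes "fy_independent d" "p \<in> homogeneous d" "p - fy_comb d c \<in> chow_relations" "b \<in> fy_set d"
  shows "fy_coord d p b = c b"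
proof -
  have "fy_comb d (\<lambda>b. fy_coord d p b - c b) = (p - fy_comb d c) - (p - fy_comb d (fy_coord d p))"
    by (simp add: fy_comb_diff)
  then have "fy_comb d (\<lambda>b. fy_coord d p b - c b) \<in> chow_relations"
    using relations_diff[OF assms(3) fy_coord[OF assms(2)]] by simp
  then have "fy_coord d p b - c b = 0" using assms(1,4) unfolding fy_independent_def by blast
  then show ?thesis by simp
qed

definition class_coord :: "nat \<Rightarrow> nat set mpoly set \<Rightarrow> nat set multiset \<Rightarrow> rat"
  where "class_coord d X = fy_coord d (SOME p. p \<in> homogeneous d \<and> X = chow_class p)"

lemma class_coord:
  assumes ind: "fy_independent d" and p: "p \<in> homogeneous d" and b: "b \<in> fy_set d"
  shows "class_coord d (chow_class p) b = fy_coord d p b"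
proof -
  define q where "q = (SOME q. q \<in> homogeneous d \<and> chow_class p = chow_class q)"
  have q: "q \<in> homogeneous d \<and> chow_class p = chow_class q"
    unfolding q_def by (rule someI[of _ p]) (use p in simp)
  have "q \<in> chow_class p" using q self_mem_chow_class by simp
  then have "q - p \<in> chow_relations" unfolding mem_chow_class unfolding K_eq by blast
  then have "(p - fy_comb d (fy_coord d p)) + (q - p) \<in> chow_relations"
    using fy_coord[OF p] relations_add by blast
  then have "q - fy_comb d (fy_coord d p) \<in> chow_relations" by simp
  then have "fy_coord d q b = fy_coord d p b" using fy_coord_unique[OF ind] q b by blast
  then show ?thesis by (simp add: class_coord_def q_def del: One_nat_def)
qed

lemma homogeneous_carrier: "p \<in> homogeneous d \<Longrightarrow> p \<in> carrier R"
  by (simp add: homogeneous_def)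

lemma fy_set_homogeneous: "b \<in> fy_set d \<Longrightarrow> mon b \<in> homogeneous d"
  by (auto simp: homogeneous_def carrier_R fy_set_def fy_mset_def chain_mset_def)

text \<open>
  Existence of coordinates is the spanning theorem, uniqueness is independence.
\<close>

lemma degree_part_coordinatized:
  assumes ind: "fy_independent d"
  shows "rational_coordinatized (degree_part d) (class_coord d) (fy_set d)"
  unfolding rational_coordinatized_def
proof (rule coordinatized.intro)
  show "finite (fy_set d)" by (rule finite_fy_set)
  have cE: "(\<And>p. p \<in> homogeneous d \<Longrightarrow> x = chow_class p \<Longrightarrow> thesis) \<Longrightarrow> thesis"
    if "x \<in> carrier (degree_part d)" for x thesis
    using \<open>x \<in> carrier (degree_part d)\<close> unfolding degree_part_carrier by blast
  note h = homogeneous_subspace[of d]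
  have cI: "chow_class p \<in> carrier (degree_part d)" if "p \<in> homogeneous d" for p
    using that unfolding degree_part_carrier by blast
  note cc = class_coord[OF ind]
  show "\<zero>\<^bsub>degree_part d\<^esub> \<in> carrier (degree_part d)"
    unfolding degree_part_zero by (rule cI[OF pm.subspace_0[OF h]])
  show "class_coord d \<zero>\<^bsub>degree_part d\<^esub> b = 0" if b: "b \<in> fy_set d" for b
    unfolding degree_part_zero cc[OF pm.subspace_0[OF h] b]
    by (rule fy_coord_unique[OF ind pm.subspace_0[OF h] _ b]) (simp add: fy_comb_def relations_zero)
  fix x y assume x: "x \<in> carrier (degree_part d)"
  obtain p where p: "p \<in> homogeneous d" "x = chow_class p" by (rule cE[OF x])
  have sm: "c \<odot>\<^bsub>degree_part d\<^esub> x = chow_class (pm_scale c p)" for c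
    unfolding p(2) by (rule degree_part_smult[OF homogeneous_carrier[OF p(1)]])
  show "c \<odot>\<^bsub>degree_part d\<^esub> x \<in> carrier (degree_part d)" for c
    unfolding sm by (rule cI[OF pm.subspace_scale[OF h p(1)]])
  show "class_coord d (c \<odot>\<^bsub>degree_part d\<^esub> x) b = c * class_coord d x b" if b: "b \<in> fy_set d" for c b
    unfolding sm unfolding p(2) cc[OF pm.subspace_scale[OF h p(1)] b] cc[OF p(1) b]
  proof (rule fy_coord_unique[OF ind pm.subspace_scale[OF h p(1)] _ b])
    show "pm_scale c p - fy_comb d (\<lambda>b. c * fy_coord d p b) \<in> chow_relations"
      unfolding fy_comb_scale pm.scale_right_diff_distrib[symmetric] by (rule relations_scale[OF fy_coord[OF p(1)]])
  qed
  assume y: "y \<in> carrier (degree_part d)"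
  obtain q where q: "q \<in> homogeneous d" "y = chow_class q" by (rule cE[OF y])
  have ad: "x \<oplus>\<^bsub>degree_part d\<^esub> y = chow_class (p + q)"
    unfolding p(2) q(2) by (rule degree_part_add[OF homogeneous_carrier[OF p(1)] homogeneous_carrier[OF q(1)]])
  show "x \<oplus>\<^bsub>degree_part d\<^esub> y \<in> carrier (degree_part d)"
    unfolding ad by (rule cI[OF pm.subspace_add[OF h p(1) q(1)]])
  show "class_coord d (x \<oplus>\<^bsub>degree_part d\<^esub> y) b = class_coord d x b + class_coord d y b" if b: "b \<in> fy_set d" for b
    unfolding ad unfolding p(2) q(2) cc[OF pm.subspace_add[OF h p(1) q(1)] b] cc[OF p(1) b] cc[OF q(1) b]
  proof (rule fy_coord_unique[OF ind pm.subspace_add[OF h p(1) q(1)] _ b])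
    show "p + q - fy_comb d (\<lambda>b. fy_coord d p b + fy_coord d q b) \<in> chow_relations"
      using relations_add[OF fy_coord[OF p(1)] fy_coord[OF q(1)]] unfolding fy_comb_add by (simp add: algebra_simps)
  qed
  assume eq: "\<And>b. b \<in> fy_set d \<Longrightarrow> class_coord d x b = class_coord d y b"
  have "fy_coord d p b = fy_coord d q b" if b: "b \<in> fy_set d" for b
    using eq[OF b] unfolding p(2) q(2) cc[OF p(1) b] cc[OF q(1) b] .
  then have "fy_comb d (fy_coord d p) = fy_comb d (fy_coord d q)" unfolding fy_comb_def by simp
  then have "p - q \<in> chow_relations" using relations_diff[OF fy_coord[OF p(1)] fy_coord[OF q(1)]] by simp
  moreover have "p - q \<in> carrier R" using homogeneous_carrier[OF pm.subspace_diff[OF h p(1) q(1)]] .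
  ultimately show "x = y" unfolding p(2) q(2) by (intro chow_class_eqI) (simp only: K_eq Int_iff)
next
  fix b assume b: "b \<in> fy_set d"
  note m = fy_set_homogeneous[OF b]
  have comb: "fy_comb d (\<lambda>j. if b = j then 1 else 0) = mon b"
  proof -
    have "fy_comb d (\<lambda>j. if b = j then 1 else 0) = (\<Sum>j\<in>fy_set d. if b = j then mon j else 0)"
      unfolding fy_comb_def by (rule sum.cong) auto
    then show ?thesis using b finite_fy_set by simp
  qed
  show "\<exists>e\<in>carrier (degree_part d). \<forall>j\<in>fy_set d. class_coord d e j = (if b = j then 1 else 0)"
  proof (intro bexI ballI)
    show "chow_class (mon b) \<in> carrier (degree_part d)" unfolding degree_part_carrier using m by blast
    fix j assume j: "j \<in> fy_set d"
    show "class_coord d (chow_class (mon b)) j = (if b = j then 1 else 0)"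
      unfolding class_coord[OF ind m j]
      by (rule fy_coord_unique[OF ind m _ j]) (simp add: comb relations_zero)
  qed
qed


context
  fixes \<sigma> :: "nat \<Rightarrow> nat"
  assumes \<sigma>: "\<sigma> permutes {1..n}"
begin

abbreviation move :: "nat set multiset \<Rightarrow> nat set multiset"
  where "move \<equiv> image_mset ((`) \<sigma>)"

lemma inj_move: "inj move"
proof (rule injI)
  have inv_move: "image_mset ((`) (pinv \<sigma>)) (move q) = q" for q
  proof -
    have "(\<lambda>F. pinv \<sigma> ` \<sigma> ` F) = id" unfolding fun_eq_iff image_comp comp_def permutes_inverses(2)[OF \<sigma>] by simp
    then show ?thesis by (simp only: image_mset.compositionality comp_def) simp
  qed
  fix q q' assume "move q = move q'"
  then show "q = q'" by (metis inv_move)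
qed

lemma image_subset_ground: "\<sigma> ` F \<subseteq> {1..n} \<longleftrightarrow> F \<subseteq> {1..n}"
  using inj_image_subset_iff[OF permutes_inj[OF \<sigma>], of F "{1..n}"] unfolding permutes_image[OF \<sigma>] .

lemma image_eq_ground: "\<sigma> ` F = {1..n} \<longleftrightarrow> F = {1..n}"
  using inj_image_eq_iff[OF permutes_inj[OF \<sigma>], of F "{1..n}"] unfolding permutes_image[OF \<sigma>] .

lemma card_image_perm: "card (\<sigma> ` F) = card F"
  by (rule card_image[OF inj_on_subset[OF permutes_inj[OF \<sigma>]]]) simp

lemma image_flat: "\<sigma> ` F \<in> flats \<longleftrightarrow> F \<in> flats"
  unfolding flats_iff image_subset_ground image_eq_ground card_image_perm image_is_empty ..

lemma rk_image: "rk (\<sigma> ` F) = rk F"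
  unfolding rk_def image_eq_ground card_image_perm ..

lemma count_move: "count (move q) (\<sigma> ` F) = count q F"
  by (induction q) (simp_all add: inj_image_eq_iff[OF permutes_inj[OF \<sigma>]])

lemma image_psubset: "\<sigma> ` F \<subset> \<sigma> ` G \<longleftrightarrow> F \<subset> G"
  unfolding psubset_eq inj_image_subset_iff[OF permutes_inj[OF \<sigma>]] inj_image_eq_iff[OF permutes_inj[OF \<sigma>]] ..

lemma chain_mset_move: "chain_mset (move q) \<longleftrightarrow> chain_mset q"
  unfolding chain_mset_def
  unfolding set_image_mset ball_simps inj_image_subset_iff[OF permutes_inj[OF \<sigma>]]
    image_subset_iff[of "(`) \<sigma>"] image_flat subset_eq[of "set_mset q" flats] ..

lemma fy_mset_move: "fy_mset (move q) \<longleftrightarrow> fy_mset q"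
proof -
  have "insert {} (set_mset (move q)) = (`) \<sigma> ` insert {} (set_mset q)" by simp
  then show ?thesis
    unfolding fy_mset_def chain_mset_move
    by (simp only: ball_simps set_image_mset image_psubset count_move rk_image)
qed

lemma fy_set_move: "move b \<in> fy_set d \<longleftrightarrow> b \<in> fy_set d"
  unfolding fy_set_def mem_Collect_eq fy_mset_move size_image_mset ..

lemma move_fy_set: "move ` fy_set d = fy_set d"
proof (rule card_subset_eq[OF finite_fy_set])
  show "move ` fy_set d \<subseteq> fy_set d" using fy_set_move by blast
  show "card (move ` fy_set d) = card (fy_set d)"
    by (rule card_image[OF inj_on_subset[OF inj_move]]) simp
qed

text \<open>
  A permutation of the ground set permutes the flats, and moves those containing \<open>i\<close> to those
  containing \<open>\<sigma> i\<close>.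
\<close>

lemma pm_extend_theta: "pm_extend move (theta i * mon q) = theta (\<sigma> i) * mon (move q)"
proof -
  have exp: "theta j * mon q' = (\<Sum>F | F \<in> flats \<and> j \<in> F. mon (add_mset F q'))" for j q'
    unfolding theta_def by (simp add: sum_distrib_right Var_times_mon)
  have "bij_betw ((`) \<sigma>) {F. F \<in> flats \<and> i \<in> F} {F. F \<in> flats \<and> \<sigma> i \<in> F}"
  proof (rule bij_betwI[where g = "(`) (pinv \<sigma>)"])
    have inv1: "\<sigma> ` (pinv \<sigma> ` F) = F" for F
      unfolding image_comp comp_def permutes_inverses(1)[OF \<sigma>] by simp
    show "(`) \<sigma> \<in> {F. F \<in> flats \<and> i \<in> F} \<rightarrow> {F. F \<in> flats \<and> \<sigma> i \<in> F}" using image_flat by blast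
    show "(`) (pinv \<sigma>) \<in> {F. F \<in> flats \<and> \<sigma> i \<in> F} \<rightarrow> {F. F \<in> flats \<and> i \<in> F}"
    proof (rule funcsetI, rule CollectI, rule conjI)
      fix F assume F: "F \<in> {F. F \<in> flats \<and> \<sigma> i \<in> F}"
      show "pinv \<sigma> ` F \<in> flats" using F image_flat[of "pinv \<sigma> ` F"] unfolding inv1 by blast
      have "pinv \<sigma> (\<sigma> i) \<in> pinv \<sigma> ` F" using F by blast
      then show "i \<in> pinv \<sigma> ` F" unfolding permutes_inverses(2)[OF \<sigma>] .
    qed
    show "pinv \<sigma> ` (\<sigma> ` F) = F" for F
      unfolding image_comp comp_def permutes_inverses(2)[OF \<sigma>] by simp
    show "\<sigma> ` (pinv \<sigma> ` F) = F" for F by (rule inv1)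
  qed
  then show ?thesis
    unfolding exp pm_extend_sum pm_extend_single image_mset_add_mset by (rule sum.reindex_bij_betw)
qed

lemma pm_extend_relations: "p \<in> chow_relations \<Longrightarrow> pm_extend move p \<in> chow_relations"
proof (rule span_image_linear[where f = "pm_extend move", OF pm_extend_add pm_extend_scale _ relations_subspace, where S = "{mon q | q. \<not> chain_mset q} \<union> {theta i * mon q | i q. i \<in> {1..n}}"])
  fix x assume "x \<in> {mon q | q. \<not> chain_mset q} \<union> {theta i * mon q | i q. i \<in> {1..n}}"
  then consider q where "x = mon q" "\<not> chain_mset q" | i q where "x = theta i * mon q" "i \<in> {1..n}" by blast
  then show "pm_extend move x \<in> chow_relations"
  proof cases
    case 1
    then show ?thesis unfolding 1(1) pm_extend_single by (intro mon_relation) (simp add: chain_mset_move)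
  next
    case 2
    have "\<sigma> i \<in> {1..n}" using 2(2) permutes_in_image[OF \<sigma>] by blast
    then show ?thesis unfolding 2(1) pm_extend_theta by (rule theta_relation)
  qed
qed (simp only: chow_relations_def)

lemma pm_extend_carrier: "p \<in> carrier R \<Longrightarrow> pm_extend move p \<in> carrier R"
  unfolding carrier_R
proof (rule CollectI, rule ballI)
  fix q' assume "q' \<in> Poly_Mapping.keys (pm_extend move p)"
  from subsetD[OF keys_pm_extend this] obtain q where q: "q \<in> Poly_Mapping.keys p" "q' = move q" by (rule imageE) 
  assume "p \<in> {p. \<forall>q\<in>Poly_Mapping.keys p. set_mset q \<subseteq> flats}"
  then have "set_mset q \<subseteq> flats" using q(1) by blast
  then show "set_mset q' \<subseteq> flats" unfolding q(2) set_image_mset image_subset_iff[of "(`) \<sigma>"] image_flat by (rule subset_eq[THEN iffD1])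
qed

lemma pm_extend_homogeneous: "p \<in> homogeneous d \<Longrightarrow> pm_extend move p \<in> homogeneous d"
  unfolding homogeneous_def
proof (rule CollectI, rule conjI)
  assume p: "p \<in> {p \<in> carrier R. \<forall>q\<in>Poly_Mapping.keys p. size q = d}"
  then show "pm_extend move p \<in> carrier R" using pm_extend_carrier by blast
  show "\<forall>q\<in>Poly_Mapping.keys (pm_extend move p). size q = d"
  proof
    fix q' assume "q' \<in> Poly_Mapping.keys (pm_extend move p)"
    from subsetD[OF keys_pm_extend this] obtain q where q: "q \<in> Poly_Mapping.keys p" "q' = move q" by (rule imageE) 
    have "size q = d" using p q(1) by blast
    then show "size q' = d" unfolding q(2) size_image_mset .
  qed
qed

lemma chow_action_class:
  "chow_action {1..n} (uniform_flats r n) \<sigma> (chow_class p) = chow_class (pm_extend move p)"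
proof -
  have "chow_class (pm_extend move x) = chow_class (pm_extend move p)" if "x \<in> chow_class p" for x
  proof (rule chow_class_eqI)
    have "x - p \<in> K" using \<open>x \<in> chow_class p\<close> unfolding mem_chow_class .
    then show "pm_extend move x - pm_extend move p \<in> K"
      unfolding pm_extend_diff[symmetric] K_eq Int_iff by (blast intro: pm_extend_relations pm_extend_carrier)
  qed
  then show ?thesis
    unfolding chow_action_def induced_map_def by (rule UN_constant_eq[OF self_mem_chow_class, rule_format])
qed

lemma pm_extend_comb: "pm_extend move (fy_comb d (\<lambda>b. c (move b))) = fy_comb d c"
proof -
  have "pm_extend move (fy_comb d (\<lambda>b. c (move b))) = (\<Sum>b\<in>fy_set d. pm_scale (c (move b)) (mon (move b)))"
    unfolding fy_comb_def pm_extend_sum pm_extend_scale pm_extend_single ..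
  also have "\<dots> = (\<Sum>b\<in>move ` fy_set d. pm_scale (c b) (mon b))"
    by (rule sum.reindex[symmetric, unfolded comp_def]) (rule inj_on_subset[OF inj_move], simp)
  finally show ?thesis unfolding move_fy_set fy_comb_def .
qed

text \<open>
  In the Feichtner--Yuzvinsky basis the action is given by a permutation matrix.
\<close>

theorem chow_trace:
  assumes ind: "fy_independent d"
  shows "lin_trace (complexify (degree_part d)) (complexify_map (degree_part d) (chow_action {1..n} (uniform_flats r n) \<sigma>))
    = of_nat (card {b \<in> fy_set d. move b = b})"
proof -
  let ?g = "chow_action {1..n} (uniform_flats r n) \<sigma>"
  interpret C: rational_coordinatized "degree_part d" "class_coord d" "fy_set d"
    by (rule degree_part_coordinatized[OF ind])
  have "lin_trace (complexify (degree_part d)) (complexify_map (degree_part d) ?g)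
      = of_rat (\<Sum>b\<in>fy_set d. if b = move b then 1 else 0)"
  proof (rule C.trace_complexify_map[where A = "\<lambda>b c. if b = move c then 1 else 0"])
    fix X assume "X \<in> carrier (degree_part d)"
    then obtain p where p: "p \<in> homogeneous d" "X = chow_class p" unfolding degree_part_carrier by blast
    have gX: "?g X = chow_class (pm_extend move p)" unfolding p(2) by (rule chow_action_class)
    show "?g X \<in> carrier (degree_part d)"
      unfolding gX degree_part_carrier using pm_extend_homogeneous[OF p(1)] by blast
    fix b assume b: "b \<in> fy_set d"
    have "b \<in> move ` fy_set d" unfolding move_fy_set by (rule b)
    then obtain a where a: "a \<in> fy_set d" "b = move a" by blast
    \<comment> \<open>The coordinates of the image are those of \<open>p\<close>, moved along with the monomials.\<close>
    define c where "c = (\<lambda>b. fy_coord d p (inv_into UNIV move b))"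
    have cm: "c (move x) = fy_coord d p x" for x unfolding c_def inv_f_f[OF inj_move] ..
    have "class_coord d (?g X) b = c b"
      unfolding gX class_coord[OF ind pm_extend_homogeneous[OF p(1)] b]
    proof (rule fy_coord_unique[OF ind pm_extend_homogeneous[OF p(1)] _ b])
      have "pm_extend move (p - fy_comb d (\<lambda>x. c (move x))) \<in> chow_relations"
        unfolding cm by (rule pm_extend_relations[OF fy_coord[OF p(1)]])
      then show "pm_extend move p - fy_comb d c \<in> chow_relations" unfolding pm_extend_diff pm_extend_comb .
    qed
    also have "c b = class_coord d X a" unfolding a(2) cm p(2) class_coord[OF ind p(1) a(1)] ..
    also have "\<dots> = (\<Sum>j\<in>fy_set d. if a = j then class_coord d X j else 0)"
      using a(1) finite_fy_set by simp
    also have "\<dots> = (\<Sum>j\<in>fy_set d. (if b = move j then 1 else 0) * class_coord d X j)"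
      unfolding a(2) inj_eq[OF inj_move] by (rule sum.cong) auto
    finally show "class_coord d (?g X) b = (\<Sum>j\<in>fy_set d. (if b = move j then 1 else 0) * class_coord d X j)" .
  qed
  also have "(\<Sum>b\<in>fy_set d. if b = move b then 1 else 0 :: rat) = of_nat (card {b \<in> fy_set d. move b = b})"
  proof -
    have "fy_set d \<inter> {b. b = move b} = {b \<in> fy_set d. move b = b}" by (auto simp: eq_commute)
    then show ?thesis by (simp only: sum.If_cases[OF finite_fy_set]) simp
  qed
  finally show ?thesis by simp
qed

end

end

section \<open>The graded Frobenius series\<close>

definition level_functions :: "bool \<Rightarrow> nat \<Rightarrow> nat \<Rightarrow> (nat \<Rightarrow> nat) set"
  where "level_functions pos n d = {v \<in> admissible_functions n d. pos \<longrightarrow> (\<forall>i\<in>{1..n}. v i > 0)}"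

lemma level_functions_closed:
  assumes v: "v \<in> level_functions pos n d" and \<sigma>: "\<sigma> permutes {1..n}"
  shows "restrict (v \<circ> \<sigma>) {1..n} \<in> level_functions pos n d"
proof -
  let ?I = "{1..n}" let ?w = "restrict (v \<circ> \<sigma>) {1..n}"
  have im: "?w ` ?I = v ` ?I"
    unfolding image_restrict_eq image_comp[symmetric] permutes_image[OF \<sigma>] ..
  have ms: "image_mset ?w (mset_set ?I) = image_mset v (mset_set ?I)"
  proof -
    have "image_mset ?w (mset_set ?I) = image_mset (v \<circ> \<sigma>) (mset_set ?I)" by (intro image_mset_cong) simp
    also have "\<dots> = image_mset v (image_mset \<sigma> (mset_set ?I))" by (simp add: image_mset.compositionality)
    also have "image_mset \<sigma> (mset_set ?I) = mset_set ?I"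
      using image_mset_mset_set[OF permutes_inj_on[OF \<sigma>], of ?I] unfolding permutes_image[OF \<sigma>] .
    finally show ?thesis .
  qed
  have in_I: "\<sigma> i \<in> ?I" if "i \<in> ?I" for i using permutes_in_image[OF \<sigma>] that by blast
  have le: "\<forall>i\<in>?I. v i \<in> {..d}" and mx: "d > 0 \<Longrightarrow> d \<in> v ` ?I" and adm: "admissible (image_mset v (mset_set ?I))"
    and pos: "pos \<Longrightarrow> \<forall>i\<in>?I. v i > 0"
    using v unfolding level_functions_def admissible_functions_def max_level_functions_def by blast+
  have "?w \<in> ?I \<rightarrow>\<^sub>E {..d}" using le in_I by (intro restrict_PiE_iff[THEN iffD2] ballI) (metis comp_apply)
  moreover have "d > 0 \<longrightarrow> d \<in> ?w ` ?I" unfolding im using mx by blast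
  moreover have "pos \<longrightarrow> (\<forall>i\<in>?I. ?w i > 0)" using pos in_I by (metis comp_apply restrict_apply')
  ultimately show ?thesis
    using adm unfolding ms[symmetric] level_functions_def admissible_functions_def max_level_functions_def by blast
qed

text \<open>
  Given a levelled multiset of size \<open>n\<close>, any function on \<open>{1..n}\<close> with its levels as values is a level
  function with the right largest value.
\<close>

lemma level_functions_image:
  assumes n: "n \<ge> 1"
  shows "{P. image_mset snd P = m \<and> image_mset fst P \<in> (\<lambda>v. image_mset v (mset_set {1..n})) ` level_functions pos n d}
    = (if size m = n then {P \<in> levelled pos m. top_level P = d} else {})"
proof -
  let ?\<Phi> = "\<lambda>v. image_mset v (mset_set {1..n})"
  have sz: "size m = n" if "image_mset snd P = m" "image_mset fst P = ?\<Phi> v" for P :: "(nat \<times> nat) multiset" and v :: "nat \<Rightarrow> nat"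
  proof -
    have "size P = n" using arg_cong[OF that(2), of size] by simp
    then show ?thesis using arg_cong[OF that(1), of size] by simp
  qed
  have im: "fst ` set_mset P = v ` {1..n}" if "image_mset fst P = ?\<Phi> v" for P :: "(nat \<times> nat) multiset" and v :: "nat \<Rightarrow> nat"
    using arg_cong[OF that, of set_mset] by simp
  have posiff: "(\<forall>i\<in>{1..n}. v i > 0) \<longleftrightarrow> 0 \<notin> v ` {1..n}" for v :: "nat \<Rightarrow> nat"
    by (metis gr0I image_eqI imageE less_not_refl)
  have ext: "v \<in> {1..n} \<rightarrow>\<^sub>E UNIV" if "v \<in> level_functions pos n d" for v
    using that unfolding level_functions_def admissible_functions_def max_level_functions_def by (blast intro: PiE_mono[THEN subsetD])
  show ?thesis
  proof (cases "size m = n")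
    case False
    then show ?thesis using sz by auto
  next
    case True
    have "image_mset fst P \<in> ?\<Phi> ` level_functions pos n d
      \<longleftrightarrow> admissible (image_mset fst P) \<and> (pos \<longrightarrow> 0 \<notin> fst ` set_mset P) \<and> top_level P = d"
      if P: "image_mset snd P = m" for P :: "(nat \<times> nat) multiset"
    proof
      assume "image_mset fst P \<in> ?\<Phi> ` level_functions pos n d"
      then obtain v where v: "v \<in> level_functions pos n d" "image_mset fst P = ?\<Phi> v" by blast
      have "v \<in> max_level_functions n d" "admissible (?\<Phi> v)" "pos \<longrightarrow> (\<forall>i\<in>{1..n}. v i > 0)"
        using v(1) unfolding level_functions_def admissible_functions_def by blast+
      then show "admissible (image_mset fst P) \<and> (pos \<longrightarrow> 0 \<notin> fst ` set_mset P) \<and> top_level P = d"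
        unfolding v(2) im[OF v(2)] posiff top_level_max[OF ext[OF v(1)] n im[OF v(2)]] by blast
    next
      assume *: "admissible (image_mset fst P) \<and> (pos \<longrightarrow> 0 \<notin> fst ` set_mset P) \<and> top_level P = d"
      have "size P = n" using arg_cong[OF P, of size] True by simp
      then have "\<exists>v\<in>{1..n} \<rightarrow>\<^sub>E UNIV. ?\<Phi> v = image_mset fst P" by (intro function_with_mset_image) simp_all
      then obtain v where v: "v \<in> {1..n} \<rightarrow>\<^sub>E UNIV" "image_mset fst P = ?\<Phi> v" by metis
      have "v \<in> level_functions pos n d"
        using * unfolding v(2) im[OF v(2)] posiff[symmetric] top_level_max[OF v(1) n im[OF v(2)], symmetric]
          level_functions_def admissible_functions_def by blast
      then show "image_mset fst P \<in> ?\<Phi> ` level_functions pos n d" using v(2) by blast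
    qed
    then show ?thesis using True unfolding levelled_def by auto
  qed
qed

lemma frobenius_of_level_functions:
  assumes n: "n \<ge> 1"
  shows "mcoeff (mseries_const (1 / fact n) * (\<Sum>\<sigma> | \<sigma> permutes {1..n}.
      mseries_const (of_nat (card {v \<in> level_functions pos n d. \<forall>i\<in>{1..n}. v (\<sigma> i) = v i})) * cycle_power_sum n \<sigma>)) m
    = (if size m = n \<and> 0 \<notin># m then of_nat (card {P \<in> levelled pos m. top_level P = d}) else 0)"
proof (cases "0 \<in># m")
  case True
  have "mcoeff (\<Sum>\<sigma> | \<sigma> permutes {1..n}. mseries_const (c \<sigma>) * cycle_power_sum n \<sigma>) m = 0" for c
    unfolding mcoeff_sum mcoeff_const_times by (rule sum.neutral) (simp add: mcoeff_zero_variable[OF n _ True] del: One_nat_def)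
  then show ?thesis using True by simp
next
  case False
  have fin: "finite (level_functions pos n d)"
    unfolding level_functions_def admissible_functions_def using finite_max_level_functions[of n d] by simp
  have sub: "level_functions pos n d \<subseteq> {1..n} \<rightarrow>\<^sub>E UNIV"
    unfolding level_functions_def admissible_functions_def max_level_functions_def by (blast intro: PiE_mono[THEN subsetD])
  have "mcoeff (mseries_const (1 / fact n) * (\<Sum>\<sigma> | \<sigma> permutes {1..n}.
      mseries_const (of_nat (card {v \<in> level_functions pos n d. \<forall>i\<in>{1..n}. v (\<sigma> i) = v i})) * cycle_power_sum n \<sigma>)) m
    = of_nat (card {P. image_mset snd P = m
        \<and> image_mset fst P \<in> (\<lambda>v. image_mset v (mset_set {1..n})) ` level_functions pos n d})"
    by (rule frobenius_of_level_action[OF fin sub level_functions_closed False])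
  then show ?thesis unfolding level_functions_image[OF n] using False by (simp del: One_nat_def mcoeff_const_times)
qed

lemma fps_nth_sum_powers:
  "finite A \<Longrightarrow> fps_nth (\<Sum>a\<in>A. fps_X ^ f a :: int fps) d = of_nat (card {a \<in> A. f a = d})"
  by (simp add: fps_sum_nth fps_X_power_nth sum.If_cases Int_def eq_commute)

text \<open>
  The identity of the generating series, over the ring of power series in \<open>t\<close>, read off one power of
  \<open>t\<close> at a time.
\<close>

lemma card_levelled:
  defines "s \<equiv> \<lambda>m i. rev (sorted_list_of_multiset m) ! (i - 1)"
  shows "card {P \<in> levelled False m. top_level P = d}
      = card {\<sigma> \<in> {\<sigma>. \<sigma> permutes {1..size m}}. (\<forall>j\<in>DEX (size m) \<sigma>. s m j > s m (j + 1)) \<and> exc (size m) \<sigma> = d}" (is ?all)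
    and "card {P \<in> levelled True m. top_level P = d}
      = card {\<sigma> \<in> derangements (size m). (\<forall>j\<in>DEX (size m) \<sigma>. s m j > s m (j + 1)) \<and> exc (size m) \<sigma> = d}" (is ?der)
proof -
  let ?X = "fps_X :: int fps" let ?n = "size m"
  interpret weakly_decreasing_word ?n "s m" m unfolding s_def by (rule sorted_word_of_mset)
  have X1: "?X \<noteq> 1" by (metis fps_X_nth fps_one_nth zero_neq_one)
  have fin: "finite {\<sigma>. \<sigma> permutes {1..?n} \<and> Q \<sigma>}" for Q :: "(nat \<Rightarrow> nat) \<Rightarrow> bool"
    by (rule finite_subset[OF _ finite_permutations[of "{1..?n}"]]) auto
  have "int (card {P \<in> levelled False m. top_level P = d}) = fps_nth (mcoeff (level_series False ?X) m) d"
    unfolding level_series.rep_eq fps_nth_sum_powers[OF finite_levelled] by simp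
  also have "\<dots> = int (card {\<sigma> \<in> {\<sigma>. \<sigma> permutes {1..?n} \<and> compatible \<sigma>}. exc ?n \<sigma> = d})"
    unfolding level_series_eq(1)[OF X1] excedance_sum_eq_mcoeff(1)[symmetric] fps_nth_sum_powers[OF fin] by simp
  finally show ?all unfolding compatible_def by (simp add: conj_ac del: One_nat_def)
  have "int (card {P \<in> levelled True m. top_level P = d}) = fps_nth (mcoeff (level_series True ?X) m) d"
    unfolding level_series.rep_eq fps_nth_sum_powers[OF finite_levelled] by simp
  also have "\<dots> = int (card {\<sigma> \<in> {\<sigma>. \<sigma> permutes {1..?n} \<and> compatible \<sigma> \<and> (\<forall>v\<in>{1..?n}. \<sigma> v \<noteq> v)}. exc ?n \<sigma> = d})"
    unfolding level_series_eq(2)[OF X1] excedance_sum_eq_mcoeff(2)[symmetric] fps_nth_sum_powers[OF fin] by simp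
  finally show ?der unfolding compatible_def derangements_def by (simp add: conj_ac del: One_nat_def)
qed

lemma mcoeff_nth_qsym_sum:
  fixes m :: "nat multiset"
  defines "s \<equiv> \<lambda>i. rev (sorted_list_of_multiset m) ! (i - 1)"
  assumes "finite A"
  shows "mcoeff (fls_nth (\<Sum>\<sigma>\<in>A. fls_const (fund_qsym (DEX n \<sigma>) n) * fls_X ^ exc n \<sigma> :: complex mseries fls) k) m
    = (if size m = n \<and> 0 \<notin># m then of_nat (card {\<sigma> \<in> A. (\<forall>j\<in>DEX n \<sigma>. s j > s (j + 1)) \<and> int (exc n \<sigma>) = k}) else 0)"
proof -
  have "mcoeff (fls_nth (\<Sum>\<sigma>\<in>A. fls_const (fund_qsym (DEX n \<sigma>) n) * fls_X ^ exc n \<sigma> :: complex mseries fls) k) m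
    = (\<Sum>\<sigma>\<in>A. if size m = n \<and> 0 \<notin># m \<and> (\<forall>j\<in>DEX n \<sigma>. s j > s (j + 1)) \<and> int (exc n \<sigma>) = k then 1 else 0)"
    unfolding fls_nth_sum mcoeff_sum fls_mult_const_nth fls_X_power_nth
  proof (rule sum.cong[OF refl])
    fix \<sigma> assume "\<sigma> \<in> A"
    show "mcoeff (fund_qsym (DEX n \<sigma>) n * (if k = int (exc n \<sigma>) then 1 else 0) :: complex mseries) m
      = (if size m = n \<and> 0 \<notin># m \<and> (\<forall>j\<in>DEX n \<sigma>. s j > s (j + 1)) \<and> int (exc n \<sigma>) = k then 1 else 0)"
      using mcoeff_fund_qsym[of "DEX n \<sigma>" n m, where 'a = complex] unfolding s_def
      by (cases "k = int (exc n \<sigma>)") (auto simp: mcoeff_simps)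
  qed
  also have "\<dots> = of_nat (card {\<sigma>\<in>A. size m = n \<and> 0 \<notin># m \<and> (\<forall>j\<in>DEX n \<sigma>. s j > s (j + 1)) \<and> int (exc n \<sigma>) = k})"
    using assms(2) by (simp add: sum.If_cases Int_def)
  finally show ?thesis by simp
qed

lemma mcoeff_frob_chow:
  assumes rn: "1 \<le> r" "r \<le> n" and ind: "uniform_chow.fy_independent n r d"
    and fixed: "\<And>\<sigma>. \<sigma> permutes {1..n} \<Longrightarrow> card {b \<in> uniform_chow.fy_set n r d. image_mset ((`) \<sigma>) b = b}
      = card {v \<in> level_functions pos n d'. \<forall>i\<in>{1..n}. v (\<sigma> i) = v i}"
  shows "mcoeff (frob_ch n (complexify (chow_degree {1..n} (uniform_flats r n) d))
      (\<lambda>\<sigma>. complexify_map (chow_degree {1..n} (uniform_flats r n) d) (chow_action {1..n} (uniform_flats r n) \<sigma>))) m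
    = (if size m = n \<and> 0 \<notin># m then of_nat (card {P \<in> levelled pos m. top_level P = d'}) else 0)"
proof -
  interpret uniform_chow n r by unfold_locales (use rn in simp_all)
  have n: "n \<ge> 1" using rn by simp
  show ?thesis
    unfolding frob_ch_def frobenius_of_level_functions[OF n, symmetric]
    by (rule arg_cong[where f = "\<lambda>S. mcoeff (mseries_const (1 / fact n) * S) m"], rule sum.cong[OF refl])
       (simp only: mem_Collect_eq chow_trace[OF _ ind] fixed)
qed

lemma card_fixed_boolean:
  assumes n: "n \<ge> 1" and \<sigma>: "\<sigma> permutes {1..n}"
  shows "card {b \<in> uniform_chow.fy_set n n d. image_mset ((`) \<sigma>) b = b}
    = card {v \<in> level_functions False n d. \<forall>i\<in>{1..n}. v (\<sigma> i) = v i}"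
proof -
  interpret uniform_chow n n by unfold_locales (use n in simp_all)
  have "bij_betw (levels n) {b \<in> fy_set d. image_mset ((`) \<sigma>) b = b}
    {v \<in> admissible_functions n d. \<forall>i\<in>{1..n}. v (\<sigma> i) = v i}"
  proof (rule bij_betw_Collect[OF fy_levels_bij[OF refl]])
    fix b assume "b \<in> fy_set d"
    then have "subset_chain n b" using chain_mset_iff[OF refl] unfolding fy_set_def fy_mset_def by blast
    then show "(\<forall>i\<in>{1..n}. levels n b (\<sigma> i) = levels n b i) \<longleftrightarrow> image_mset ((`) \<sigma>) b = b"
      using image_fixed_iff_levels[OF \<sigma>] by blast
  qed
  then show ?thesis by (simp add: level_functions_def bij_betw_same_card del: One_nat_def)
qed

text \<open>
  Adding the ground set to a monomial does not change which permutations fix it.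
\<close>

lemma card_fixed_truncated:
  assumes n: "n = Suc r" "r \<ge> 1" and \<sigma>: "\<sigma> permutes {1..n}"
  shows "card {b \<in> uniform_chow.fy_set n r d. image_mset ((`) \<sigma>) b = b}
    = card {v \<in> level_functions True n (Suc d). \<forall>i\<in>{1..n}. v (\<sigma> i) = v i}"
proof -
  interpret A: uniform_chow n r by unfold_locales (use n in simp_all)
  interpret B: uniform_chow n n by unfold_locales (use n in simp_all)
  have "bij_betw (\<lambda>b. levels n (add_mset {1..n} b)) {b \<in> A.fy_set d. image_mset ((`) \<sigma>) b = b}
    {v \<in> {v \<in> admissible_functions n (Suc d). \<forall>i\<in>{1..n}. v i > 0}. \<forall>i\<in>{1..n}. v (\<sigma> i) = v i}"
  proof (rule bij_betw_Collect[OF truncated_levels_bij[OF n]])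
    fix b assume "b \<in> A.fy_set d"
    then have "B.fy_mset (add_mset {1..n} b)" using truncated_fy_iff[OF n] unfolding A.fy_set_def by blast
    then have c: "subset_chain n (add_mset {1..n} b)"
      using B.chain_mset_iff[OF refl] unfolding B.fy_mset_def by blast
    show "(\<forall>i\<in>{1..n}. levels n (add_mset {1..n} b) (\<sigma> i) = levels n (add_mset {1..n} b) i) \<longleftrightarrow> image_mset ((`) \<sigma>) b = b"
      unfolding image_fixed_iff_levels[OF \<sigma> c, symmetric] image_mset_add_mset permutes_image[OF \<sigma>] by simp
  qed
  then show ?thesis by (simp add: level_functions_def bij_betw_same_card del: One_nat_def)
qed

theorem grFrob_boolean:
  assumes n: "n \<ge> 1"
  shows "grFrob_chow_uniform n n = Q_eulerian n"
proof (rule fls_eqI, rule mseries_eqI)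
  fix k :: int and m :: "nat multiset"
  interpret uniform_chow n n by unfold_locales (use n in simp_all)
  let ?s = "\<lambda>i. rev (sorted_list_of_multiset m) ! (i - 1)"
  have fin: "finite {\<sigma>. \<sigma> permutes {1..n}}" by (rule finite_permutations) simp
  have Q: "mcoeff (fls_nth (Q_eulerian n) k) m = (if size m = n \<and> 0 \<notin># m then of_nat (card
      {\<sigma> \<in> {\<sigma>. \<sigma> permutes {1..n}}. (\<forall>j\<in>DEX n \<sigma>. ?s j > ?s (j + 1)) \<and> int (exc n \<sigma>) = k}) else 0)"
    unfolding Q_eulerian_def by (rule mcoeff_nth_qsym_sum[OF fin])
  show "mcoeff (fls_nth (grFrob_chow_uniform n n) k) m = mcoeff (fls_nth (Q_eulerian n) k) m"
  proof (cases "k < 0")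
    case True
    then have none: "{\<sigma> \<in> {\<sigma>. \<sigma> permutes {1..n}}. (\<forall>j\<in>DEX n \<sigma>. ?s j > ?s (j + 1)) \<and> int (exc n \<sigma>) = k} = {}" by auto
    then have "mcoeff (fls_nth (Q_eulerian n) k) m = 0" unfolding Q none by simp
    then show ?thesis using True by (simp add: grFrob_chow_uniform_def grFrob_def mcoeff_simps)
  next
    case False
    then obtain d where k: "k = int d" by (metis nonneg_int_cases not_le)
    have ind: "fy_independent d"
      unfolding fy_independent_def fy_comb_def using fy_independent_boolean[OF refl] by blast
    have "mcoeff (fls_nth (grFrob_chow_uniform n n) k) m
      = (if size m = n \<and> 0 \<notin># m then of_nat (card {P \<in> levelled False m. top_level P = d}) else 0)"
      using mcoeff_frob_chow[OF n order_refl ind card_fixed_boolean[OF n], of m]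
      by (simp add: grFrob_chow_uniform_def grFrob_def k del: One_nat_def)
    then show ?thesis unfolding Q unfolding k of_nat_eq_iff card_levelled(1) by (cases "size m = n") simp_all
  qed
qed

lemma exc_derangement_pos:
  assumes n: "n \<ge> 1" and \<sigma>: "\<sigma> \<in> derangements n"
  shows "exc n \<sigma> > 0"
proof -
  have p: "\<sigma> permutes {1..n}" and d: "\<forall>i\<in>{1..n}. \<sigma> i \<noteq> i" using \<sigma> unfolding derangements_def by blast+
  have one: "1 \<in> {1..n}" using n by simp
  then have "\<sigma> 1 \<in> {1..n}" "\<sigma> 1 \<noteq> 1" using permutes_in_image[OF p] d by blast+
  then have "1 \<in> EXC n \<sigma>" by (auto simp: EXC_def)
  then show ?thesis unfolding exc_def by (auto simp: card_gt_0_iff EXC_def)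
qed

text \<open>
  The shift of the degree by one is the factor by the variable of the ground set. The series of the
  derangements has no constant term, because \<open>1\<close> is an excedance of every derangement.
\<close>

theorem grFrob_truncated:
  assumes n: "n \<ge> 2"
  shows "grFrob_chow_uniform (n - 1) n = fls_X_inv * Q0_eulerian n"
proof (rule fls_eqI, rule mseries_eqI)
  fix k :: int and m :: "nat multiset"
  define r where "r = n - 1"
  have nr: "n = Suc r" "r \<ge> 1" using n by (simp_all add: r_def)
  interpret uniform_chow n r by unfold_locales (use nr in simp_all)
  let ?s = "\<lambda>i. rev (sorted_list_of_multiset m) ! (i - 1)"
  have fin: "finite (derangements n)"
    by (rule finite_subset[OF _ finite_permutations[of "{1..n}"]]) (auto simp: derangements_def)
  have Q: "mcoeff (fls_nth (fls_X_inv * Q0_eulerian n) k) m = (if size m = n \<and> 0 \<notin># m then of_nat (card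
      {\<sigma> \<in> derangements n. (\<forall>j\<in>DEX n \<sigma>. ?s j > ?s (j + 1)) \<and> int (exc n \<sigma>) = k + 1}) else 0)"
    unfolding Q0_eulerian_def fls_X_inv_times_conv_shift fls_shift_nth by (rule mcoeff_nth_qsym_sum[OF fin])
  show "mcoeff (fls_nth (grFrob_chow_uniform (n - 1) n) k) m = mcoeff (fls_nth (fls_X_inv * Q0_eulerian n) k) m"
  proof (cases "k < 0")
    case True
    have "int (exc n \<sigma>) \<noteq> k + 1" if "\<sigma> \<in> derangements n" for \<sigma>
      using exc_derangement_pos[OF _ that] n True by simp
    then have none: "{\<sigma> \<in> derangements n. (\<forall>j\<in>DEX n \<sigma>. ?s j > ?s (j + 1)) \<and> int (exc n \<sigma>) = k + 1} = {}" by blast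
    then have "mcoeff (fls_nth (fls_X_inv * Q0_eulerian n) k) m = 0" unfolding Q none by simp
    then show ?thesis using True by (simp add: grFrob_chow_uniform_def grFrob_def mcoeff_simps)
  next
    case False
    then obtain d where k: "k = int d" by (metis nonneg_int_cases not_le)
    have ind: "fy_independent d"
      unfolding fy_independent_def fy_comb_def using fy_independent_truncated[OF nr] by blast
    have "r \<le> n" using nr by simp
    then have "mcoeff (fls_nth (grFrob_chow_uniform (n - 1) n) k) m
      = (if size m = n \<and> 0 \<notin># m then of_nat (card {P \<in> levelled True m. top_level P = Suc d}) else 0)"
      using mcoeff_frob_chow[OF nr(2) _ ind card_fixed_truncated[OF nr], of m]
      by (simp add: grFrob_chow_uniform_def grFrob_def k r_def[symmetric] del: One_nat_def)
    moreover have "int e = k + 1 \<longleftrightarrow> e = Suc d" for e unfolding k by presburger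
    ultimately show ?thesis unfolding Q card_levelled(2) by (cases "size m = n") simp_all
  qed
qed

theorem corollary1p7:
  fixes n :: nat
  assumes "n \<ge> 1"
  shows "grFrob_chow_uniform n n = Q_eulerian n
    \<and> (n \<ge> 2 \<longrightarrow> grFrob_chow_uniform (n - 1) n = fls_X_inv * Q0_eulerian n)"
  using grFrob_boolean[OF assms] grFrob_truncated by blast

end
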